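(* Let $d\ge 2$ be an integer. For each $\epsilon>0$, let $C\subset\mathbf{R}^d$ be a Poisson point process with intensity $\lambda=\epsilon^{1-d}$ (the Boltzmann-Grad scaling $\lambda\epsilon^{d-1}=1$), and denote by $\mathbf{E}$ the corresponding expectation. Let $f^{in}\in C_c(\mathbf{R}^d\times\mathbf{S}^{d-1})$ satisfy $f^{in}\ge 0$. For almost every realization $C$, let $f_\epsilon\equiv f_\epsilon(t,x,v;C)$ be the solution of the transport equation with specular reflection on the boundary of the billiard table $\Omega_\epsilon(C)=\{x\in\mathbf{R}^d:\ \mathrm{dist}(x,C)>\epsilon\}$ and with initial data $f^{in}$ (the initial boundary value problem written out in the context). Set $$F_\epsilon(t,x,v):=\mathbf{E}\left[f_\epsilon(t,x,v;C)\,\mathbf{1}_{(x,v)\in\overline{\mathcal{Z}_\epsilon(C)}}\right],\qquad \mathcal{Z}_\epsilon(C):=\Omega_\epsilon(C)\times\mathbf{S}^{d-1}.$$ Then $$F_\epsilon\to F\quad\text{weakly-* in }L^\infty([0,+\infty)\times\mathbf{R}^d\times\mathbf{S}^{d-1})\quad\text{as }\epsilon\to 0,$$ where $F$ is the solution of the linear Boltzmann equation $$ \begin{cases} (\partial_t+v\cdot\nabla_x)F(t,x,v)=\dfrac12\displaystyle\int_{\mathbf{S}^{d-1}}\bigl(F(t,x,v-2(v\cdot\nu)\nu)-F(t,x,v)\bigr)\,|v\cdot\nu|\,d\nu,\\[2mm] F(0,x,v)=f^{in}(x,v). \end{cases} $$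
   Context: Notation: $\mathbf{S}^{d-1}$ is the unit sphere of $\mathbf{R}^d$, $d\nu$ is its surface measure, $B(x,r)$ is the ball of center $x$ and radius $r$ in $\mathbf{R}^d$, $\#S$ is the cardinality of a set $S$, $|A|$ is the Lebesgue measure of $A\subset\mathbf{R}^d$, and $\mathrm{dist}(x,C)=\inf_{c\in C}|x-c|$. Poisson point process: a Poisson point process in $\mathbf{R}^d$ with intensity $\lambda>0$ is a random denumerable set $C\subset\mathbf{R}^d$ such that, for each Borel set $A\subset\mathbf{R}^d$, the random variable $\#(C\cap A)$ has Poisson distribution of parameter $\lambda|A|$, and for all pairwise disjoint Borel sets $A_1,\dots,A_k$ the random variables $\#(C\cap A_1),\dots,\#(C\cap A_k)$ are independent. Almost surely, $C\cap B(0,R)$ is finite for all $R>0$. Billiard table: for $\epsilon>0$ and $C\subset\mathbf{R}^d$ denumerable, $\Omega_\epsilon(C):=\{x\in\mathbf{R}^d:\ \mathrm{dist}(x,C)>\epsilon\}$ and $\mathcal{Z}_\epsilon(C):=\Omega_\epsilon(C)\times\mathbf{S}^{d-1}$. The obstacles (balls of radius $\epsilon$ centered at the points of $C$) may overlap. If $C\cap B(0,R)$ is finite for all $R>0$, then $\partial\Omega_\epsilon(C)\cap B(0,R)$ is a piecewise $C^1$ submanifold for all $R>0$. For $x\in\partial\Omega_\epsilon(C)$ such that $\#(C\cap\partial B(x,\epsilon))=1$, denote by $c_\epsilon(x)$ the unique point of $C\cap\partial B(x,\epsilon)$. Transport equation with specular reflection: for $C$ denumerable such that $C\cap B(0,R)$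 is finite for all $R>0$, $f_\epsilon(t,x,v;C)$, defined for $t\ge 0$ and $(x,v)\in\overline{\mathcal{Z}_\epsilon(C)}$, is the solution of the initial boundary value problem (well-posed in $L^p(\Omega_\epsilon(C)\times\mathbf{S}^{d-1})$) $$ \begin{cases} \partial_tf_\epsilon(t,x,v;C)+v\cdot\nabla_xf_\epsilon(t,x,v;C)=0, & x\in\Omega_\epsilon(C),\ v\in\mathbf{S}^{d-1},\ t>0,\\ f_\epsilon(t,x,v;C)=f_\epsilon\!\left(t,x,v-2\left(v\cdot\tfrac{x-c_\epsilon(x)}{\epsilon}\right)\tfrac{x-c_\epsilon(x)}{\epsilon};C\right), & x\in\partial\Omega_\epsilon(C),\ \#(C\cap\partial B(x,\epsilon))=1,\\ f_\epsilon(0,x,v;C)=f^{in}(x,v), & x\in\Omega_\epsilon(C). \end{cases} $$ That is, $f_\epsilon$ is the density of non-interacting point particles moving at unit speed in $\Omega_\epsilon(C)$, in straight lines between collisions, and specularly reflected at the surface of the obstacles. The product $f_\epsilon(t,x,v;C)\mathbf{1}_{(x,v)\in\overline{\mathcal{Z}_\epsilon(C)}}$ is understood to be $0$ when $(x,v)\notin\overline{\mathcal{Z}_\epsilon(C)}$. The solution $F$ of the linear Boltzmann equation is understood in the mild (integral, Duhamel) sense. *)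

theory Defs
  imports "HOL-Probability.Probability"
begin

section \<open>Poisson point processes\<close>

definition point_count :: "'a set \<Rightarrow> 'a set \<Rightarrow> ennreal" where
  "point_count C A = emeasure (count_space UNIV) (C \<inter> A)"

text \<open>A Poisson law whose parameter is allowed to be infinite: the count is then almost surely
  infinite. For parameter 0 the formula gives the Dirac mass at 0.\<close>

definition has_poisson_law :: "'w measure \<Rightarrow> ennreal \<Rightarrow> ('w \<Rightarrow> ennreal) \<Rightarrow> bool" where
  "has_poisson_law M p N \<longleftrightarrow> N \<in> borel_measurable M \<and>
     (if p = \<infinity> then AE w in M. N w = \<infinity>
      else \<forall>k::nat. measure M {w \<in> space M. N w = of_nat k}
             = enn2real p ^ k / fact k * exp (- enn2real p))"

definition poisson_point_process ::
    "'w measure \<Rightarrow> real \<Rightarrow> ('w \<Rightarrow> 'a::euclidean_space set) \<Rightarrow> bool" where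
  "poisson_point_process M lam C \<longleftrightarrow>
     prob_space M \<and>
     (\<forall>w\<in>space M. countable (C w)) \<and>
     (\<forall>A\<in>sets borel.
        has_poisson_law M (ennreal lam * emeasure lborel A) (\<lambda>w. point_count (C w) A)) \<and>
     (\<forall>(k::nat) A. (\<forall>i<k. A i \<in> sets borel) \<longrightarrow> disjoint_family_on A {..<k} \<longrightarrow>
        prob_space.indep_vars M (\<lambda>_. borel) (\<lambda>i w. point_count (C w) (A i)) {..<k})"

section \<open>The billiard table and the transport equation\<close>

text \<open>The case \<open>C = {}\<close> is separated because \<open>infdist x {} = 0\<close> in the library, whereas the
  infimum over the empty set is infinite here.\<close>

definition billiard_table :: "real \<Rightarrow> 'a::euclidean_space set \<Rightarrow> 'a set" where
  "billiard_table \<epsilon> C = {x. C = {} \<or> infdist x C > \<epsilon>}"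

definition billiard_phase :: "real \<Rightarrow> 'a::euclidean_space set \<Rightarrow> ('a \<times> 'a) set" where
  "billiard_phase \<epsilon> C = billiard_table \<epsilon> C \<times> sphere 0 1"

definition obstacle_center :: "real \<Rightarrow> 'a::euclidean_space set \<Rightarrow> 'a \<Rightarrow> 'a" where
  "obstacle_center \<epsilon> C x = (THE c. c \<in> C \<inter> sphere x \<epsilon>)"

definition specular :: "'a::euclidean_space \<Rightarrow> 'a \<Rightarrow> 'a" where
  "specular n v = v - (2 * (v \<bullet> n)) *\<^sub>R n"

text \<open>Since the initial data are only continuous, \<open>\<partial>\<^sub>t f + v \<cdot> \<nabla>\<^sub>x f\<close> is the derivative of \<open>f\<close> in the
  direction \<open>(1, v)\<close> of phase space-time, as usual for transport equations. The second clause says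
  that the values of \<open>f\<close> at time 0 and at the boundary are the traces of \<open>f\<close> along the
  characteristics; it is what couples the equation to the initial and boundary conditions.
  Nothing is imposed at boundary points lying on several obstacle spheres; this leaves \<open>f\<close>
  undetermined only on a null set of phase space.\<close>

definition transport_solution ::
    "real \<Rightarrow> 'a::euclidean_space set \<Rightarrow> ('a \<Rightarrow> 'a \<Rightarrow> real) \<Rightarrow> (real \<Rightarrow> 'a \<Rightarrow> 'a \<Rightarrow> real) \<Rightarrow> bool" where
  "transport_solution \<epsilon> C fin f \<longleftrightarrow>
     (\<forall>t>0. \<forall>x\<in>billiard_table \<epsilon> C. \<forall>v\<in>sphere 0 1.
        ((\<lambda>s. f (t + s) (x + s *\<^sub>R v) v) has_real_derivative 0) (at 0)) \<and>
     (\<forall>t\<ge>0. \<forall>x. \<forall>v\<in>sphere 0 1. \<forall>l>0.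
        (\<forall>s\<in>{0<..<l}. x + s *\<^sub>R v \<in> billiard_table \<epsilon> C) \<longrightarrow>
        continuous_on {0..l} (\<lambda>s. f (t + s) (x + s *\<^sub>R v) v)) \<and>
     (\<forall>t>0. \<forall>x\<in>frontier (billiard_table \<epsilon> C). \<forall>v\<in>sphere 0 1. card (C \<inter> sphere x \<epsilon>) = 1 \<longrightarrow>
        f t x v = f t x (specular ((x - obstacle_center \<epsilon> C x) /\<^sub>R \<epsilon>) v)) \<and>
     (\<forall>x\<in>billiard_table \<epsilon> C. \<forall>v\<in>sphere 0 1. f 0 x v = fin x v)"

section \<open>The linear Boltzmann equation\<close>

text \<open>Surface measure of the unit sphere, by polar coordinates: the measure of \<open>A\<close> is the dimension
  times the volume of the cone \<open>{x. 0 < norm x < 1 \<and> x / norm x \<in> A}\<close>.\<close>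

definition sphere_measure :: "'a::euclidean_space measure" where
  "sphere_measure = scale_measure (of_nat DIM('a))
     (distr (restrict_space lborel (ball 0 1 - {0})) (restrict_space borel (sphere 0 1))
        (\<lambda>x. x /\<^sub>R norm x))"

definition boltzmann_collision :: "('a::euclidean_space \<Rightarrow> real) \<Rightarrow> 'a \<Rightarrow> real" where
  "boltzmann_collision g v =
     1 / 2 * (\<integral>n. (g (specular n v) - g v) * \<bar>v \<bullet> n\<bar> \<partial>sphere_measure)"

definition phase_time_measure :: "(real \<times> 'a::euclidean_space \<times> 'a) measure" where
  "phase_time_measure = restrict_space lborel {0..} \<Otimes>\<^sub>M (lborel \<Otimes>\<^sub>M sphere_measure)"

text \<open>Mild solutions, in the class of functions bounded on bounded time intervals, where they are
  unique.\<close>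

definition boltzmann_mild_solution ::
    "('a::euclidean_space \<Rightarrow> 'a \<Rightarrow> real) \<Rightarrow> (real \<Rightarrow> 'a \<Rightarrow> 'a \<Rightarrow> real) \<Rightarrow> bool" where
  "boltzmann_mild_solution fin F \<longleftrightarrow>
     (\<lambda>(t, x, v). F t x v) \<in> borel_measurable phase_time_measure \<and>
     (\<forall>T. \<exists>B. \<forall>t\<in>{0..T}. \<forall>x. \<forall>v\<in>sphere 0 1. \<bar>F t x v\<bar> \<le> B) \<and>
     (\<forall>t\<ge>0. \<forall>x. \<forall>v\<in>sphere 0 1.
        F t x v = fin (x - t *\<^sub>R v) v
          + (LINT s:{0..t}|lborel. boltzmann_collision (F s (x - (t - s) *\<^sub>R v)) v))"

section \<open>Weak-* convergence in \<open>L\<^sup>\<infinity>\<close>\<close>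

definition Linf :: "'b measure \<Rightarrow> ('b \<Rightarrow> real) set" where
  "Linf M = {g \<in> borel_measurable M. \<exists>B. AE z in M. \<bar>g z\<bar> \<le> B}"

definition weak_star_tendsto_Linf ::
    "'b measure \<Rightarrow> ('i \<Rightarrow> 'b \<Rightarrow> real) \<Rightarrow> ('b \<Rightarrow> real) \<Rightarrow> 'i filter \<Rightarrow> bool" where
  "weak_star_tendsto_Linf M G g net \<longleftrightarrow>
     (\<forall>\<^sub>F i in net. G i \<in> Linf M) \<and> g \<in> Linf M \<and>
     (\<forall>\<phi>::'b \<Rightarrow> real. integrable M \<phi> \<longrightarrow>
        ((\<lambda>i. \<integral>z. G i z * \<phi> z \<partial>M) \<longlongrightarrow> (\<integral>z. g z * \<phi> z \<partial>M)) net)"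

section \<open>The averaged particle density\<close>

text \<open>The expectation is taken over the completed probability space. For almost every \<open>(t, x, v)\<close>
  the value \<open>f t x v (C w)\<close> is determined by the transport equation for almost every \<open>w\<close> only, so it
  is a random variable up to a null event; on random variables of the original space the
  expectation is unchanged.\<close>

definition averaged_density ::
    "'w measure \<Rightarrow> real \<Rightarrow> ('w \<Rightarrow> 'a::euclidean_space set) \<Rightarrow>
     (real \<Rightarrow> 'a \<Rightarrow> 'a \<Rightarrow> 'a set \<Rightarrow> real) \<Rightarrow> real \<Rightarrow> 'a \<Rightarrow> 'a \<Rightarrow> real" where
  "averaged_density M \<epsilon> C f t x v =
     (\<integral>w. f t x v (C w) * indicator (closure (billiard_phase \<epsilon> (C w))) (x, v) \<partial>completion M)"

end

theory Submission
  imports Defs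
begin

text \<open>The value \<open>f t x v\<close> of a solution of the transport equation is the value of the initial density
  at the other end of the billiard trajectory that arrives at \<open>x\<close> with velocity \<open>v\<close> after time \<open>t\<close>.
  That trajectory is followed backwards: below, a trajectory starts at a position \<open>x\<close> with the
  reversed velocity, still called \<open>v\<close>, and runs for a time \<open>r\<close>. For a configuration \<open>C\<close> of obstacles,
  \<open>after_collisions \<epsilon> C g n r x v\<close> is the value of \<open>g\<close> at its end if it makes exactly \<open>n\<close> collisions,
  and 0 otherwise; the sum over \<open>n\<close> is the transported density (\<open>transport_value\<close>).

  The limit needs only lower bounds and a conservation law. Let \<open>g\<close> be nonnegative and fix \<open>n\<close>. By
  the Mecke formula (\<open>mecke\<close>), the expectation of \<open>after_collisions\<close> over the Poisson process is an
  integral over the centre \<open>c\<close> of the first obstacle hit, restricted to the event that the tube swept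
  before the collision contains no other centre. In the coordinates \<open>c = x + s v - \<epsilon> n\<close> (flight time
  and normal at the collision, \<open>cylinder_coordinates\<close>) the volume element is
  \<open>\<epsilon>^(d-1) max 0 (-v \<bullet> n) ds dn\<close>, whose factor \<open>\<epsilon>^(d-1)\<close> is cancelled by the intensity. Since the tube
  has volume of order \<open>\<epsilon>^(d-1)\<close>, the probability that it is void tends to an exponential in the flight
  time. Repeating this for each collision, with the swept region and the obstacles already met as
  history, bounds the inferior limit from below by the \<open>n\<close>-th term of the Duhamel series of the linear
  Boltzmann equation. Histories interfere with the later flight (a new obstacle inside the region
  known to be void, or a second collision with an old obstacle) only for a null set of collision
  times and normals in the limit, and Fatou's lemma absorbs them
  (\<open>duhamel_le_liminf_void_mean\<close>).

  Conservation turns these lower bounds into limits. If \<open>0 \<le> g \<le> K\<close>, they apply to \<open>g\<close> and to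
  \<open>K - g\<close>. The two expectations add up to at most \<open>K\<close>, because a trajectory has at most one number of
  collisions; the two Duhamel series add up to exactly \<open>K\<close>, because constants solve the Boltzmann
  equation and bounded mild solutions are given by their Duhamel series (\<open>gain_form_series\<close>,
  \<open>mild_solution_series\<close>). Hence neither inequality can be strict (\<open>mean_transport_tendsto\<close>).

  What remains is that almost every trajectory is well defined, with finitely many collisions in
  finite time and none of them tangential or with two obstacles at once (\<open>after_collisions_total\<close>).
  Specular reflection preserves phase volume (\<open>collision_preserves_phase_volume\<close>), so the phase volume
  that has undergone \<open>j\<close> collisions within a bounded region, summed over \<open>j\<close>, is at most the flux off
  the finitely many obstacles there (\<open>flux_bound\<close>); degenerate collisions carry no flux. The averaged
  densities are then almost everywhere the expectations above, they take values in \<open>[0, K]\<close> almost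
  everywhere, and dominated convergence turns pointwise into weak-* convergence.\<close>

section \<open>Surface measure of the unit sphere\<close>

text \<open>Transporting the measure to the Borel sets of the whole space lets it be paired with \<open>lborel\<close>
  and composed with Borel maps without restriction to the sphere.\<close>

definition surface :: "'a::euclidean_space measure" where
  "surface = distr sphere_measure borel (\<lambda>x. x)"

lemma sets_surface [measurable_cong, simp]: "sets surface = sets borel"
  by (simp add: surface_def)

lemma space_surface [simp]: "space surface = UNIV"
  by (simp add: surface_def)

lemma measurable_radial [measurable]: "(\<lambda>x::'a::euclidean_space. x /\<^sub>R norm x) \<in> borel_measurable borel"
  by measurable

lemma measurable_radial_sphere:
  "(\<lambda>x::'a::euclidean_space. x /\<^sub>R norm x) \<in>
     restrict_space lborel (ball 0 1 - {0}) \<rightarrow>\<^sub>M restrict_space borel (sphere 0 1)"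
  by (rule measurable_restrict_space2)
     (auto simp: space_restrict_space intro!: measurable_restrict_space1)

lemma measurable_ident_sphere:
  "(\<lambda>x. x) \<in> restrict_space borel (sphere 0 1) \<rightarrow>\<^sub>M (borel :: 'a::euclidean_space measure)"
  by (rule measurable_restrict_space1) simp

lemma sets_sphere_measure [measurable_cong]:
  "sets (sphere_measure :: 'a::euclidean_space measure) = sets (restrict_space borel (sphere 0 1))"
  by (simp add: sphere_measure_def)

lemma space_sphere_measure: "space (sphere_measure :: 'a::euclidean_space measure) = sphere 0 1"
  by (simp add: sphere_measure_def space_scale_measure space_restrict_space)

lemma nn_integral_surface:
  fixes f :: "'a::euclidean_space \<Rightarrow> ennreal"
  assumes [measurable]: "f \<in> borel_measurable borel"
  shows "(\<integral>\<^sup>+n. f n \<partial>surface) =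
    of_nat DIM('a) * (\<integral>\<^sup>+x. indicator (ball 0 1 - {0}) x * f (x /\<^sub>R norm x) \<partial>lborel)"
proof -
  have m: "f \<in> borel_measurable (restrict_space borel (sphere 0 1))"
    using assms by (rule measurable_restrict_space1)
  have "(\<integral>\<^sup>+n. f n \<partial>surface) = (\<integral>\<^sup>+n. f n \<partial>sphere_measure)"
    unfolding surface_def
    by (subst nn_integral_distr)
       (use measurable_ident_sphere in
         \<open>auto simp: measurable_cong_sets[OF sets_sphere_measure refl]\<close>)
  also have "\<dots> = of_nat DIM('a) * (\<integral>\<^sup>+x. f (x /\<^sub>R norm x) \<partial>restrict_space lborel (ball 0 1 - {0}))"
    unfolding sphere_measure_def
    by (subst nn_integral_scale_measure)
       (use m in \<open>auto simp: nn_integral_distr[OF measurable_radial_sphere]\<close>)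
  also have "(\<integral>\<^sup>+x. f (x /\<^sub>R norm x) \<partial>restrict_space lborel (ball 0 1 - {0})) =
     (\<integral>\<^sup>+x. indicator (ball 0 1 - {0}) x * f (x /\<^sub>R norm x) \<partial>lborel)"
    by (subst nn_integral_restrict_space) (auto intro!: nn_integral_cong split: split_indicator)
  finally show ?thesis .
qed

lemma emeasure_surface:
  fixes A :: "'a::euclidean_space set"
  assumes [measurable]: "A \<in> sets borel"
  shows "emeasure surface A =
    of_nat DIM('a) * emeasure lborel {x \<in> ball 0 1 - {0}. x /\<^sub>R norm x \<in> A}"
proof -
  have "emeasure surface A = (\<integral>\<^sup>+n. indicator A n \<partial>surface)" by simp
  also have "\<dots> = of_nat DIM('a) *
     (\<integral>\<^sup>+x. indicator (ball 0 1 - {0}) x * indicator A (x /\<^sub>R norm x) \<partial>lborel)"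
    by (rule nn_integral_surface) simp
  also have "(\<integral>\<^sup>+x. indicator (ball 0 1 - {0}) x * indicator A (x /\<^sub>R norm x) \<partial>lborel) =
     (\<integral>\<^sup>+x. indicator {x \<in> ball 0 1 - {0}. x /\<^sub>R norm x \<in> A} x \<partial>lborel)"
    by (intro nn_integral_cong) (auto split: split_indicator)
  also have "\<dots> = emeasure lborel {x \<in> ball 0 1 - {0}. x /\<^sub>R norm x \<in> A}"
    by (rule nn_integral_indicator) simp
  finally show ?thesis .
qed

lemma finite_measure_surface: "finite_measure (surface :: 'a::euclidean_space measure)"
proof
  have "emeasure (surface :: 'a measure) UNIV \<le> of_nat DIM('a) * emeasure lborel (ball 0 1 :: 'a set)"
    by (subst emeasure_surface) (auto intro!: mult_left_mono emeasure_mono)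
  also have "\<dots> < \<infinity>"
    using emeasure_lborel_ball_finite[of "0::'a" 1] by (simp add: ennreal_mult_less_top of_nat_less_top)
  finally show "emeasure (surface :: 'a measure) (space surface) \<noteq> \<infinity>" by simp
qed

interpretation surface: finite_measure surface
  by (rule finite_measure_surface)

lemma AE_surface_norm: "AE n in surface. norm (n::'a::euclidean_space) = 1"
proof (rule AE_I')
  show "- sphere (0::'a) 1 \<in> null_sets surface"
    by (intro null_setsI) (auto simp: emeasure_surface cong: conj_cong)
qed auto

lemma nn_integral_lborel_scale:
  fixes f :: "'a::euclidean_space \<Rightarrow> ennreal"
  assumes [measurable]: "f \<in> borel_measurable borel" and c: "c \<noteq> 0"
  shows "(\<integral>\<^sup>+x. f x \<partial>lborel) = ennreal (\<bar>c\<bar> ^ DIM('a)) * (\<integral>\<^sup>+x. f (t + c *\<^sub>R x) \<partial>lborel)"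
  by (subst lborel_affine[OF c, of t])
     (simp add: nn_integral_density nn_integral_distr nn_integral_cmult)

lemma nn_integral_lborel_shift:
  fixes f :: "'a::euclidean_space \<Rightarrow> ennreal"
  assumes "f \<in> borel_measurable borel"
  shows "(\<integral>\<^sup>+x. f (x + a) \<partial>lborel) = (\<integral>\<^sup>+x. f x \<partial>lborel)"
  using nn_integral_lborel_scale[OF assms, of 1 a] by (simp add: add.commute)

lemma nn_integral_lborel_uminus:
  fixes f :: "'a::euclidean_space \<Rightarrow> ennreal"
  assumes "f \<in> borel_measurable borel"
  shows "(\<integral>\<^sup>+x. f (- x) \<partial>lborel) = (\<integral>\<^sup>+x. f x \<partial>lborel)"
  using nn_integral_lborel_scale[OF assms, of "-1" 0] by simp

section \<open>Lebesgue measure along a direction\<close>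

text \<open>Averaging the translates of \<open>N\<close> by \<open>\<tau> e\<close> over \<open>\<tau> \<in> [0, 1]\<close> leaves its measure unchanged, and by
  Fubini this average vanishes.\<close>

lemma null_if_null_on_lines:
  fixes N :: "'a::euclidean_space set"
  assumes [measurable]: "N \<in> sets borel" and line: "\<And>x. AE \<tau> in lborel. x + \<tau> *\<^sub>R e \<notin> N"
  shows "N \<in> null_sets lborel"
proof -
  have "0 = (\<integral>\<^sup>+x. \<integral>\<^sup>+\<tau>. indicator {0..1::real} \<tau> * indicator N (x + \<tau> *\<^sub>R e) \<partial>lborel \<partial>lborel)"
  proof (rule sym, rule nn_integral_zero', intro always_eventually allI)
    fix x
    show "(\<integral>\<^sup>+\<tau>. indicator {0..1::real} \<tau> * indicator N (x + \<tau> *\<^sub>R e) \<partial>lborel) = (0::ennreal)"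
      by (rule nn_integral_zero') (use line[of x] in \<open>auto elim!: eventually_mono\<close>)
  qed
  also have "\<dots> = (\<integral>\<^sup>+\<tau>. \<integral>\<^sup>+x. indicator {0..1::real} \<tau> * indicator N (x + \<tau> *\<^sub>R e) \<partial>lborel \<partial>lborel)"
    by (rule lborel_pair.Fubini') measurable
  also have "\<dots> = (\<integral>\<^sup>+\<tau>. indicator {0..1::real} \<tau> * emeasure lborel N \<partial>lborel)"
    by (intro nn_integral_cong)
       (simp add: nn_integral_cmult nn_integral_lborel_shift[where f="indicator N"])
  also have "\<dots> = emeasure lborel N"
    by (simp add: nn_integral_multc)
  finally show ?thesis by (intro null_setsI) auto
qed

text \<open>Both sides are the same integral in the squared radius \<open>u = q + \<tau>\<^sup>2 = r\<^sup>2\<close>. Here \<open>q\<close> is the squared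
  distance of a point from the axis and \<open>\<tau>\<close> its coordinate along the axis.\<close>

lemma substitution_radius:
  fixes \<phi> :: "real \<Rightarrow> ennreal"
  assumes [measurable]: "\<phi> \<in> borel_measurable borel" and q: "0 \<le> q"
  shows "(\<integral>\<^sup>+\<tau>. indicator {\<tau>. 0 < \<tau> \<and> q + \<tau>\<^sup>2 < 1} \<tau> * ennreal (\<tau> / (q + \<tau>\<^sup>2)) * \<phi> (sqrt (q + \<tau>\<^sup>2)) \<partial>lborel)
       = (\<integral>\<^sup>+r. indicator {r. 0 < r \<and> r < 1 \<and> q < r\<^sup>2} r * ennreal (1 / r) * \<phi> r \<partial>lborel)"
proof (cases "q < 1")
  case False
  have "q < r\<^sup>2 \<longleftrightarrow> False" if "0 < r" "r < 1" for r
    using that False power_le_one[of r 2] by auto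
  moreover have "q + \<tau>\<^sup>2 < 1 \<longleftrightarrow> False" for \<tau> using False by (auto simp: not_less add_increasing2)
  ultimately show ?thesis by (simp cong: conj_cong)
next
  case True
  let ?f = "\<lambda>u. \<phi> (sqrt u) * ennreal (1 / (2 * u))"
  let ?T = "sqrt (1 - q)"
  have "(\<integral>\<^sup>+u. ?f u * indicator {q + 0\<^sup>2..q + ?T\<^sup>2} u \<partial>lborel) =
      (\<integral>\<^sup>+\<tau>. ?f (q + \<tau>\<^sup>2) * ennreal (2 * \<tau>) * indicator {0..?T} \<tau> \<partial>lborel)"
    by (rule nn_integral_substitution_aux)
       (use True in \<open>auto intro!: derivative_eq_intros continuous_intros\<close>)
  moreover have "(\<integral>\<^sup>+u. ?f u * indicator {(sqrt q)\<^sup>2..1\<^sup>2} u \<partial>lborel) =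
      (\<integral>\<^sup>+r. ?f (r\<^sup>2) * ennreal (2 * r) * indicator {sqrt q..1} r \<partial>lborel)"
  proof (rule nn_integral_substitution_aux)
    fix r assume "r \<in> {sqrt q..1}"
    then show "0 \<le> 2 * r" using order_trans[OF real_sqrt_ge_zero[OF q], of r] by auto
  qed (use True q in \<open>auto intro!: derivative_eq_intros continuous_intros\<close>)
  moreover have "q + ?T\<^sup>2 = 1" "(sqrt q)\<^sup>2 = q" using True q by auto
  ultimately have eq: "(\<integral>\<^sup>+\<tau>. ?f (q + \<tau>\<^sup>2) * ennreal (2 * \<tau>) * indicator {0..?T} \<tau> \<partial>lborel) =
      (\<integral>\<^sup>+r. ?f (r\<^sup>2) * ennreal (2 * r) * indicator {sqrt q..1} r \<partial>lborel)"
    by simp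
  have "(\<integral>\<^sup>+\<tau>. indicator {\<tau>. 0 < \<tau> \<and> q + \<tau>\<^sup>2 < 1} \<tau> * ennreal (\<tau> / (q + \<tau>\<^sup>2)) * \<phi> (sqrt (q + \<tau>\<^sup>2)) \<partial>lborel)
     = (\<integral>\<^sup>+\<tau>. ?f (q + \<tau>\<^sup>2) * ennreal (2 * \<tau>) * indicator {0..?T} \<tau> \<partial>lborel)"
  proof (rule nn_integral_cong_AE)
    have "AE \<tau> in lborel. \<tau> \<noteq> 0 \<and> \<tau> \<noteq> ?T" by (intro AE_conjI AE_lborel_singleton)
    then show "AE \<tau> in lborel. indicator {\<tau>. 0 < \<tau> \<and> q + \<tau>\<^sup>2 < 1} \<tau> * ennreal (\<tau> / (q + \<tau>\<^sup>2)) * \<phi> (sqrt (q + \<tau>\<^sup>2))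
      = ?f (q + \<tau>\<^sup>2) * ennreal (2 * \<tau>) * indicator {0..?T} \<tau>"
    proof eventually_elim
      case (elim \<tau>)
      show ?case
      proof (cases "0 < \<tau> \<and> q + \<tau>\<^sup>2 < 1")
        case True
        have "\<tau> \<le> ?T" using True by (intro real_le_rsqrt) auto
        moreover have "ennreal (1 / (2 * (q + \<tau>\<^sup>2))) * ennreal (2 * \<tau>) = ennreal (\<tau> / (q + \<tau>\<^sup>2))"
          using True q by (simp add: ennreal_mult[symmetric] del: distrib_left_numeral)
        moreover have "?f (q + \<tau>\<^sup>2) * ennreal (2 * \<tau>) =
            (ennreal (1 / (2 * (q + \<tau>\<^sup>2))) * ennreal (2 * \<tau>)) * \<phi> (sqrt (q + \<tau>\<^sup>2))"
          by (simp only: ac_simps)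
        ultimately show ?thesis using True
          by (simp del: distrib_left_numeral)
      next
        case False
        have "\<tau> \<notin> {0..?T}"
        proof
          assume *: "\<tau> \<in> {0..?T}"
          then have "\<tau> < ?T" using elim by auto
          then have "\<tau>\<^sup>2 < ?T\<^sup>2" using * by (intro power_strict_mono) auto
          then show False using False elim * \<open>q < 1\<close> by auto
        qed
        then show ?thesis using False by simp
      qed
    qed
  qed
  also note eq
  also have "(\<integral>\<^sup>+r. ?f (r\<^sup>2) * ennreal (2 * r) * indicator {sqrt q..1} r \<partial>lborel) =
     (\<integral>\<^sup>+r. indicator {r. 0 < r \<and> r < 1 \<and> q < r\<^sup>2} r * ennreal (1 / r) * \<phi> r \<partial>lborel)"
  proof (rule nn_integral_cong_AE)
    have "AE r in lborel. r \<noteq> 0 \<and> r \<noteq> 1 \<and> r \<noteq> sqrt q" by (intro AE_conjI AE_lborel_singleton)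
    then show "AE r in lborel. ?f (r\<^sup>2) * ennreal (2 * r) * indicator {sqrt q..1} r =
       indicator {r. 0 < r \<and> r < 1 \<and> q < r\<^sup>2} r * ennreal (1 / r) * \<phi> r"
    proof eventually_elim
      case (elim r)
      show ?case
      proof (cases "0 < r \<and> r < 1 \<and> q < r\<^sup>2")
        case True
        then have "sqrt q \<le> r" by (intro real_le_lsqrt) auto
        moreover have "ennreal (1 / (2 * r\<^sup>2)) * ennreal (2 * r) = ennreal (1 / r)"
          using True by (simp add: ennreal_mult[symmetric] power2_eq_square)
        moreover have "?f (r\<^sup>2) * ennreal (2 * r) =
            (ennreal (1 / (2 * r\<^sup>2)) * ennreal (2 * r)) * \<phi> (sqrt (r\<^sup>2))"
          by (simp only: ac_simps)
        ultimately show ?thesis using True by simp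
      next
        case False
        have "r \<notin> {sqrt q..1}"
        proof
          assume *: "r \<in> {sqrt q..1}"
          then have "sqrt q < r" "r < 1" using elim by auto
          moreover have "0 < r" using \<open>sqrt q < r\<close> q real_sqrt_ge_zero[OF q] by linarith
          moreover have "(sqrt q)\<^sup>2 < r\<^sup>2" using \<open>sqrt q < r\<close> q by (intro power_strict_mono) auto
          ultimately show False using False q by simp
        qed
        then show ?thesis using False by simp
      qed
    qed
  qed
  finally show ?thesis .
qed

lemma norm_diff_line:
  fixes x v :: "'a::euclidean_space"
  assumes "norm v = 1"
  shows "(norm (x - (v \<bullet> x - \<tau>) *\<^sub>R v))\<^sup>2 = ((norm x)\<^sup>2 - (v \<bullet> x)\<^sup>2) + \<tau>\<^sup>2"
proof -
  have "v \<bullet> v = 1" using assms by (simp add: norm_eq_1)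
  then show ?thesis
    unfolding power2_norm_eq_inner inner_diff_left inner_diff_right inner_scaleR_left inner_scaleR_right
      inner_commute[of x v]
    by (simp only: power2_eq_square) (simp only: algebra_simps)
qed

text \<open>The unit sphere, translated along the unit vector \<open>v\<close>, sweeps out a cylinder, and each point of the
  cylinder is met by exactly one point of the front hemisphere; \<open>v \<bullet> n\<close> is the Jacobian. Polar
  coordinates write the surface integral as an integral over the solid
  ball, where \<open>x\<close> stands for \<open>norm x\<close> times a point of the sphere. After exchanging the order of
  integration, the layer at radius \<open>r\<close> contributes \<open>r^(d-1)\<close> times the integral over the cylinder, by
  scaling.\<close>

lemma cylinder_unit:
  fixes v :: "'a::euclidean_space" and h :: "'a \<Rightarrow> ennreal"
  assumes v: "norm v = 1" and [measurable]: "h \<in> borel_measurable borel"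
  shows "(\<integral>\<^sup>+s. \<integral>\<^sup>+n. ennreal (max 0 (v \<bullet> n)) * h (s *\<^sub>R v + n) \<partial>surface \<partial>lborel) =
    (\<integral>\<^sup>+c. indicator {c. (norm c)\<^sup>2 - (v \<bullet> c)\<^sup>2 < 1} c * h c \<partial>lborel)"
proof -
  (* the squared distance of x from the axis spanned by v *)
  define q where "q x = (norm x)\<^sup>2 - (v \<bullet> x)\<^sup>2" for x
  have q_nonneg: "0 \<le> q x" for x
    using Cauchy_Schwarz_ineq2[of v x] v by (simp add: q_def abs_le_square_iff[symmetric])
  have q_scale: "q (r *\<^sub>R x) = r\<^sup>2 * q x" for r x
    by (simp add: q_def power_mult_distrib algebra_simps)
  have [measurable]: "q \<in> borel_measurable borel" unfolding q_def by measurable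
  have vv: "v \<bullet> v = 1" using v by (simp add: norm_eq_1)
  let ?d = "of_nat DIM('a) :: ennreal"
  let ?B = "ball 0 1 - {0} :: 'a set"
  define W where "W = (\<integral>\<^sup>+c. indicator {c. q c < 1} c * h c \<partial>lborel)"
  define Z where "Z = (\<integral>\<^sup>+s. \<integral>\<^sup>+n. ennreal (max 0 (v \<bullet> n)) * h (s *\<^sub>R v + n) \<partial>surface \<partial>lborel)"
  define k where "k x = indicator ?B x * ennreal (max 0 (v \<bullet> x) / (norm x)\<^sup>2)" for x
  have [measurable]: "?B \<in> sets borel" by simp
  have [measurable]: "k \<in> borel_measurable borel" unfolding k_def by measurable
  have "Z = (\<integral>\<^sup>+s. ?d * (\<integral>\<^sup>+x. indicator ?B x *
      (ennreal (max 0 (v \<bullet> (x /\<^sub>R norm x))) * h (s *\<^sub>R v + x /\<^sub>R norm x)) \<partial>lborel) \<partial>lborel)"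
    unfolding Z_def by (intro nn_integral_cong nn_integral_surface) measurable
  also have "\<dots> = ?d * (\<integral>\<^sup>+s. \<integral>\<^sup>+x. indicator ?B x *
      (ennreal (max 0 (v \<bullet> (x /\<^sub>R norm x))) * h (s *\<^sub>R v + x /\<^sub>R norm x)) \<partial>lborel \<partial>lborel)"
    by (rule nn_integral_cmult) measurable
  also have "(\<integral>\<^sup>+s. \<integral>\<^sup>+x. indicator ?B x *
      (ennreal (max 0 (v \<bullet> (x /\<^sub>R norm x))) * h (s *\<^sub>R v + x /\<^sub>R norm x)) \<partial>lborel \<partial>lborel)
    = (\<integral>\<^sup>+x. \<integral>\<^sup>+s. indicator ?B x *
      (ennreal (max 0 (v \<bullet> (x /\<^sub>R norm x))) * h (s *\<^sub>R v + x /\<^sub>R norm x)) \<partial>lborel \<partial>lborel)"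
    by (rule lborel_pair.Fubini') measurable
  (* with the time rescaled by norm x, the argument is a point of the line through x, divided by norm x *)
  also have "\<dots> = (\<integral>\<^sup>+x. \<integral>\<^sup>+s. k x * h ((s *\<^sub>R v + x) /\<^sub>R norm x) \<partial>lborel \<partial>lborel)"
  proof (rule nn_integral_cong)
    fix x :: 'a
    show "(\<integral>\<^sup>+s. indicator ?B x *
        (ennreal (max 0 (v \<bullet> (x /\<^sub>R norm x))) * h (s *\<^sub>R v + x /\<^sub>R norm x)) \<partial>lborel)
      = (\<integral>\<^sup>+s. k x * h ((s *\<^sub>R v + x) /\<^sub>R norm x) \<partial>lborel)"
    proof (cases "x \<in> ?B")
      case True
      then have pos: "norm x > 0" by simp
      have "(\<integral>\<^sup>+s. indicator ?B x *
          (ennreal (max 0 (v \<bullet> (x /\<^sub>R norm x))) * h (s *\<^sub>R v + x /\<^sub>R norm x)) \<partial>lborel)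
        = ennreal (max 0 (v \<bullet> (x /\<^sub>R norm x))) * (\<integral>\<^sup>+s. h (s *\<^sub>R v + x /\<^sub>R norm x) \<partial>lborel)"
        using True by (simp add: nn_integral_cmult)
      also have "(\<integral>\<^sup>+s. h (s *\<^sub>R v + x /\<^sub>R norm x) \<partial>lborel) =
          ennreal \<bar>1 / norm x\<bar> * (\<integral>\<^sup>+s. h ((0 + 1 / norm x * s) *\<^sub>R v + x /\<^sub>R norm x) \<partial>lborel)"
        by (rule nn_integral_real_affine) (use pos in auto)
      also have "(\<lambda>s. h ((0 + 1 / norm x * s) *\<^sub>R v + x /\<^sub>R norm x)) = (\<lambda>s. h ((s *\<^sub>R v + x) /\<^sub>R norm x))"
        by (simp add: scaleR_add_right divide_inverse)
      also have "ennreal (max 0 (v \<bullet> (x /\<^sub>R norm x))) * (ennreal \<bar>1 / norm x\<bar> * (\<integral>\<^sup>+s. h ((s *\<^sub>R v + x) /\<^sub>R norm x) \<partial>lborel))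
         = k x * (\<integral>\<^sup>+s. h ((s *\<^sub>R v + x) /\<^sub>R norm x) \<partial>lborel)"
      proof -
        have "max 0 (v \<bullet> (x /\<^sub>R norm x)) * (1 / norm x) = max 0 (v \<bullet> x) / (norm x)\<^sup>2"
          using pos by (auto simp: max_def field_simps power2_eq_square zero_le_mult_iff)
        then have eq: "ennreal (max 0 (v \<bullet> (x /\<^sub>R norm x))) * ennreal \<bar>1 / norm x\<bar> = k x"
          using pos True by (subst ennreal_mult[symmetric]) (auto simp: k_def)
        show ?thesis unfolding mult.assoc[symmetric] eq ..
      qed
      also have "\<dots> = (\<integral>\<^sup>+s. k x * h ((s *\<^sub>R v + x) /\<^sub>R norm x) \<partial>lborel)"
        by (simp add: nn_integral_cmult)
      finally show ?thesis .
    qed (simp add: k_def)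
  qed
  also have "\<dots> = (\<integral>\<^sup>+s. \<integral>\<^sup>+x. k x * h ((s *\<^sub>R v + x) /\<^sub>R norm x) \<partial>lborel \<partial>lborel)"
    by (rule lborel_pair.Fubini') measurable
  also have "\<dots> = (\<integral>\<^sup>+s. \<integral>\<^sup>+x. k (x - s *\<^sub>R v) * h (x /\<^sub>R norm (x - s *\<^sub>R v)) \<partial>lborel \<partial>lborel)"
  proof (rule nn_integral_cong)
    fix s
    show "(\<integral>\<^sup>+x. k x * h ((s *\<^sub>R v + x) /\<^sub>R norm x) \<partial>lborel) =
      (\<integral>\<^sup>+x. k (x - s *\<^sub>R v) * h (x /\<^sub>R norm (x - s *\<^sub>R v)) \<partial>lborel)"
      by (subst nn_integral_lborel_shift[where a="- s *\<^sub>R v", symmetric]) auto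
  qed
  also have "\<dots> = (\<integral>\<^sup>+x. \<integral>\<^sup>+s. k (x - s *\<^sub>R v) * h (x /\<^sub>R norm (x - s *\<^sub>R v)) \<partial>lborel \<partial>lborel)"
    by (rule lborel_pair.Fubini') measurable
  also have "\<dots> = (\<integral>\<^sup>+x. \<integral>\<^sup>+r. indicator {r. 0 < r \<and> r < 1 \<and> q x < r\<^sup>2} r * ennreal (1 / r) * h (x /\<^sub>R r) \<partial>lborel \<partial>lborel)"
  proof (rule nn_integral_cong)
    fix x :: 'a
    have n: "norm (x - (v \<bullet> x - \<tau>) *\<^sub>R v) = sqrt (q x + \<tau>\<^sup>2)" for \<tau>
      using norm_diff_line[OF v, of x \<tau>] by (simp add: q_def real_sqrt_unique)
    have "(\<integral>\<^sup>+s. k (x - s *\<^sub>R v) * h (x /\<^sub>R norm (x - s *\<^sub>R v)) \<partial>lborel) =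
      ennreal \<bar>-1\<bar> * (\<integral>\<^sup>+\<tau>. k (x - (v \<bullet> x + -1 * \<tau>) *\<^sub>R v) * h (x /\<^sub>R norm (x - (v \<bullet> x + -1 * \<tau>) *\<^sub>R v)) \<partial>lborel)"
      by (rule nn_integral_real_affine) auto
    also have "\<dots> = (\<integral>\<^sup>+\<tau>. k (x - (v \<bullet> x - \<tau>) *\<^sub>R v) * h (x /\<^sub>R norm (x - (v \<bullet> x - \<tau>) *\<^sub>R v)) \<partial>lborel)"
      by simp
    also have "\<dots> = (\<integral>\<^sup>+\<tau>. indicator {\<tau>. 0 < \<tau> \<and> q x + \<tau>\<^sup>2 < 1} \<tau> * ennreal (\<tau> / (q x + \<tau>\<^sup>2)) *
        h (x /\<^sub>R sqrt (q x + \<tau>\<^sup>2)) \<partial>lborel)"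
    proof (rule nn_integral_cong)
      fix \<tau> :: real
      let ?y = "x - (v \<bullet> x - \<tau>) *\<^sub>R v"
      have vy: "v \<bullet> ?y = \<tau>" using vv by (simp add: inner_diff_right algebra_simps)
      have "k ?y = indicator {\<tau>. 0 < \<tau> \<and> q x + \<tau>\<^sup>2 < 1} \<tau> * ennreal (\<tau> / (q x + \<tau>\<^sup>2))"
      proof (cases "0 < \<tau>")
        case True
        then have y0: "?y \<noteq> 0" using vy by auto
        have "?y \<in> ?B \<longleftrightarrow> q x + \<tau>\<^sup>2 < 1"
          using y0 n[of \<tau>] by simp
        then show ?thesis
          unfolding k_def vy norm_diff_line[OF v] q_def[symmetric] using True
          by (auto split: split_indicator simp: q_def)
      next
        case False
        then show ?thesis by (simp add: k_def vy)
      qed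
      then show "k ?y * h (x /\<^sub>R norm ?y) = indicator {\<tau>. 0 < \<tau> \<and> q x + \<tau>\<^sup>2 < 1} \<tau> *
          ennreal (\<tau> / (q x + \<tau>\<^sup>2)) * h (x /\<^sub>R sqrt (q x + \<tau>\<^sup>2))"
        by (simp add: n)
    qed
    also have "\<dots> = (\<integral>\<^sup>+r. indicator {r. 0 < r \<and> r < 1 \<and> q x < r\<^sup>2} r * ennreal (1 / r) * h (x /\<^sub>R r) \<partial>lborel)"
      by (rule substitution_radius) (auto simp: q_nonneg)
    finally show "(\<integral>\<^sup>+s. k (x - s *\<^sub>R v) * h (x /\<^sub>R norm (x - s *\<^sub>R v)) \<partial>lborel) = \<dots>" .
  qed
  also have "\<dots> = (\<integral>\<^sup>+r. \<integral>\<^sup>+x. indicator {r. 0 < r \<and> r < 1 \<and> q x < r\<^sup>2} r * ennreal (1 / r) * h (x /\<^sub>R r) \<partial>lborel \<partial>lborel)"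
    by (rule lborel_pair.Fubini') measurable
  also have "\<dots> = (\<integral>\<^sup>+r. ennreal (r ^ (DIM('a) - 1)) * indicator {0<..<1} r * W \<partial>lborel)"
  proof (rule nn_integral_cong)
    fix r :: real
    show "(\<integral>\<^sup>+x. indicator {r. 0 < r \<and> r < 1 \<and> q x < r\<^sup>2} r * ennreal (1 / r) * h (x /\<^sub>R r) \<partial>lborel)
      = ennreal (r ^ (DIM('a) - 1)) * indicator {0<..<1} r * W"
    proof (cases "0 < r \<and> r < 1")
      case True
      have "(\<integral>\<^sup>+x. indicator {r. 0 < r \<and> r < 1 \<and> q x < r\<^sup>2} r * ennreal (1 / r) * h (x /\<^sub>R r) \<partial>lborel)
        = ennreal (1 / r) * (\<integral>\<^sup>+x. indicator {x. q x < r\<^sup>2} x * h (x /\<^sub>R r) \<partial>lborel)"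
        using True by (subst nn_integral_cmult[symmetric])
          (auto intro!: nn_integral_cong split: split_indicator)
      also have "(\<integral>\<^sup>+x. indicator {x. q x < r\<^sup>2} x * h (x /\<^sub>R r) \<partial>lborel) =
         ennreal (\<bar>r\<bar> ^ DIM('a)) * (\<integral>\<^sup>+x. indicator {x. q x < r\<^sup>2} (0 + r *\<^sub>R x) * h ((0 + r *\<^sub>R x) /\<^sub>R r) \<partial>lborel)"
        by (rule nn_integral_lborel_scale) (use True in auto)
      also have "(\<integral>\<^sup>+x. indicator {x. q x < r\<^sup>2} (0 + r *\<^sub>R x) * h ((0 + r *\<^sub>R x) /\<^sub>R r) \<partial>lborel) = W"
        unfolding W_def using True
        by (intro nn_integral_cong) (auto split: split_indicator simp: q_scale)
      also have "ennreal (1 / r) * (ennreal (\<bar>r\<bar> ^ DIM('a)) * W) = ennreal (r ^ (DIM('a) - 1)) * W"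
      proof -
        have "1 / r * r ^ DIM('a) = r ^ (DIM('a) - 1)"
          using True by (simp add: power_diff DIM_positive Suc_leI)
        then show ?thesis using True
          by (simp add: mult.assoc[symmetric] ennreal_mult[symmetric])
      qed
      finally show ?thesis using True by simp
    qed auto
  qed
  also have "\<dots> = (\<integral>\<^sup>+r. ennreal (r ^ (DIM('a) - 1)) * indicator {0<..<1} r \<partial>lborel) * W"
    by (rule nn_integral_multc) measurable
  also have "(\<integral>\<^sup>+r. ennreal (r ^ (DIM('a) - 1)) * indicator {0<..<1} r \<partial>lborel) =
     (\<integral>\<^sup>+r. ennreal (r ^ (DIM('a) - 1)) * indicator {0..1} r \<partial>lborel)"
  proof (rule nn_integral_cong_AE)
    have "AE r in lborel. r \<noteq> 0 \<and> r \<noteq> (1::real)" by (intro AE_conjI AE_lborel_singleton)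
    then show "AE r in lborel. ennreal (r ^ (DIM('a) - 1)) * indicator {0<..<1} r =
       ennreal (r ^ (DIM('a) - 1)) * indicator {0..1} r"
      by eventually_elim (auto split: split_indicator)
  qed
  also have "\<dots> = ennreal (1 ^ DIM('a) / DIM('a) - 0 ^ DIM('a) / DIM('a))"
  proof (rule nn_integral_FTC_Icc)
    show "((\<lambda>x. x ^ DIM('a) / DIM('a)) has_real_derivative x ^ (DIM('a) - 1)) (at x)" for x :: real
      by (auto intro!: derivative_eq_intros)
  qed auto
  also have "\<dots> = ennreal (1 / DIM('a))" by (simp add: zero_power)
  finally have "Z = ?d * (ennreal (1 / DIM('a)) * W)" .
  also have "\<dots> = W"
    by (simp add: mult.assoc[symmetric] ennreal_of_nat_eq_real_of_nat ennreal_mult[symmetric])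
  finally show ?thesis unfolding Z_def W_def q_def .
qed

section \<open>Specular reflection\<close>

lemma specular_measurable [measurable (raw)]:
  fixes f g :: "'b \<Rightarrow> 'a::euclidean_space"
  assumes [measurable]: "f \<in> borel_measurable M" "g \<in> borel_measurable M"
  shows "(\<lambda>x. specular (f x) (g x)) \<in> borel_measurable M"
  unfolding specular_def by measurable

lemma norm_specular:
  assumes "norm n = 1" shows "norm (specular n v) = norm (v::'a::euclidean_space)"
proof -
  have nn: "n \<bullet> n = 1" using assms by (simp add: norm_eq_1)
  have "specular n v \<bullet> specular n v = v \<bullet> v"
    by (simp add: specular_def inner_diff_left inner_diff_right nn inner_commute[of n v])
  then show ?thesis by (simp add: norm_eq_sqrt_inner)
qed

lemma inner_specular:
  assumes "norm n = 1" shows "specular n v \<bullet> n = - (v \<bullet> (n::'a::euclidean_space))"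
  using assms by (simp add: specular_def inner_diff_left norm_eq_1)

lemma specular_specular:
  assumes "norm n = 1" shows "specular n (specular n v) = (v::'a::euclidean_space)"
proof -
  have "specular n (specular n v) = specular n v - (2 * (specular n v \<bullet> n)) *\<^sub>R n"
    by (simp add: specular_def)
  also have "\<dots> = v" unfolding inner_specular[OF assms] by (simp add: specular_def)
  finally show ?thesis .
qed

lemma specular_scaleR: "specular n (a *\<^sub>R v) = a *\<^sub>R specular n (v::'a::euclidean_space)"
  by (simp add: specular_def algebra_simps)

lemma specular_add: "specular n (v + w) = specular n v + specular n (w::'a::euclidean_space)"
  by (simp add: specular_def algebra_simps inner_add_left)

lemma specular_minus: "specular n (- v) = - specular n (v::'a::euclidean_space)"
  by (simp add: specular_def)

lemma specular_minus_normal: "specular (- n) v = specular n (v::'a::euclidean_space)"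
  by (simp add: specular_def)

text \<open>Uniqueness of translation-invariant measure, for a single map: in
  \<open>\<integral>\<integral> f (specular n x) * indicator (ball 0 1) y\<close> the reflection can be moved from \<open>x\<close> to \<open>y\<close> by
  translations, and the ball is invariant under reflection.\<close>

lemma nn_integral_lborel_specular:
  fixes f :: "'a::euclidean_space \<Rightarrow> ennreal"
  assumes [measurable]: "f \<in> borel_measurable borel" and n: "norm n = 1"
  shows "(\<integral>\<^sup>+x. f (specular n x) \<partial>lborel) = (\<integral>\<^sup>+x. f x \<partial>lborel)"
proof -
  let ?g = "indicator (ball 0 1) :: 'a \<Rightarrow> ennreal"
  have [measurable]: "?g \<in> borel_measurable borel"
    by (intro borel_measurable_indicator borel_open open_ball)
  have shift: "(\<integral>\<^sup>+x. k (specular n (x + a)) \<partial>lborel) = (\<integral>\<^sup>+x. k (specular n x) \<partial>lborel)"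
    if [measurable]: "k \<in> borel_measurable borel" for k :: "'a \<Rightarrow> ennreal" and a
    by (rule nn_integral_lborel_shift[where f="\<lambda>x. k (specular n x)"]) measurable
  have g: "?g (specular n x) = ?g x" for x using norm_specular[OF n, of x] by (simp split: split_indicator)
  let ?b = "emeasure lborel (ball 0 1 :: 'a set)"
  have b: "?b \<noteq> 0" "?b \<noteq> \<infinity>"
    using emeasure_lborel_ball_finite[of "0::'a" 1]
    by (auto simp: emeasure_ball unit_ball_vol_pos less_imp_neq[symmetric])
  have "(\<integral>\<^sup>+x. f (specular n x) \<partial>lborel) * ?b = (\<integral>\<^sup>+x. \<integral>\<^sup>+y. f (specular n x) * ?g y \<partial>lborel \<partial>lborel)"
  proof -
    have "(\<integral>\<^sup>+x. f (specular n x) \<partial>lborel) * ?b = (\<integral>\<^sup>+x. f (specular n x) * ?b \<partial>lborel)"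
      by (rule nn_integral_multc[symmetric]) measurable
    also have "\<dots> = (\<integral>\<^sup>+x. \<integral>\<^sup>+y. f (specular n x) * ?g y \<partial>lborel \<partial>lborel)"
      by (intro nn_integral_cong, subst nn_integral_cmult) auto
    finally show ?thesis .
  qed
  also have "\<dots> = (\<integral>\<^sup>+x. \<integral>\<^sup>+y. f (specular n x) * ?g (y + specular n x) \<partial>lborel \<partial>lborel)"
    by (intro nn_integral_cong nn_integral_lborel_shift[symmetric, where f="\<lambda>y. f (specular n _) * ?g y"])
       measurable
  also have "\<dots> = (\<integral>\<^sup>+y. \<integral>\<^sup>+x. f (specular n x) * ?g (y + specular n x) \<partial>lborel \<partial>lborel)"
    by (rule lborel_pair.Fubini') measurable
  also have "\<dots> = (\<integral>\<^sup>+y. \<integral>\<^sup>+x. f (specular n x - y) * ?g (specular n x) \<partial>lborel \<partial>lborel)"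
  proof (rule nn_integral_cong)
    fix y
    have "(\<integral>\<^sup>+x. f (specular n x) * ?g (y + specular n x) \<partial>lborel) =
      (\<integral>\<^sup>+x. f (specular n (x + - specular n y)) * ?g (y + specular n (x + - specular n y)) \<partial>lborel)"
      by (rule shift[symmetric, where k="\<lambda>z. f z * ?g (y + z)"]) measurable
    also have "\<dots> = (\<integral>\<^sup>+x. f (specular n x - y) * ?g (specular n x) \<partial>lborel)"
      by (simp add: specular_add specular_minus specular_specular[OF n] del: add_uminus_conv_diff) simp
    finally show "(\<integral>\<^sup>+x. f (specular n x) * ?g (y + specular n x) \<partial>lborel) = \<dots>" .
  qed
  also have "\<dots> = (\<integral>\<^sup>+x. \<integral>\<^sup>+y. f (specular n x - y) * ?g (specular n x) \<partial>lborel \<partial>lborel)"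
    by (rule lborel_pair.Fubini') measurable
  also have "\<dots> = (\<integral>\<^sup>+x. (\<integral>\<^sup>+y. f y \<partial>lborel) * ?g (specular n x) \<partial>lborel)"
  proof (rule nn_integral_cong)
    fix x
    have "(\<integral>\<^sup>+y. f (specular n x - y) * ?g (specular n x) \<partial>lborel) =
        (\<integral>\<^sup>+y. f (specular n x - y) \<partial>lborel) * ?g (specular n x)"
      by (rule nn_integral_multc) measurable
    also have "(\<integral>\<^sup>+y. f (specular n x - y) \<partial>lborel) = (\<integral>\<^sup>+y. f (specular n x + y) \<partial>lborel)"
      by (subst nn_integral_lborel_uminus[symmetric]) auto
    also have "\<dots> = (\<integral>\<^sup>+y. f y \<partial>lborel)"
      by (subst add.commute) (rule nn_integral_lborel_shift, measurable)
    finally show "(\<integral>\<^sup>+y. f (specular n x - y) * ?g (specular n x) \<partial>lborel) =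
      (\<integral>\<^sup>+y. f y \<partial>lborel) * ?g (specular n x)" .
  qed
  also have "\<dots> = (\<integral>\<^sup>+y. f y \<partial>lborel) * ?b"
    unfolding g by (simp add: nn_integral_cmult)
  finally show ?thesis using b by (metis ennreal_mult_divide_eq top_neq_ennreal infinity_ennreal_def)
qed

text \<open>A norm-preserving homogeneous map commutes with the radial projection of the ball to the sphere, so
  invariance of Lebesgue measure passes to the sphere in polar coordinates.\<close>

lemma nn_integral_surface_isometry:
  fixes f :: "'a::euclidean_space \<Rightarrow> ennreal" and L :: "'a \<Rightarrow> 'a"
  assumes [measurable]: "f \<in> borel_measurable borel" "L \<in> borel_measurable borel"
    and L: "\<And>x. norm (L x) = norm x" "\<And>a x. L (a *\<^sub>R x) = a *\<^sub>R L x"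
    and inv: "\<And>g. g \<in> borel_measurable borel \<Longrightarrow> (\<integral>\<^sup>+x. g (L x) \<partial>lborel) = (\<integral>\<^sup>+x. g x \<partial>lborel)"
  shows "(\<integral>\<^sup>+x. f (L x) \<partial>surface) = (\<integral>\<^sup>+x. f x \<partial>surface)"
proof -
  have [measurable]: "ball 0 1 - {0::'a} \<in> sets borel" by simp
  have "L x = 0 \<longleftrightarrow> x = 0" for x using L(1)[of x] by (metis norm_eq_zero)
  then have ind: "indicator (ball 0 1 - {0}) (L x) = (indicator (ball 0 1 - {0}) x :: ennreal)" for x
    by (auto simp: L split: split_indicator)
  have "(\<integral>\<^sup>+x. f (L x) \<partial>surface) = of_nat DIM('a) *
      (\<integral>\<^sup>+x. indicator (ball 0 1 - {0}) x * f (L (x /\<^sub>R norm x)) \<partial>lborel)"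
    by (rule nn_integral_surface[where f="\<lambda>x. f (L x)"]) measurable
  also have "\<dots> = of_nat DIM('a) *
      (\<integral>\<^sup>+x. indicator (ball 0 1 - {0}) (L x) * f (L x /\<^sub>R norm (L x)) \<partial>lborel)"
    by (simp add: ind L)
  also have "\<dots> = of_nat DIM('a) *
      (\<integral>\<^sup>+x. indicator (ball 0 1 - {0}) x * f (x /\<^sub>R norm x) \<partial>lborel)"
    by (subst inv[where g="\<lambda>x. indicator (ball 0 1 - {0}) x * f (x /\<^sub>R norm x)"]) auto
  also have "\<dots> = (\<integral>\<^sup>+x. f x \<partial>surface)" by (rule nn_integral_surface[symmetric]) measurable
  finally show ?thesis .
qed

lemma nn_integral_surface_specular:
  fixes f :: "'a::euclidean_space \<Rightarrow> ennreal"
  assumes "f \<in> borel_measurable borel" and n: "norm n = 1"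
  shows "(\<integral>\<^sup>+v. f (specular n v) \<partial>surface) = (\<integral>\<^sup>+v. f v \<partial>surface)"
  by (rule nn_integral_surface_isometry)
     (auto simp: assms norm_specular specular_scaleR nn_integral_lborel_specular)

lemma nn_integral_surface_uminus:
  fixes f :: "'a::euclidean_space \<Rightarrow> ennreal"
  assumes "f \<in> borel_measurable borel"
  shows "(\<integral>\<^sup>+v. f (- v) \<partial>surface) = (\<integral>\<^sup>+v. f v \<partial>surface)"
  by (rule nn_integral_surface_isometry) (auto simp: assms nn_integral_lborel_uminus)

section \<open>A line through an obstacle\<close>

text \<open>For a unit vector \<open>v\<close> this is a quarter of the discriminant of the equation
  \<open>(norm (x + s v - c))\<^sup>2 = \<epsilon>\<^sup>2\<close> in \<open>s\<close>. Its roots are the times at which the line enters and leaves the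
  ball of radius \<open>\<epsilon>\<close> around \<open>c\<close>.\<close>

definition disc :: "real \<Rightarrow> 'a::euclidean_space \<Rightarrow> 'a \<Rightarrow> 'a \<Rightarrow> real" where
  "disc \<epsilon> x v c = \<epsilon>\<^sup>2 - ((norm (c - x))\<^sup>2 - (v \<bullet> (c - x))\<^sup>2)"

definition entry_time :: "real \<Rightarrow> 'a::euclidean_space \<Rightarrow> 'a \<Rightarrow> 'a \<Rightarrow> real" where
  "entry_time \<epsilon> x v c = v \<bullet> (c - x) - sqrt (disc \<epsilon> x v c)"

definition exit_time :: "real \<Rightarrow> 'a::euclidean_space \<Rightarrow> 'a \<Rightarrow> 'a \<Rightarrow> real" where
  "exit_time \<epsilon> x v c = v \<bullet> (c - x) + sqrt (disc \<epsilon> x v c)"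

lemma measurable_disc [measurable (raw)]:
  fixes x v c :: "'b \<Rightarrow> 'a::euclidean_space"
  assumes [measurable]: "x \<in> borel_measurable M" "v \<in> borel_measurable M" "c \<in> borel_measurable M"
  shows "(\<lambda>w. disc \<epsilon> (x w) (v w) (c w)) \<in> borel_measurable M"
    "(\<lambda>w. entry_time \<epsilon> (x w) (v w) (c w)) \<in> borel_measurable M"
    "(\<lambda>w. exit_time \<epsilon> (x w) (v w) (c w)) \<in> borel_measurable M"
  unfolding disc_def entry_time_def exit_time_def by measurable

lemma dist_line_power2:
  fixes x v c :: "'a::euclidean_space"
  assumes "norm v = 1"
  shows "(norm (x + s *\<^sub>R v - c))\<^sup>2 = \<epsilon>\<^sup>2 + ((s - v \<bullet> (c - x))\<^sup>2 - disc \<epsilon> x v c)"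
proof -
  have vv: "v \<bullet> v = 1" using assms by (simp add: norm_eq_1)
  define y where "y = c - x"
  have eq: "x + s *\<^sub>R v - c = s *\<^sub>R v - y" by (simp add: y_def)
  have eq2: "(norm (s *\<^sub>R v - y))\<^sup>2 = s\<^sup>2 - 2 * s * (v \<bullet> y) + (norm y)\<^sup>2"
    unfolding power2_norm_eq_inner inner_diff_left inner_diff_right inner_scaleR_left inner_scaleR_right
      inner_commute[of y v] vv by (simp add: power2_eq_square algebra_simps)
  show ?thesis
    unfolding disc_def y_def[symmetric] eq eq2 by (simp add: power2_diff)
qed

lemma disc_shift: "disc \<epsilon> (x + s *\<^sub>R v) v c = disc \<epsilon> x v (c::'a::euclidean_space)" if "norm v = 1"
  using dist_line_power2[OF that, of x s c \<epsilon>] dist_line_power2[OF that, of "x + s *\<^sub>R v" 0 c \<epsilon>]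
    that by (simp add: inner_diff_right inner_add_right algebra_simps power2_commute norm_eq_1)

lemma entry_time_shift:
  "entry_time \<epsilon> (x + s *\<^sub>R v) v c = entry_time \<epsilon> x v (c::'a::euclidean_space) - s"
  "exit_time \<epsilon> (x + s *\<^sub>R v) v c = exit_time \<epsilon> x v (c::'a::euclidean_space) - s" if "norm v = 1"
  using that by (simp_all add: entry_time_def exit_time_def disc_shift inner_diff_right inner_add_right norm_eq_1)

lemma in_ball_line_iff:
  fixes x v c :: "'a::euclidean_space"
  assumes "norm v = 1" "\<epsilon> > 0"
  shows "norm (x + s *\<^sub>R v - c) < \<epsilon> \<longleftrightarrow> disc \<epsilon> x v c > 0 \<and> entry_time \<epsilon> x v c < s \<and> s < exit_time \<epsilon> x v c"
    and "norm (x + s *\<^sub>R v - c) \<le> \<epsilon> \<longleftrightarrow> disc \<epsilon> x v c \<ge> 0 \<and> entry_time \<epsilon> x v c \<le> s \<and> s \<le> exit_time \<epsilon> x v c"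
proof -
  let ?b = "s - v \<bullet> (c - x)" and ?D = "disc \<epsilon> x v c"
  have "norm (x + s *\<^sub>R v - c) < \<epsilon> \<longleftrightarrow> (norm (x + s *\<^sub>R v - c))\<^sup>2 < \<epsilon>\<^sup>2"
    using assms(2) by (auto intro!: power_strict_mono intro: power2_less_imp_less)
  also have "\<dots> \<longleftrightarrow> ?b\<^sup>2 < ?D" unfolding dist_line_power2[OF assms(1), where \<epsilon>=\<epsilon>] by simp
  also have "\<dots> \<longleftrightarrow> ?D > 0 \<and> \<bar>?b\<bar> < sqrt ?D"
    by (metis abs_ge_zero dual_order.strict_trans2 real_sqrt_abs real_sqrt_less_iff zero_le_power2)
  also have "\<dots> \<longleftrightarrow> ?D > 0 \<and> entry_time \<epsilon> x v c < s \<and> s < exit_time \<epsilon> x v c"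
    by (auto simp: entry_time_def exit_time_def abs_less_iff)
  finally show "norm (x + s *\<^sub>R v - c) < \<epsilon> \<longleftrightarrow> disc \<epsilon> x v c > 0 \<and> entry_time \<epsilon> x v c < s \<and> s < exit_time \<epsilon> x v c" .
  have "norm (x + s *\<^sub>R v - c) \<le> \<epsilon> \<longleftrightarrow> (norm (x + s *\<^sub>R v - c))\<^sup>2 \<le> \<epsilon>\<^sup>2"
    using assms(2) by (simp add: abs_le_square_iff[symmetric])
  also have "\<dots> \<longleftrightarrow> ?b\<^sup>2 \<le> ?D" unfolding dist_line_power2[OF assms(1), where \<epsilon>=\<epsilon>] by simp
  also have "\<dots> \<longleftrightarrow> ?D \<ge> 0 \<and> \<bar>?b\<bar> \<le> sqrt ?D"
    by (metis order_trans real_sqrt_abs real_sqrt_le_iff zero_le_power2)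
  also have "\<dots> \<longleftrightarrow> ?D \<ge> 0 \<and> entry_time \<epsilon> x v c \<le> s \<and> s \<le> exit_time \<epsilon> x v c"
    by (auto simp: entry_time_def exit_time_def abs_le_iff)
  finally show "norm (x + s *\<^sub>R v - c) \<le> \<epsilon> \<longleftrightarrow> disc \<epsilon> x v c \<ge> 0 \<and> entry_time \<epsilon> x v c \<le> s \<and> s \<le> exit_time \<epsilon> x v c" .
qed

lemma norm_entry_point:
  fixes x v c :: "'a::euclidean_space"
  assumes "norm v = 1" "\<epsilon> > 0" "disc \<epsilon> x v c \<ge> 0"
  shows "norm (x + entry_time \<epsilon> x v c *\<^sub>R v - c) = \<epsilon>" "norm (x + exit_time \<epsilon> x v c *\<^sub>R v - c) = \<epsilon>"
proof -
  have "(norm (x + entry_time \<epsilon> x v c *\<^sub>R v - c))\<^sup>2 = \<epsilon>\<^sup>2"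
    unfolding dist_line_power2[OF assms(1), where \<epsilon>=\<epsilon>] using assms(3) by (simp add: entry_time_def)
  then show "norm (x + entry_time \<epsilon> x v c *\<^sub>R v - c) = \<epsilon>" using assms(2) by (simp add: power2_eq_iff_nonneg)
  have "(norm (x + exit_time \<epsilon> x v c *\<^sub>R v - c))\<^sup>2 = \<epsilon>\<^sup>2"
    unfolding dist_line_power2[OF assms(1), where \<epsilon>=\<epsilon>] using assms(3) by (simp add: exit_time_def)
  then show "norm (x + exit_time \<epsilon> x v c *\<^sub>R v - c) = \<epsilon>" using assms(2) by (simp add: power2_eq_iff_nonneg)
qed

text \<open>A centre \<open>c\<close> that is hit from outside is determined by the time \<open>s\<close> and the outer normal \<open>n\<close> of
  the collision; this recovers the collision from the coordinates \<open>(s, n)\<close> of \<open>c\<close>.\<close>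

lemma incoming_data:
  fixes x v n :: "'a::euclidean_space" and s :: real
  assumes v: "norm v = 1" and n: "norm n = 1" and \<epsilon>: "\<epsilon> > 0" and vn: "v \<bullet> n < 0"
  defines "c \<equiv> x + s *\<^sub>R v - \<epsilon> *\<^sub>R n"
  shows "disc \<epsilon> x v c > 0" "entry_time \<epsilon> x v c = s"
proof -
  have b: "v \<bullet> (c - x) = s - \<epsilon> * (v \<bullet> n)"
    using v by (simp add: c_def inner_diff_right inner_add_right norm_eq_1)
  have "(norm (x + s *\<^sub>R v - c))\<^sup>2 = \<epsilon>\<^sup>2" using n \<epsilon> by (simp add: c_def)
  then have D: "disc \<epsilon> x v c = (\<epsilon> * (v \<bullet> n))\<^sup>2"
    using dist_line_power2[OF v, of x s c \<epsilon>] unfolding b by simp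
  then show "disc \<epsilon> x v c > 0" using vn \<epsilon> by simp
  have "sqrt (disc \<epsilon> x v c) = - (\<epsilon> * (v \<bullet> n))"
    unfolding D using vn \<epsilon> by (simp add: abs_if mult_less_0_iff)
  then show "entry_time \<epsilon> x v c = s" unfolding entry_time_def b by simp
qed

section \<open>Coordinates of a collision\<close>

text \<open>For a fixed trajectory, the obstacle centre is parametrised by the time and the normal of the
  collision. This is the unit cylinder, scaled by \<open>\<epsilon>\<close> across the line.\<close>

lemma cylinder_coordinates:
  fixes v x :: "'a::euclidean_space" and h :: "'a \<Rightarrow> ennreal"
  assumes v: "norm v = 1" and \<epsilon>: "\<epsilon> > 0" and [measurable]: "h \<in> borel_measurable borel"
  shows "(\<integral>\<^sup>+c. indicator {c. disc \<epsilon> x v c > 0} c * h c \<partial>lborel) = ennreal (\<epsilon> ^ (DIM('a) - 1)) *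
    (\<integral>\<^sup>+s. \<integral>\<^sup>+n. ennreal (max 0 (- (v \<bullet> n))) * h (x + s *\<^sub>R v - \<epsilon> *\<^sub>R n) \<partial>surface \<partial>lborel)"
proof -
  define k where "k c = h (x - \<epsilon> *\<^sub>R c)" for c
  have [measurable]: "k \<in> borel_measurable borel" unfolding k_def by measurable
  have w: "norm (- v) = 1" using v by simp
  have "(\<integral>\<^sup>+c. indicator {c. disc \<epsilon> x v c > 0} c * h c \<partial>lborel) =
     ennreal (\<bar>-\<epsilon>\<bar> ^ DIM('a)) * (\<integral>\<^sup>+c. indicator {c. disc \<epsilon> x v c > 0} (x + (- \<epsilon>) *\<^sub>R c) * h (x + (- \<epsilon>) *\<^sub>R c) \<partial>lborel)"
    by (rule nn_integral_lborel_scale) (use \<epsilon> in auto)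
  also have "(\<integral>\<^sup>+c. indicator {c. disc \<epsilon> x v c > 0} (x + (- \<epsilon>) *\<^sub>R c) * h (x + (- \<epsilon>) *\<^sub>R c) \<partial>lborel)
    = (\<integral>\<^sup>+c. indicator {c. (norm c)\<^sup>2 - ((- v) \<bullet> c)\<^sup>2 < 1} c * k c \<partial>lborel)"
  proof (rule nn_integral_cong)
    fix c
    have "disc \<epsilon> x v (x + (- \<epsilon>) *\<^sub>R c) = \<epsilon>\<^sup>2 * (1 - ((norm c)\<^sup>2 - ((- v) \<bullet> c)\<^sup>2))"
      by (simp add: disc_def power_mult_distrib algebra_simps)
    then have "disc \<epsilon> x v (x + (- \<epsilon>) *\<^sub>R c) > 0 \<longleftrightarrow> (norm c)\<^sup>2 - ((- v) \<bullet> c)\<^sup>2 < 1"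
      using \<epsilon> by (simp add: zero_less_mult_iff)
    then show "indicator {c. disc \<epsilon> x v c > 0} (x + (- \<epsilon>) *\<^sub>R c) * h (x + (- \<epsilon>) *\<^sub>R c) =
      indicator {c. (norm c)\<^sup>2 - ((- v) \<bullet> c)\<^sup>2 < 1} c * k c"
      by (simp add: k_def indicator_def)
  qed
  also have "\<dots> = (\<integral>\<^sup>+s. \<integral>\<^sup>+n. ennreal (max 0 ((- v) \<bullet> n)) * k (s *\<^sub>R (- v) + n) \<partial>surface \<partial>lborel)"
    by (rule cylinder_unit[OF w, symmetric]) measurable
  also have "\<dots> = ennreal \<bar>1 / \<epsilon>\<bar> * (\<integral>\<^sup>+s. \<integral>\<^sup>+n. ennreal (max 0 ((- v) \<bullet> n)) * k ((0 + 1 / \<epsilon> * s) *\<^sub>R (- v) + n) \<partial>surface \<partial>lborel)"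
    by (rule nn_integral_real_affine) (use \<epsilon> in auto)
  also have "(\<integral>\<^sup>+s. \<integral>\<^sup>+n. ennreal (max 0 ((- v) \<bullet> n)) * k ((0 + 1 / \<epsilon> * s) *\<^sub>R (- v) + n) \<partial>surface \<partial>lborel) =
    (\<integral>\<^sup>+s. \<integral>\<^sup>+n. ennreal (max 0 (- (v \<bullet> n))) * h (x + s *\<^sub>R v - \<epsilon> *\<^sub>R n) \<partial>surface \<partial>lborel)"
    using \<epsilon> by (intro nn_integral_cong) (simp add: k_def algebra_simps)
  finally have "(\<integral>\<^sup>+c. indicator {c. disc \<epsilon> x v c > 0} c * h c \<partial>lborel) = (ennreal (\<bar>-\<epsilon>\<bar> ^ DIM('a)) * ennreal \<bar>1 / \<epsilon>\<bar>) *
    (\<integral>\<^sup>+s. \<integral>\<^sup>+n. ennreal (max 0 (- (v \<bullet> n))) * h (x + s *\<^sub>R v - \<epsilon> *\<^sub>R n) \<partial>surface \<partial>lborel)"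
    by (simp only: mult.assoc)
  also have "ennreal (\<bar>-\<epsilon>\<bar> ^ DIM('a)) * ennreal \<bar>1 / \<epsilon>\<bar> = ennreal (\<epsilon> ^ (DIM('a) - 1))"
    using \<epsilon> by (simp add: ennreal_mult[symmetric] power_diff DIM_positive Suc_leI)
  finally show ?thesis .
qed

text \<open>For a fixed obstacle, the starting point \<open>x\<close> is parametrised by the time \<open>s\<close> and the normal \<open>n\<close> of
  the collision; translation invariance exchanges the roles of \<open>x\<close> and \<open>c\<close>.\<close>

lemma incoming_coordinates:
  fixes v c :: "'a::euclidean_space" and \<Theta> :: "real \<Rightarrow> 'a \<Rightarrow> ennreal"
  assumes v: "norm v = 1" and \<epsilon>: "\<epsilon> > 0"
    and \<Theta> [measurable]: "(\<lambda>(s, y). \<Theta> s y) \<in> borel_measurable (borel \<Otimes>\<^sub>M borel)"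
  shows "(\<integral>\<^sup>+x. indicator {x. disc \<epsilon> x v c > 0} x *
        \<Theta> (entry_time \<epsilon> x v c) (x + entry_time \<epsilon> x v c *\<^sub>R v) \<partial>lborel) =
    ennreal (\<epsilon> ^ (DIM('a) - 1)) *
    (\<integral>\<^sup>+s. \<integral>\<^sup>+n. ennreal (max 0 (- (v \<bullet> n))) * \<Theta> s (c + \<epsilon> *\<^sub>R n) \<partial>surface \<partial>lborel)"
proof -
  let ?e = "\<lambda>y. entry_time \<epsilon> 0 v y"
  have "(\<integral>\<^sup>+x. indicator {x. disc \<epsilon> x v c > 0} x *
        \<Theta> (entry_time \<epsilon> x v c) (x + entry_time \<epsilon> x v c *\<^sub>R v) \<partial>lborel) =
     ennreal (\<bar>-1\<bar> ^ DIM('a)) * (\<integral>\<^sup>+y. indicator {x. disc \<epsilon> x v c > 0} (c + (-1) *\<^sub>R y) *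
        \<Theta> (entry_time \<epsilon> (c + (-1) *\<^sub>R y) v c) (c + (-1) *\<^sub>R y + entry_time \<epsilon> (c + (-1) *\<^sub>R y) v c *\<^sub>R v) \<partial>lborel)"
    by (rule nn_integral_lborel_scale) auto
  also have "\<dots> = (\<integral>\<^sup>+y. indicator {y. disc \<epsilon> 0 v y > 0} y * \<Theta> (?e y) (c - y + ?e y *\<^sub>R v) \<partial>lborel)"
    by (simp add: disc_def entry_time_def indicator_def)
  also have "\<dots> = ennreal (\<epsilon> ^ (DIM('a) - 1)) * (\<integral>\<^sup>+s. \<integral>\<^sup>+n. ennreal (max 0 (- (v \<bullet> n))) *
      \<Theta> (?e (0 + s *\<^sub>R v - \<epsilon> *\<^sub>R n)) (c - (0 + s *\<^sub>R v - \<epsilon> *\<^sub>R n) + ?e (0 + s *\<^sub>R v - \<epsilon> *\<^sub>R n) *\<^sub>R v) \<partial>surface \<partial>lborel)"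
    by (rule cylinder_coordinates[OF v \<epsilon>]) measurable
  also have "(\<integral>\<^sup>+s. \<integral>\<^sup>+n. ennreal (max 0 (- (v \<bullet> n))) *
      \<Theta> (?e (0 + s *\<^sub>R v - \<epsilon> *\<^sub>R n)) (c - (0 + s *\<^sub>R v - \<epsilon> *\<^sub>R n) + ?e (0 + s *\<^sub>R v - \<epsilon> *\<^sub>R n) *\<^sub>R v) \<partial>surface \<partial>lborel)
    = (\<integral>\<^sup>+s. \<integral>\<^sup>+n. ennreal (max 0 (- (v \<bullet> n))) * \<Theta> s (c + \<epsilon> *\<^sub>R n) \<partial>surface \<partial>lborel)"
  proof (rule nn_integral_cong, rule nn_integral_cong_AE)
    fix s :: real
    show "AE n in surface. ennreal (max 0 (- (v \<bullet> n))) *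
      \<Theta> (?e (0 + s *\<^sub>R v - \<epsilon> *\<^sub>R n)) (c - (0 + s *\<^sub>R v - \<epsilon> *\<^sub>R n) + ?e (0 + s *\<^sub>R v - \<epsilon> *\<^sub>R n) *\<^sub>R v) =
      ennreal (max 0 (- (v \<bullet> n))) * \<Theta> s (c + \<epsilon> *\<^sub>R n)"
      using AE_surface_norm
    proof eventually_elim
      case (elim n)
      then show ?case
        using incoming_data(2)[OF v elim \<epsilon>, of 0 s] by (cases "v \<bullet> n < 0") (auto simp: max_def)
    qed
  qed
  finally show ?thesis .
qed

text \<open>The exit of a line from the ball is its entry for the reversed velocity.\<close>

lemma outgoing_coordinates:
  fixes v c :: "'a::euclidean_space" and \<Theta> :: "real \<Rightarrow> 'a \<Rightarrow> ennreal"
  assumes v: "norm v = 1" and \<epsilon>: "\<epsilon> > 0"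
    and \<Theta> [measurable]: "(\<lambda>(s, y). \<Theta> s y) \<in> borel_measurable (borel \<Otimes>\<^sub>M borel)"
  shows "(\<integral>\<^sup>+x. indicator {x. disc \<epsilon> x v c > 0} x *
        \<Theta> (exit_time \<epsilon> x v c) (x + exit_time \<epsilon> x v c *\<^sub>R v) \<partial>lborel) =
    ennreal (\<epsilon> ^ (DIM('a) - 1)) *
    (\<integral>\<^sup>+s. \<integral>\<^sup>+n. ennreal (max 0 (v \<bullet> n)) * \<Theta> s (c + \<epsilon> *\<^sub>R n) \<partial>surface \<partial>lborel)"
proof -
  have w: "norm (- v) = 1" using v by simp
  have rev: "disc \<epsilon> x (- v) c = disc \<epsilon> x v c" "entry_time \<epsilon> x (- v) c = - exit_time \<epsilon> x v c" for x
    by (simp_all add: disc_def entry_time_def exit_time_def)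
  have "(\<integral>\<^sup>+x. indicator {x. disc \<epsilon> x (- v) c > 0} x *
        \<Theta> (- entry_time \<epsilon> x (- v) c) (x + entry_time \<epsilon> x (- v) c *\<^sub>R (- v)) \<partial>lborel) =
    ennreal (\<epsilon> ^ (DIM('a) - 1)) *
    (\<integral>\<^sup>+s. \<integral>\<^sup>+n. ennreal (max 0 (- ((- v) \<bullet> n))) * \<Theta> (- s) (c + \<epsilon> *\<^sub>R n) \<partial>surface \<partial>lborel)"
    by (rule incoming_coordinates[OF w \<epsilon>, where \<Theta>="\<lambda>s y. \<Theta> (- s) y"]) measurable
  also have "(\<integral>\<^sup>+s. \<integral>\<^sup>+n. ennreal (max 0 (- ((- v) \<bullet> n))) * \<Theta> (- s) (c + \<epsilon> *\<^sub>R n) \<partial>surface \<partial>lborel) =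
     (\<integral>\<^sup>+s. \<integral>\<^sup>+n. ennreal (max 0 (v \<bullet> n)) * \<Theta> s (c + \<epsilon> *\<^sub>R n) \<partial>surface \<partial>lborel)"
    by (subst nn_integral_real_affine[where c="-1" and t=0]) auto
  finally show ?thesis by (simp add: rev)
qed

text \<open>Liouville's theorem for one specular reflection. In the coordinates of a collision, incoming and
  outgoing phase volumes are \<open>max 0 (- (v \<bullet> n)) ds dn dv\<close> and \<open>max 0 (v \<bullet> n) ds dn dv\<close>; for fixed \<open>n\<close> the
  reflection \<open>v \<mapsto> specular n v\<close> preserves \<open>dv\<close> and reverses the sign of \<open>v \<bullet> n\<close>. On the right-hand
  side the particle is followed backwards along the straight line through the obstacle, so that both
  sides integrate over a position at time 0.\<close>

lemma collision_preserves_phase_volume: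
  fixes c :: "'a::euclidean_space" and \<Theta> :: "real \<Rightarrow> 'a \<Rightarrow> 'a \<Rightarrow> ennreal"
  assumes \<epsilon>: "\<epsilon> > 0"
    and \<Theta> [measurable]: "(\<lambda>(s, y, v). \<Theta> s y v) \<in> borel_measurable (borel \<Otimes>\<^sub>M borel \<Otimes>\<^sub>M borel)"
  shows "(\<integral>\<^sup>+v. \<integral>\<^sup>+x. indicator {x. disc \<epsilon> x v c > 0} x *
        \<Theta> (entry_time \<epsilon> x v c) (x + entry_time \<epsilon> x v c *\<^sub>R v)
          (specular ((x + entry_time \<epsilon> x v c *\<^sub>R v - c) /\<^sub>R \<epsilon>) v) \<partial>lborel \<partial>surface) =
    (\<integral>\<^sup>+v. \<integral>\<^sup>+x. indicator {x. disc \<epsilon> x v c > 0} x *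
        \<Theta> (exit_time \<epsilon> x v c) (x + exit_time \<epsilon> x v c *\<^sub>R v) v \<partial>lborel \<partial>surface)"
    (is "?L = ?R")
proof -
  interpret P: pair_sigma_finite lborel "surface :: 'a measure" ..
  interpret Q: pair_sigma_finite "surface :: 'a measure" "surface :: 'a measure" ..
  let ?k = "ennreal (\<epsilon> ^ (DIM('a) - 1))"
  have [measurable (raw)]: "(\<lambda>w. \<Theta> (f w) (g w) (h w)) \<in> borel_measurable N"
    if "f \<in> borel_measurable N" "g \<in> borel_measurable N" "h \<in> borel_measurable N"
    for N :: "'n measure" and f g h
    using measurable_compose[OF measurable_Pair[OF that(1) measurable_Pair[OF that(2,3)]] \<Theta>] by simp
  have "?L = (\<integral>\<^sup>+v. ?k * (\<integral>\<^sup>+s. \<integral>\<^sup>+n. ennreal (max 0 (- (v \<bullet> n))) *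
      \<Theta> s (c + \<epsilon> *\<^sub>R n) (specular ((c + \<epsilon> *\<^sub>R n - c) /\<^sub>R \<epsilon>) v) \<partial>surface \<partial>lborel) \<partial>surface)"
  proof (rule nn_integral_cong_AE, use AE_surface_norm in eventually_elim)
    case (elim v)
    show ?case
      by (rule incoming_coordinates[OF elim \<epsilon>, where
            \<Theta>="\<lambda>s y. \<Theta> s y (specular ((y - c) /\<^sub>R \<epsilon>) v)"]) measurable
  qed
  also have "\<dots> = ?k * (\<integral>\<^sup>+v. \<integral>\<^sup>+s. \<integral>\<^sup>+n. ennreal (max 0 (- (v \<bullet> n))) *
      \<Theta> s (c + \<epsilon> *\<^sub>R n) (specular n v) \<partial>surface \<partial>lborel \<partial>surface)"
    using \<epsilon> by (simp add: nn_integral_cmult)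
  also have "(\<integral>\<^sup>+v. \<integral>\<^sup>+s. \<integral>\<^sup>+n. ennreal (max 0 (- (v \<bullet> n))) *
      \<Theta> s (c + \<epsilon> *\<^sub>R n) (specular n v) \<partial>surface \<partial>lborel \<partial>surface) =
    (\<integral>\<^sup>+s. \<integral>\<^sup>+v. \<integral>\<^sup>+n. ennreal (max 0 (- (v \<bullet> n))) *
      \<Theta> s (c + \<epsilon> *\<^sub>R n) (specular n v) \<partial>surface \<partial>surface \<partial>lborel)"
    by (rule P.Fubini') measurable
  also have "\<dots> = (\<integral>\<^sup>+s. \<integral>\<^sup>+n. \<integral>\<^sup>+v. ennreal (max 0 (- (v \<bullet> n))) *
      \<Theta> s (c + \<epsilon> *\<^sub>R n) (specular n v) \<partial>surface \<partial>surface \<partial>lborel)"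
    by (intro nn_integral_cong Q.Fubini') measurable
  also have "\<dots> = (\<integral>\<^sup>+s. \<integral>\<^sup>+n. \<integral>\<^sup>+v. ennreal (max 0 (v \<bullet> n)) *
      \<Theta> s (c + \<epsilon> *\<^sub>R n) v \<partial>surface \<partial>surface \<partial>lborel)"
  proof (rule nn_integral_cong, rule nn_integral_cong_AE)
    fix s
    show "AE n in surface. (\<integral>\<^sup>+v. ennreal (max 0 (- (v \<bullet> n))) * \<Theta> s (c + \<epsilon> *\<^sub>R n) (specular n v) \<partial>surface) =
      (\<integral>\<^sup>+v. ennreal (max 0 (v \<bullet> n)) * \<Theta> s (c + \<epsilon> *\<^sub>R n) v \<partial>surface)"
      using AE_surface_norm
    proof eventually_elim
      case (elim n)
      show ?case
        using nn_integral_surface_specular[OF _ elim, where f="\<lambda>v. ennreal (max 0 (v \<bullet> n)) *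
           \<Theta> s (c + \<epsilon> *\<^sub>R n) v"]
        by (simp add: inner_specular[OF elim])
    qed
  qed
  also have "\<dots> = (\<integral>\<^sup>+s. \<integral>\<^sup>+v. \<integral>\<^sup>+n. ennreal (max 0 (v \<bullet> n)) *
      \<Theta> s (c + \<epsilon> *\<^sub>R n) v \<partial>surface \<partial>surface \<partial>lborel)"
    by (intro nn_integral_cong Q.Fubini') measurable
  also have "\<dots> = (\<integral>\<^sup>+v. \<integral>\<^sup>+s. \<integral>\<^sup>+n. ennreal (max 0 (v \<bullet> n)) *
      \<Theta> s (c + \<epsilon> *\<^sub>R n) v \<partial>surface \<partial>lborel \<partial>surface)"
    by (rule P.Fubini'[symmetric]) measurable
  also have "?k * \<dots> = (\<integral>\<^sup>+v. ?k * (\<integral>\<^sup>+s. \<integral>\<^sup>+n. ennreal (max 0 (v \<bullet> n)) *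
      \<Theta> s (c + \<epsilon> *\<^sub>R n) v \<partial>surface \<partial>lborel) \<partial>surface)"
    by (rule nn_integral_cmult[symmetric]) measurable
  also have "\<dots> = ?R"
  proof (rule nn_integral_cong_AE, use AE_surface_norm in eventually_elim)
    case (elim v)
    show ?case
      by (rule outgoing_coordinates[OF elim \<epsilon>, symmetric, where \<Theta>="\<lambda>s y. \<Theta> s y v"]) measurable
  qed
  finally show ?thesis .
qed

section \<open>Negligible sets of positions and directions\<close>

lemma finite_quadratic_roots:
  fixes a :: real assumes "a \<noteq> 0" shows "finite {\<tau>. a * \<tau>\<^sup>2 + b * \<tau> + k = 0}"
proof -
  have "finite {\<tau>. poly [:k, b, a:] \<tau> = 0}" by (rule poly_roots_finite) (use assms in simp)
  then show ?thesis by (rule rev_finite_subset) (auto simp: power2_eq_square algebra_simps)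
qed

lemma AE_not_in_finite:
  fixes X :: "'a::euclidean_space set"
  shows "finite X \<Longrightarrow> AE x in lborel. x \<notin> X"
  by (rule AE_not_in) (auto intro!: countable_imp_null_set_lborel countable_finite)

lemma norm_add_scaleR_power2:
  "(norm (y + \<tau> *\<^sub>R e))\<^sup>2 = (norm e)\<^sup>2 * \<tau>\<^sup>2 + 2 * (y \<bullet> e) * \<tau> + (norm (y::'a::euclidean_space))\<^sup>2"
  unfolding power2_norm_eq_inner inner_add_left inner_add_right inner_scaleR_left inner_scaleR_right
    inner_commute[of e y] by (simp add: power2_eq_square algebra_simps)

lemma orthogonal_direction:
  fixes p :: "'a::euclidean_space"
  assumes "DIM('a) \<ge> 2"
  obtains e :: 'a where "e \<noteq> 0" "p \<bullet> e = 0"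
  using orthogonal_to_vector_exists[OF assms, of p] by (auto simp: orthogonal_def)

text \<open>The exceptional sets below are zero sets of quadratic polynomials whose restriction to every line in
  some direction is nonconstant; each such line meets them in at most two points.\<close>

lemma AE_not_in_if_quadratic_on_lines:
  fixes N :: "'a::euclidean_space set"
  assumes N: "N \<in> sets borel" and e: "e \<noteq> 0"
    and q: "\<And>x. \<exists>b k. \<forall>\<tau>. x + \<tau> *\<^sub>R e \<in> N \<longrightarrow> (norm e)\<^sup>2 * \<tau>\<^sup>2 + b * \<tau> + k = 0"
  shows "AE x in lborel. x \<notin> N"
proof (rule AE_not_in, rule null_if_null_on_lines[OF N])
  fix x
  obtain b k where bk: "\<And>\<tau>. x + \<tau> *\<^sub>R e \<in> N \<Longrightarrow> (norm e)\<^sup>2 * \<tau>\<^sup>2 + b * \<tau> + k = 0" using q[of x] by blast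
  have "(norm e)\<^sup>2 \<noteq> 0" using e by simp
  from AE_not_in_finite[OF finite_quadratic_roots[OF this, of b k]]
  show "AE \<tau> in lborel. x + \<tau> *\<^sub>R e \<notin> N"
    by eventually_elim (use bk in blast)
qed

text \<open>Tangency is a nonconstant quadratic condition in any direction orthogonal to \<open>v\<close>, which exists in
  dimension at least 2.\<close>

lemma AE_disc_nonzero:
  fixes v c x :: "'a::euclidean_space"
  assumes "DIM('a) \<ge> 2"
  shows "AE x in lborel. disc \<epsilon> x v c \<noteq> 0" "AE c in lborel. disc \<epsilon> x v c \<noteq> 0"
proof -
  obtain e where e: "e \<noteq> 0" "v \<bullet> e = 0" using orthogonal_direction[OF assms] .
  have D: "disc \<epsilon> x v (c + \<tau> *\<^sub>R e) = - ((norm e)\<^sup>2 * \<tau>\<^sup>2 + (2 * ((c - x) \<bullet> e)) * \<tau> +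
        ((norm (c - x))\<^sup>2 - (v \<bullet> (c - x))\<^sup>2 - \<epsilon>\<^sup>2))" for \<tau> x c
  proof -
    have "c + \<tau> *\<^sub>R e - x = (c - x) + \<tau> *\<^sub>R e" by simp
    moreover have "v \<bullet> ((c - x) + \<tau> *\<^sub>R e) = v \<bullet> (c - x)" using e by (simp add: inner_add_right)
    ultimately show ?thesis unfolding disc_def by (simp only: norm_add_scaleR_power2[of "c - x" \<tau> e])
  qed
  have D': "disc \<epsilon> (x + \<tau> *\<^sub>R e) v c = disc \<epsilon> (- c) v (- x + (- \<tau>) *\<^sub>R e)" for \<tau> x c
  proof -
    have "- x + (- \<tau>) *\<^sub>R e - - c = c - (x + \<tau> *\<^sub>R e)" by simp
    then show ?thesis unfolding disc_def by (simp only:)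
  qed
  have "AE x in lborel. x \<notin> {x. disc \<epsilon> x v c = 0}"
  proof (rule AE_not_in_if_quadratic_on_lines[OF _ e(1)])
    fix x
    let ?b = "2 * ((- x - - c) \<bullet> e)" and ?k = "(norm (- x - - c))\<^sup>2 - (v \<bullet> (- x - - c))\<^sup>2 - \<epsilon>\<^sup>2"
    have "(norm e)\<^sup>2 * \<tau>\<^sup>2 + (- ?b) * \<tau> + ?k = 0" if "x + \<tau> *\<^sub>R e \<in> {x. disc \<epsilon> x v c = 0}" for \<tau>
      using that D[of "- c" "- x" "- \<tau>"] unfolding mem_Collect_eq D' by simp
    then show "\<exists>b k. \<forall>\<tau>. x + \<tau> *\<^sub>R e \<in> {x. disc \<epsilon> x v c = 0} \<longrightarrow> (norm e)\<^sup>2 * \<tau>\<^sup>2 + b * \<tau> + k = 0" by blast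
  qed simp
  then show "AE x in lborel. disc \<epsilon> x v c \<noteq> 0" by simp
  have "AE c in lborel. c \<notin> {c. disc \<epsilon> x v c = 0}"
  proof (rule AE_not_in_if_quadratic_on_lines[OF _ e(1)])
    fix c
    show "\<exists>b k. \<forall>\<tau>. c + \<tau> *\<^sub>R e \<in> {c. disc \<epsilon> x v c = 0} \<longrightarrow> (norm e)\<^sup>2 * \<tau>\<^sup>2 + b * \<tau> + k = 0"
      unfolding mem_Collect_eq D neg_equal_0_iff_equal by blast
  qed simp
  then show "AE c in lborel. disc \<epsilon> x v c \<noteq> 0" by simp
qed

lemma AE_norm_neq:
  fixes c :: "'a::euclidean_space"
  shows "AE x in lborel. norm (x - c) \<noteq> \<epsilon>"
proof -
  obtain e :: 'a where e: "e \<in> Basis" using nonempty_Basis by blast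
  have "AE x in lborel. x \<notin> {x. norm (x - c) = \<epsilon>}"
  proof (rule AE_not_in_if_quadratic_on_lines[where e=e])
    fix x
    have "(norm e)\<^sup>2 * \<tau>\<^sup>2 + 2 * ((x - c) \<bullet> e) * \<tau> + ((norm (x - c))\<^sup>2 - \<epsilon>\<^sup>2) = 0"
      if "x + \<tau> *\<^sub>R e \<in> {x. norm (x - c) = \<epsilon>}" for \<tau>
    proof -
      have eq: "(x - c) + \<tau> *\<^sub>R e = x + \<tau> *\<^sub>R e - c" by simp
      show ?thesis using that norm_add_scaleR_power2[of "x - c" \<tau> e] unfolding eq by simp
    qed
    then show "\<exists>b k. \<forall>\<tau>. x + \<tau> *\<^sub>R e \<in> {x. norm (x - c) = \<epsilon>} \<longrightarrow> (norm e)\<^sup>2 * \<tau>\<^sup>2 + b * \<tau> + k = 0" by blast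
  qed (use e in auto)
  then show ?thesis by simp
qed

text \<open>A set of directions is null if its cone is, and the cone is null if it meets every line in the
  direction \<open>e\<close> in finitely many points.\<close>

lemma AE_surface_not_in:
  fixes N :: "'a::euclidean_space set"
  assumes [measurable]: "N \<in> sets borel"
    and e: "\<And>x. finite {\<tau>. x + \<tau> *\<^sub>R e \<noteq> 0 \<and> (x + \<tau> *\<^sub>R e) /\<^sub>R norm (x + \<tau> *\<^sub>R e) \<in> N}"
  shows "AE n in surface. n \<notin> N"
proof -
  have "{x. x \<noteq> 0 \<and> x /\<^sub>R norm x \<in> N} \<in> null_sets lborel"
  proof (rule null_if_null_on_lines)
    show "AE \<tau> in lborel. x + \<tau> *\<^sub>R e \<notin> {x. x \<noteq> 0 \<and> x /\<^sub>R norm x \<in> N}" for x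
      using AE_not_in_finite[OF e[of x]] by simp
  qed simp
  then have "{x \<in> ball 0 1 - {0}. x /\<^sub>R norm x \<in> N} \<in> null_sets lborel"
    by (rule null_sets_subset) auto
  then have "N \<in> null_sets surface"
    by (intro null_setsI) (auto simp: emeasure_surface)
  then show ?thesis by (rule AE_not_in)
qed

lemma AE_surface_neq:
  fixes p :: "'a::euclidean_space"
  assumes "DIM('a) \<ge> 2"
  shows "AE n in surface. n \<noteq> p"
proof -
  obtain e where e: "e \<noteq> 0" "p \<bullet> e = 0" using orthogonal_direction[OF assms] .
  have "AE n in surface. n \<notin> {p}"
  proof (rule AE_surface_not_in)
    fix x
    have "\<tau> = - (x \<bullet> e) / (e \<bullet> e)" if "x + \<tau> *\<^sub>R e \<noteq> 0" "(x + \<tau> *\<^sub>R e) /\<^sub>R norm (x + \<tau> *\<^sub>R e) \<in> {p}" for \<tau>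
    proof -
      let ?y = "x + \<tau> *\<^sub>R e"
      have "?y /\<^sub>R norm ?y = p" using that(2) by blast
      then have "(?y /\<^sub>R norm ?y) \<bullet> e = 0" using e(2) by (simp only:)
      then have "?y \<bullet> e = 0" using that(1) by (simp only: inner_scaleR_left mult_eq_0_iff inverse_nonzero_iff_nonzero norm_eq_zero simp_thms)
      then have "x \<bullet> e + \<tau> * (e \<bullet> e) = 0" by (simp only: inner_add_left inner_scaleR_left)
      moreover have "e \<bullet> e \<noteq> 0" using e(1) by (simp only: inner_eq_zero_iff not_False_eq_True)
      ultimately show ?thesis by (simp only: eq_divide_eq if_True if_False simp_thms)
    qed
    then have "{\<tau>. x + \<tau> *\<^sub>R e \<noteq> 0 \<and> (x + \<tau> *\<^sub>R e) /\<^sub>R norm (x + \<tau> *\<^sub>R e) \<in> {p}} \<subseteq> {- (x \<bullet> e) / (e \<bullet> e)}"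
      by blast
    then show "finite {\<tau>. x + \<tau> *\<^sub>R e \<noteq> 0 \<and> (x + \<tau> *\<^sub>R e) /\<^sub>R norm (x + \<tau> *\<^sub>R e) \<in> {p}}"
      by (rule finite_subset) simp
  qed simp
  then show ?thesis by simp
qed

lemma AE_surface_not_in_finite:
  fixes X :: "'a::euclidean_space set"
  assumes "DIM('a) \<ge> 2" "finite X"
  shows "AE n in surface. n \<notin> X"
proof -
  have "AE n in surface. \<forall>p\<in>X. n \<noteq> p"
    by (intro AE_finite_allI assms AE_surface_neq)
  then show ?thesis by eventually_elim blast
qed

text \<open>With \<open>a = c - c'\<close>, the points \<open>y\<close> of the cone over the exceptional set satisfy
  \<open>(norm a)\<^sup>2 * norm y = - 2 \<epsilon> (a \<bullet> y)\<close>. Along a line orthogonal to \<open>a\<close> the right-hand side is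
  constant, so that \<open>(norm y)\<^sup>2\<close>, a nonconstant quadratic, takes a prescribed value.\<close>

lemma AE_surface_off_sphere:
  fixes c c' :: "'a::euclidean_space"
  assumes "DIM('a) \<ge> 2" "c \<noteq> c'" "\<epsilon> > 0"
  shows "AE n in surface. norm (c + \<epsilon> *\<^sub>R n - c') \<noteq> \<epsilon>"
proof -
  define a where "a = c - c'"
  have a: "a \<noteq> 0" using assms by (simp add: a_def)
  obtain e where e: "e \<noteq> 0" "a \<bullet> e = 0" using orthogonal_direction[OF assms(1)] .
  have "AE n in surface. n \<notin> {n. norm (a + \<epsilon> *\<^sub>R n) = \<epsilon>}"
  proof (rule AE_surface_not_in)
    fix x
    define k where "k = - (2 * \<epsilon> * (a \<bullet> x)) / (norm a)\<^sup>2"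
    have "(norm e)\<^sup>2 * \<tau>\<^sup>2 + (2 * (x \<bullet> e)) * \<tau> + ((norm x)\<^sup>2 - k\<^sup>2) = 0"
      if *: "x + \<tau> *\<^sub>R e \<noteq> 0" "norm (a + \<epsilon> *\<^sub>R ((x + \<tau> *\<^sub>R e) /\<^sub>R norm (x + \<tau> *\<^sub>R e))) = \<epsilon>" for \<tau>
    proof -
      let ?y = "x + \<tau> *\<^sub>R e"
      let ?n = "?y /\<^sub>R norm ?y"
      have "norm ?n = 1" using *(1) by simp
      then have "\<epsilon>\<^sup>2 + 2 * (a \<bullet> ?n) * \<epsilon> + (norm a)\<^sup>2 = \<epsilon>\<^sup>2"
        using norm_add_scaleR_power2[of a \<epsilon> ?n] unfolding *(2) by simp
      then have A: "(norm a)\<^sup>2 = - 2 * (a \<bullet> ?n) * \<epsilon>" by simp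
      have "(norm a)\<^sup>2 * norm ?y = - 2 * \<epsilon> * ((a \<bullet> ?n) * norm ?y)" unfolding A by (simp only: ac_simps)
      also have "(a \<bullet> ?n) * norm ?y = a \<bullet> (norm ?y *\<^sub>R ?n)" by (simp only: inner_scaleR_right mult.commute)
      also have "norm ?y *\<^sub>R ?n = ?y" using *(1) by simp
      also have "a \<bullet> ?y = a \<bullet> x" using e(2) by (simp add: inner_add_right)
      finally have "(norm a)\<^sup>2 * norm ?y = - (2 * \<epsilon> * (a \<bullet> x))" by simp
      moreover have "norm ?y = ((norm a)\<^sup>2 * norm ?y) / (norm a)\<^sup>2" using a by simp
      ultimately have "norm ?y = k" unfolding k_def by (simp only:)
      then have "(norm ?y)\<^sup>2 = k\<^sup>2" by simp
      then show ?thesis unfolding norm_add_scaleR_power2 by simp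
    qed
    then have "{\<tau>. x + \<tau> *\<^sub>R e \<noteq> 0 \<and> (x + \<tau> *\<^sub>R e) /\<^sub>R norm (x + \<tau> *\<^sub>R e) \<in> {n. norm (a + \<epsilon> *\<^sub>R n) = \<epsilon>}}
      \<subseteq> {\<tau>. (norm e)\<^sup>2 * \<tau>\<^sup>2 + (2 * (x \<bullet> e)) * \<tau> + ((norm x)\<^sup>2 - k\<^sup>2) = 0}"
      by blast
    moreover have "(norm e)\<^sup>2 \<noteq> 0" using e(1) by simp
    ultimately show "finite {\<tau>. x + \<tau> *\<^sub>R e \<noteq> 0 \<and> (x + \<tau> *\<^sub>R e) /\<^sub>R norm (x + \<tau> *\<^sub>R e) \<in> {n. norm (a + \<epsilon> *\<^sub>R n) = \<epsilon>}}"
      using finite_quadratic_roots finite_subset by blast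
  qed simp
  moreover have "c + \<epsilon> *\<^sub>R n - c' = a + \<epsilon> *\<^sub>R n" for n by (simp add: a_def)
  ultimately show ?thesis by (simp only: mem_Collect_eq)
qed

section \<open>The tube swept by a flight\<close>

text \<open>The condition \<open>0 < exit_time \<epsilon> x v c\<close> rules out the obstacle from which the trajectory has just been
  reflected: it touches the line at time 0, where its exit time is 0.\<close>

definition blocked :: "real \<Rightarrow> real \<Rightarrow> 'a::euclidean_space \<Rightarrow> 'a \<Rightarrow> 'a \<Rightarrow> bool" where
  "blocked \<epsilon> r x v c \<longleftrightarrow> disc \<epsilon> x v c \<ge> 0 \<and> entry_time \<epsilon> x v c \<le> r \<and> 0 < exit_time \<epsilon> x v c"

text \<open>The cross section of the unit ball in the direction \<open>v\<close>.\<close>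

definition collision_rate :: "'a::euclidean_space \<Rightarrow> ennreal" where
  "collision_rate v = (\<integral>\<^sup>+n. ennreal (max 0 (- (v \<bullet> n))) \<partial>surface)"

lemma measurable_blocked [measurable (raw)]:
  fixes x v c :: "'b \<Rightarrow> 'a::euclidean_space"
  assumes [measurable]: "r \<in> borel_measurable M" "x \<in> borel_measurable M" "v \<in> borel_measurable M" "c \<in> borel_measurable M"
  shows "Measurable.pred M (\<lambda>w. blocked \<epsilon> (r w) (x w) (v w) (c w))"
  unfolding blocked_def by measurable

lemma measurable_collision_rate [measurable]: "collision_rate \<in> borel_measurable borel"
  unfolding collision_rate_def by measurable

lemma collision_rate_le:
  assumes "norm (v::'a::euclidean_space) = 1"
  shows "collision_rate v \<le> emeasure surface (UNIV :: 'a set)"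
proof -
  have "collision_rate v \<le> (\<integral>\<^sup>+n. 1 \<partial>(surface :: 'a measure))"
    unfolding collision_rate_def
  proof (rule nn_integral_mono_AE, use AE_surface_norm in eventually_elim)
    case (elim n)
    have "\<bar>v \<bullet> n\<bar> \<le> 1" using Cauchy_Schwarz_ineq2[of v n] assms elim by simp
    then show ?case by auto
  qed
  then show ?thesis by simp
qed

lemma blocked_iff:
  fixes x v c :: "'a::euclidean_space"
  assumes "norm v = 1" "\<epsilon> > 0" "r > 0"
  shows "blocked \<epsilon> r x v c \<longleftrightarrow> (\<exists>s\<in>{0..r}. norm (x + s *\<^sub>R v - c) \<le> \<epsilon>) \<and> 0 < exit_time \<epsilon> x v c"
proof -
  have le: "entry_time \<epsilon> x v c \<le> exit_time \<epsilon> x v c" if "disc \<epsilon> x v c \<ge> 0"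
    using that real_sqrt_ge_zero[of "disc \<epsilon> x v c"] by (simp add: entry_time_def exit_time_def)
  show ?thesis
  proof
    assume b: "blocked \<epsilon> r x v c"
    then have "norm (x + max 0 (entry_time \<epsilon> x v c) *\<^sub>R v - c) \<le> \<epsilon>"
      using le by (subst in_ball_line_iff(2)[OF assms(1,2)]) (auto simp: blocked_def)
    then show "(\<exists>s\<in>{0..r}. norm (x + s *\<^sub>R v - c) \<le> \<epsilon>) \<and> 0 < exit_time \<epsilon> x v c"
      using b assms(3) by (intro conjI bexI[of _ "max 0 (entry_time \<epsilon> x v c)"]) (auto simp: blocked_def)
  next
    assume "(\<exists>s\<in>{0..r}. norm (x + s *\<^sub>R v - c) \<le> \<epsilon>) \<and> 0 < exit_time \<epsilon> x v c"
    then show "blocked \<epsilon> r x v c"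
      unfolding in_ball_line_iff(2)[OF assms(1,2)] blocked_def by auto
  qed
qed

text \<open>Up to the ball around the starting point, a centre that blocks the flight is hit from outside, so
  the volume can be computed in the coordinates of the collision.\<close>

lemma tube_volume:
  fixes x v :: "'a::euclidean_space"
  assumes dim: "DIM('a) \<ge> 2" and v: "norm v = 1" and \<epsilon>: "\<epsilon> > 0" and r: "r \<ge> 0"
  shows "emeasure lborel {c. blocked \<epsilon> r x v c} \<le>
    ennreal (\<epsilon> ^ (DIM('a) - 1)) * (collision_rate v * ennreal r + ennreal (unit_ball_vol DIM('a) * \<epsilon>))"
proof -
  let ?h = "\<lambda>c. indicator {0<..r} (entry_time \<epsilon> x v c) :: ennreal"
  have [measurable]: "cball x \<epsilon> \<in> sets borel" by simp
  have "emeasure lborel {c. blocked \<epsilon> r x v c} \<le>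
     (\<integral>\<^sup>+c. indicator {c. disc \<epsilon> x v c > 0} c * ?h c + indicator (cball x \<epsilon>) c \<partial>lborel)"
  proof (subst nn_integral_indicator[symmetric])
    show "(\<integral>\<^sup>+c. indicator {c. blocked \<epsilon> r x v c} c \<partial>lborel) \<le>
      (\<integral>\<^sup>+c. indicator {c. disc \<epsilon> x v c > 0} c * ?h c + indicator (cball x \<epsilon>) c \<partial>lborel)"
    proof (rule nn_integral_mono_AE, use AE_disc_nonzero(2)[OF dim, of \<epsilon> x v] in eventually_elim)
      case (elim c)
      show ?case
      proof (cases "blocked \<epsilon> r x v c \<and> entry_time \<epsilon> x v c \<le> 0")
        case True
        then have "norm (x + 0 *\<^sub>R v - c) \<le> \<epsilon>"
          by (subst in_ball_line_iff(2)[OF v \<epsilon>]) (auto simp: blocked_def)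
        then show ?thesis by (auto simp: dist_norm split: split_indicator)
      next
        case False
        then show ?thesis using elim by (auto simp: blocked_def split: split_indicator)
      qed
    qed
  qed simp
  also have "\<dots> = (\<integral>\<^sup>+c. indicator {c. disc \<epsilon> x v c > 0} c * ?h c \<partial>lborel) + emeasure lborel (cball x \<epsilon>)"
    by (subst nn_integral_add) auto
  also have "(\<integral>\<^sup>+c. indicator {c. disc \<epsilon> x v c > 0} c * ?h c \<partial>lborel) = ennreal (\<epsilon> ^ (DIM('a) - 1)) *
    (\<integral>\<^sup>+s. \<integral>\<^sup>+n. ennreal (max 0 (- (v \<bullet> n))) * ?h (x + s *\<^sub>R v - \<epsilon> *\<^sub>R n) \<partial>surface \<partial>lborel)"
    by (rule cylinder_coordinates[OF v \<epsilon>]) measurable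
  also have "(\<integral>\<^sup>+s. \<integral>\<^sup>+n. ennreal (max 0 (- (v \<bullet> n))) * ?h (x + s *\<^sub>R v - \<epsilon> *\<^sub>R n) \<partial>surface \<partial>lborel) =
     (\<integral>\<^sup>+s. \<integral>\<^sup>+n. ennreal (max 0 (- (v \<bullet> n))) * indicator {0<..r} s \<partial>surface \<partial>lborel)"
  proof (rule nn_integral_cong, rule nn_integral_cong_AE)
    fix s
    show "AE n in surface. ennreal (max 0 (- (v \<bullet> n))) * ?h (x + s *\<^sub>R v - \<epsilon> *\<^sub>R n) =
        ennreal (max 0 (- (v \<bullet> n))) * indicator {0<..r} s"
      using AE_surface_norm
    proof eventually_elim
      case (elim n)
      then show ?case
        using incoming_data(2)[OF v elim \<epsilon>, of x s] by (cases "v \<bullet> n < 0") (auto simp: max_def)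
    qed
  qed
  also have "\<dots> = (\<integral>\<^sup>+s. collision_rate v * indicator {0<..r} s \<partial>lborel)"
    unfolding collision_rate_def by (intro nn_integral_cong nn_integral_multc) measurable
  also have "\<dots> = collision_rate v * ennreal r"
    by (subst nn_integral_cmult_indicator) (use r in simp_all)
  also have "emeasure lborel (cball x \<epsilon>) = ennreal (\<epsilon> ^ (DIM('a) - 1)) * ennreal (unit_ball_vol DIM('a) * \<epsilon>)"
  proof -
    have "\<epsilon> ^ DIM('a) = \<epsilon> ^ (DIM('a) - 1) * \<epsilon>" using DIM_positive[where 'a='a] by (metis power_minus_mult)
    then show ?thesis using \<epsilon>
      by (simp add: emeasure_cball ennreal_mult[symmetric] ac_simps)
  qed
  finally show ?thesis by (simp add: distrib_left)
qed

section \<open>The measurable space of locally finite sets\<close>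

definition locally_finite :: "'a::euclidean_space set \<Rightarrow> bool" where
  "locally_finite C \<longleftrightarrow> (\<forall>R. finite (C \<inter> cball 0 R))"

text \<open>The sigma algebra is generated by the hitting events. It also makes the counting variables
  measurable (\<open>measurable_point_count\<close>), because points can be told apart by a countable basis.\<close>

definition config :: "'a::euclidean_space set measure" where
  "config = sigma {C. locally_finite C} ((\<lambda>A. {C. locally_finite C \<and> C \<inter> A \<noteq> {}}) ` sets borel)"

lemma space_config: "space config = {C. locally_finite C}"
  by (simp add: config_def space_measure_of_conv)

lemma sets_config:
  "sets config = sigma_sets {C. locally_finite C} ((\<lambda>A. {C. locally_finite C \<and> C \<inter> A \<noteq> {}}) ` sets borel)"
  unfolding config_def by (rule sets_measure_of) auto

lemma measurable_configI:
  fixes K :: "'w \<Rightarrow> 'a::euclidean_space set"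
  assumes "\<And>w. w \<in> space M \<Longrightarrow> locally_finite (K w)"
    and "\<And>A. A \<in> sets borel \<Longrightarrow> {w \<in> space M. K w \<inter> A \<noteq> {}} \<in> sets M"
  shows "K \<in> M \<rightarrow>\<^sub>M config"
proof (rule measurable_sigma_sets[OF sets_config])
  fix y :: "'a set set"
  assume "y \<in> (\<lambda>A. {C. locally_finite C \<and> C \<inter> A \<noteq> {}}) ` sets borel"
  then obtain A where A: "A \<in> sets borel" "y = {C. locally_finite C \<and> C \<inter> A \<noteq> {}}" by auto
  have "K -` y \<inter> space M = {w \<in> space M. K w \<inter> A \<noteq> {}}" using assms(1) A(2) by auto
  then show "K -` y \<inter> space M \<in> sets M" using assms(2)[OF A(1)] by simp
qed (use assms(1) in auto)

lemma sets_config_hit: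
  fixes A :: "'a::euclidean_space set"
  assumes "A \<in> sets borel" shows "{C \<in> space config. C \<inter> A \<noteq> {}} \<in> sets config"
proof -
  have "{C \<in> space config. C \<inter> A \<noteq> {}} = {C. locally_finite C \<and> C \<inter> A \<noteq> {}}" by (simp add: space_config)
  also have "\<dots> \<in> sets config" unfolding sets_config using assms by (intro sigma_sets.Basic imageI)
  finally show ?thesis .
qed

lemma pred_config_hit [measurable (raw)]:
  assumes "K \<in> M \<rightarrow>\<^sub>M config" "A \<in> sets borel" shows "Measurable.pred M (\<lambda>w. K w \<inter> A \<noteq> {})"
  by (rule pred_sets1[OF sets_config_hit[OF assms(2)] assms(1)])

lemma pred_config_avoid [measurable (raw)]:
  assumes "K \<in> M \<rightarrow>\<^sub>M config" "A \<in> sets borel" shows "Measurable.pred M (\<lambda>w. K w \<inter> A = {})"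
  using pred_intros_logic(2)[OF pred_config_hit[OF assms]] by simp

lemma locally_finite_countable: "locally_finite C \<Longrightarrow> countable C"
proof -
  assume "locally_finite C"
  then have F: "countable (C \<inter> cball 0 (real n))" for n
    unfolding locally_finite_def by (blast intro: countable_finite)
  have "countable (\<Union>n::nat. C \<inter> cball 0 (real n))"
    by (rule countable_UN) (auto intro: F)
  moreover have "C = (\<Union>n::nat. C \<inter> cball 0 (real n))"
    using real_arch_simple by (auto simp: mem_cball)
  ultimately show "countable C" by metis
qed

lemma locally_finite_bounded:
  assumes "locally_finite C" "bounded A" shows "finite (C \<inter> A)"
proof -
  obtain R where "A \<subseteq> ball 0 R" using bounded_subset_ballD[OF assms(2)] by blast
  then have "A \<subseteq> cball 0 R" using ball_subset_cball by blast
  then show ?thesis using assms(1) by (meson finite_subset inf_mono locally_finite_def order_refl)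
qed

lemma locally_finite_Un: "locally_finite C \<Longrightarrow> finite P \<Longrightarrow> locally_finite (C \<union> P)"
  by (simp add: locally_finite_def Int_Un_distrib2)

lemma locally_finite_insert: "locally_finite C \<Longrightarrow> locally_finite (insert c C)"
  using locally_finite_Un[of C "{c}"] by simp

lemma separate_finite:
  fixes S :: "'a::metric_space set"
  assumes B: "topological_basis B" and "finite S"
  obtains U where "\<And>x. x \<in> S \<Longrightarrow> U x \<in> B \<and> x \<in> U x" "disjoint_family_on U S"
proof -
  obtain d where d: "d > 0" "\<And>x y. x \<in> S \<Longrightarrow> y \<in> S \<Longrightarrow> x \<noteq> y \<Longrightarrow> d \<le> dist x y"
  proof (cases "\<exists>x\<in>S. \<exists>y\<in>S. x \<noteq> y")
    case True
    let ?D = "(\<lambda>(x, y). dist x y) ` {(x, y). x \<in> S \<and> y \<in> S \<and> x \<noteq> y}"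
    have "finite {(x, y). x \<in> S \<and> y \<in> S \<and> x \<noteq> y}"
      by (rule finite_subset[of _ "S \<times> S"]) (use \<open>finite S\<close> in auto)
    then have fin: "finite ?D" by (rule finite_imageI)
    have ne: "?D \<noteq> {}" using True by auto
    show ?thesis
    proof (rule that[of "Min ?D"])
      show "0 < Min ?D" using Min_in[OF fin ne] by auto
      show "Min ?D \<le> dist x y" if "x \<in> S" "y \<in> S" "x \<noteq> y" for x y
        using that by (intro Min_le[OF fin]) auto
    qed
  next
    case False
    then show ?thesis by (intro that[of 1]) auto
  qed
  have "\<exists>V. V \<in> B \<and> x \<in> V \<and> V \<subseteq> ball x (d / 2)" for x
  proof -
    have "x \<in> ball x (d / 2)" using d(1) by simp
    from topological_basisE[OF B open_ball this] show ?thesis by blast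
  qed
  then have "\<forall>x. \<exists>V. V \<in> B \<and> x \<in> V \<and> V \<subseteq> ball x (d / 2)" by blast
  from choice[OF this] obtain U where
    U: "\<And>x. U x \<in> B" "\<And>x. x \<in> U x" "\<And>x. U x \<subseteq> ball x (d / 2)" by blast
  have "U x \<inter> U y = {}" if xy: "x \<in> S" "y \<in> S" "x \<noteq> y" for x y
  proof -
    have "z \<notin> U y" if z: "z \<in> U x" for z
    proof
      assume "z \<in> U y"
      then have "dist x z < d / 2" "dist y z < d / 2" using U(3)[of x] U(3)[of y] z by auto
      then have "dist x y < d" using dist_triangle_half_r[of z x d y] by (simp add: dist_commute)
      then show False using d(2)[OF xy] by simp
    qed
    then show ?thesis by auto
  qed
  then show ?thesis using U by (intro that[of U]) (auto simp: disjoint_family_on_def)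
qed

text \<open>Counting by hitting events: finitely many points are separated by disjoint basic open sets, and a
  disjoint family hits \<open>C \<inter> A\<close> at most as often as there are points.\<close>

lemma point_count_eq_SUP:
  fixes C A :: "'a::euclidean_space set"
  assumes B: "topological_basis B"
  shows "point_count C A = (SUP F\<in>{F. finite F \<and> F \<subseteq> B \<and> disjoint F}.
    \<Sum>U\<in>F. indicator {C. C \<inter> (A \<inter> U) \<noteq> {}} C)" (is "_ = (SUP F\<in>?\<F>. ?s F)")
proof (rule antisym)
  have fin: "of_nat (card S) \<le> (SUP F\<in>?\<F>. ?s F)" if S: "finite S" "S \<subseteq> C \<inter> A" for S
  proof -
    obtain U where U: "\<And>x. x \<in> S \<Longrightarrow> U x \<in> B \<and> x \<in> U x" "disjoint_family_on U S"
      using separate_finite[OF B S(1)] by blast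
    have inj: "inj_on U S" using U by (fastforce simp: inj_on_def disjoint_family_on_def)
    have "disjoint (U ` S)" using U(2) by (rule disjoint_family_on_disjoint_image)
    then have "U ` S \<in> ?\<F>" using S(1) U(1) by blast
    then have "?s (U ` S) \<le> (SUP F\<in>?\<F>. ?s F)" by (rule SUP_upper)
    moreover have "?s (U ` S) = of_nat (card S)"
    proof -
      have "?s (U ` S) = (\<Sum>x\<in>S. indicator {C. C \<inter> (A \<inter> U x) \<noteq> {}} C)"
        by (simp add: sum.reindex[OF inj])
      also have "\<dots> = (\<Sum>x\<in>S. 1)"
      proof (rule sum.cong[OF refl])
        fix x assume "x \<in> S"
        then have "x \<in> C \<inter> (A \<inter> U x)" using S(2) U(1) by blast
        then have "C \<inter> (A \<inter> U x) \<noteq> {}" by (metis empty_iff)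
        then have "C \<in> {C. C \<inter> (A \<inter> U x) \<noteq> {}}" by (rule CollectI)
        then show "indicator {C. C \<inter> (A \<inter> U x) \<noteq> {}} C = (1::ennreal)"
          by (rule indicator_simps(1))
      qed
      finally show ?thesis by simp
    qed
    ultimately show ?thesis by (simp only:)
  qed
  show "point_count C A \<le> (SUP F\<in>?\<F>. ?s F)"
  proof (cases "finite (C \<inter> A)")
    case True
    then show ?thesis using fin[of "C \<inter> A"] by (simp add: point_count_def emeasure_count_space)
  next
    case False
    have "of_nat n \<le> (SUP F\<in>?\<F>. ?s F)" for n
      using infinite_arbitrarily_large[OF False, of n] fin by blast
    then have "(SUP n. of_nat n) \<le> (SUP F\<in>?\<F>. ?s F)" by (intro SUP_least)
    then show ?thesis unfolding ennreal_SUP_of_nat_eq_top by (rule order_trans[OF top_greatest])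
  qed
next
  show "(SUP F\<in>?\<F>. ?s F) \<le> point_count C A"
  proof (rule SUP_least)
    fix F assume F: "F \<in> ?\<F>"
    have "?s F \<le> (\<Sum>U\<in>F. emeasure (count_space UNIV) (C \<inter> (A \<inter> U)))"
    proof (rule sum_mono)
      fix U
      show "indicator {C. C \<inter> (A \<inter> U) \<noteq> {}} C \<le> emeasure (count_space UNIV) (C \<inter> (A \<inter> U))"
      proof (cases "C \<inter> (A \<inter> U) = {}")
        case False
        then obtain x where "x \<in> C \<inter> (A \<inter> U)" by blast
        then have "emeasure (count_space UNIV) {x} \<le> emeasure (count_space UNIV) (C \<inter> (A \<inter> U))"
          by (intro emeasure_mono) auto
        then show ?thesis using False by simp
      qed simp
    qed
    also have "\<dots> = emeasure (count_space UNIV) (\<Union>U\<in>F. C \<inter> (A \<inter> U))"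
      using F by (intro sum_emeasure) (auto simp: disjoint_family_on_def disjoint_def)
    also have "\<dots> \<le> point_count C A" unfolding point_count_def by (intro emeasure_mono) auto
    finally show "?s F \<le> point_count C A" .
  qed
qed

lemma measurable_point_count:
  fixes A :: "'a::euclidean_space set"
  assumes A: "A \<in> sets borel" shows "(\<lambda>C. point_count C A) \<in> borel_measurable config"
proof -
  obtain B :: "'a set set" where B: "countable B" "topological_basis B" using ex_countable_basis by blast
  have "countable {F. finite F \<and> F \<subseteq> B \<and> disjoint F}"
    by (rule countable_subset[OF _ countable_Collect_finite_subset[OF B(1)]]) auto
  moreover have "(\<lambda>C. \<Sum>U\<in>F. indicator {C. C \<inter> (A \<inter> U) \<noteq> {}} C :: ennreal) \<in> borel_measurable config"
    if "F \<in> {F. finite F \<and> F \<subseteq> B \<and> disjoint F}" for F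
  proof (rule borel_measurable_sum)
    fix U assume "U \<in> F"
    then have "U \<in> sets borel" using that topological_basis_open[OF B(2)] by auto
    then have [measurable]: "A \<inter> U \<in> sets borel" using A by auto
    show "(\<lambda>C. indicator {C. C \<inter> (A \<inter> U) \<noteq> {}} C :: ennreal) \<in> borel_measurable config"
      unfolding indicator_def of_bool_def by measurable
  qed
  ultimately show ?thesis unfolding point_count_eq_SUP[OF B(2)] by (rule borel_measurable_SUP)
qed

lemma measurable_point_count_compose [measurable (raw)]:
  assumes "K \<in> M \<rightarrow>\<^sub>M config" "A \<in> sets borel"
  shows "(\<lambda>w. point_count (K w) A) \<in> borel_measurable M"
  by (rule measurable_compose[OF assms(1) measurable_point_count[OF assms(2)]])

lemma measurable_config_Un:
  fixes K :: "'w \<Rightarrow> 'b::euclidean_space set"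
  assumes K: "K \<in> M \<rightarrow>\<^sub>M config" and P: "finite P"
  shows "(\<lambda>w. K w \<union> P) \<in> M \<rightarrow>\<^sub>M config"
proof (rule measurable_configI)
  note [measurable] = K
  show "locally_finite (K w \<union> P)" if "w \<in> space M" for w
    using measurable_space[OF K that] P by (simp add: space_config locally_finite_Un)
  fix A :: "'b set" assume [measurable]: "A \<in> sets borel"
  have "{w \<in> space M. (K w \<union> P) \<inter> A \<noteq> {}} = {w \<in> space M. K w \<inter> A \<noteq> {} \<or> P \<inter> A \<noteq> {}}" by auto
  also have "\<dots> \<in> sets M" by measurable
  finally show "{w \<in> space M. (K w \<union> P) \<inter> A \<noteq> {}} \<in> sets M" .
qed

lemma measurable_config_insert [measurable (raw)]:
  fixes K :: "'w \<Rightarrow> 'b::euclidean_space set"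
  assumes K: "K \<in> M \<rightarrow>\<^sub>M config" and f: "f \<in> borel_measurable M"
  shows "(\<lambda>w. insert (f w) (K w)) \<in> M \<rightarrow>\<^sub>M config"
proof (rule measurable_configI)
  note [measurable] = K f
  show "locally_finite (insert (f w) (K w))" if "w \<in> space M" for w
    using measurable_space[OF K that] by (simp add: space_config locally_finite_insert)
  fix A :: "'b set" assume [measurable]: "A \<in> sets borel"
  have "{w \<in> space M. insert (f w) (K w) \<inter> A \<noteq> {}} = {w \<in> space M. K w \<inter> A \<noteq> {} \<or> f w \<in> A}" by auto
  also have "\<dots> \<in> sets M" by measurable
  finally show "{w \<in> space M. insert (f w) (K w) \<inter> A \<noteq> {}} \<in> sets M" .
qed

text \<open>The ball makes the count finite, so that complements can be subtracted in the induction over the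
  product sigma algebra.\<close>

lemma measurable_count_section_bounded:
  fixes K :: "'y \<Rightarrow> 'a::euclidean_space set"
  assumes K [measurable]: "K \<in> M \<rightarrow>\<^sub>M config" and E: "E \<in> sets (M \<Otimes>\<^sub>M borel)"
  shows "(\<lambda>y. emeasure (count_space UNIV) {c \<in> K y \<inter> cball 0 R. (y, c) \<in> E}) \<in> borel_measurable M"
proof -
  let ?G = "{a \<times> b | a b. a \<in> sets M \<and> b \<in> sets (borel :: 'a measure)}"
  let ?f = "\<lambda>E y. emeasure (count_space UNIV) {c \<in> K y \<inter> cball 0 R. (y, c) \<in> E}"
  have fin: "finite (K y \<inter> cball 0 R)" if "y \<in> space M" for y
    using measurable_space[OF K that] by (simp add: space_config locally_finite_def)
  show "?f E \<in> borel_measurable M"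
    using Int_stable_pair_measure_generator pair_measure_closed E unfolding sets_pair_measure
  proof (induct E rule: sigma_sets_induct_disjoint)
    case (basic A)
    then obtain a b where [measurable]: "a \<in> sets M" "b \<in> sets borel" and A: "A = a \<times> b" by auto
    have "?f A y = indicator a y * point_count (K y) (b \<inter> cball 0 R)" for y
      by (auto simp: A point_count_def indicator_def intro!: arg_cong[where f="emeasure _"])
    moreover have "b \<inter> cball 0 R \<in> sets borel" by measurable
    then have [measurable]: "(\<lambda>y. point_count (K y) (b \<inter> cball 0 R)) \<in> borel_measurable M"
      by (rule measurable_compose[OF K measurable_point_count])
    ultimately show ?case by simp
  next
    case empty
    then show ?case by simp
  next
    case (compl A)
    have "?f (space M \<times> space borel - A) y = point_count (K y) (cball 0 R) - ?f A y" if y: "y \<in> space M" for y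
    proof -
      have eq: "{c \<in> K y \<inter> cball 0 R. (y, c) \<in> space M \<times> space borel - A} =
          (K y \<inter> cball 0 R) - {c \<in> K y \<inter> cball 0 R. (y, c) \<in> A}" using y by auto
      have "finite {c \<in> K y \<inter> cball 0 R. (y, c) \<in> A}" using fin[OF y] by (rule rev_finite_subset) auto
      then show ?thesis unfolding point_count_def eq
        by (intro emeasure_Diff) (auto simp: emeasure_count_space)
    qed
    moreover have "(\<lambda>y. point_count (K y) (cball 0 R) - ?f A y) \<in> borel_measurable M"
    proof -
      have "(\<lambda>y. point_count (K y) (cball 0 R)) \<in> borel_measurable M"
        by (rule measurable_compose[OF K measurable_point_count]) simp
      then show ?thesis using compl by measurable
    qed
    ultimately show ?case by (subst measurable_cong) auto
  next
    case (union A)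
    have "?f (\<Union>i. A i) y = (\<Sum>i. ?f (A i) y)" for y
    proof -
      have "{c \<in> K y \<inter> cball 0 R. (y, c) \<in> (\<Union>i. A i)} = (\<Union>i. {c \<in> K y \<inter> cball 0 R. (y, c) \<in> A i})" by auto
      then show ?thesis using union(1)
        by (simp, subst suminf_emeasure) (auto simp: disjoint_family_on_def)
    qed
    then show ?case using union by simp
  qed
qed

lemma measurable_sum_over_config:
  fixes K :: "'y \<Rightarrow> 'a::euclidean_space set" and g :: "'y \<Rightarrow> 'a \<Rightarrow> ennreal"
  assumes K: "K \<in> M \<rightarrow>\<^sub>M config" and g: "(\<lambda>(y, c). g y c) \<in> borel_measurable (M \<Otimes>\<^sub>M borel)"
  shows "(\<lambda>y. \<integral>\<^sup>+c. g y c \<partial>count_space (K y)) \<in> borel_measurable M"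
proof -
  let ?I = "\<lambda>g y. \<integral>\<^sup>+c. g (y, c) \<partial>count_space (K y)"
  have "?I (\<lambda>(y, c). g y c) \<in> borel_measurable M"
    using g
  proof (induction rule: borel_measurable_induct)
    case (cong f g)
    have "?I f y = ?I g y" if "y \<in> space M" for y
      using that cong by (intro nn_integral_cong) (auto simp: space_pair_measure)
    then show ?case using cong by (simp cong: measurable_cong)
  next
    case (set E)
    have "?I (indicator E) y = (SUP n::nat. emeasure (count_space UNIV) {c \<in> K y \<inter> cball 0 (real n). (y, c) \<in> E})" for y
    proof -
      have "?I (indicator E) y = (\<integral>\<^sup>+c. indicator {c \<in> K y. (y, c) \<in> E} c \<partial>count_space UNIV)"
        by (subst nn_integral_count_space_indicator, simp, intro nn_integral_cong) (auto split: split_indicator)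
      also have "\<dots> = emeasure (count_space UNIV) {c \<in> K y. (y, c) \<in> E}" by (rule nn_integral_indicator) simp
      also have "{c \<in> K y. (y, c) \<in> E} = (\<Union>n::nat. {c \<in> K y \<inter> cball 0 (real n). (y, c) \<in> E})"
        using real_arch_simple by auto
      also have "emeasure (count_space UNIV) \<dots> = (SUP n::nat. emeasure (count_space UNIV) {c \<in> K y \<inter> cball 0 (real n). (y, c) \<in> E})"
        by (rule SUP_emeasure_incseq[symmetric]) (auto simp: incseq_def)
      finally show ?thesis .
    qed
    then show ?case using measurable_count_section_bounded[OF K set] by simp
  next
    case (mult u c)
    then show ?case by (simp add: nn_integral_cmult)
  next
    case (add u v)
    then show ?case by (simp add: nn_integral_add)
  next
    case (seq U)
    have "?I (SUP i. U i) y = (SUP i. ?I (U i) y)" for y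
    proof -
      have "?I (SUP i. U i) y = (\<integral>\<^sup>+c. (SUP i. U i (y, c)) \<partial>count_space (K y))"
        by (simp add: image_comp)
      also have "\<dots> = (SUP i. ?I (U i) y)"
        using seq by (intro nn_integral_monotone_convergence_SUP) (auto simp: incseq_def le_fun_def)
      finally show ?thesis .
    qed
    then show ?case using seq by simp
  qed
  then show ?thesis by simp
qed

section \<open>Void probabilities and the Mecke formula\<close>

text \<open>The law of a Poisson process with intensity \<open>lam\<close> on locally finite sets, described by the
  probability of finding no point in \<open>A\<close> and the mean number of points in \<open>B\<close> on that event. These two
  properties imply the Mecke formula.\<close>

locale poisson_config = prob_space PP for PP :: "'a::euclidean_space set measure" +
  fixes lam :: real
  assumes sets_PP [measurable_cong]: "sets PP = sets config"
    and lam_nonneg: "0 \<le> lam"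
    and void_probability: "\<And>A. A \<in> sets borel \<Longrightarrow> emeasure lborel A < \<infinity> \<Longrightarrow>
        emeasure PP {C \<in> space PP. C \<inter> A = {}} = ennreal (exp (- (lam * measure lborel A)))"
    and count_indep: "\<And>A B. A \<in> sets borel \<Longrightarrow> B \<in> sets borel \<Longrightarrow> A \<inter> B = {} \<Longrightarrow>
        (\<integral>\<^sup>+C. point_count C B * indicator {C. C \<inter> A = {}} C \<partial>PP) =
          ennreal lam * emeasure lborel B * emeasure PP {C \<in> space PP. C \<inter> A = {}}"
begin

lemma space_PP: "space PP = {C. locally_finite C}"
  using sets_eq_imp_space_eq[OF sets_PP] by (simp add: space_config)

text \<open>Rectangles of a Borel set and a void event: an intersection-stable generator of the product sigma
  algebra on which the Mecke formula is a statement about counts.\<close>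

definition void_rect :: "('a \<times> 'a set) set set" where
  "void_rect = {B \<times> {C. locally_finite C \<and> C \<inter> A = {}} | A B. A \<in> sets borel \<and> B \<in> sets borel}"

lemma Int_stable_void_rect: "Int_stable void_rect"
proof (rule Int_stableI)
  fix a b :: "('a \<times> 'a set) set" assume "a \<in> void_rect" "b \<in> void_rect"
  then obtain A B A' B' where [simp]: "A \<in> sets borel" "B \<in> sets borel" "A' \<in> sets borel" "B' \<in> sets borel"
    and ab: "a = B \<times> {C. locally_finite C \<and> C \<inter> A = {}}" "b = B' \<times> {C. locally_finite C \<and> C \<inter> A' = {}}"
    unfolding void_rect_def by blast
  have "a \<inter> b = (B \<inter> B') \<times> {C. locally_finite C \<and> C \<inter> (A \<union> A') = {}}" unfolding ab by auto
  moreover have "B \<inter> B' \<in> sets borel" "A \<union> A' \<in> sets borel" by auto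
  ultimately show "a \<inter> b \<in> void_rect" unfolding void_rect_def by blast
qed

lemma void_rect_subset: "void_rect \<subseteq> Pow (UNIV \<times> {C. locally_finite C})"
  unfolding void_rect_def by auto

lemma sets_borel_config: "sets (borel \<Otimes>\<^sub>M config) = sigma_sets (UNIV \<times> {C. locally_finite C}) void_rect"
proof
  define S where "S = sigma (UNIV \<times> {C. locally_finite C}) void_rect"
  have spS: "space S = UNIV \<times> {C. locally_finite C}"
    unfolding S_def by (rule space_measure_of[OF void_rect_subset])
  have setsS: "sets S = sigma_sets (UNIV \<times> {C. locally_finite C}) void_rect"
    unfolding S_def by (rule sets_measure_of[OF void_rect_subset])
  have R: "B \<times> {C. locally_finite C \<and> C \<inter> A = {}} \<in> sets S" if "A \<in> sets borel" "B \<in> sets borel" for A B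
    unfolding setsS using that by (intro sigma_sets.Basic) (auto simp: void_rect_def)
  have fst: "fst \<in> S \<rightarrow>\<^sub>M borel"
  proof (rule measurableI)
    fix B :: "'a set" assume "B \<in> sets borel"
    moreover have "fst -` B \<inter> space S = B \<times> {C. locally_finite C \<and> C \<inter> {} = {}}" unfolding spS by auto
    ultimately show "fst -` B \<inter> space S \<in> sets S" using R[of "{}" B] by simp
  qed simp
  have snd: "snd \<in> S \<rightarrow>\<^sub>M config"
  proof (rule measurable_configI)
    fix A :: "'a set" assume "A \<in> sets borel"
    moreover have "{w \<in> space S. snd w \<inter> A \<noteq> {}} = space S - UNIV \<times> {C. locally_finite C \<and> C \<inter> A = {}}"
      unfolding spS by auto
    ultimately show "{w \<in> space S. snd w \<inter> A \<noteq> {}} \<in> sets S" using R[of A UNIV] by simp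
  qed (auto simp: spS)
  have "(\<lambda>w. (fst w, snd w)) \<in> S \<rightarrow>\<^sub>M borel \<Otimes>\<^sub>M config" using fst snd by measurable
  then have "(\<lambda>w. w) \<in> S \<rightarrow>\<^sub>M borel \<Otimes>\<^sub>M config" by simp
  then show "sets (borel \<Otimes>\<^sub>M config) \<subseteq> sigma_sets (UNIV \<times> {C. locally_finite C}) void_rect"
  proof (intro subsetI)
    fix X :: "('a \<times> 'a set) set" assume X: "X \<in> sets (borel \<Otimes>\<^sub>M config)"
    then have "X \<subseteq> space S" using sets.sets_into_space[OF X] by (simp add: spS space_pair_measure space_config)
    moreover have "(\<lambda>w. w) -` X \<inter> space S \<in> sets S"
      using \<open>(\<lambda>w. w) \<in> S \<rightarrow>\<^sub>M borel \<Otimes>\<^sub>M config\<close> X by (rule measurable_sets)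
    ultimately show "X \<in> sigma_sets (UNIV \<times> {C. locally_finite C}) void_rect"
      by (simp add: Int_absorb2 setsS)
  qed
  show "sigma_sets (UNIV \<times> {C. locally_finite C}) void_rect \<subseteq> sets (borel \<Otimes>\<^sub>M config)"
  proof -
    have "void_rect \<subseteq> sets (borel \<Otimes>\<^sub>M config)"
    proof
      fix X assume "X \<in> void_rect"
      then obtain A B where AB: "A \<in> sets borel" "B \<in> sets borel" "X = B \<times> {C. locally_finite C \<and> C \<inter> A = {}}"
        unfolding void_rect_def by blast
      have "{C \<in> space config. C \<inter> A = {}} \<in> sets config"
        using AB(1) by measurable
      then show "X \<in> sets (borel \<Otimes>\<^sub>M config)" using AB by (simp add: space_config)
    qed
    then show ?thesis
      using sets.sigma_sets_subset[of void_rect "borel \<Otimes>\<^sub>M config"]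
      by (simp add: space_pair_measure space_config)
  qed
qed

text \<open>For \<open>E = B \<times> {C. C \<inter> A = {}}\<close>, a point \<open>c \<in> C\<close> with \<open>(c, C) \<in> E\<close> is a point of \<open>B - A\<close> counted on the
  void event of \<open>A\<close>, so the formula is the mean-count hypothesis of the locale. Both sides are finite
  measures of \<open>E\<close> thanks to the restriction to a ball, hence they agree on the generated sigma
  algebra.\<close>

lemma mecke_indicator:
  assumes E: "E \<in> sets (borel \<Otimes>\<^sub>M config)"
  shows "(\<integral>\<^sup>+C. emeasure (count_space UNIV) {c \<in> C \<inter> cball 0 R. (c, C) \<in> E} \<partial>PP) =
     ennreal lam * (\<integral>\<^sup>+c. \<integral>\<^sup>+C. indicator (cball 0 R) c * indicator E (c, insert c C) \<partial>PP \<partial>lborel)"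
    (is "?L E = ?R E")
proof -
  have cb [measurable]: "cball (0::'a) R \<in> sets borel" by simp
  let ?\<Omega> = "UNIV \<times> {C :: 'a set. locally_finite C}"
  let ?n = "\<lambda>E C. emeasure (count_space UNIV) {c \<in> C \<inter> cball 0 R. (c, C) \<in> E}"
  let ?r = "\<lambda>E c. \<integral>\<^sup>+C. indicator (cball 0 R) c * indicator E (c, insert c C) \<partial>PP"
  have n_meas: "?n E \<in> borel_measurable PP" if "E \<in> sets (borel \<Otimes>\<^sub>M config)" for E
  proof -
    have "(\<lambda>(C, c). (c, C)) \<in> config \<Otimes>\<^sub>M borel \<rightarrow>\<^sub>M borel \<Otimes>\<^sub>M config" by measurable
    from measurable_sets[OF this that]
    have "(\<lambda>(C, c). (c, C)) -` E \<inter> space (config \<Otimes>\<^sub>M borel) \<in> sets (config \<Otimes>\<^sub>M borel)" .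
    from measurable_count_section_bounded[OF measurable_ident this, of R]
    have "(\<lambda>C. emeasure (count_space UNIV) {c \<in> C \<inter> cball 0 R. (C, c) \<in> (\<lambda>(C, c). (c, C)) -` E \<inter> space (config \<Otimes>\<^sub>M borel)}) \<in> borel_measurable config"
      by simp
    also have "?this \<longleftrightarrow> ?n E \<in> borel_measurable config"
      by (intro measurable_cong arg_cong[where f="emeasure _"]) (auto simp: space_pair_measure)
    finally show ?thesis using sets_PP by (simp cong: measurable_cong_sets)
  qed
  have ind_meas: "(\<lambda>(c, C). indicator (cball 0 R) c * indicator E (c, insert c C) :: ennreal) \<in> borel_measurable (lborel \<Otimes>\<^sub>M PP)"
    if [measurable]: "E \<in> sets (borel \<Otimes>\<^sub>M config)" for E
    by measurable
  have r_meas: "?r E \<in> borel_measurable lborel" if "E \<in> sets (borel \<Otimes>\<^sub>M config)" for E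
    using borel_measurable_nn_integral[OF ind_meas[OF that]] by simp
  have fin: "finite (C \<inter> cball 0 R)" if "C \<in> space PP" for C
    using that by (simp add: space_PP locally_finite_def)
  have total: "?L ?\<Omega> = ennreal lam * emeasure lborel (cball (0::'a) R)"
       "?R ?\<Omega> = ennreal lam * emeasure lborel (cball (0::'a) R)"
  proof -
    have "?L ?\<Omega> = (\<integral>\<^sup>+C. point_count C (cball 0 R) * indicator {C. C \<inter> {} = {}} C \<partial>PP)"
      by (intro nn_integral_cong) (auto simp: space_PP point_count_def intro!: arg_cong[where f="emeasure _"])
    also have "\<dots> = ennreal lam * emeasure lborel (cball (0::'a) R) * emeasure PP {C \<in> space PP. C \<inter> {} = {}}"
      by (rule count_indep) auto
    finally show "?L ?\<Omega> = ennreal lam * emeasure lborel (cball (0::'a) R)" by (simp add: emeasure_space_1)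
    have "?R ?\<Omega> = ennreal lam * (\<integral>\<^sup>+c. \<integral>\<^sup>+C. indicator (cball (0::'a) R) c \<partial>PP \<partial>lborel)"
      by (intro arg_cong[where f="\<lambda>x. ennreal lam * x"] nn_integral_cong)
         (auto simp: space_PP locally_finite_insert split: split_indicator)
    also have "\<dots> = ennreal lam * emeasure lborel (cball (0::'a) R)" by (simp add: emeasure_space_1)
    finally show "?R ?\<Omega> = ennreal lam * emeasure lborel (cball (0::'a) R)" .
  qed
  have fin_total: "ennreal lam * emeasure lborel (cball (0::'a) R) < \<infinity>"
    using emeasure_lborel_cball_finite[of "0::'a" R] by (simp add: ennreal_mult_less_top)
  (* complements are subtracted from the total, which is finite *)
  have cancel: "x = y" if "x + z = y + z" "z < \<infinity>" for x y z :: ennreal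
    using that by (metis ennreal_add_left_cancel add.commute infinity_ennreal_def less_irrefl)
  have sub: "E \<in> sets (borel \<Otimes>\<^sub>M config)" if "E \<in> sigma_sets ?\<Omega> void_rect" for E
    using that by (simp add: sets_borel_config)
  from E have "E \<in> sigma_sets ?\<Omega> void_rect" by (simp add: sets_borel_config)
  with Int_stable_void_rect void_rect_subset show ?thesis
  proof (induct E rule: sigma_sets_induct_disjoint)
    case (basic E)
    then obtain A B where [measurable]: "A \<in> sets borel" "B \<in> sets borel"
      and E: "E = B \<times> {C. locally_finite C \<and> C \<inter> A = {}}" unfolding void_rect_def by blast
    let ?B = "(B \<inter> cball 0 R) - A"
    have "?L E = (\<integral>\<^sup>+C. point_count C ?B * indicator {C. C \<inter> A = {}} C \<partial>PP)"
    proof (rule nn_integral_cong)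
      fix C assume C: "C \<in> space PP"
      show "?n E C = point_count C ?B * indicator {C. C \<inter> A = {}} C"
      proof (cases "C \<inter> A = {}")
        case True
        then have "{c \<in> C \<inter> cball 0 R. (c, C) \<in> E} = C \<inter> ?B" using C by (auto simp: E space_PP)
        then show ?thesis using True by (simp add: point_count_def)
      qed (simp add: E)
    qed
    also have "\<dots> = ennreal lam * emeasure lborel ?B * emeasure PP {C \<in> space PP. C \<inter> A = {}}"
      by (rule count_indep) auto
    also have "\<dots> = ?R E"
    proof -
      have "?r E c = indicator ?B c * emeasure PP {C \<in> space PP. C \<inter> A = {}}" for c
      proof -
        have "?r E c = (\<integral>\<^sup>+C. indicator ?B c * indicator {C \<in> space PP. C \<inter> A = {}} C \<partial>PP)"
          by (intro nn_integral_cong) (auto simp: E space_PP locally_finite_insert split: split_indicator)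
        also have "\<dots> = indicator ?B c * (\<integral>\<^sup>+C. indicator {C \<in> space PP. C \<inter> A = {}} C \<partial>PP)"
          by (rule nn_integral_cmult) measurable
        also have "(\<integral>\<^sup>+C. indicator {C \<in> space PP. C \<inter> A = {}} C \<partial>PP) = emeasure PP {C \<in> space PP. C \<inter> A = {}}"
          by (rule nn_integral_indicator) measurable
        finally show ?thesis .
      qed
      then have "?R E = ennreal lam * (\<integral>\<^sup>+c. indicator ?B c * emeasure PP {C \<in> space PP. C \<inter> A = {}} \<partial>lborel)"
        by (simp only:)
      also have "(\<integral>\<^sup>+c. indicator ?B c * emeasure PP {C \<in> space PP. C \<inter> A = {}} \<partial>lborel) =
         (\<integral>\<^sup>+c. indicator ?B c \<partial>lborel) * emeasure PP {C \<in> space PP. C \<inter> A = {}}"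
        by (rule nn_integral_multc) measurable
      also have "(\<integral>\<^sup>+c. indicator ?B c \<partial>lborel) = emeasure lborel ?B"
        by (rule nn_integral_indicator) measurable
      finally show ?thesis by (simp only: mult.assoc)
    qed
    finally show ?case .
  next
    case empty
    show ?case by simp
  next
    case (compl E)
    have "?L ?\<Omega> = (\<integral>\<^sup>+C. ?n (?\<Omega> - E) C + ?n E C \<partial>PP)"
    proof (rule nn_integral_cong)
      fix C assume C: "C \<in> space PP"
      have "{c \<in> C \<inter> cball 0 R. (c, C) \<in> ?\<Omega>} = {c \<in> C \<inter> cball 0 R. (c, C) \<in> ?\<Omega> - E} \<union> {c \<in> C \<inter> cball 0 R. (c, C) \<in> E}"
        using C by (auto simp: space_PP)
      then show "?n ?\<Omega> C = ?n (?\<Omega> - E) C + ?n E C"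
        by (simp only:) (intro plus_emeasure[symmetric], auto)
    qed
    also have "\<dots> = ?L (?\<Omega> - E) + ?L E"
    proof (rule nn_integral_add)
      show "?n E \<in> borel_measurable PP" using sub[OF compl(1)] by (rule n_meas)
      show "?n (?\<Omega> - E) \<in> borel_measurable PP"
        by (rule n_meas, rule sub, rule sigma_sets.Compl, rule compl)
    qed
    finally have 1: "?L ?\<Omega> = ?L (?\<Omega> - E) + ?L E" .
    have "?r ?\<Omega> c = ?r (?\<Omega> - E) c + ?r E c" for c
    proof -
      have "?r ?\<Omega> c = (\<integral>\<^sup>+C. indicator (cball 0 R) c * indicator (?\<Omega> - E) (c, insert c C) +
          indicator (cball 0 R) c * indicator E (c, insert c C) \<partial>PP)"
        by (intro nn_integral_cong) (auto simp: space_PP locally_finite_insert split: split_indicator)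
      also have "\<dots> = ?r (?\<Omega> - E) c + ?r E c"
      proof (rule nn_integral_add)
        have m: "E \<in> sets (borel \<Otimes>\<^sub>M config)" "?\<Omega> - E \<in> sets (borel \<Otimes>\<^sub>M config)"
          using sub compl(1) sigma_sets.Compl by blast+
        show "(\<lambda>C. indicator (cball 0 R) c * indicator E (c, insert c C) :: ennreal) \<in> borel_measurable PP"
          using measurable_compose[OF measurable_Pair1' ind_meas[OF m(1)], of c] by simp
        show "(\<lambda>C. indicator (cball 0 R) c * indicator (?\<Omega> - E) (c, insert c C) :: ennreal) \<in> borel_measurable PP"
          using measurable_compose[OF measurable_Pair1' ind_meas[OF m(2)], of c] by simp
      qed
      finally show ?thesis .
    qed
    then have "(\<integral>\<^sup>+c. ?r ?\<Omega> c \<partial>lborel) = (\<integral>\<^sup>+c. ?r (?\<Omega> - E) c + ?r E c \<partial>lborel)" by (simp only:)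
    also have "\<dots> = (\<integral>\<^sup>+c. ?r (?\<Omega> - E) c \<partial>lborel) + (\<integral>\<^sup>+c. ?r E c \<partial>lborel)"
      by (rule nn_integral_add) (rule r_meas, use sub compl(1) sigma_sets.Compl in blast)+
    finally have 2: "?R ?\<Omega> = ?R (?\<Omega> - E) + ?R E" by (simp only: distrib_left)
    have "?L (?\<Omega> - E) + ?L E = ?R (?\<Omega> - E) + ?L E"
      using 1 2 total compl(2) by (simp only:)
    moreover have "?L E < \<infinity>"
    proof -
      have "?L E \<le> ?L ?\<Omega>" unfolding 1 by simp
      then show ?thesis using fin_total unfolding total by simp
    qed
    ultimately show ?case
      using cancel[of "?L (?\<Omega> - E)" "?L E" "?R (?\<Omega> - E)"] by blast
  next
    case (union E)
    have mE: "E i \<in> sets (borel \<Otimes>\<^sub>M config)" for i using union(2) sub by blast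
    have "?L (\<Union>i. E i) = (\<integral>\<^sup>+C. (\<Sum>i. ?n (E i) C) \<partial>PP)"
    proof (rule nn_integral_cong)
      fix C
      have "{c \<in> C \<inter> cball 0 R. (c, C) \<in> (\<Union>i. E i)} = (\<Union>i. {c \<in> C \<inter> cball 0 R. (c, C) \<in> E i})" by auto
      moreover have "disjoint_family (\<lambda>i. {c \<in> C \<inter> cball 0 R. (c, C) \<in> E i})"
        using union(1) by (auto simp: disjoint_family_on_def)
      ultimately show "?n (\<Union>i. E i) C = (\<Sum>i. ?n (E i) C)"
        using suminf_emeasure[of "\<lambda>i. {c \<in> C \<inter> cball 0 R. (c, C) \<in> E i}" "count_space UNIV"] by simp
    qed
    also have "\<dots> = (\<Sum>i. ?L (E i))" by (rule nn_integral_suminf) (rule n_meas[OF mE])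
    finally have 1: "?L (\<Union>i. E i) = (\<Sum>i. ?L (E i))" .
    have "?r (\<Union>i. E i) c = (\<Sum>i. ?r (E i) c)" for c
    proof -
      have "?r (\<Union>i. E i) c = (\<integral>\<^sup>+C. (\<Sum>i. indicator (cball 0 R) c * indicator (E i) (c, insert c C)) \<partial>PP)"
        by (intro nn_integral_cong) (simp add: suminf_indicator[OF union(1), symmetric] ennreal_suminf_cmult)
      also have "\<dots> = (\<Sum>i. ?r (E i) c)"
      proof (rule nn_integral_suminf)
        fix i
        show "(\<lambda>C. indicator (cball 0 R) c * indicator (E i) (c, insert c C) :: ennreal) \<in> borel_measurable PP"
          using measurable_compose[OF measurable_Pair1' ind_meas[OF mE], of c i] by simp
      qed
      finally show ?thesis .
    qed
    then have "(\<integral>\<^sup>+c. ?r (\<Union>i. E i) c \<partial>lborel) = (\<integral>\<^sup>+c. (\<Sum>i. ?r (E i) c) \<partial>lborel)" by (simp only:)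
    also have "\<dots> = (\<Sum>i. \<integral>\<^sup>+c. ?r (E i) c \<partial>lborel)" by (rule nn_integral_suminf) (rule r_meas[OF mE])
    finally have "?R (\<Union>i. E i) = (\<Sum>i. ?R (E i))" by (simp only: ennreal_suminf_cmult)
    then show ?case using 1 union(3) by (simp only:)
  qed
qed

text \<open>A point of the process behaves like an additional point that is independent of the
  process and spread over space with density \<open>lam\<close>. It extends from indicators by monotone approximation.\<close>

theorem mecke:
  fixes h :: "'a \<Rightarrow> 'a set \<Rightarrow> ennreal"
  assumes h: "(\<lambda>(c, C). h c C) \<in> borel_measurable (borel \<Otimes>\<^sub>M config)"
  shows "(\<integral>\<^sup>+C. \<integral>\<^sup>+c. h c C \<partial>count_space C \<partial>PP) =
     ennreal lam * (\<integral>\<^sup>+c. \<integral>\<^sup>+C. h c (insert c C) \<partial>PP \<partial>lborel)"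
proof -
  let ?I = "\<lambda>g C. \<integral>\<^sup>+c. g (c, C) \<partial>count_space C"
  have I_meas: "?I g \<in> borel_measurable PP" if [measurable]: "g \<in> borel_measurable (borel \<Otimes>\<^sub>M config)" for g :: "'a \<times> 'a set \<Rightarrow> ennreal"
  proof -
    have "(\<lambda>C. \<integral>\<^sup>+c. g (c, C) \<partial>count_space C) \<in> borel_measurable config"
      by (rule measurable_sum_over_config) measurable
    then show ?thesis using sets_PP by (simp cong: measurable_cong_sets)
  qed
  have J_meas: "(\<lambda>(c, C). g (c, insert c C)) \<in> borel_measurable (lborel \<Otimes>\<^sub>M PP)"
    if [measurable]: "g \<in> borel_measurable (borel \<Otimes>\<^sub>M config)" for g :: "'a \<times> 'a set \<Rightarrow> ennreal"
    by measurable
  have J1: "(\<lambda>C. g (c, insert c C)) \<in> borel_measurable PP" "(\<lambda>c. \<integral>\<^sup>+C. g (c, insert c C) \<partial>PP) \<in> borel_measurable lborel"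
    if "g \<in> borel_measurable (borel \<Otimes>\<^sub>M config)" for g :: "'a \<times> 'a set \<Rightarrow> ennreal" and c
    using measurable_compose[OF measurable_Pair1' J_meas[OF that], of c]
      borel_measurable_nn_integral[OF J_meas[OF that]] by simp_all
  have "(\<integral>\<^sup>+C. ?I (\<lambda>(c, C). h c C) C \<partial>PP) = ennreal lam * (\<integral>\<^sup>+c. \<integral>\<^sup>+C. (\<lambda>(c, C). h c C) (c, insert c C) \<partial>PP \<partial>lborel)"
    using h
  proof (induction rule: borel_measurable_induct)
    case (cong f g)
    have "(\<integral>\<^sup>+C. ?I f C \<partial>PP) = (\<integral>\<^sup>+C. ?I g C \<partial>PP)"
      using cong(3) by (intro nn_integral_cong) (auto simp: space_pair_measure space_config space_PP)
    moreover have "(\<integral>\<^sup>+c. \<integral>\<^sup>+C. f (c, insert c C) \<partial>PP \<partial>lborel) = (\<integral>\<^sup>+c. \<integral>\<^sup>+C. g (c, insert c C) \<partial>PP \<partial>lborel)"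
      using cong(3) by (intro nn_integral_cong) (auto simp: space_pair_measure space_config space_PP locally_finite_insert)
    ultimately show ?case using cong(4) by simp
  next
    case (set E)
    note [measurable] = set
    let ?n = "\<lambda>n::nat. \<lambda>C. emeasure (count_space UNIV) {c \<in> C \<inter> cball 0 (real n). (c, C) \<in> E}"
    have "?I (indicator E) C = (SUP n. ?n n C)" for C
    proof -
      have "?I (indicator E) C = (\<integral>\<^sup>+c. indicator {c \<in> C. (c, C) \<in> E} c \<partial>count_space UNIV)"
        by (subst nn_integral_count_space_indicator, simp, intro nn_integral_cong) (auto split: split_indicator)
      also have "\<dots> = emeasure (count_space UNIV) {c \<in> C. (c, C) \<in> E}" by (rule nn_integral_indicator) simp
      also have "{c \<in> C. (c, C) \<in> E} = (\<Union>n::nat. {c \<in> C \<inter> cball 0 (real n). (c, C) \<in> E})"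
        using real_arch_simple by auto
      also have "emeasure (count_space UNIV) \<dots> = (SUP n. ?n n C)"
        by (rule SUP_emeasure_incseq[symmetric]) (auto simp: incseq_def)
      finally show ?thesis .
    qed
    then have "(\<integral>\<^sup>+C. ?I (indicator E) C \<partial>PP) = (\<integral>\<^sup>+C. (SUP n. ?n n C) \<partial>PP)" by (simp only:)
    also have "\<dots> = (SUP n. \<integral>\<^sup>+C. ?n n C \<partial>PP)"
    proof (rule nn_integral_monotone_convergence_SUP)
      show "incseq ?n" by (auto simp: incseq_def le_fun_def intro!: emeasure_mono)
      fix n
      have [measurable]: "cball (0::'a) (real n) \<in> sets borel" by simp
      have "(\<lambda>C. \<integral>\<^sup>+c. (\<lambda>(c, C). indicator (cball 0 (real n)) c * indicator E (c, C)) (c, C) \<partial>count_space C) \<in> borel_measurable PP"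
        by (rule I_meas) measurable
      also have "(\<lambda>C. \<integral>\<^sup>+c. (\<lambda>(c, C). indicator (cball 0 (real n)) c * indicator E (c, C)) (c, C) \<partial>count_space C) = ?n n"
      proof
        fix C
        have "(\<integral>\<^sup>+c. (\<lambda>(c, C). indicator (cball 0 (real n)) c * indicator E (c, C)) (c, C) \<partial>count_space C) =
          (\<integral>\<^sup>+c. indicator {c \<in> C \<inter> cball 0 (real n). (c, C) \<in> E} c \<partial>count_space UNIV)"
          by (subst nn_integral_count_space_indicator, simp, intro nn_integral_cong) (auto split: split_indicator)
        also have "\<dots> = ?n n C" by (rule nn_integral_indicator) simp
        finally show "(\<integral>\<^sup>+c. (\<lambda>(c, C). indicator (cball 0 (real n)) c * indicator E (c, C)) (c, C) \<partial>count_space C) = ?n n C" .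
      qed
      finally show "?n n \<in> borel_measurable PP" .
    qed
    also have "\<dots> = (SUP n::nat. ennreal lam * (\<integral>\<^sup>+c. \<integral>\<^sup>+C. indicator (cball 0 (real n)) c * indicator E (c, insert c C) \<partial>PP \<partial>lborel))"
      by (simp only: mecke_indicator[OF set])
    also have "\<dots> = ennreal lam * (SUP n::nat. \<integral>\<^sup>+c. \<integral>\<^sup>+C. indicator (cball 0 (real n)) c * indicator E (c, insert c C) \<partial>PP \<partial>lborel)"
      by (rule SUP_mult_left_ennreal[symmetric])
    also have "(SUP n::nat. \<integral>\<^sup>+c. \<integral>\<^sup>+C. indicator (cball 0 (real n)) c * indicator E (c, insert c C) \<partial>PP \<partial>lborel)
      = (SUP n::nat. \<integral>\<^sup>+c. indicator (cball 0 (real n)) c * (\<integral>\<^sup>+C. indicator E (c, insert c C) \<partial>PP) \<partial>lborel)"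
      using J1(1)[OF borel_measurable_indicator[OF set]] by (simp add: nn_integral_cmult)
    also have "\<dots> = (\<integral>\<^sup>+c. (SUP n::nat. indicator (cball 0 (real n)) c * (\<integral>\<^sup>+C. indicator E (c, insert c C) \<partial>PP)) \<partial>lborel)"
    proof (rule nn_integral_monotone_convergence_SUP[symmetric])
      show "incseq (\<lambda>n c. indicator (cball 0 (real n)) c * (\<integral>\<^sup>+C. indicator E (c, insert c C) \<partial>PP))"
        by (auto simp: incseq_def le_fun_def intro!: mult_right_mono split: split_indicator)
      fix n
      have [measurable]: "cball (0::'a) (real n) \<in> sets borel" by simp
      show "(\<lambda>c. indicator (cball 0 (real n)) c * (\<integral>\<^sup>+C. indicator E (c, insert c C) \<partial>PP)) \<in> borel_measurable lborel"
        using J1(2)[OF borel_measurable_indicator[OF set]] by measurable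
    qed
    also have "\<dots> = (\<integral>\<^sup>+c. \<integral>\<^sup>+C. indicator E (c, insert c C) \<partial>PP \<partial>lborel)"
    proof (rule nn_integral_cong)
      fix c :: 'a
      have "(SUP n::nat. indicator (cball 0 (real n)) c) = (1::ennreal)"
      proof (rule antisym)
        obtain n :: nat where "norm c \<le> real n" using real_arch_simple by blast
        then show "1 \<le> (SUP n::nat. indicator (cball 0 (real n)) c :: ennreal)"
          by (intro SUP_upper2[of n]) auto
      qed (auto intro!: SUP_least split: split_indicator)
      then show "(SUP n::nat. indicator (cball 0 (real n)) c * (\<integral>\<^sup>+C. indicator E (c, insert c C) \<partial>PP)) =
          (\<integral>\<^sup>+C. indicator E (c, insert c C) \<partial>PP)"
        by (simp only: SUP_mult_right_ennreal[symmetric] mult_1)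
    qed
    finally show ?case .
  next
    case (mult u k)
    have "(\<integral>\<^sup>+C. ?I (\<lambda>x. k * u x) C \<partial>PP) = k * (\<integral>\<^sup>+C. ?I u C \<partial>PP)"
      using I_meas[OF mult(2)] by (simp add: nn_integral_cmult)
    moreover have "(\<integral>\<^sup>+c. \<integral>\<^sup>+C. k * u (c, insert c C) \<partial>PP \<partial>lborel) = k * (\<integral>\<^sup>+c. \<integral>\<^sup>+C. u (c, insert c C) \<partial>PP \<partial>lborel)"
      using J1[OF mult(2)] by (simp add: nn_integral_cmult)
    ultimately show ?case using mult by (simp add: mult.left_commute)
  next
    case (add u v)
    have "(\<integral>\<^sup>+C. ?I (\<lambda>x. v x + u x) C \<partial>PP) = (\<integral>\<^sup>+C. ?I v C \<partial>PP) + (\<integral>\<^sup>+C. ?I u C \<partial>PP)"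
      using I_meas[OF add(1)] I_meas[OF add(3)] by (simp add: nn_integral_add)
    moreover have "(\<integral>\<^sup>+c. \<integral>\<^sup>+C. v (c, insert c C) + u (c, insert c C) \<partial>PP \<partial>lborel) =
        (\<integral>\<^sup>+c. \<integral>\<^sup>+C. v (c, insert c C) \<partial>PP \<partial>lborel) + (\<integral>\<^sup>+c. \<integral>\<^sup>+C. u (c, insert c C) \<partial>PP \<partial>lborel)"
      using J1[OF add(1)] J1[OF add(3)] by (simp add: nn_integral_add)
    ultimately show ?case using add by (simp add: distrib_left)
  next
    case (seq U)
    have inc: "incseq (\<lambda>i x. U i (f x))" for f :: "'z \<Rightarrow> 'a \<times> 'a set"
      using seq(3) unfolding incseq_def le_fun_def by blast
    have "?I (SUP i. U i) C = (SUP i. ?I (U i) C)" for C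
      unfolding SUP_apply by (rule nn_integral_monotone_convergence_SUP[OF inc]) simp
    then have "(\<integral>\<^sup>+C. ?I (SUP i. U i) C \<partial>PP) = (\<integral>\<^sup>+C. (SUP i. ?I (U i) C) \<partial>PP)" by (simp only:)
    also have "\<dots> = (SUP i. \<integral>\<^sup>+C. ?I (U i) C \<partial>PP)"
      using seq(3) by (intro nn_integral_monotone_convergence_SUP I_meas seq(1))
        (auto simp: incseq_def le_fun_def intro!: nn_integral_mono)
    finally have 1: "(\<integral>\<^sup>+C. ?I (SUP i. U i) C \<partial>PP) = (SUP i. \<integral>\<^sup>+C. ?I (U i) C \<partial>PP)" .
    have "(\<integral>\<^sup>+C. (SUP i. U i) (c, insert c C) \<partial>PP) = (SUP i. \<integral>\<^sup>+C. U i (c, insert c C) \<partial>PP)" for c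
      unfolding SUP_apply by (rule nn_integral_monotone_convergence_SUP[OF inc]) (rule J1(1)[OF seq(1)])
    then have "(\<integral>\<^sup>+c. \<integral>\<^sup>+C. (SUP i. U i) (c, insert c C) \<partial>PP \<partial>lborel) = (\<integral>\<^sup>+c. (SUP i. \<integral>\<^sup>+C. U i (c, insert c C) \<partial>PP) \<partial>lborel)"
      by (simp only:)
    also have "\<dots> = (SUP i. \<integral>\<^sup>+c. \<integral>\<^sup>+C. U i (c, insert c C) \<partial>PP \<partial>lborel)"
      using seq(3) by (intro nn_integral_monotone_convergence_SUP J1(2) seq(1))
        (auto simp: incseq_def le_fun_def intro!: nn_integral_mono)
    finally have 2: "(\<integral>\<^sup>+c. \<integral>\<^sup>+C. (SUP i. U i) (c, insert c C) \<partial>PP \<partial>lborel) =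
       (SUP i. \<integral>\<^sup>+c. \<integral>\<^sup>+C. U i (c, insert c C) \<partial>PP \<partial>lborel)" .
    show ?case unfolding 1 2 SUP_mult_left_ennreal by (intro SUP_cong refl seq.IH)
  qed
  then show ?thesis by simp
qed

end

section \<open>Trajectories in a fixed configuration\<close>

definition first_hit :: "real \<Rightarrow> 'a::euclidean_space set \<Rightarrow> real \<Rightarrow> 'a \<Rightarrow> 'a \<Rightarrow> 'a \<Rightarrow> bool" where
  "first_hit \<epsilon> C r x v c \<longleftrightarrow> disc \<epsilon> x v c > 0 \<and> 0 < entry_time \<epsilon> x v c \<and> entry_time \<epsilon> x v c < r \<and>
     (\<forall>c'\<in>C. c' \<noteq> c \<longrightarrow> \<not> blocked \<epsilon> (entry_time \<epsilon> x v c) x v c')"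

definition hit_point :: "real \<Rightarrow> 'a::euclidean_space \<Rightarrow> 'a \<Rightarrow> 'a \<Rightarrow> 'a" where
  "hit_point \<epsilon> x v c = x + entry_time \<epsilon> x v c *\<^sub>R v"

definition deflected :: "real \<Rightarrow> 'a::euclidean_space \<Rightarrow> 'a \<Rightarrow> 'a \<Rightarrow> 'a" where
  "deflected \<epsilon> x v c = specular ((hit_point \<epsilon> x v c - c) /\<^sub>R \<epsilon>) v"

text \<open>At most one obstacle is hit first, so the integral has at most one nonzero term. Writing it as a sum
  over the whole configuration is what allows the Mecke formula to be applied.\<close>

definition collide :: "real \<Rightarrow> 'a::euclidean_space set \<Rightarrow> (real \<Rightarrow> 'a \<Rightarrow> 'a \<Rightarrow> ennreal) \<Rightarrow> real \<Rightarrow> 'a \<Rightarrow> 'a \<Rightarrow> ennreal" where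
  "collide \<epsilon> C g r x v = (\<integral>\<^sup>+c. indicator {c. first_hit \<epsilon> C r x v c} c *
     g (r - entry_time \<epsilon> x v c) (hit_point \<epsilon> x v c) (deflected \<epsilon> x v c) \<partial>count_space C)"

definition free_flight :: "real \<Rightarrow> 'a::euclidean_space set \<Rightarrow> ('a \<Rightarrow> 'a \<Rightarrow> ennreal) \<Rightarrow> real \<Rightarrow> 'a \<Rightarrow> 'a \<Rightarrow> ennreal" where
  "free_flight \<epsilon> C g r x v = (if \<forall>c\<in>C. \<not> blocked \<epsilon> r x v c then g (x + r *\<^sub>R v) v else 0)"

definition after_collisions :: "real \<Rightarrow> 'a::euclidean_space set \<Rightarrow> ('a \<Rightarrow> 'a \<Rightarrow> ennreal) \<Rightarrow> nat \<Rightarrow> real \<Rightarrow> 'a \<Rightarrow> 'a \<Rightarrow> ennreal" where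
  "after_collisions \<epsilon> C g n = (collide \<epsilon> C ^^ n) (free_flight \<epsilon> C g)"

lemma after_collisions_0: "after_collisions \<epsilon> C g 0 = free_flight \<epsilon> C g"
  and after_collisions_Suc: "after_collisions \<epsilon> C g (Suc n) = collide \<epsilon> C (after_collisions \<epsilon> C g n)"
  by (simp_all add: after_collisions_def)

lemma pred_Ball_config:
  assumes K: "K \<in> M \<rightarrow>\<^sub>M config" and P: "Measurable.pred (M \<Otimes>\<^sub>M borel) (\<lambda>(y, c). P y c)"
  shows "Measurable.pred M (\<lambda>y. \<forall>c\<in>K y. P y c)"
proof -
  have [measurable]: "{w \<in> space (M \<Otimes>\<^sub>M borel). \<not> (case w of (y, c) \<Rightarrow> P y c)} \<in> sets (M \<Otimes>\<^sub>M borel)"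
    using P by (intro predE pred_intros_logic)
  define E where "E = {w \<in> space (M \<Otimes>\<^sub>M borel). \<not> (case w of (y, c) \<Rightarrow> P y c)}"
  have "(\<lambda>y. \<integral>\<^sup>+c. indicator E (y, c) \<partial>count_space (K y)) \<in> borel_measurable M"
    by (rule measurable_sum_over_config[OF K]) (simp add: E_def)
  then have "{y \<in> space M. (\<integral>\<^sup>+c. indicator E (y, c) \<partial>count_space (K y)) = 0} \<in> sets M"
    by measurable
  also have "{y \<in> space M. (\<integral>\<^sup>+c. indicator E (y, c) \<partial>count_space (K y)) = 0} = {y \<in> space M. \<forall>c\<in>K y. P y c}"
    by (subst nn_integral_0_iff_AE)
       (auto simp: AE_count_space E_def space_pair_measure indicator_def split: if_splits)
  finally show ?thesis by (simp add: pred_def)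
qed

lemma pred_first_hit [measurable (raw)]:
  fixes x v c :: "'y \<Rightarrow> 'a::euclidean_space"
  assumes [measurable]: "K \<in> M \<rightarrow>\<^sub>M config" "r \<in> borel_measurable M"
    "x \<in> borel_measurable M" "v \<in> borel_measurable M" "c \<in> borel_measurable M"
  shows "Measurable.pred M (\<lambda>y. first_hit \<epsilon> (K y) (r y) (x y) (v y) (c y))"
proof -
  have [measurable]: "Measurable.pred M (\<lambda>y. \<forall>c'\<in>K y. c' \<noteq> c y \<longrightarrow> \<not> blocked \<epsilon> (entry_time \<epsilon> (x y) (v y) (c y)) (x y) (v y) c')"
    by (rule pred_Ball_config) measurable
  show ?thesis unfolding first_hit_def by measurable
qed

lemma measurable_hit_point [measurable (raw)]:
  fixes x v c :: "'y \<Rightarrow> 'a::euclidean_space"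
  assumes [measurable]: "x \<in> borel_measurable M" "v \<in> borel_measurable M" "c \<in> borel_measurable M"
  shows "(\<lambda>y. hit_point \<epsilon> (x y) (v y) (c y)) \<in> borel_measurable M"
    "(\<lambda>y. deflected \<epsilon> (x y) (v y) (c y)) \<in> borel_measurable M"
  unfolding deflected_def hit_point_def by measurable

lemma measurable_collide:
  fixes K :: "'y \<Rightarrow> 'a::euclidean_space set"
  assumes K [measurable]: "K \<in> M \<rightarrow>\<^sub>M config"
    and G: "(\<lambda>(y, r, x, v). G y r x v) \<in> borel_measurable (M \<Otimes>\<^sub>M borel \<Otimes>\<^sub>M borel \<Otimes>\<^sub>M borel)"
    and [measurable]: "r \<in> borel_measurable M" "x \<in> borel_measurable M" "v \<in> borel_measurable M"
  shows "(\<lambda>y. collide \<epsilon> (K y) (G y) (r y) (x y) (v y)) \<in> borel_measurable M"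
  unfolding collide_def
proof (rule measurable_sum_over_config[OF K])
  have "(\<lambda>w. (fst w, r (fst w) - entry_time \<epsilon> (x (fst w)) (v (fst w)) (snd w),
      hit_point \<epsilon> (x (fst w)) (v (fst w)) (snd w), deflected \<epsilon> (x (fst w)) (v (fst w)) (snd w)))
    \<in> M \<Otimes>\<^sub>M borel \<rightarrow>\<^sub>M M \<Otimes>\<^sub>M borel \<Otimes>\<^sub>M borel \<Otimes>\<^sub>M borel"
    by measurable
  from measurable_compose[OF this G] have [measurable]: "(\<lambda>w. G (fst w) (r (fst w) - entry_time \<epsilon> (x (fst w)) (v (fst w)) (snd w))
      (hit_point \<epsilon> (x (fst w)) (v (fst w)) (snd w)) (deflected \<epsilon> (x (fst w)) (v (fst w)) (snd w)))
      \<in> borel_measurable (M \<Otimes>\<^sub>M borel)" by simp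
  have [measurable]: "Measurable.pred (M \<Otimes>\<^sub>M borel) (\<lambda>w. first_hit \<epsilon> (K (fst w)) (r (fst w)) (x (fst w)) (v (fst w)) (snd w))"
    by measurable
  have "(\<lambda>w. indicator {c. first_hit \<epsilon> (K (fst w)) (r (fst w)) (x (fst w)) (v (fst w)) c} (snd w) *
      G (fst w) (r (fst w) - entry_time \<epsilon> (x (fst w)) (v (fst w)) (snd w))
      (hit_point \<epsilon> (x (fst w)) (v (fst w)) (snd w)) (deflected \<epsilon> (x (fst w)) (v (fst w)) (snd w)))
      \<in> borel_measurable (M \<Otimes>\<^sub>M borel)"
    unfolding indicator_def of_bool_def mem_Collect_eq by measurable
  then show "(\<lambda>(y, c). indicator {c. first_hit \<epsilon> (K y) (r y) (x y) (v y) c} c *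
      G y (r y - entry_time \<epsilon> (x y) (v y) c) (hit_point \<epsilon> (x y) (v y) c) (deflected \<epsilon> (x y) (v y) c))
      \<in> borel_measurable (M \<Otimes>\<^sub>M borel)"
    by (simp add: case_prod_beta)
qed

lemma measurable_free_flight:
  fixes K :: "'y \<Rightarrow> 'a::euclidean_space set"
  assumes K [measurable]: "K \<in> M \<rightarrow>\<^sub>M config"
    and g: "(\<lambda>(x, v). g x v) \<in> borel_measurable (borel \<Otimes>\<^sub>M borel)"
    and [measurable]: "r \<in> borel_measurable M" "x \<in> borel_measurable M" "v \<in> borel_measurable M"
  shows "(\<lambda>y. free_flight \<epsilon> (K y) g (r y) (x y) (v y)) \<in> borel_measurable M"
proof -
  have [measurable]: "(\<lambda>y. g (x y + r y *\<^sub>R v y) (v y)) \<in> borel_measurable M"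
    using measurable_compose[OF _ g, of "\<lambda>y. (x y + r y *\<^sub>R v y, v y)" M] by simp
  have [measurable]: "Measurable.pred M (\<lambda>y. \<forall>c\<in>K y. \<not> blocked \<epsilon> (r y) (x y) (v y) c)"
    by (rule pred_Ball_config) measurable
  show ?thesis unfolding free_flight_def by measurable
qed

lemma measurable_after_collisions_joint:
  fixes K :: "'y \<Rightarrow> 'a::euclidean_space set"
  assumes K [measurable]: "K \<in> M \<rightarrow>\<^sub>M config"
    and g: "(\<lambda>(x, v). g x v) \<in> borel_measurable (borel \<Otimes>\<^sub>M borel)"
  shows "(\<lambda>(y, r, x, v). after_collisions \<epsilon> (K y) g n r x v) \<in> borel_measurable (M \<Otimes>\<^sub>M borel \<Otimes>\<^sub>M borel \<Otimes>\<^sub>M borel)"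
proof (induction n)
  case 0
  show ?case unfolding after_collisions_0 case_prod_beta
    by (rule measurable_free_flight[OF _ g]) measurable
next
  case (Suc n)
  let ?M = "M \<Otimes>\<^sub>M borel \<Otimes>\<^sub>M borel \<Otimes>\<^sub>M borel :: ('y \<times> real \<times> 'a \<times> 'a) measure"
  have "(\<lambda>w. (fst (fst w), snd w)) \<in> ?M \<Otimes>\<^sub>M (borel \<Otimes>\<^sub>M borel \<Otimes>\<^sub>M borel) \<rightarrow>\<^sub>M ?M" by measurable
  from measurable_compose[OF this Suc] show ?case
    unfolding after_collisions_Suc case_prod_beta
    by (intro measurable_collide) (auto simp: case_prod_beta)
qed

lemma measurable_after_collisions [measurable (raw)]:
  fixes K :: "'y \<Rightarrow> 'a::euclidean_space set"
  assumes K: "K \<in> M \<rightarrow>\<^sub>M config"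
    and g: "(\<lambda>(x, v). g x v) \<in> borel_measurable (borel \<Otimes>\<^sub>M borel)"
    and [measurable]: "r \<in> borel_measurable M" "x \<in> borel_measurable M" "v \<in> borel_measurable M"
  shows "(\<lambda>y. after_collisions \<epsilon> (K y) g n (r y) (x y) (v y)) \<in> borel_measurable M"
  using measurable_compose[OF _ measurable_after_collisions_joint[OF K g], of "\<lambda>y. (y, r y, x y, v y)" M]
  by simp

section \<open>One collision\<close>

lemma entry_less_exit: "disc \<epsilon> x v c > 0 \<Longrightarrow> entry_time \<epsilon> x v c < exit_time \<epsilon> x v c"
  using real_sqrt_gt_zero[of "disc \<epsilon> x v c"] by (simp add: entry_time_def exit_time_def)

lemma first_hit_unique:
  assumes "first_hit \<epsilon> C r x v c" "first_hit \<epsilon> C r x v c'" "c \<in> C" "c' \<in> C"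
  shows "c = c'"
proof -
  have *: False if "first_hit \<epsilon> C r x v a" "first_hit \<epsilon> C r x v b" "a \<in> C" "b \<in> C" "a \<noteq> b"
    "entry_time \<epsilon> x v a \<le> entry_time \<epsilon> x v b" for a b
    using that entry_less_exit[of \<epsilon> x v a] unfolding first_hit_def blocked_def by auto
  show ?thesis using *[of c c'] *[of c' c] assms linear by metis
qed

lemma nn_integral_count_space_single:
  assumes "c \<in> C" "\<And>c'. c' \<in> C \<Longrightarrow> c' \<noteq> c \<Longrightarrow> g c' = 0"
  shows "(\<integral>\<^sup>+c. g c \<partial>count_space C) = (g c :: ennreal)"
proof -
  have "(\<integral>\<^sup>+c. g c \<partial>count_space C) = (\<Sum>a\<in>{c}. g a)"
    by (rule nn_integral_count_space'[of "{c}" C]) (use assms in auto)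
  then show ?thesis by simp
qed

lemma collide_eq:
  assumes "first_hit \<epsilon> C r x v c" "c \<in> C"
  shows "collide \<epsilon> C g r x v = g (r - entry_time \<epsilon> x v c) (hit_point \<epsilon> x v c) (deflected \<epsilon> x v c)"
proof -
  have "collide \<epsilon> C g r x v = indicator {c. first_hit \<epsilon> C r x v c} c *
     g (r - entry_time \<epsilon> x v c) (hit_point \<epsilon> x v c) (deflected \<epsilon> x v c)"
    unfolding collide_def
  proof (rule nn_integral_count_space_single[OF assms(2)])
    fix c' assume "c' \<in> C" "c' \<noteq> c"
    then have "\<not> first_hit \<epsilon> C r x v c'" using first_hit_unique[OF assms(1) _ assms(2)] by blast
    then show "indicator {c. first_hit \<epsilon> C r x v c} c' *
        g (r - entry_time \<epsilon> x v c') (hit_point \<epsilon> x v c') (deflected \<epsilon> x v c') = 0" by simp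
  qed
  then show ?thesis using assms(1) by simp
qed

lemma collide_eq_0:
  assumes "\<And>c. c \<in> C \<Longrightarrow> \<not> first_hit \<epsilon> C r x v c"
  shows "collide \<epsilon> C g r x v = 0"
  unfolding collide_def by (rule nn_integral_zero') (use assms in \<open>auto simp: AE_count_space\<close>)

lemma first_hit_blocked:
  assumes "first_hit \<epsilon> C r x v c" shows "blocked \<epsilon> r x v c"
  using assms entry_less_exit[of \<epsilon> x v c] unfolding first_hit_def blocked_def by auto

text \<open>After a reflection the line moves away from the obstacle just hit, which is therefore behind it.\<close>

lemma outgoing_not_blocked:
  fixes y v n :: "'a::euclidean_space"
  assumes "norm v = 1" "norm n = 1" "\<epsilon> > 0" "v \<bullet> n > 0"
  shows "\<not> blocked \<epsilon> r y v (y - \<epsilon> *\<^sub>R n)"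
proof -
  have "entry_time \<epsilon> y (- v) (y - \<epsilon> *\<^sub>R n) = 0"
    using incoming_data(2)[of "- v" n \<epsilon> y 0] assms by simp
  moreover have "entry_time \<epsilon> y (- v) c = - exit_time \<epsilon> y v c" for c
    by (simp add: disc_def entry_time_def exit_time_def)
  ultimately show ?thesis by (simp add: blocked_def)
qed

lemma hit_geometry:
  fixes x v c :: "'a::euclidean_space"
  assumes v: "norm v = 1" and \<epsilon>: "\<epsilon> > 0" and D: "disc \<epsilon> x v c > 0"
  defines "n \<equiv> (hit_point \<epsilon> x v c - c) /\<^sub>R \<epsilon>"
  shows "norm n = 1" "v \<bullet> n < 0" "norm (deflected \<epsilon> x v c) = 1" "deflected \<epsilon> x v c \<bullet> n > 0"
    "c = hit_point \<epsilon> x v c - \<epsilon> *\<^sub>R n" "norm (hit_point \<epsilon> x v c - c) = \<epsilon>"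
    "\<not> blocked \<epsilon> r (hit_point \<epsilon> x v c) (deflected \<epsilon> x v c) c"
proof -
  show norm_hit: "norm (hit_point \<epsilon> x v c - c) = \<epsilon>"
    using norm_entry_point(1)[OF v \<epsilon>, of x c] D by (simp add: hit_point_def)
  then show n: "norm n = 1" using \<epsilon> by (simp add: n_def)
  have "v \<bullet> (hit_point \<epsilon> x v c - c) = - sqrt (disc \<epsilon> x v c)"
    using v by (simp add: hit_point_def entry_time_def inner_diff_right inner_add_right norm_eq_1)
  then show vn: "v \<bullet> n < 0" using D \<epsilon> by (simp add: n_def)
  show "norm (deflected \<epsilon> x v c) = 1"
    unfolding deflected_def n_def[symmetric] using norm_specular[OF n] v by simp
  moreover show "deflected \<epsilon> x v c \<bullet> n > 0"
    unfolding deflected_def n_def[symmetric] inner_specular[OF n] using vn by simp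
  moreover show c: "c = hit_point \<epsilon> x v c - \<epsilon> *\<^sub>R n" using \<epsilon> by (simp add: n_def)
  ultimately show "\<not> blocked \<epsilon> r (hit_point \<epsilon> x v c) (deflected \<epsilon> x v c) c"
    using outgoing_not_blocked[OF _ n \<epsilon>, of "deflected \<epsilon> x v c" r "hit_point \<epsilon> x v c"] by simp
qed

lemma first_hit_clear:
  fixes x v c :: "'a::euclidean_space"
  assumes "norm v = 1" "\<epsilon> > 0" "first_hit \<epsilon> C r x v c" "c' \<in> C" "c' \<noteq> c"
  shows "norm (hit_point \<epsilon> x v c - c') > \<epsilon>"
proof (rule ccontr)
  assume "\<not> norm (hit_point \<epsilon> x v c - c') > \<epsilon>"
  then have "disc \<epsilon> x v c' \<ge> 0 \<and> entry_time \<epsilon> x v c' \<le> entry_time \<epsilon> x v c \<and> entry_time \<epsilon> x v c \<le> exit_time \<epsilon> x v c'"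
    using in_ball_line_iff(2)[OF assms(1,2)] unfolding hit_point_def by (simp add: not_less)
  then have "blocked \<epsilon> (entry_time \<epsilon> x v c) x v c'"
    using assms(3) unfolding blocked_def first_hit_def by auto
  then show False using assms(3-5) unfolding first_hit_def by auto
qed

section \<open>Degenerate trajectories\<close>

text \<open>The trajectory is tangent to an obstacle, ends on the boundary of one, or hits two at once.\<close>

definition degenerate :: "real \<Rightarrow> 'a::euclidean_space set \<Rightarrow> real \<Rightarrow> 'a \<Rightarrow> 'a \<Rightarrow> bool" where
  "degenerate \<epsilon> C r x v \<longleftrightarrow> (\<exists>c\<in>C. disc \<epsilon> x v c = 0 \<or> norm (x + r *\<^sub>R v - c) = \<epsilon> \<or>
     (\<exists>c'\<in>C. c' \<noteq> c \<and> disc \<epsilon> x v c > 0 \<and> norm (hit_point \<epsilon> x v c - c') = \<epsilon>))"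

text \<open>Among the finitely many obstacles that block the flight, the one with the smallest entry time is hit
  first; in a nondegenerate situation it is unique.\<close>

lemma flight_or_hit:
  fixes x v :: "'a::euclidean_space"
  assumes v: "norm v = 1" and \<epsilon>: "\<epsilon> > 0" and r: "r > 0" and C: "locally_finite C"
    and valid: "\<And>c. c \<in> C \<Longrightarrow> \<not> blocked \<epsilon> 0 x v c" and nd: "\<not> degenerate \<epsilon> C r x v"
  shows "(\<forall>c\<in>C. \<not> blocked \<epsilon> r x v c) \<or> (\<exists>c\<in>C. first_hit \<epsilon> C r x v c)"
proof (cases "\<exists>c\<in>C. blocked \<epsilon> r x v c")
  case True
  let ?B = "{c \<in> C. blocked \<epsilon> r x v c}"
  have "?B \<subseteq> C \<inter> cball x (r + \<epsilon>)"
  proof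
    fix c assume c: "c \<in> ?B"
    then obtain s where s: "s \<in> {0..r}" "norm (x + s *\<^sub>R v - c) \<le> \<epsilon>" using blocked_iff[OF v \<epsilon> r, of x c] by auto
    have "norm (x - c) \<le> norm (x + s *\<^sub>R v - c) + norm (s *\<^sub>R v)"
      using norm_triangle_ineq4[of "x + s *\<^sub>R v - c" "s *\<^sub>R v"] by simp
    then show "c \<in> C \<inter> cball x (r + \<epsilon>)" using s v c by (auto simp: dist_norm)
  qed
  then have fin: "finite ?B" using locally_finite_bounded[OF C bounded_cball] finite_subset by blast
  have ne: "?B \<noteq> {}" using True by auto
  obtain c where c: "c \<in> ?B" "\<And>c'. c' \<in> ?B \<Longrightarrow> entry_time \<epsilon> x v c \<le> entry_time \<epsilon> x v c'"
    using ex_min_if_finite[OF finite_imageI[OF fin, of "entry_time \<epsilon> x v"]] ne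
    by (metis (no_types, lifting) arg_min_if_finite(1) arg_min_least fin)
  have D: "disc \<epsilon> x v c > 0" using c(1) nd unfolding blocked_def degenerate_def by fastforce
  have "0 < entry_time \<epsilon> x v c"
    using valid[of c] c(1) unfolding blocked_def by fastforce
  moreover have "entry_time \<epsilon> x v c \<noteq> r"
    using norm_entry_point(1)[OF v \<epsilon>, of x c] D nd c(1) unfolding degenerate_def by auto
  moreover have "entry_time \<epsilon> x v c \<le> r" using c(1) by (simp add: blocked_def)
  moreover have "\<not> blocked \<epsilon> (entry_time \<epsilon> x v c) x v c'" if c': "c' \<in> C" "c' \<noteq> c" for c'
  proof
    assume b: "blocked \<epsilon> (entry_time \<epsilon> x v c) x v c'"
    then have "c' \<in> ?B" using \<open>entry_time \<epsilon> x v c \<le> r\<close> c' unfolding blocked_def by auto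
    then have eq: "entry_time \<epsilon> x v c' = entry_time \<epsilon> x v c" using c(2) b unfolding blocked_def by force
    have "norm (hit_point \<epsilon> x v c - c') = \<epsilon>"
      using norm_entry_point(1)[OF v \<epsilon>, of x c'] b unfolding hit_point_def blocked_def eq by auto
    then show False using nd c(1) c' D unfolding degenerate_def by auto
  qed
  ultimately have "first_hit \<epsilon> C r x v c" using D unfolding first_hit_def by auto
  then show ?thesis using c(1) by auto
qed auto

lemma after_hit_valid:
  fixes x v :: "'a::euclidean_space"
  assumes v: "norm v = 1" and \<epsilon>: "\<epsilon> > 0" and h: "first_hit \<epsilon> C r x v c" and c': "c' \<in> C"
  shows "\<not> blocked \<epsilon> 0 (hit_point \<epsilon> x v c) (deflected \<epsilon> x v c) c'"
proof -
  have D: "disc \<epsilon> x v c > 0" using h by (simp add: first_hit_def)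
  note geo = hit_geometry[OF v \<epsilon> D]
  show ?thesis
  proof (cases "c' = c")
    case False
    have "norm (hit_point \<epsilon> x v c + 0 *\<^sub>R deflected \<epsilon> x v c - c') > \<epsilon>"
      using first_hit_clear[OF v \<epsilon> h c' False] by simp
    then show ?thesis
      using in_ball_line_iff(2)[OF geo(3) \<epsilon>, of "hit_point \<epsilon> x v c" 0 c'] by (auto simp: blocked_def)
  qed (use geo(7) in simp)
qed

text \<open>A trajectory either ends after fewer than \<open>J\<close> collisions, or makes \<open>J\<close> collisions, or becomes
  degenerate on the way.\<close>

lemma collide_chain_lower:
  fixes x v :: "'a::euclidean_space"
  assumes "norm v = 1" and \<epsilon>: "\<epsilon> > 0" and "r > 0" and C: "locally_finite C"
    and "\<And>c. c \<in> C \<Longrightarrow> \<not> blocked \<epsilon> 0 x v c"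
  shows "1 \<le> (\<Sum>j<J. after_collisions \<epsilon> C (\<lambda>_ _. 1) j r x v) + (collide \<epsilon> C ^^ J) (\<lambda>_ _ _. 1) r x v +
     (\<Sum>j<J. (collide \<epsilon> C ^^ j) (\<lambda>r x v. indicator {(r, x, v). degenerate \<epsilon> C r x v} (r, x, v)) r x v)"
  using assms(1,3,5)
proof (induction J arbitrary: r x v)
  case (Suc J)
  let ?N = "\<lambda>r x v. indicator {(r, x, v). degenerate \<epsilon> C r x v} (r, x, v) :: ennreal"
  let ?A = "\<lambda>j. after_collisions \<epsilon> C (\<lambda>_ _. 1) j"
  have up: "1 \<le> a + b + c" if "1 \<le> c" for a b c :: ennreal
    using that by (simp add: add_increasing)
  have up': "1 \<le> a + b + c" if "1 \<le> a" for a b c :: ennreal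
    using that by (metis add_increasing2 zero_le)
  consider "degenerate \<epsilon> C r x v" | "\<forall>c\<in>C. \<not> blocked \<epsilon> r x v c" | c where "c \<in> C" "first_hit \<epsilon> C r x v c"
    using flight_or_hit[OF Suc.prems(1) \<epsilon> Suc.prems(2) C Suc.prems(3)] by blast
  then show ?case
  proof cases
    case 1
    then have "1 \<le> (\<Sum>j<Suc J. (collide \<epsilon> C ^^ j) ?N r x v)"
      unfolding sum.lessThan_Suc_shift by simp
    then show ?thesis by (rule up)
  next
    case 2
    then have "1 \<le> (\<Sum>j<Suc J. ?A j r x v)"
      unfolding sum.lessThan_Suc_shift by (simp add: after_collisions_0 free_flight_def)
    then show ?thesis by (rule up')
  next
    case 3
    let ?r = "r - entry_time \<epsilon> x v c" and ?x = "hit_point \<epsilon> x v c" and ?v = "deflected \<epsilon> x v c"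
    have D: "disc \<epsilon> x v c > 0" and r: "0 < ?r" using 3 by (auto simp: first_hit_def)
    have IH: "1 \<le> (\<Sum>j<J. ?A j ?r ?x ?v) + (collide \<epsilon> C ^^ J) (\<lambda>_ _ _. 1) ?r ?x ?v + (\<Sum>j<J. (collide \<epsilon> C ^^ j) ?N ?r ?x ?v)"
      by (rule Suc.IH[OF hit_geometry(3)[OF Suc.prems(1) \<epsilon> D] r]) (rule after_hit_valid[OF Suc.prems(1) \<epsilon> 3(2)])
    note eq = collide_eq[OF 3(2,1)]
    have sA: "(\<Sum>j<J. ?A j ?r ?x ?v) \<le> (\<Sum>j<Suc J. ?A j r x v)"
      unfolding sum.lessThan_Suc_shift by (simp add: after_collisions_Suc eq)
    have sN: "(\<Sum>j<J. (collide \<epsilon> C ^^ j) ?N ?r ?x ?v) \<le> (\<Sum>j<Suc J. (collide \<epsilon> C ^^ j) ?N r x v)"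
      unfolding sum.lessThan_Suc_shift by (simp add: eq)
    have s1: "(collide \<epsilon> C ^^ Suc J) (\<lambda>_ _ _. 1) r x v = (collide \<epsilon> C ^^ J) (\<lambda>_ _ _. 1) ?r ?x ?v"
      by (simp add: eq)
    show ?thesis unfolding s1 by (rule order_trans[OF IH]) (intro add_mono sA sN order_refl)
  qed
qed simp

lemma after_collisions_sum_le:
  assumes "\<And>x v. g x v \<le> K"
  shows "(\<Sum>j<J. after_collisions \<epsilon> C g j r x v) \<le> K"
proof (induction J arbitrary: r x v)
  case (Suc J)
  consider c where "c \<in> C" "first_hit \<epsilon> C r x v c" | "\<forall>c\<in>C. \<not> first_hit \<epsilon> C r x v c" by blast
  then show ?case
  proof cases
    case 1
    then have "free_flight \<epsilon> C g r x v = 0" using first_hit_blocked unfolding free_flight_def by fastforce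
    then show ?thesis unfolding sum.lessThan_Suc_shift
      using Suc by (simp add: after_collisions_0 after_collisions_Suc collide_eq[OF 1(2,1)])
  next
    case 2
    then show ?thesis unfolding sum.lessThan_Suc_shift
      using assms by (simp add: after_collisions_0 after_collisions_Suc collide_eq_0 free_flight_def)
  qed
qed simp

section \<open>Phase volume carried off the obstacles\<close>

definition clear_of :: "real \<Rightarrow> 'a::euclidean_space set \<Rightarrow> 'a \<Rightarrow> 'a \<Rightarrow> bool" where
  "clear_of \<epsilon> C c y \<longleftrightarrow> (\<forall>c'\<in>C. c' \<noteq> c \<longrightarrow> \<epsilon> < norm (y - c'))"

text \<open>The particle emerges from the obstacle \<open>c\<close> during the time interval \<open>(0, T)\<close> at a point not covered by
  another obstacle. The point \<open>x\<close> is its straight backward extension to time 0, which serves as a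
  coordinate only.\<close>

definition departures :: "real \<Rightarrow> 'a::euclidean_space set \<Rightarrow> real \<Rightarrow> 'a \<Rightarrow> 'a \<Rightarrow> 'a \<Rightarrow> bool" where
  "departures \<epsilon> C T x v c \<longleftrightarrow> disc \<epsilon> x v c > 0 \<and> 0 < exit_time \<epsilon> x v c \<and> exit_time \<epsilon> x v c < T \<and>
     clear_of \<epsilon> C c (x + exit_time \<epsilon> x v c *\<^sub>R v)"

text \<open>The phase volume leaving the obstacles during \<open>(0, T)\<close>, weighted by the value of \<open>h\<close> for the remaining
  time.\<close>

definition flux :: "real \<Rightarrow> 'a::euclidean_space set \<Rightarrow> real \<Rightarrow> (real \<Rightarrow> 'a \<Rightarrow> 'a \<Rightarrow> ennreal) \<Rightarrow> ennreal" where
  "flux \<epsilon> C T h = (\<integral>\<^sup>+c. \<integral>\<^sup>+v. \<integral>\<^sup>+x. indicator {x. departures \<epsilon> C T x v c} x *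
     h (T - exit_time \<epsilon> x v c) (x + exit_time \<epsilon> x v c *\<^sub>R v) v \<partial>lborel \<partial>surface \<partial>count_space C)"

lemma const_config: "locally_finite C \<Longrightarrow> (\<lambda>_. C) \<in> M \<rightarrow>\<^sub>M config"
  by (rule measurable_const) (simp add: space_config)

lemma pred_clear_of:
  fixes y c :: "'y \<Rightarrow> 'a::euclidean_space"
  assumes C: "locally_finite C" and [measurable]: "y \<in> borel_measurable M" "c \<in> borel_measurable M"
  shows "Measurable.pred M (\<lambda>w. clear_of \<epsilon> C (c w) (y w))"
  unfolding clear_of_def by (rule pred_Ball_config[OF const_config[OF C]]) measurable

lemma pred_departures:
  fixes x v c :: "'y \<Rightarrow> 'a::euclidean_space"
  assumes C: "locally_finite C"
    and [measurable]: "x \<in> borel_measurable M" "v \<in> borel_measurable M" "c \<in> borel_measurable M"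
  shows "Measurable.pred M (\<lambda>w. departures \<epsilon> C T (x w) (v w) (c w))"
proof -
  have [measurable]: "Measurable.pred M (\<lambda>w. clear_of \<epsilon> C (c w) (x w + exit_time \<epsilon> (x w) (v w) (c w) *\<^sub>R v w))"
    by (rule pred_clear_of[OF C]) measurable
  show ?thesis unfolding departures_def by measurable
qed

lemma first_hit_shift:
  fixes x v c :: "'a::euclidean_space"
  assumes v: "norm v = 1"
  shows "first_hit \<epsilon> C (T - a) (x + a *\<^sub>R v) v c \<longleftrightarrow> disc \<epsilon> x v c > 0 \<and> a < entry_time \<epsilon> x v c \<and>
    entry_time \<epsilon> x v c < T \<and> (\<forall>c'\<in>C. c' \<noteq> c \<longrightarrow>
      \<not> (disc \<epsilon> x v c' \<ge> 0 \<and> entry_time \<epsilon> x v c' \<le> entry_time \<epsilon> x v c \<and> a < exit_time \<epsilon> x v c'))"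
  unfolding first_hit_def blocked_def disc_shift[OF v] entry_time_shift[OF v] by auto

lemma hit_point_shift:
  fixes x v c :: "'a::euclidean_space"
  assumes v: "norm v = 1"
  shows "hit_point \<epsilon> (x + a *\<^sub>R v) v c = hit_point \<epsilon> x v c"
    "deflected \<epsilon> (x + a *\<^sub>R v) v c = deflected \<epsilon> x v c"
  unfolding deflected_def hit_point_def entry_time_shift[OF v] by (simp_all add: algebra_simps)

text \<open>A collision with \<open>c\<close> on a given line has one predecessor at most: either the particle started in the
  free region, or it last left a single obstacle \<open>b\<close>. In both cases the collision takes place at a
  point clear of the other obstacles.\<close>

lemma flux_pointwise:
  fixes x v c :: "'a::euclidean_space"
  assumes v: "norm v = 1" and \<epsilon>: "\<epsilon> > 0" and cC: "c \<in> C"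
  shows "indicator {x. \<forall>c\<in>C. \<epsilon> < norm (x - c)} x * indicator {c. first_hit \<epsilon> C T x v c} c +
     (\<integral>\<^sup>+b. indicator {b. departures \<epsilon> C T x v b} b *
        indicator {c. first_hit \<epsilon> C (T - exit_time \<epsilon> x v b) (x + exit_time \<epsilon> x v b *\<^sub>R v) v c} c \<partial>count_space C)
   \<le> (indicator {x. disc \<epsilon> x v c > 0 \<and> 0 < entry_time \<epsilon> x v c \<and> entry_time \<epsilon> x v c < T \<and>
        clear_of \<epsilon> C c (hit_point \<epsilon> x v c)} x :: ennreal)" (is "?X + (\<integral>\<^sup>+b. ?Y b \<partial>count_space C) \<le> ?S")
proof -
  let ?P = "\<lambda>b. departures \<epsilon> C T x v b"
  let ?F = "\<lambda>b. first_hit \<epsilon> C (T - exit_time \<epsilon> x v b) (x + exit_time \<epsilon> x v b *\<^sub>R v) v c"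
  have S: "?S = 1" if "first_hit \<epsilon> C (T - a) (x + a *\<^sub>R v) v c" "0 \<le> a" for a
  proof -
    note f = that(1)[unfolded first_hit_shift[OF v]]
    have "clear_of \<epsilon> C c (hit_point \<epsilon> x v c)"
      unfolding clear_of_def
    proof (intro ballI impI, rule ccontr)
      fix c' assume c': "c' \<in> C" "c' \<noteq> c" "\<not> \<epsilon> < norm (hit_point \<epsilon> x v c - c')"
      then have "disc \<epsilon> x v c' \<ge> 0 \<and> entry_time \<epsilon> x v c' \<le> entry_time \<epsilon> x v c \<and> entry_time \<epsilon> x v c \<le> exit_time \<epsilon> x v c'"
        using in_ball_line_iff(2)[OF v \<epsilon>] unfolding hit_point_def by (simp add: not_less)
      then show False using f c' by auto
    qed
    then show ?thesis using f that(2) by auto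
  qed
  have Q: "?P b \<and> ?F b" if "?Y b \<noteq> 0" for b
    using that by (auto split: split_indicator_asm)
  have uniq: "b = b'" if b: "b \<in> C" "?P b" "?F b" and b': "b' \<in> C" "?P b'" "?F b'" for b b'
  proof -
    have *: False if b: "b \<in> C" "?P b" "?F b" and b': "b' \<in> C" "?P b'" "?F b'"
      and ne: "b \<noteq> b'" and le: "exit_time \<epsilon> x v b \<le> exit_time \<epsilon> x v b'" for b b'
    proof -
      have b'c: "b' \<noteq> c" and lt: "exit_time \<epsilon> x v b' < entry_time \<epsilon> x v c"
        using b'(3) entry_less_exit[of \<epsilon> x v c] unfolding first_hit_shift[OF v] by auto
      have D: "disc \<epsilon> x v b' > 0" using b'(2) by (simp add: departures_def)
      have "\<not> (disc \<epsilon> x v b' \<ge> 0 \<and> entry_time \<epsilon> x v b' \<le> entry_time \<epsilon> x v c \<and> exit_time \<epsilon> x v b < exit_time \<epsilon> x v b')"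
        using b(3) b'(1) b'c unfolding first_hit_shift[OF v] by blast
      then have "exit_time \<epsilon> x v b = exit_time \<epsilon> x v b'"
        using D lt entry_less_exit[OF D] le by auto
      moreover have "\<epsilon> < norm (x + exit_time \<epsilon> x v b *\<^sub>R v - b')"
        using b(2) b'(1) ne unfolding departures_def clear_of_def by auto
      ultimately show False using norm_entry_point(2)[OF v \<epsilon>, of x b'] D by simp
    qed
    show ?thesis using *[of b b'] *[of b' b] b b' linear by metis
  qed
  show ?thesis
  proof (cases "\<exists>b\<in>C. ?Y b \<noteq> 0")
    case True
    then obtain b where b: "b \<in> C" "?P b" "?F b" using Q by blast
    have "(\<integral>\<^sup>+b. ?Y b \<partial>count_space C) = ?Y b"
    proof (rule nn_integral_count_space_single[OF b(1)])
      fix b' assume "b' \<in> C" "b' \<noteq> b"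
      then show "?Y b' = 0" using uniq[OF b, of b'] Q[of b'] by blast
    qed
    also have "\<dots> = 1" using b by simp
    finally have Y: "(\<integral>\<^sup>+b. ?Y b \<partial>count_space C) = 1" .
    have "?S = 1" by (rule S[OF b(3)]) (use b(2) in \<open>simp add: departures_def\<close>)
    moreover have "?X = 0"
    proof (rule ccontr)
      assume "?X \<noteq> 0"
      then have f: "first_hit \<epsilon> C (T - 0) (x + 0 *\<^sub>R v) v c" by (auto split: split_indicator_asm)
      have bc: "b \<noteq> c" and lt: "exit_time \<epsilon> x v b < entry_time \<epsilon> x v c"
        using b(3) entry_less_exit[of \<epsilon> x v c] unfolding first_hit_shift[OF v] by auto
      have D: "disc \<epsilon> x v b > 0" and e: "0 < exit_time \<epsilon> x v b" using b(2) by (simp_all add: departures_def)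
      show False using f b(1) bc lt e D entry_less_exit[OF D] unfolding first_hit_shift[OF v] by force
    qed
    ultimately show ?thesis using Y by simp
  next
    case False
    then have Y: "(\<integral>\<^sup>+b. ?Y b \<partial>count_space C) = 0"
      by (intro nn_integral_zero') (auto simp: AE_count_space)
    show ?thesis
    proof (cases "?X = 0")
      case True
      show ?thesis unfolding True Y by simp
    next
      case False
      then have f: "first_hit \<epsilon> C (T - 0) (x + 0 *\<^sub>R v) v c" and X: "?X = 1" by (auto split: split_indicator_asm)
      show ?thesis unfolding S[OF f order_refl] X Y by simp
    qed
  qed
qed

lemma nn_integral_count_space_phase_swap:
  fixes F :: "'a::euclidean_space \<Rightarrow> 'a \<Rightarrow> 'a \<Rightarrow> ennreal"
  assumes C: "countable C" and F: "(\<lambda>(c, v, x). F c v x) \<in> borel_measurable (borel \<Otimes>\<^sub>M borel \<Otimes>\<^sub>M borel)"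
  shows "(\<integral>\<^sup>+c. \<integral>\<^sup>+v. \<integral>\<^sup>+x. F c v x \<partial>lborel \<partial>surface \<partial>count_space C) =
    (\<integral>\<^sup>+v. \<integral>\<^sup>+x. \<integral>\<^sup>+c. F c v x \<partial>count_space C \<partial>lborel \<partial>surface)"
proof -
  have m1: "(\<lambda>x. F c v x) \<in> borel_measurable lborel" for c v
    using measurable_compose[OF _ F, of "\<lambda>x. (c, v, x)" lborel] by simp
  have m2: "(\<lambda>v. \<integral>\<^sup>+x. F c v x \<partial>lborel) \<in> borel_measurable surface" for c
  proof -
    have [measurable]: "(\<lambda>(v, x). F c v x) \<in> borel_measurable (surface \<Otimes>\<^sub>M lborel)"
      using measurable_compose[OF _ F, of "\<lambda>w. (c, fst w, snd w)" "surface \<Otimes>\<^sub>M lborel"] by (simp add: case_prod_beta)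
    show ?thesis by measurable
  qed
  have "(\<integral>\<^sup>+v. \<integral>\<^sup>+x. \<integral>\<^sup>+c. F c v x \<partial>count_space C \<partial>lborel \<partial>surface) =
      (\<integral>\<^sup>+v. \<integral>\<^sup>+c. \<integral>\<^sup>+x. F c v x \<partial>lborel \<partial>count_space C \<partial>surface)"
    by (intro nn_integral_cong nn_integral_count_space_nn_integral C m1)
  also have "\<dots> = (\<integral>\<^sup>+c. \<integral>\<^sup>+v. \<integral>\<^sup>+x. F c v x \<partial>lborel \<partial>surface \<partial>count_space C)"
    by (intro nn_integral_count_space_nn_integral C m2)
  finally show ?thesis ..
qed

lemma measurable_collide_const:
  fixes C :: "'a::euclidean_space set"
  assumes C: "locally_finite C"
    and G: "(\<lambda>(r, x, v). G r x v) \<in> borel_measurable (borel \<Otimes>\<^sub>M borel \<Otimes>\<^sub>M borel)"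
    and [measurable]: "r \<in> borel_measurable M" "x \<in> borel_measurable M" "v \<in> borel_measurable M"
  shows "(\<lambda>y. collide \<epsilon> C G (r y) (x y) (v y)) \<in> borel_measurable M"
proof (rule measurable_collide[OF const_config[OF C]])
  show "(\<lambda>(y, r, x, v). G r x v) \<in> borel_measurable (M \<Otimes>\<^sub>M borel \<Otimes>\<^sub>M borel \<Otimes>\<^sub>M borel)"
    using measurable_compose[OF measurable_snd G, of M] by (simp add: case_prod_beta)
qed measurable

lemma measurable_collide_funpow:
  fixes C :: "'a::euclidean_space set"
  assumes C: "locally_finite C"
    and G: "(\<lambda>(r, x, v). G r x v) \<in> borel_measurable (borel \<Otimes>\<^sub>M borel \<Otimes>\<^sub>M borel)"
  shows "(\<lambda>(r, x, v). (collide \<epsilon> C ^^ n) G r x v) \<in> borel_measurable (borel \<Otimes>\<^sub>M borel \<Otimes>\<^sub>M borel)"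
proof (induction n)
  case (Suc n)
  show ?case unfolding funpow.simps o_apply case_prod_beta
    by (rule measurable_collide_const[OF C Suc]) measurable
qed (use G in simp)

text \<open>Particles arriving at an obstacle come either from the initial free region or from an earlier
  departure, and those two sources do not overlap (\<open>flux_pointwise\<close>). What arrives leaves with the same
  phase volume (\<open>collision_preserves_phase_volume\<close>). Hence the \<open>h\<close>-weighted volume of initial positions that
  collide, plus the flux of \<open>collide \<epsilon> C h\<close>, is at most the flux of \<open>h\<close>; iterating absorbs all numbers of
  collisions into one flux.\<close>

theorem flux_bound:
  fixes C :: "'a::euclidean_space set"
  assumes \<epsilon>: "\<epsilon> > 0" and C: "locally_finite C"
    and h: "(\<lambda>(r, x, v). h r x v) \<in> borel_measurable (borel \<Otimes>\<^sub>M borel \<Otimes>\<^sub>M borel)"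
  shows "(\<Sum>j<J. \<integral>\<^sup>+v. \<integral>\<^sup>+x. indicator {x. \<forall>c\<in>C. \<epsilon> < norm (x - c)} x * (collide \<epsilon> C ^^ Suc j) h T x v \<partial>lborel \<partial>surface)
    \<le> flux \<epsilon> C T h"
  using h
proof (induction J arbitrary: h)
  case (Suc J)
  note h = Suc.prems
  have cC: "countable C" using C by (rule locally_finite_countable)
  let ?O = "{x. \<forall>c\<in>C. \<epsilon> < norm (x - c)}"
  let ?k = "\<lambda>c v x. h (T - entry_time \<epsilon> x v c) (hit_point \<epsilon> x v c) (deflected \<epsilon> x v c)"
  let ?F = "\<lambda>a x v c. indicator {c. first_hit \<epsilon> C (T - a) (x + a *\<^sub>R v) v c} c :: ennreal"
  let ?e = "\<lambda>x v c. exit_time \<epsilon> x v c"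
  let ?P = "\<lambda>c v x. indicator {x. departures \<epsilon> C T x v c} x :: ennreal"
  have h' [measurable (raw)]: "(\<lambda>w. h (f w) (g w) (k w)) \<in> borel_measurable N"
    if "f \<in> borel_measurable N" "g \<in> borel_measurable N" "k \<in> borel_measurable N"
    for N :: "'n measure" and f g k
    using measurable_compose[OF measurable_Pair[OF that(1) measurable_Pair[OF that(2,3)]] h] by simp
  have [measurable]: "(\<lambda>w. collide \<epsilon> C h (f w) (g w) (k w)) \<in> borel_measurable N"
    if "f \<in> borel_measurable N" "g \<in> borel_measurable N" "k \<in> borel_measurable N"
    for N :: "'n measure" and f g k
    by (rule measurable_collide_const[OF C h that])
  have predO [measurable]: "Measurable.pred N (\<lambda>w. \<forall>c\<in>C. \<epsilon> < norm (f w - c))"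
    if [measurable]: "f \<in> borel_measurable N" for N :: "'n measure" and f
    by (rule pred_Ball_config[OF const_config[OF C]]) measurable
  note [measurable (raw)] = pred_departures[OF C] pred_clear_of[OF C] pred_first_hit[OF const_config[OF C]]
  have T1: "collide \<epsilon> C h (T - a) (x + a *\<^sub>R v) v = (\<integral>\<^sup>+c. ?F a x v c * ?k c v x \<partial>count_space C)"
    if "norm v = 1" for a x v
    unfolding collide_def entry_time_shift[OF that] hit_point_shift[OF that] by simp
  have "(\<Sum>j<Suc J. \<integral>\<^sup>+v. \<integral>\<^sup>+x. indicator ?O x * (collide \<epsilon> C ^^ Suc j) h T x v \<partial>lborel \<partial>surface) =
     (\<integral>\<^sup>+v. \<integral>\<^sup>+x. indicator ?O x * collide \<epsilon> C h T x v \<partial>lborel \<partial>surface) +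
     (\<Sum>j<J. \<integral>\<^sup>+v. \<integral>\<^sup>+x. indicator ?O x * (collide \<epsilon> C ^^ Suc j) (collide \<epsilon> C h) T x v \<partial>lborel \<partial>surface)"
    unfolding sum.lessThan_Suc_shift by (simp add: funpow_swap1)
  also have "\<dots> \<le> (\<integral>\<^sup>+v. \<integral>\<^sup>+x. indicator ?O x * collide \<epsilon> C h T x v \<partial>lborel \<partial>surface) + flux \<epsilon> C T (collide \<epsilon> C h)"
  proof (intro add_left_mono Suc.IH)
    show "(\<lambda>(r, x, v). collide \<epsilon> C h r x v) \<in> borel_measurable (borel \<Otimes>\<^sub>M borel \<Otimes>\<^sub>M borel)"
      using measurable_collide_funpow[OF C h, where \<epsilon>=\<epsilon> and n=1] by simp
  qed
  also have "flux \<epsilon> C T (collide \<epsilon> C h) = (\<integral>\<^sup>+v. \<integral>\<^sup>+x. \<integral>\<^sup>+b. ?P b v x *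
      collide \<epsilon> C h (T - ?e x v b) (x + ?e x v b *\<^sub>R v) v \<partial>count_space C \<partial>lborel \<partial>surface)"
    unfolding flux_def
    by (rule nn_integral_count_space_phase_swap[OF cC]) (unfold case_prod_beta indicator_def of_bool_def mem_Collect_eq, measurable)
  also have "(\<integral>\<^sup>+v. \<integral>\<^sup>+x. indicator ?O x * collide \<epsilon> C h T x v \<partial>lborel \<partial>surface) + \<dots> =
     (\<integral>\<^sup>+v. \<integral>\<^sup>+x. indicator ?O x * collide \<epsilon> C h T x v + (\<integral>\<^sup>+b. ?P b v x *
      collide \<epsilon> C h (T - ?e x v b) (x + ?e x v b *\<^sub>R v) v \<partial>count_space C) \<partial>lborel \<partial>surface)"
  proof -
    have m1 [measurable]: "(\<lambda>(v, x). indicator ?O x * collide \<epsilon> C h T x v) \<in> borel_measurable (borel \<Otimes>\<^sub>M borel)"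
      unfolding case_prod_beta indicator_def of_bool_def mem_Collect_eq by measurable
    have m2 [measurable]: "(\<lambda>(v, x). \<integral>\<^sup>+b. ?P b v x * collide \<epsilon> C h (T - ?e x v b) (x + ?e x v b *\<^sub>R v) v \<partial>count_space C)
        \<in> borel_measurable (borel \<Otimes>\<^sub>M borel)"
      unfolding case_prod_beta
      by (rule measurable_sum_over_config[OF const_config[OF C]])
         (unfold case_prod_beta indicator_def of_bool_def mem_Collect_eq, measurable)
    show ?thesis
      by (subst nn_integral_add[symmetric], measurable, intro nn_integral_cong nn_integral_add[symmetric]) measurable
  qed
  also have "\<dots> \<le> (\<integral>\<^sup>+v. \<integral>\<^sup>+x. \<integral>\<^sup>+c. indicator {x. disc \<epsilon> x v c > 0 \<and> 0 < entry_time \<epsilon> x v c \<and>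
        entry_time \<epsilon> x v c < T \<and> clear_of \<epsilon> C c (hit_point \<epsilon> x v c)} x * ?k c v x \<partial>count_space C \<partial>lborel \<partial>surface)"
  proof (rule nn_integral_mono_AE, use AE_surface_norm in eventually_elim)
    case (elim v)
    show ?case
    proof (rule nn_integral_mono)
      fix x
      have "(\<integral>\<^sup>+b. ?P b v x * collide \<epsilon> C h (T - ?e x v b) (x + ?e x v b *\<^sub>R v) v \<partial>count_space C) =
         (\<integral>\<^sup>+b. \<integral>\<^sup>+c. ?P b v x * ?F (?e x v b) x v c * ?k c v x \<partial>count_space C \<partial>count_space C)"
        unfolding T1[OF elim] by (simp add: nn_integral_cmult[symmetric] mult.assoc)
      also have "\<dots> = (\<integral>\<^sup>+c. \<integral>\<^sup>+b. ?P b v x * ?F (?e x v b) x v c * ?k c v x \<partial>count_space C \<partial>count_space C)"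
        by (rule nn_integral_count_space_nn_integral[OF cC]) simp
      also have "\<dots> = (\<integral>\<^sup>+c. (\<integral>\<^sup>+b. ?P b v x * ?F (?e x v b) x v c \<partial>count_space C) * ?k c v x \<partial>count_space C)"
        by (simp add: nn_integral_multc)
      finally have "indicator ?O x * collide \<epsilon> C h T x v + (\<integral>\<^sup>+b. ?P b v x *
          collide \<epsilon> C h (T - ?e x v b) (x + ?e x v b *\<^sub>R v) v \<partial>count_space C) =
        (\<integral>\<^sup>+c. (indicator ?O x * indicator {c. first_hit \<epsilon> C T x v c} c +
            (\<integral>\<^sup>+b. ?P b v x * ?F (?e x v b) x v c \<partial>count_space C)) * ?k c v x \<partial>count_space C)"
        using T1[OF elim, of 0 x]
        by (simp add: distrib_right nn_integral_add nn_integral_cmult[symmetric] mult.assoc)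
      also have "\<dots> \<le> (\<integral>\<^sup>+c. indicator {x. disc \<epsilon> x v c > 0 \<and> 0 < entry_time \<epsilon> x v c \<and>
          entry_time \<epsilon> x v c < T \<and> clear_of \<epsilon> C c (hit_point \<epsilon> x v c)} x * ?k c v x \<partial>count_space C)"
      proof (intro nn_integral_mono mult_right_mono)
        fix c assume "c \<in> space (count_space C)"
        then have "c \<in> C" by simp
        from flux_pointwise[OF elim \<epsilon> this, of x T]
        show "indicator ?O x * indicator {c. first_hit \<epsilon> C T x v c} c +
            (\<integral>\<^sup>+b. ?P b v x * ?F (?e x v b) x v c \<partial>count_space C) \<le> indicator {x. disc \<epsilon> x v c > 0 \<and> 0 < entry_time \<epsilon> x v c \<and>
          entry_time \<epsilon> x v c < T \<and> clear_of \<epsilon> C c (hit_point \<epsilon> x v c)} x"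
          by (simp add: indicator_def of_bool_def)
      qed simp
      finally show "indicator ?O x * collide \<epsilon> C h T x v + (\<integral>\<^sup>+b. ?P b v x *
          collide \<epsilon> C h (T - ?e x v b) (x + ?e x v b *\<^sub>R v) v \<partial>count_space C) \<le> \<dots>" .
    qed
  qed
  also have "\<dots> = (\<integral>\<^sup>+c. \<integral>\<^sup>+v. \<integral>\<^sup>+x. indicator {x. disc \<epsilon> x v c > 0 \<and> 0 < entry_time \<epsilon> x v c \<and>
        entry_time \<epsilon> x v c < T \<and> clear_of \<epsilon> C c (hit_point \<epsilon> x v c)} x * ?k c v x \<partial>lborel \<partial>surface \<partial>count_space C)"
    by (rule nn_integral_count_space_phase_swap[OF cC, symmetric])
       (unfold case_prod_beta indicator_def of_bool_def mem_Collect_eq, measurable)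
  also have "\<dots> = flux \<epsilon> C T h"
    unfolding flux_def
  proof (rule nn_integral_cong)
    fix c
    let ?\<Theta> = "\<lambda>s y v. (if 0 < s \<and> s < T \<and> clear_of \<epsilon> C c y then h (T - s) y v else 0)"
    have "(\<integral>\<^sup>+v. \<integral>\<^sup>+x. indicator {x. disc \<epsilon> x v c > 0 \<and> 0 < entry_time \<epsilon> x v c \<and>
        entry_time \<epsilon> x v c < T \<and> clear_of \<epsilon> C c (hit_point \<epsilon> x v c)} x * ?k c v x \<partial>lborel \<partial>surface) =
      (\<integral>\<^sup>+v. \<integral>\<^sup>+x. indicator {x. disc \<epsilon> x v c > 0} x *
        ?\<Theta> (entry_time \<epsilon> x v c) (x + entry_time \<epsilon> x v c *\<^sub>R v)
          (specular ((x + entry_time \<epsilon> x v c *\<^sub>R v - c) /\<^sub>R \<epsilon>) v) \<partial>lborel \<partial>surface)"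
      unfolding deflected_def hit_point_def by (intro nn_integral_cong) (simp add: indicator_def)
    also have "\<dots> = (\<integral>\<^sup>+v. \<integral>\<^sup>+x. indicator {x. disc \<epsilon> x v c > 0} x *
        ?\<Theta> (exit_time \<epsilon> x v c) (x + exit_time \<epsilon> x v c *\<^sub>R v) v \<partial>lborel \<partial>surface)"
      by (rule collision_preserves_phase_volume[OF \<epsilon>]) (unfold case_prod_beta, measurable)
    also have "\<dots> = (\<integral>\<^sup>+v. \<integral>\<^sup>+x. ?P c v x * h (T - ?e x v c) (x + ?e x v c *\<^sub>R v) v \<partial>lborel \<partial>surface)"
      unfolding departures_def by (intro nn_integral_cong) (simp add: indicator_def)
    finally show "(\<integral>\<^sup>+v. \<integral>\<^sup>+x. indicator {x. disc \<epsilon> x v c > 0 \<and> 0 < entry_time \<epsilon> x v c \<and>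
        entry_time \<epsilon> x v c < T \<and> clear_of \<epsilon> C c (hit_point \<epsilon> x v c)} x * ?k c v x \<partial>lborel \<partial>surface) = \<dots>" .
  qed
  finally show ?case .
qed simp

section \<open>Almost every trajectory has finitely many collisions\<close>

lemma degenerate_shift:
  fixes x v :: "'a::euclidean_space"
  assumes v: "norm v = 1"
  shows "degenerate \<epsilon> C (T - a) (x + a *\<^sub>R v) v \<longleftrightarrow> degenerate \<epsilon> C T x v"
  unfolding degenerate_def disc_shift[OF v] hit_point_shift[OF v] by (simp add: algebra_simps)

text \<open>For a fixed velocity and each of the countably many obstacles, or pairs of obstacles, degeneracy is a
  nontrivial quadratic condition on the position.\<close>

lemma AE_not_degenerate:
  fixes v :: "'a::euclidean_space"
  assumes dim: "DIM('a) \<ge> 2" and \<epsilon>: "\<epsilon> > 0" and C: "countable C" and v: "norm v = 1"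
  shows "AE x in lborel. \<not> degenerate \<epsilon> C T x v"
proof -
  have 1: "AE x in lborel. disc \<epsilon> x v c \<noteq> 0" for c by (rule AE_disc_nonzero(1)[OF dim])
  have 2: "AE x in lborel. norm (x + T *\<^sub>R v - c) \<noteq> \<epsilon>" for c
    using AE_norm_neq[of "c - T *\<^sub>R v" \<epsilon>] by (simp add: algebra_simps)
  have 3: "AE x in lborel. c' \<noteq> c \<longrightarrow> disc \<epsilon> x v c > 0 \<longrightarrow> norm (hit_point \<epsilon> x v c - c') \<noteq> \<epsilon>" for c c'
  proof (cases "c' = c")
    case False
    let ?\<Theta> = "\<lambda>(s::real) y. indicator {y. norm (y - c') = \<epsilon>} y :: ennreal"
    have "(\<integral>\<^sup>+x. indicator {x. disc \<epsilon> x v c > 0} x *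
        ?\<Theta> (entry_time \<epsilon> x v c) (x + entry_time \<epsilon> x v c *\<^sub>R v) \<partial>lborel) =
      ennreal (\<epsilon> ^ (DIM('a) - 1)) *
      (\<integral>\<^sup>+s. \<integral>\<^sup>+n. ennreal (max 0 (- (v \<bullet> n))) * ?\<Theta> s (c + \<epsilon> *\<^sub>R n) \<partial>surface \<partial>lborel)"
      by (rule incoming_coordinates[OF v \<epsilon>, where \<Theta>="?\<Theta>"]) measurable
    also have "(\<integral>\<^sup>+n. ennreal (max 0 (- (v \<bullet> n))) * ?\<Theta> s (c + \<epsilon> *\<^sub>R n) \<partial>surface) = 0" for s :: real
      by (rule nn_integral_zero')
         (use AE_surface_off_sphere[OF dim False[symmetric] \<epsilon>] in \<open>auto elim!: eventually_mono\<close>)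
    finally have "(\<integral>\<^sup>+x. indicator {x. disc \<epsilon> x v c > 0} x *
        ?\<Theta> (entry_time \<epsilon> x v c) (x + entry_time \<epsilon> x v c *\<^sub>R v) \<partial>lborel) = 0" by simp
    then have "AE x in lborel. indicator {x. disc \<epsilon> x v c > 0} x *
        ?\<Theta> (entry_time \<epsilon> x v c) (x + entry_time \<epsilon> x v c *\<^sub>R v) = 0"
      by (subst (asm) nn_integral_0_iff_AE) simp_all
    then show ?thesis
      by eventually_elim (auto simp: hit_point_def split: split_indicator_asm)
  qed simp
  have "AE x in lborel. \<forall>c\<in>C. disc \<epsilon> x v c \<noteq> 0 \<and> norm (x + T *\<^sub>R v - c) \<noteq> \<epsilon> \<and>
      (\<forall>c'\<in>C. c' \<noteq> c \<longrightarrow> disc \<epsilon> x v c > 0 \<longrightarrow> norm (hit_point \<epsilon> x v c - c') \<noteq> \<epsilon>)"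
    by (intro AE_ball_countable' C AE_conjI 1 2 3)
  then show ?thesis by eventually_elim (auto simp: degenerate_def)
qed

lemma AE_phase_zero:
  fixes F :: "'a::euclidean_space \<Rightarrow> 'a \<Rightarrow> ennreal"
  assumes [measurable]: "(\<lambda>(v, x). F v x) \<in> borel_measurable (borel \<Otimes>\<^sub>M borel)"
    and z: "(\<integral>\<^sup>+v. \<integral>\<^sup>+x. F v x \<partial>lborel \<partial>surface) = 0"
  shows "AE v in surface. AE x in lborel. F v x = 0"
proof -
  have "AE v in surface. (\<integral>\<^sup>+x. F v x \<partial>lborel) = 0"
    using z by (subst (asm) nn_integral_0_iff_AE) simp_all
  then show ?thesis
    by eventually_elim (subst (asm) nn_integral_0_iff_AE, simp_all)
qed

lemma AE_phase_finite:
  fixes F :: "'a::euclidean_space \<Rightarrow> 'a \<Rightarrow> ennreal"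
  assumes [measurable]: "(\<lambda>(v, x). F v x) \<in> borel_measurable (borel \<Otimes>\<^sub>M borel)"
    and z: "(\<integral>\<^sup>+v. \<integral>\<^sup>+x. F v x \<partial>lborel \<partial>surface) < \<infinity>"
  shows "AE v in surface. AE x in lborel. F v x < \<infinity>"
proof -
  have "AE v in surface. (\<integral>\<^sup>+x. F v x \<partial>lborel) \<noteq> \<infinity>"
    by (rule nn_integral_PInf_AE) (use z in simp_all)
  then show ?thesis
  proof eventually_elim
    case (elim v)
    have "AE x in lborel. F v x \<noteq> \<infinity>" by (rule nn_integral_PInf_AE) (use elim in simp_all)
    then show ?case by eventually_elim (simp add: less_top)
  qed
qed

lemma ennreal_suminf_finite_tendsto_0:
  fixes a :: "nat \<Rightarrow> ennreal"
  assumes "(\<Sum>j. a j) < \<infinity>" shows "a \<longlonglongrightarrow> 0"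
proof -
  have fin: "a j < \<infinity>" for j
    using assms sum_le_suminf[of a "{j}"] by (simp add: summableI le_less_trans)
  then have a: "a j = ennreal (enn2real (a j))" for j by (simp add: less_top)
  have "summable (\<lambda>j. enn2real (a j))"
    by (rule summable_suminf_not_top) (use assms a in simp_all)
  from summable_LIMSEQ_zero[OF this] have "(\<lambda>j. ennreal (enn2real (a j))) \<longlonglongrightarrow> ennreal 0"
    by (rule tendsto_ennrealI)
  then show ?thesis using a by simp
qed

text \<open>Speed is 1, so a trajectory of duration \<open>r\<close> that starts in the ball of radius \<open>R - r\<close> stays in the
  ball of radius \<open>R\<close>.\<close>

lemma collide_localised:
  fixes x v :: "'a::euclidean_space"
  assumes \<epsilon>: "\<epsilon> > 0" and "norm v = 1" "0 \<le> r" "norm x \<le> R - r"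
  shows "(collide \<epsilon> C ^^ j) (\<lambda>_ _ _. 1) r x v \<le> (collide \<epsilon> C ^^ j) (\<lambda>r x v. indicator (cball 0 R) x) r x v"
  using assms(2-4)
proof (induction j arbitrary: r x v)
  case (Suc j)
  show ?case
  proof (cases "\<exists>c\<in>C. first_hit \<epsilon> C r x v c")
    case True
    then obtain c where c: "c \<in> C" "first_hit \<epsilon> C r x v c" by blast
    then have D: "disc \<epsilon> x v c > 0" and e: "0 < entry_time \<epsilon> x v c" "entry_time \<epsilon> x v c < r" by (auto simp: first_hit_def)
    have "norm (hit_point \<epsilon> x v c) \<le> norm x + entry_time \<epsilon> x v c"
      unfolding hit_point_def using norm_triangle_ineq[of x "entry_time \<epsilon> x v c *\<^sub>R v"] Suc.prems(1) e by simp
    then show ?thesis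
      using Suc.IH[OF hit_geometry(3)[OF Suc.prems(1) \<epsilon> D], of "r - entry_time \<epsilon> x v c" "hit_point \<epsilon> x v c"]
        Suc.prems e by (simp add: collide_eq[OF c(2,1)])
  next
    case False
    then show ?thesis by (simp add: collide_eq_0)
  qed
qed simp

text \<open>By \<open>collide_chain_lower\<close> two losses must be excluded. Degenerate situations after \<open>j > 0\<close> collisions have
  phase volume at most the flux of the indicator of degeneracy, which is 0. Trajectories with at least
  \<open>j\<close> collisions, started in a ball, have phase volumes that sum over \<open>j\<close> to at most a finite flux, so
  almost every one of them makes finitely many collisions.\<close>

theorem after_collisions_total:
  fixes C :: "'a::euclidean_space set"
  assumes dim: "DIM('a) \<ge> 2" and \<epsilon>: "\<epsilon> > 0" and C: "locally_finite C" and T: "T > 0"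
  shows "AE v in surface. AE x in lborel. (\<forall>c\<in>C. \<epsilon> < norm (x - c)) \<longrightarrow>
    (\<Sum>j. after_collisions \<epsilon> C (\<lambda>_ _. 1) j T x v) = 1"
proof -
  let ?O = "{x. \<forall>c\<in>C. \<epsilon> < norm (x - c)}"
  let ?N = "\<lambda>r x v. indicator {(r, x, v). degenerate \<epsilon> C r x v} (r, x, v) :: ennreal"
  have cC: "countable C" using C by (rule locally_finite_countable)
  have predO [measurable]: "Measurable.pred N (\<lambda>w. \<forall>c\<in>C. \<epsilon> < norm (f w - c))"
    if [measurable]: "f \<in> borel_measurable N" for N :: "'n measure" and f
    by (rule pred_Ball_config[OF const_config[OF C]]) measurable
  have N: "(\<lambda>(r, x, v). ?N r x v) \<in> borel_measurable (borel \<Otimes>\<^sub>M borel \<Otimes>\<^sub>M borel)"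
    unfolding case_prod_beta indicator_def of_bool_def mem_Collect_eq degenerate_def
    using cC by measurable
  have meas: "(\<lambda>(v, x). indicator ?O x * (collide \<epsilon> C ^^ j) h T x v) \<in> borel_measurable (borel \<Otimes>\<^sub>M borel)"
    if "(\<lambda>(r, x, v). h r x v) \<in> borel_measurable (borel \<Otimes>\<^sub>M borel \<Otimes>\<^sub>M borel)" for h j
  proof -
    have [measurable]: "(\<lambda>w. (collide \<epsilon> C ^^ j) h T (snd w) (fst w)) \<in> borel_measurable (borel \<Otimes>\<^sub>M borel)"
      using measurable_compose[OF _ measurable_collide_funpow[OF C that, where n=j and \<epsilon>=\<epsilon>],
          of "\<lambda>w. (T, snd w, fst w)" "borel \<Otimes>\<^sub>M borel"] by simp
    show ?thesis unfolding case_prod_beta indicator_def of_bool_def mem_Collect_eq by measurable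
  qed
  (* degenerate trajectories *)
  have A: "AE v in surface. AE x in lborel. indicator ?O x * (collide \<epsilon> C ^^ j) ?N T x v = 0" for j
  proof (cases j)
    case 0
    show ?thesis using AE_surface_norm
    proof eventually_elim
      case (elim v)
      show ?case using AE_not_degenerate[OF dim \<epsilon> cC elim, of T] by eventually_elim (simp add: 0)
    qed
  next
    case (Suc i)
    have "flux \<epsilon> C T ?N = 0"
      unfolding flux_def
    proof (rule nn_integral_zero', rule AE_I2, rule nn_integral_zero')
      fix c
      show "AE v in surface. (\<integral>\<^sup>+x. indicator {x. departures \<epsilon> C T x v c} x *
          ?N (T - exit_time \<epsilon> x v c) (x + exit_time \<epsilon> x v c *\<^sub>R v) v \<partial>lborel) = 0"
        using AE_surface_norm
      proof eventually_elim
        case (elim v)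
        have "AE x in lborel. indicator {x. departures \<epsilon> C T x v c} x *
            ?N (T - exit_time \<epsilon> x v c) (x + exit_time \<epsilon> x v c *\<^sub>R v) v = 0"
          using AE_not_degenerate[OF dim \<epsilon> cC elim, of T]
        proof eventually_elim
          case (elim x)
          then show ?case
            using degenerate_shift[OF \<open>norm v = 1\<close>, of \<epsilon> C T "exit_time \<epsilon> x v c" x] by simp
        qed
        then show ?case by (rule nn_integral_zero')
      qed
    qed
    then have "(\<Sum>j<Suc i. \<integral>\<^sup>+v. \<integral>\<^sup>+x. indicator ?O x * (collide \<epsilon> C ^^ Suc j) ?N T x v \<partial>lborel \<partial>surface) \<le> 0"
      using flux_bound[OF \<epsilon> C N, where J="Suc i" and T=T] by (simp only:)
    then have "(\<integral>\<^sup>+v. \<integral>\<^sup>+x. indicator ?O x * (collide \<epsilon> C ^^ Suc i) ?N T x v \<partial>lborel \<partial>surface) = 0"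
      unfolding sum.lessThan_Suc by (simp add: add_eq_0_iff_both_eq_0)
    then show ?thesis unfolding Suc by (rule AE_phase_zero[OF meas[OF N]])
  qed
  (* infinitely many collisions, for starting points in a ball of radius R *)
  have B: "AE v in surface. AE x in lborel. norm x \<le> real R \<longrightarrow> x \<in> ?O \<longrightarrow>
      (\<lambda>j. (collide \<epsilon> C ^^ j) (\<lambda>_ _ _. 1) T x v) \<longlonglongrightarrow> 0" for R :: nat
  proof -
    let ?R = "real R + T"
    let ?h = "\<lambda>(r::real) x (v::'a). indicator (cball (0::'a) ?R) x :: ennreal"
    have [measurable]: "cball (0::'a) ?R \<in> sets borel" by simp
    have h: "(\<lambda>(r, x, v). ?h r x v) \<in> borel_measurable (borel \<Otimes>\<^sub>M borel \<Otimes>\<^sub>M borel)" by measurable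
    let ?a = "\<lambda>j v x. indicator ?O x * (collide \<epsilon> C ^^ Suc j) ?h T x v"
    (* an obstacle that contributes lies within \<epsilon> of the ball of radius R + T, and x within T + \<epsilon> of it *)
    have "flux \<epsilon> C T ?h \<le> (\<integral>\<^sup>+c. indicator (cball 0 (?R + \<epsilon>)) c *
        (emeasure (surface :: 'a measure) UNIV * emeasure lborel (cball (0::'a) (T + \<epsilon>))) \<partial>count_space C)"
      unfolding flux_def
    proof (rule nn_integral_mono)
      fix c
      have "(\<integral>\<^sup>+v. \<integral>\<^sup>+x. indicator {x. departures \<epsilon> C T x v c} x *
         indicator (cball 0 ?R) (x + exit_time \<epsilon> x v c *\<^sub>R v) \<partial>lborel \<partial>surface)
        \<le> (\<integral>\<^sup>+(v::'a). \<integral>\<^sup>+x. indicator (cball 0 (?R + \<epsilon>)) c * indicator (cball c (T + \<epsilon>)) x \<partial>lborel \<partial>surface)"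
      proof (rule nn_integral_mono_AE, use AE_surface_norm in eventually_elim)
        case (elim v)
        show ?case
        proof (rule nn_integral_mono)
          fix x
          show "indicator {x. departures \<epsilon> C T x v c} x * indicator (cball 0 ?R) (x + exit_time \<epsilon> x v c *\<^sub>R v)
            \<le> (indicator (cball 0 (?R + \<epsilon>)) c * indicator (cball c (T + \<epsilon>)) x :: ennreal)"
          proof (cases "departures \<epsilon> C T x v c \<and> x + exit_time \<epsilon> x v c *\<^sub>R v \<in> cball 0 ?R")
            case True
            let ?y = "x + exit_time \<epsilon> x v c *\<^sub>R v"
            have yc: "norm (?y - c) = \<epsilon>" and y: "norm ?y \<le> ?R" and e: "0 < exit_time \<epsilon> x v c" "exit_time \<epsilon> x v c < T"
              using True norm_entry_point(2)[OF elim \<epsilon>, of x c] by (auto simp: departures_def)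
            have "norm c \<le> norm ?y + norm (?y - c)" using norm_triangle_ineq4[of ?y "?y - c"] by simp
            then have "c \<in> cball 0 (?R + \<epsilon>)" using yc y by simp
            moreover have "norm (x - c) \<le> norm (?y - c) + norm (exit_time \<epsilon> x v c *\<^sub>R v)"
              using norm_triangle_ineq4[of "?y - c" "exit_time \<epsilon> x v c *\<^sub>R v"] by simp
            then have "x \<in> cball c (T + \<epsilon>)" using yc e elim by (simp add: dist_norm norm_minus_commute)
            ultimately show ?thesis using True by simp
          qed (auto split: split_indicator)
        qed
      qed
      also have "\<dots> = indicator (cball 0 (?R + \<epsilon>)) c * (emeasure (surface :: 'a measure) UNIV * emeasure lborel (cball c (T + \<epsilon>)))"
      proof -
        have inner: "(\<integral>\<^sup>+x. k * indicator (cball c (T + \<epsilon>)) x \<partial>lborel) = k * emeasure lborel (cball c (T + \<epsilon>))" for k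
          by (rule nn_integral_cmult_indicator) simp
        show ?thesis unfolding inner by (simp add: ac_simps)
      qed
      also have "emeasure lborel (cball c (T + \<epsilon>)) = emeasure lborel (cball (0::'a) (T + \<epsilon>))"
        using T \<epsilon> by (simp add: emeasure_cball)
      finally show "(\<integral>\<^sup>+v. \<integral>\<^sup>+x. indicator {x. departures \<epsilon> C T x v c} x *
         indicator (cball 0 ?R) (x + exit_time \<epsilon> x v c *\<^sub>R v) \<partial>lborel \<partial>surface)
        \<le> indicator (cball 0 (?R + \<epsilon>)) c * (emeasure (surface :: 'a measure) UNIV * emeasure lborel (cball (0::'a) (T + \<epsilon>)))" .
    qed
    also have "\<dots> = (\<integral>\<^sup>+c. indicator (cball 0 (?R + \<epsilon>)) c \<partial>count_space C) *
        (emeasure (surface :: 'a measure) UNIV * emeasure lborel (cball (0::'a) (T + \<epsilon>)))"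
      by (rule nn_integral_multc) simp
    also have "(\<integral>\<^sup>+c. indicator (cball 0 (?R + \<epsilon>)) c \<partial>count_space C) = emeasure (count_space UNIV) (C \<inter> cball 0 (?R + \<epsilon>))"
    proof -
      have "(\<integral>\<^sup>+c. indicator (cball 0 (?R + \<epsilon>)) c \<partial>count_space C) =
          (\<integral>\<^sup>+c. indicator (C \<inter> cball 0 (?R + \<epsilon>)) c \<partial>count_space UNIV)"
        by (subst nn_integral_count_space_indicator, simp, intro nn_integral_cong) (auto split: split_indicator)
      also have "\<dots> = emeasure (count_space UNIV) (C \<inter> cball 0 (?R + \<epsilon>))"
        by (rule nn_integral_indicator) simp
      finally show ?thesis .
    qed
    finally have "flux \<epsilon> C T ?h \<le> emeasure (count_space UNIV) (C \<inter> cball 0 (?R + \<epsilon>)) *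
        (emeasure (surface :: 'a measure) UNIV * emeasure lborel (cball (0::'a) (T + \<epsilon>)))" .
    also have "\<dots> < \<infinity>"
    proof -
      have "finite (C \<inter> cball 0 (?R + \<epsilon>))" using C unfolding locally_finite_def by blast
      moreover have "emeasure (surface :: 'a measure) UNIV < top"
        by (metis surface.emeasure_finite top.not_eq_extremum infinity_ennreal_def)
      ultimately show ?thesis using emeasure_lborel_cball_finite[of "0::'a" "T + \<epsilon>"]
        by (auto simp: ennreal_mult_less_top emeasure_count_space less_top of_nat_less_top)
    qed
    finally have fin: "flux \<epsilon> C T ?h < \<infinity>" .
    have ma: "(\<lambda>(v, x). ?a j v x) \<in> borel_measurable (borel \<Otimes>\<^sub>M borel)" for j by (rule meas[OF h])
    then have [measurable]: "(\<lambda>(v, x). ?a j v x) \<in> borel_measurable (surface \<Otimes>\<^sub>M lborel)" for j by measurable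
    have mx: "(\<lambda>x. ?a j v x) \<in> borel_measurable lborel" for j v
      using measurable_compose[OF measurable_Pair1' ma[of j], of v] by simp
    have mv: "(\<lambda>v. \<integral>\<^sup>+x. ?a j v x \<partial>lborel) \<in> borel_measurable surface" for j by measurable
    have ms: "(\<lambda>(v, x). \<Sum>j. ?a j v x) \<in> borel_measurable (borel \<Otimes>\<^sub>M borel)"
    proof -
      note [measurable] = ma
      have "(\<lambda>w. \<Sum>j. (case w of (v, x) \<Rightarrow> ?a j v x)) \<in> borel_measurable (borel \<Otimes>\<^sub>M borel)"
        by measurable
      then show ?thesis unfolding case_prod_beta .
    qed
    have "(\<integral>\<^sup>+v. \<integral>\<^sup>+x. (\<Sum>j. ?a j v x) \<partial>lborel \<partial>surface) = (\<integral>\<^sup>+v. (\<Sum>j. \<integral>\<^sup>+x. ?a j v x \<partial>lborel) \<partial>surface)"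
      by (intro nn_integral_cong nn_integral_suminf mx)
    also have "\<dots> = (\<Sum>j. \<integral>\<^sup>+v. \<integral>\<^sup>+x. ?a j v x \<partial>lborel \<partial>surface)" by (rule nn_integral_suminf[OF mv])
    also have "\<dots> \<le> flux \<epsilon> C T ?h"
      unfolding suminf_eq_SUP by (rule SUP_least) (rule flux_bound[OF \<epsilon> C h])
    finally have "(\<integral>\<^sup>+v. \<integral>\<^sup>+x. (\<Sum>j. ?a j v x) \<partial>lborel \<partial>surface) < \<infinity>" using fin by (rule le_less_trans)
    from AE_phase_finite[OF ms this] have "AE v in surface. AE x in lborel. (\<Sum>j. ?a j v x) < \<infinity>" .
    with AE_surface_norm show ?thesis
    proof eventually_elim
      case (elim v)
      from elim(2) show ?case
      proof eventually_elim
        case (elim x)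
        show ?case
        proof (intro impI)
          assume x: "norm x \<le> real R" "x \<in> ?O"
          have "(\<lambda>j. ?a j v x) \<longlonglongrightarrow> 0" by (rule ennreal_suminf_finite_tendsto_0) (rule elim)
          then have lim: "(\<lambda>j. (collide \<epsilon> C ^^ Suc j) ?h T x v) \<longlonglongrightarrow> 0" using x(2) by simp
          have "(\<lambda>j. (collide \<epsilon> C ^^ Suc j) (\<lambda>_ _ _. 1) T x v) \<longlonglongrightarrow> 0"
          proof (rule tendsto_sandwich[OF _ _ tendsto_const lim])
            show "\<forall>\<^sub>F j in sequentially. (collide \<epsilon> C ^^ Suc j) (\<lambda>_ _ _. 1) T x v \<le> (collide \<epsilon> C ^^ Suc j) ?h T x v"
              by (intro always_eventually allI collide_localised[OF \<epsilon>])
                 (use x \<open>norm v = 1\<close> T in auto)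
          qed simp
          then show "(\<lambda>j. (collide \<epsilon> C ^^ j) (\<lambda>_ _ _. 1) T x v) \<longlonglongrightarrow> 0"
            by (rule LIMSEQ_imp_Suc)
        qed
      qed
    qed
  qed
  have "AE v in surface. \<forall>j::nat. AE x in lborel. indicator ?O x * (collide \<epsilon> C ^^ j) ?N T x v = 0"
    by (subst AE_all_countable) (intro allI A)
  moreover have "AE v in surface. \<forall>R::nat. AE x in lborel. norm x \<le> real R \<longrightarrow> x \<in> ?O \<longrightarrow>
      (\<lambda>j. (collide \<epsilon> C ^^ j) (\<lambda>_ _ _. 1) T x v) \<longlonglongrightarrow> 0"
    by (subst AE_all_countable) (intro allI B)
  ultimately show ?thesis using AE_surface_norm
  proof eventually_elim
    case (elim v)
    have "AE x in lborel. \<forall>j::nat. indicator ?O x * (collide \<epsilon> C ^^ j) ?N T x v = 0"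
      by (subst AE_all_countable) (rule elim(1))
    moreover have "AE x in lborel. \<forall>R::nat. norm x \<le> real R \<longrightarrow> x \<in> ?O \<longrightarrow>
      (\<lambda>j. (collide \<epsilon> C ^^ j) (\<lambda>_ _ _. 1) T x v) \<longlonglongrightarrow> 0"
      by (subst AE_all_countable) (rule elim(2))
    ultimately show ?case
    proof eventually_elim
      case (elim x)
      let ?A = "\<lambda>j. after_collisions \<epsilon> C (\<lambda>_ _. 1) j T x v"
      show ?case
      proof (intro impI antisym)
        show "(\<Sum>j. ?A j) \<le> 1"
          unfolding suminf_eq_SUP by (rule SUP_least) (rule after_collisions_sum_le, simp)
        assume x: "\<forall>c\<in>C. \<epsilon> < norm (x - c)"
        obtain R :: nat where "norm x \<le> real R" using real_arch_simple by blast
        then have lim: "(\<lambda>j. (collide \<epsilon> C ^^ j) (\<lambda>_ _ _. 1) T x v) \<longlonglongrightarrow> 0" using elim(2) x by blast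
        have valid: "\<not> blocked \<epsilon> 0 x v c" if "c \<in> C" for c
          using x that in_ball_line_iff(2)[OF \<open>norm v = 1\<close> \<epsilon>, of x 0 c] by (force simp: blocked_def)
        have le: "1 \<le> (\<Sum>j<J. ?A j) + (collide \<epsilon> C ^^ J) (\<lambda>_ _ _. 1) T x v" for J
        proof -
          have "(collide \<epsilon> C ^^ j) ?N T x v = 0" for j using elim(1) x by simp
          then show ?thesis using collide_chain_lower[OF \<open>norm v = 1\<close> \<epsilon> T C valid, of J] by simp
        qed
        have "(\<lambda>J. (\<Sum>j<J. ?A j) + (collide \<epsilon> C ^^ J) (\<lambda>_ _ _. 1) T x v) \<longlonglongrightarrow> (\<Sum>j. ?A j) + 0"
          by (intro tendsto_add lim summable_LIMSEQ summableI)
        then have "1 \<le> (\<Sum>j. ?A j) + 0" by (rule LIMSEQ_le_const) (use le in blast)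
        then show "1 \<le> (\<Sum>j. ?A j)" by simp
      qed
    qed
  qed
qed

section \<open>Solutions of the transport equation along trajectories\<close>

text \<open>Local finiteness makes the infimum distance to \<open>C\<close> attained, so that it exceeds \<open>\<epsilon>\<close> as soon as every
  distance does.\<close>

lemma mem_billiard_table_iff:
  fixes C :: "'a::euclidean_space set"
  assumes C: "locally_finite C"
  shows "x \<in> billiard_table \<epsilon> C \<longleftrightarrow> (\<forall>c\<in>C. \<epsilon> < norm (x - c))"
proof (cases "C = {}")
  case False
  show ?thesis
  proof
    assume "x \<in> billiard_table \<epsilon> C"
    then have "\<epsilon> < infdist x C" using False by (simp add: billiard_table_def)
    then show "\<forall>c\<in>C. \<epsilon> < norm (x - c)" using infdist_le[of _ C x] by (force simp: dist_norm)
  next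
    assume far: "\<forall>c\<in>C. \<epsilon> < norm (x - c)"
    define m where "m = Min (insert (\<epsilon> + 1) (dist x ` (C \<inter> cball x (\<epsilon> + 1))))"
    have fin: "finite (insert (\<epsilon> + 1) (dist x ` (C \<inter> cball x (\<epsilon> + 1))))"
      using locally_finite_bounded[OF C bounded_cball] by simp
    have "\<epsilon> < m" unfolding m_def using fin far by (subst Min_gr_iff) (auto simp: dist_norm)
    moreover have "m \<le> dist x c" if "c \<in> C" for c
    proof (cases "dist x c \<le> \<epsilon> + 1")
      case True
      then show ?thesis unfolding m_def using fin that by (intro Min_le) auto
    next
      case False
      moreover have "m \<le> \<epsilon> + 1" unfolding m_def using fin by (intro Min_le) auto
      ultimately show ?thesis by simp
    qed
    then have "m \<le> infdist x C" unfolding infdist_notempty[OF False] by (intro cINF_greatest False)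
    ultimately show "x \<in> billiard_table \<epsilon> C" by (simp add: billiard_table_def)
  qed
qed (simp add: billiard_table_def)

text \<open>The derivative along the characteristic vanishes inside the segment and continuity carries the value
  to its end points, which may lie on the boundary.\<close>

lemma transport_along_segment:
  fixes x w :: "'a::euclidean_space"
  assumes sol: "transport_solution \<epsilon> C fin f" and t: "t \<ge> 0" and l: "l > 0" and w: "norm w = 1"
    and seg: "\<And>s. 0 < s \<Longrightarrow> s < l \<Longrightarrow> x + s *\<^sub>R w \<in> billiard_table \<epsilon> C"
  shows "f (t + l) (x + l *\<^sub>R w) w = f t x w"
proof -
  let ?\<phi> = "\<lambda>s. f (t + s) (x + s *\<^sub>R w) w"
  have "continuous_on {0..l} ?\<phi>"
    using sol t l w seg unfolding transport_solution_def by auto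
  moreover have "DERIV ?\<phi> s :> 0" if "0 < s" "s < l" for s
  proof -
    have "((\<lambda>h. f ((t + s) + h) ((x + s *\<^sub>R w) + h *\<^sub>R w) w) has_real_derivative 0) (at 0)"
      using sol seg[OF that] that t w unfolding transport_solution_def by auto
    moreover have "(\<lambda>h. f ((t + s) + h) ((x + s *\<^sub>R w) + h *\<^sub>R w) w) = (\<lambda>h. ?\<phi> (h + s))"
      by (simp add: algebra_simps)
    ultimately show ?thesis using DERIV_shift[of ?\<phi> 0 0 s] by simp
  qed
  ultimately have "?\<phi> l = ?\<phi> 0" using l by (intro DERIV_isconst_end) auto
  then show ?thesis by simp
qed

lemma not_blocked_clear:
  fixes x v c :: "'a::euclidean_space"
  assumes "norm v = 1" "\<epsilon> > 0" "\<not> blocked \<epsilon> r x v c" "0 < s" "s \<le> r"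
  shows "\<epsilon> < norm (x + s *\<^sub>R v - c)"
  using assms in_ball_line_iff(2)[OF assms(1,2), of x s c] by (force simp: blocked_def)

lemma first_hit_frontier:
  fixes x v c :: "'a::euclidean_space"
  assumes v: "norm v = 1" and \<epsilon>: "\<epsilon> > 0" and C: "locally_finite C" and c: "c \<in> C" and h: "first_hit \<epsilon> C r x v c"
  shows "0 < s \<Longrightarrow> s < entry_time \<epsilon> x v c \<Longrightarrow> x + s *\<^sub>R v \<in> billiard_table \<epsilon> C"
    and "hit_point \<epsilon> x v c \<in> frontier (billiard_table \<epsilon> C)"
    and "C \<inter> sphere (hit_point \<epsilon> x v c) \<epsilon> = {c}"
proof -
  have D: "disc \<epsilon> x v c > 0" and e: "0 < entry_time \<epsilon> x v c" using h by (auto simp: first_hit_def)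
  note geo = hit_geometry[OF v \<epsilon> D]
  show table: "x + s *\<^sub>R v \<in> billiard_table \<epsilon> C" if "0 < s" "s < entry_time \<epsilon> x v c" for s
    unfolding mem_billiard_table_iff[OF C]
  proof
    fix c' assume c': "c' \<in> C"
    show "\<epsilon> < norm (x + s *\<^sub>R v - c')"
    proof (cases "c' = c")
      case True
      then show ?thesis using in_ball_line_iff(2)[OF v \<epsilon>, of x s c] that by force
    next
      case False
      then show ?thesis using not_blocked_clear[OF v \<epsilon> _ that(1), of "entry_time \<epsilon> x v c" x c'] h c' that
        by (auto simp: first_hit_def)
    qed
  qed
  show "C \<inter> sphere (hit_point \<epsilon> x v c) \<epsilon> = {c}"
    using geo(6) c first_hit_clear[OF v \<epsilon> h] by (force simp: dist_norm)
  have "hit_point \<epsilon> x v c \<notin> billiard_table \<epsilon> C"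
    unfolding mem_billiard_table_iff[OF C] using c geo(6) by (auto intro!: bexI[of _ c])
  moreover have "hit_point \<epsilon> x v c \<in> closure (billiard_table \<epsilon> C)"
    unfolding closure_approachable
  proof (intro allI impI)
    fix \<delta> :: real assume \<delta>: "\<delta> > 0"
    define s where "s = entry_time \<epsilon> x v c - min \<delta> (entry_time \<epsilon> x v c) / 2"
    have s: "0 < s" "s < entry_time \<epsilon> x v c" "entry_time \<epsilon> x v c - s < \<delta>"
      using \<delta> e by (auto simp: s_def min_def)
    have "dist (x + s *\<^sub>R v) (hit_point \<epsilon> x v c) = norm ((s - entry_time \<epsilon> x v c) *\<^sub>R v)"
      by (simp add: hit_point_def dist_norm algebra_simps)
    also have "\<dots> < \<delta>" using v s by simp
    finally show "\<exists>y\<in>billiard_table \<epsilon> C. dist y (hit_point \<epsilon> x v c) < \<delta>" using table[OF s(1,2)] by blast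
  qed
  ultimately show "hit_point \<epsilon> x v c \<in> frontier (billiard_table \<epsilon> C)"
    unfolding frontier_def using interior_subset by blast
qed

text \<open>Induction over the number of collisions: the density is constant along the first flight by the
  equation and unchanged by the reflection at its end. The backward trajectory has velocity \<open>v\<close>, the
  particle velocity \<open>- v\<close>.\<close>

lemma transport_value_after:
  fixes C :: "'a::euclidean_space set"
  assumes sol: "transport_solution \<epsilon> C fin f" and \<epsilon>: "\<epsilon> > 0" and C: "locally_finite C"
    and g: "\<And>x v. norm v = 1 \<Longrightarrow> g x v = ennreal (fin x (- v))"
    and fin_nonneg: "\<And>x v. norm v = 1 \<Longrightarrow> 0 \<le> fin x v"
    and v: "norm v = 1" and r: "r > 0"
  shows "(after_collisions \<epsilon> C (\<lambda>_ _. 1) n r x v = 1 \<and> after_collisions \<epsilon> C g n r x v = ennreal (f r x (- v)) \<and> 0 \<le> f r x (- v)) \<or>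
    (after_collisions \<epsilon> C (\<lambda>_ _. 1) n r x v = 0 \<and> after_collisions \<epsilon> C g n r x v = 0)"
  using v r
proof (induction n arbitrary: r x v)
  case 0
  note v = 0(1) and r = 0(2)
  show ?case
  proof (cases "\<forall>c\<in>C. \<not> blocked \<epsilon> r x v c")
    case True
    have table: "x + s *\<^sub>R v \<in> billiard_table \<epsilon> C" if "0 < s" "s \<le> r" for s
      unfolding mem_billiard_table_iff[OF C] using not_blocked_clear[OF v \<epsilon> _ that] True by blast
    have "f (0 + r) ((x + r *\<^sub>R v) + r *\<^sub>R (- v)) (- v) = f 0 (x + r *\<^sub>R v) (- v)"
    proof (rule transport_along_segment[OF sol _ r])
      fix s assume s: "0 < s" "s < r"
      have eq: "(x + r *\<^sub>R v) + s *\<^sub>R (- v) = x + (r - s) *\<^sub>R v" by (simp add: algebra_simps)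
      show "(x + r *\<^sub>R v) + s *\<^sub>R (- v) \<in> billiard_table \<epsilon> C" unfolding eq using table[of "r - s"] s by simp
    qed (use v in auto)
    also have "f 0 (x + r *\<^sub>R v) (- v) = fin (x + r *\<^sub>R v) (- v)"
      using sol table[of r] r v unfolding transport_solution_def by auto
    finally show ?thesis using True v fin_nonneg by (simp add: after_collisions_0 free_flight_def g)
  next
    case False
    then show ?thesis by (auto simp: after_collisions_0 free_flight_def)
  qed
next
  case (Suc n)
  note v = Suc.prems(1) and r = Suc.prems(2)
  show ?case
  proof (cases "\<exists>c\<in>C. first_hit \<epsilon> C r x v c")
    case True
    then obtain c where c: "c \<in> C" "first_hit \<epsilon> C r x v c" by blast
    then have D: "disc \<epsilon> x v c > 0" and e: "0 < entry_time \<epsilon> x v c" "entry_time \<epsilon> x v c < r" by (auto simp: first_hit_def)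
    let ?e = "entry_time \<epsilon> x v c" and ?y = "hit_point \<epsilon> x v c" and ?w = "deflected \<epsilon> x v c"
    note fr = first_hit_frontier[OF v \<epsilon> C c]
    have "f ((r - ?e) + ?e) (?y + ?e *\<^sub>R (- v)) (- v) = f (r - ?e) ?y (- v)"
    proof (rule transport_along_segment[OF sol _ e(1)])
      fix s assume s: "0 < s" "s < ?e"
      have eq: "?y + s *\<^sub>R (- v) = x + (?e - s) *\<^sub>R v" by (simp add: hit_point_def algebra_simps)
      show "?y + s *\<^sub>R (- v) \<in> billiard_table \<epsilon> C" unfolding eq using fr(1)[of "?e - s"] s by simp
    qed (use v e in auto)
    then have "f r x (- v) = f (r - ?e) ?y (- v)" by (simp add: hit_point_def)
    also have "\<dots> = f (r - ?e) ?y (specular ((?y - obstacle_center \<epsilon> C ?y) /\<^sub>R \<epsilon>) (- v))"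
      using sol fr(2,3) e v unfolding transport_solution_def by simp
    also have "obstacle_center \<epsilon> C ?y = c" unfolding obstacle_center_def fr(3) by simp
    also have "specular ((?y - c) /\<^sub>R \<epsilon>) (- v) = - ?w" by (simp add: deflected_def specular_minus)
    finally have "f r x (- v) = f (r - ?e) ?y (- ?w)" .
    then show ?thesis
      using Suc.IH[OF hit_geometry(3)[OF v \<epsilon> D], of "r - ?e" ?y] e
      by (simp add: after_collisions_Suc collide_eq[OF c(2,1)])
  next
    case False
    then show ?thesis by (simp add: after_collisions_Suc collide_eq_0)
  qed
qed

theorem transport_value:
  fixes C :: "'a::euclidean_space set"
  assumes sol: "transport_solution \<epsilon> C fin f" and \<epsilon>: "\<epsilon> > 0" and C: "locally_finite C"
    and g: "\<And>x v. norm v = 1 \<Longrightarrow> g x v = ennreal (fin x (- v))"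
    and fin_nonneg: "\<And>x v. norm v = 1 \<Longrightarrow> 0 \<le> fin x v"
    and v: "norm v = 1" and r: "r > 0"
    and total: "(\<Sum>j. after_collisions \<epsilon> C (\<lambda>_ _. 1) j r x v) = 1"
  shows "(\<Sum>j. after_collisions \<epsilon> C g j r x v) = ennreal (f r x (- v))" "0 \<le> f r x (- v)"
proof -
  let ?A = "\<lambda>j. after_collisions \<epsilon> C (\<lambda>_ _. 1) j r x v" and ?G = "\<lambda>j. after_collisions \<epsilon> C g j r x v"
  note val = transport_value_after[OF sol \<epsilon> C g fin_nonneg v r, of _ x]
  have "?G j = ?A j * ennreal (f r x (- v))" for j using val[of j] by auto
  then have "(\<Sum>j. ?G j) = (\<Sum>j. ?A j * ennreal (f r x (- v)))" by (simp only:)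
  also have "\<dots> = (\<Sum>j. ?A j) * ennreal (f r x (- v))" by (rule ennreal_suminf_multc)
  finally show "(\<Sum>j. ?G j) = ennreal (f r x (- v))" by (simp add: total)
  show "0 \<le> f r x (- v)"
  proof (rule ccontr)
    assume "\<not> 0 \<le> f r x (- v)"
    then have "?A j = 0" for j using val[of j] by blast
    then show False using total by simp
  qed
qed

section \<open>Expectations conditioned on a history\<close>

text \<open>The expectation after part of the trajectory has been revealed: \<open>A\<close> is the region already found to be
  void and \<open>P\<close> the finite set of obstacles already hit.\<close>

definition void_mean :: "'a::euclidean_space set measure \<Rightarrow> real \<Rightarrow> ('a \<Rightarrow> 'a \<Rightarrow> ennreal) \<Rightarrow> nat \<Rightarrow>
    real \<Rightarrow> 'a \<Rightarrow> 'a \<Rightarrow> 'a set \<Rightarrow> 'a set \<Rightarrow> ennreal" where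
  "void_mean PP \<epsilon> g n r x v A P =
     (\<integral>\<^sup>+C. indicator {C. C \<inter> A = {}} C * after_collisions \<epsilon> (C \<union> P) g n r x v \<partial>PP)"

text \<open>The contribution of histories whose next obstacle is \<open>c\<close>: the tube swept on the way to it joins the void
  region, and \<open>c\<close> joins the known obstacles.\<close>

definition next_void_mean :: "'a::euclidean_space set measure \<Rightarrow> real \<Rightarrow> ('a \<Rightarrow> 'a \<Rightarrow> ennreal) \<Rightarrow> nat \<Rightarrow>
    real \<Rightarrow> 'a \<Rightarrow> 'a \<Rightarrow> 'a set \<Rightarrow> 'a set \<Rightarrow> 'a \<Rightarrow> ennreal" where
  "next_void_mean PP \<epsilon> g n r x v A P c =
     (if 0 < entry_time \<epsilon> x v c \<and> entry_time \<epsilon> x v c < r \<and> c \<notin> A \<and>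
         (\<forall>p\<in>P. \<not> blocked \<epsilon> (entry_time \<epsilon> x v c) x v p)
      then void_mean PP \<epsilon> g n (r - entry_time \<epsilon> x v c) (hit_point \<epsilon> x v c) (deflected \<epsilon> x v c)
        (A \<union> {c'. blocked \<epsilon> (entry_time \<epsilon> x v c) x v c'}) (insert c P)
      else 0)"

lemma collision_rate_finite:
  fixes v :: "'a::euclidean_space"
  assumes "norm v = 1" shows "collision_rate v < top"
proof -
  have "emeasure (surface :: 'a measure) UNIV < top"
    by (metis surface.emeasure_finite top.not_eq_extremum infinity_ennreal_def)
  with collision_rate_le[OF assms] show ?thesis by (rule le_less_trans)
qed

context poisson_config begin

lemma measurable_config_PP: "f \<in> config \<rightarrow>\<^sub>M N \<Longrightarrow> f \<in> PP \<rightarrow>\<^sub>M N"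
  using measurable_cong_sets[OF sets_PP refl] by blast

lemma measurable_snd_config: "snd \<in> M \<Otimes>\<^sub>M PP \<rightarrow>\<^sub>M config"
  using measurable_cong_sets[OF refl sets_PP] measurable_snd by blast

lemma measurable_ident_config: "(\<lambda>C. C) \<in> PP \<rightarrow>\<^sub>M config"
  using measurable_config_PP[OF measurable_ident] by simp

lemma next_void_mean_joint:
  assumes A [measurable]: "A \<in> sets borel" and P: "finite P"
    and g: "(\<lambda>(x, v). g x v) \<in> borel_measurable (borel \<Otimes>\<^sub>M borel)"
  shows "(\<lambda>(c, C). indicator {C. C \<inter> (A \<union> {c'. blocked \<epsilon> (entry_time \<epsilon> x v c) x v c'}) = {}} C *
     after_collisions \<epsilon> (C \<union> insert c P) g n (r - entry_time \<epsilon> x v c) (hit_point \<epsilon> x v c) (deflected \<epsilon> x v c))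
     \<in> borel_measurable (borel \<Otimes>\<^sub>M PP)"
proof -
  note [measurable] = measurable_snd_config
  have [measurable]: "(\<lambda>w. snd w \<union> P) \<in> borel \<Otimes>\<^sub>M PP \<rightarrow>\<^sub>M config"
    by (rule measurable_config_Un[OF _ P]) measurable
  have [measurable]: "(\<lambda>w. after_collisions \<epsilon> (insert (fst w) (snd w \<union> P)) g n (r - entry_time \<epsilon> x v (fst w))
     (hit_point \<epsilon> x v (fst w)) (deflected \<epsilon> x v (fst w))) \<in> borel_measurable (borel \<Otimes>\<^sub>M PP)"
    using g by measurable
  have [measurable]: "Measurable.pred (borel \<Otimes>\<^sub>M PP) (\<lambda>w. \<forall>c'\<in>snd w. \<not> blocked \<epsilon> (entry_time \<epsilon> x v (fst w)) x v c')"
    by (rule pred_Ball_config) measurable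
  have "(\<lambda>w. (if snd w \<inter> A = {} \<and> (\<forall>c'\<in>snd w. \<not> blocked \<epsilon> (entry_time \<epsilon> x v (fst w)) x v c') then 1 else 0) *
      after_collisions \<epsilon> (insert (fst w) (snd w \<union> P)) g n (r - entry_time \<epsilon> x v (fst w))
     (hit_point \<epsilon> x v (fst w)) (deflected \<epsilon> x v (fst w))) \<in> borel_measurable (borel \<Otimes>\<^sub>M PP)"
    by measurable
  also have "(\<lambda>w. (if snd w \<inter> A = {} \<and> (\<forall>c'\<in>snd w. \<not> blocked \<epsilon> (entry_time \<epsilon> x v (fst w)) x v c') then 1 else 0) *
      after_collisions \<epsilon> (insert (fst w) (snd w \<union> P)) g n (r - entry_time \<epsilon> x v (fst w))
     (hit_point \<epsilon> x v (fst w)) (deflected \<epsilon> x v (fst w))) =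
    (\<lambda>(c, C). indicator {C. C \<inter> (A \<union> {c'. blocked \<epsilon> (entry_time \<epsilon> x v c) x v c'}) = {}} C *
     after_collisions \<epsilon> (C \<union> insert c P) g n (r - entry_time \<epsilon> x v c) (hit_point \<epsilon> x v c) (deflected \<epsilon> x v c))"
    by (rule ext) (auto simp: case_prod_beta indicator_def)
  finally show ?thesis .
qed

lemma measurable_next_void_mean:
  assumes A [measurable]: "A \<in> sets borel" and P: "finite P"
    and g: "(\<lambda>(x, v). g x v) \<in> borel_measurable (borel \<Otimes>\<^sub>M borel)"
  shows "next_void_mean PP \<epsilon> g n r x v A P \<in> borel_measurable borel"
proof -
  note [measurable] = borel_measurable_nn_integral[OF next_void_mean_joint[OF A P g]]
  have [measurable]: "Measurable.pred borel (\<lambda>c. \<forall>p\<in>P. \<not> blocked \<epsilon> (entry_time \<epsilon> x v c) x v p)"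
    using P by measurable
  show ?thesis unfolding next_void_mean_def[abs_def] void_mean_def by measurable
qed

text \<open>The Mecke formula singles out the next obstacle \<open>c\<close> and the cylinder coordinates express it by the time
  and the normal of the collision. It is only an inequality because the next obstacle might also be
  one of the known obstacles \<open>P\<close>.\<close>

lemma void_mean_Suc_lower:
  fixes x v :: 'a
  assumes v: "norm v = 1" and \<epsilon>: "\<epsilon> > 0" and A [measurable]: "A \<in> sets borel" and P: "finite P"
    and g: "(\<lambda>(x, v). g x v) \<in> borel_measurable (borel \<Otimes>\<^sub>M borel)"
  shows "ennreal lam * (ennreal (\<epsilon> ^ (DIM('a) - 1)) *
      (\<integral>\<^sup>+s. \<integral>\<^sup>+n'. ennreal (max 0 (- (v \<bullet> n'))) * next_void_mean PP \<epsilon> g n r x v A P (x + s *\<^sub>R v - \<epsilon> *\<^sub>R n') \<partial>surface \<partial>lborel))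
    \<le> void_mean PP \<epsilon> g (Suc n) r x v A P"
proof -
  let ?k = "\<lambda>D c. after_collisions \<epsilon> D g n (r - entry_time \<epsilon> x v c) (hit_point \<epsilon> x v c) (deflected \<epsilon> x v c)"
  define h where "h c C = (if C \<inter> A = {} \<and> first_hit \<epsilon> (C \<union> P) r x v c then ?k (C \<union> P) c else 0)" for c C
  let ?N = "next_void_mean PP \<epsilon> g n r x v A P"
  have h_meas: "(\<lambda>(c, C). h c C) \<in> borel_measurable (borel \<Otimes>\<^sub>M config)"
  proof -
    have [measurable]: "(\<lambda>w. snd w \<union> P) \<in> borel \<Otimes>\<^sub>M config \<rightarrow>\<^sub>M config"
      by (rule measurable_config_Un[OF _ P]) measurable
    have [measurable]: "(\<lambda>w. ?k (snd w \<union> P) (fst w)) \<in> borel_measurable (borel \<Otimes>\<^sub>M config)"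
      using g by measurable
    show ?thesis unfolding h_def case_prod_beta by measurable
  qed
  have "ennreal (\<epsilon> ^ (DIM('a) - 1)) *
      (\<integral>\<^sup>+s. \<integral>\<^sup>+n'. ennreal (max 0 (- (v \<bullet> n'))) * ?N (x + s *\<^sub>R v - \<epsilon> *\<^sub>R n') \<partial>surface \<partial>lborel) =
      (\<integral>\<^sup>+c. indicator {c. disc \<epsilon> x v c > 0} c * ?N c \<partial>lborel)"
    by (rule cylinder_coordinates[OF v \<epsilon> measurable_next_void_mean[OF A P g], symmetric])
  also have "\<dots> \<le> (\<integral>\<^sup>+c. \<integral>\<^sup>+C. h c (insert c C) \<partial>PP \<partial>lborel)"
  proof (rule nn_integral_mono)
    fix c
    show "indicator {c. disc \<epsilon> x v c > 0} c * ?N c \<le> (\<integral>\<^sup>+C. h c (insert c C) \<partial>PP)"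
    proof (cases "disc \<epsilon> x v c > 0 \<and> 0 < entry_time \<epsilon> x v c \<and> entry_time \<epsilon> x v c < r \<and> c \<notin> A \<and>
         (\<forall>p\<in>P. \<not> blocked \<epsilon> (entry_time \<epsilon> x v c) x v p)")
      case True
      then have "indicator {c. disc \<epsilon> x v c > 0} c * ?N c =
        (\<integral>\<^sup>+C. indicator {C. C \<inter> (A \<union> {c'. blocked \<epsilon> (entry_time \<epsilon> x v c) x v c'}) = {}} C * ?k (C \<union> insert c P) c \<partial>PP)"
        by (simp add: next_void_mean_def void_mean_def)
      also have "\<dots> \<le> (\<integral>\<^sup>+C. h c (insert c C) \<partial>PP)"
      proof (rule nn_integral_mono)
        fix C
        show "indicator {C. C \<inter> (A \<union> {c'. blocked \<epsilon> (entry_time \<epsilon> x v c) x v c'}) = {}} C * ?k (C \<union> insert c P) c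
           \<le> h c (insert c C)"
        proof (cases "C \<inter> (A \<union> {c'. blocked \<epsilon> (entry_time \<epsilon> x v c) x v c'}) = {}")
          case void: True
          have "insert c C \<inter> A = {}" using void True by auto
          moreover have "first_hit \<epsilon> (insert c C \<union> P) r x v c"
            using void True unfolding first_hit_def by auto
          moreover have "insert c C \<union> P = C \<union> insert c P" by auto
          ultimately have "h c (insert c C) = ?k (C \<union> insert c P) c" unfolding h_def by (simp only: if_True simp_thms)
          then show ?thesis by (simp split: split_indicator)
        qed simp
      qed
      finally show ?thesis .
    next
      case False
      then have zero: "indicator {c. disc \<epsilon> x v c > 0} c * ?N c = 0"
        by (auto simp: next_void_mean_def split: split_indicator)
      show ?thesis unfolding zero by simp
    qed
  qed
  also have "ennreal lam * \<dots> = (\<integral>\<^sup>+C. \<integral>\<^sup>+c. h c C \<partial>count_space C \<partial>PP)"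
    by (rule mecke[OF h_meas, symmetric])
  also have "\<dots> \<le> void_mean PP \<epsilon> g (Suc n) r x v A P"
    unfolding void_mean_def
  proof (rule nn_integral_mono)
    fix C
    show "(\<integral>\<^sup>+c. h c C \<partial>count_space C) \<le> indicator {C. C \<inter> A = {}} C * after_collisions \<epsilon> (C \<union> P) g (Suc n) r x v"
    proof (cases "\<exists>c\<in>C. h c C \<noteq> 0")
      case True
      then obtain c where c: "c \<in> C" "h c C \<noteq> 0" by blast
      then have CA: "C \<inter> A = {}" and f: "first_hit \<epsilon> (C \<union> P) r x v c" by (auto simp: h_def split: if_splits)
      have "(\<integral>\<^sup>+c. h c C \<partial>count_space C) = h c C"
      proof (rule nn_integral_count_space_single[OF c(1)])
        fix c' assume "c' \<in> C" "c' \<noteq> c"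
        then have "\<not> first_hit \<epsilon> (C \<union> P) r x v c'" using first_hit_unique[OF f, of c'] c(1) by blast
        then show "h c' C = 0" by (simp add: h_def)
      qed
      also have "\<dots> = after_collisions \<epsilon> (C \<union> P) g (Suc n) r x v"
        using CA f c(1) by (simp add: h_def after_collisions_Suc collide_eq[OF f])
      finally show ?thesis using CA by simp
    next
      case False
      then have "(\<integral>\<^sup>+c. h c C \<partial>count_space C) = 0"
        by (intro nn_integral_zero') (auto simp: AE_count_space)
      then show ?thesis by simp
    qed
  qed
  finally show ?thesis by (simp add: mult_left_mono)
qed

text \<open>A flight without collision requires the tube and \<open>A\<close> to be void; the void probability is bounded below
  by treating the two volumes as disjoint.\<close>

lemma void_mean_0_lower:
  fixes x v :: 'a
  assumes dim: "DIM('a) \<ge> 2" and v: "norm v = 1" and \<epsilon>: "\<epsilon> > 0" and r: "r \<ge> 0"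
    and lam: "lam * \<epsilon> ^ (DIM('a) - 1) = 1" and A [measurable]: "A \<in> sets borel"
    and P: "\<And>p. p \<in> P \<Longrightarrow> \<not> blocked \<epsilon> r x v p"
    and a: "0 \<le> a" "ennreal lam * emeasure lborel A \<le> ennreal a"
  shows "g (x + r *\<^sub>R v) v * ennreal (exp (- (a + enn2real (collision_rate v) * r + unit_ball_vol DIM('a) * \<epsilon>)))
     \<le> void_mean PP \<epsilon> g 0 r x v A P"
proof -
  let ?t = "{c. blocked \<epsilon> r x v c}"
  have t [measurable]: "?t \<in> sets borel" by measurable
  have kr: "collision_rate v = ennreal (enn2real (collision_rate v))"
    using collision_rate_finite[OF v] by simp
  have lam_pos: "lam > 0" using lam lam_nonneg \<epsilon> by (cases "lam = 0") auto
  let ?b = "a + (enn2real (collision_rate v) * r + unit_ball_vol DIM('a) * \<epsilon>)"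
  have b0: "0 \<le> ?b" using a r \<epsilon> by (simp add: unit_ball_vol_nonneg)
  have "ennreal lam * emeasure lborel ?t \<le> ennreal lam * (ennreal (\<epsilon> ^ (DIM('a) - 1)) *
      (collision_rate v * ennreal r + ennreal (unit_ball_vol DIM('a) * \<epsilon>)))"
    by (rule mult_left_mono[OF tube_volume[OF dim v \<epsilon> r]]) simp
  also have "\<dots> = ennreal (lam * \<epsilon> ^ (DIM('a) - 1)) * (collision_rate v * ennreal r + ennreal (unit_ball_vol DIM('a) * \<epsilon>))"
    using \<epsilon> lam_nonneg by (simp add: ennreal_mult mult.assoc)
  also have "\<dots> = ennreal (enn2real (collision_rate v) * r + unit_ball_vol DIM('a) * \<epsilon>)"
    unfolding lam using r \<epsilon> by (subst kr) (simp add: ennreal_mult[symmetric] ennreal_plus[symmetric] unit_ball_vol_nonneg del: ennreal_plus)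
  finally have tube: "ennreal lam * emeasure lborel ?t \<le> ennreal (enn2real (collision_rate v) * r + unit_ball_vol DIM('a) * \<epsilon>)" .
  have "ennreal lam * emeasure lborel (A \<union> ?t) \<le> ennreal lam * (emeasure lborel A + emeasure lborel ?t)"
    by (intro mult_left_mono emeasure_subadditive) auto
  also have "\<dots> \<le> ennreal a + ennreal (enn2real (collision_rate v) * r + unit_ball_vol DIM('a) * \<epsilon>)"
    unfolding distrib_left by (intro add_mono a tube)
  also have "\<dots> = ennreal ?b" using a r \<epsilon> by (simp add: unit_ball_vol_nonneg)
  finally have vol: "ennreal lam * emeasure lborel (A \<union> ?t) \<le> ennreal ?b" .
  have fin: "emeasure lborel (A \<union> ?t) < \<infinity>"
  proof (rule ccontr)
    assume "\<not> emeasure lborel (A \<union> ?t) < \<infinity>"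
    then have "emeasure lborel (A \<union> ?t) = \<infinity>" by (simp add: less_top[symmetric])
    then show False using vol lam_pos by (simp add: ennreal_mult_top top_unique)
  qed
  then have "ennreal (lam * measure lborel (A \<union> ?t)) \<le> ennreal ?b"
    using vol lam_nonneg by (simp add: emeasure_eq_ennreal_measure ennreal_mult less_top)
  then have le: "lam * measure lborel (A \<union> ?t) \<le> ?b" using b0 by simp
  have "g (x + r *\<^sub>R v) v * ennreal (exp (- (a + enn2real (collision_rate v) * r + unit_ball_vol DIM('a) * \<epsilon>)))
     \<le> g (x + r *\<^sub>R v) v * ennreal (exp (- (lam * measure lborel (A \<union> ?t))))"
    using le by (intro mult_left_mono ennreal_leI) (auto simp: add.assoc)
  also have "\<dots> = g (x + r *\<^sub>R v) v * emeasure PP {C \<in> space PP. C \<inter> (A \<union> ?t) = {}}"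
    by (subst void_probability[OF _ fin]) auto
  also have "\<dots> = g (x + r *\<^sub>R v) v * (\<integral>\<^sup>+C. indicator {C \<in> space PP. C \<inter> (A \<union> ?t) = {}} C \<partial>PP)"
  proof -
    have "{C \<in> space PP. C \<inter> (A \<union> ?t) = {}} \<in> sets PP"
      using pred_config_avoid[OF measurable_ident_config, of "A \<union> ?t"] by (simp add: pred_def)
    then show ?thesis by simp
  qed
  also have "\<dots> = (\<integral>\<^sup>+C. g (x + r *\<^sub>R v) v * indicator {C \<in> space PP. C \<inter> (A \<union> ?t) = {}} C \<partial>PP)"
  proof (rule nn_integral_cmult[symmetric])
    show "indicator {C \<in> space PP. C \<inter> (A \<union> ?t) = {}} \<in> borel_measurable PP"
      using pred_config_avoid[OF measurable_ident_config, of "A \<union> ?t"] by (simp add: pred_def)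
  qed
  also have "\<dots> \<le> void_mean PP \<epsilon> g 0 r x v A P"
    unfolding void_mean_def
  proof (rule nn_integral_mono)
    fix C
    show "g (x + r *\<^sub>R v) v * indicator {C \<in> space PP. C \<inter> (A \<union> ?t) = {}} C \<le>
       indicator {C. C \<inter> A = {}} C * after_collisions \<epsilon> (C \<union> P) g 0 r x v"
    proof (cases "C \<inter> (A \<union> ?t) = {}")
      case True
      then have "C \<inter> A = {}" "\<forall>c\<in>C \<union> P. \<not> blocked \<epsilon> r x v c" using P by auto
      then show ?thesis by (simp add: after_collisions_0 free_flight_def split: split_indicator)
    qed simp
  qed
  finally show ?thesis .
qed

end

lemma next_void_mean_eq:
  fixes x v n' :: "'a::euclidean_space" and s :: real
  assumes v: "norm v = 1" and n': "norm n' = 1" and \<epsilon>: "\<epsilon> > 0" and vn: "v \<bullet> n' < 0"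
  defines "c \<equiv> x + s *\<^sub>R v - \<epsilon> *\<^sub>R n'"
  assumes s: "0 < s" "s < r" and cA: "c \<notin> A" and P: "\<And>p. p \<in> P \<Longrightarrow> \<not> blocked \<epsilon> s x v p"
  shows "next_void_mean PP \<epsilon> g n r x v A P c =
    void_mean PP \<epsilon> g n (r - s) (x + s *\<^sub>R v) (specular n' v) (A \<union> {c'. blocked \<epsilon> s x v c'}) (insert c P)"
proof -
  have e: "entry_time \<epsilon> x v c = s" unfolding c_def by (rule incoming_data(2)[OF v n' \<epsilon> vn])
  have h: "hit_point \<epsilon> x v c = x + s *\<^sub>R v" by (simp add: hit_point_def e)
  have "(x + s *\<^sub>R v - c) /\<^sub>R \<epsilon> = n'" using \<epsilon> by (simp add: c_def)
  then have d: "deflected \<epsilon> x v c = specular n' v" by (simp add: deflected_def h)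
  show ?thesis unfolding next_void_mean_def e h d using s cA P by auto
qed

section \<open>The Duhamel series as a lower bound\<close>

text \<open>The limiting probability of a flight of duration \<open>s\<close> without collision.\<close>

definition damping :: "'a::euclidean_space \<Rightarrow> real \<Rightarrow> ennreal" where
  "damping v s = ennreal (exp (- (enn2real (collision_rate v) * s)))"

text \<open>The contribution of trajectories with exactly \<open>n\<close> collisions to the solution of the Boltzmann
  equation, followed backwards.\<close>

primrec duhamel :: "('a::euclidean_space \<Rightarrow> 'a \<Rightarrow> ennreal) \<Rightarrow> nat \<Rightarrow> real \<Rightarrow> 'a \<Rightarrow> 'a \<Rightarrow> ennreal" where
  "duhamel g 0 r x v = damping v r * g (x + r *\<^sub>R v) v"
| "duhamel g (Suc n) r x v = (\<integral>\<^sup>+s. \<integral>\<^sup>+n'. ennreal (max 0 (- (v \<bullet> n'))) *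
     (indicator {0<..<r} s * damping v s * duhamel g n (r - s) (x + s *\<^sub>R v) (specular n' v)) \<partial>surface \<partial>lborel)"

text \<open>The normal is recovered from the velocities before and after the collision, up to sign. Hence a finite
  set of forbidden outgoing velocities forbids finitely many normals.\<close>

lemma specular_eq_normal:
  fixes v n :: "'a::euclidean_space"
  assumes n: "norm n = 1" and vn: "v \<bullet> n \<noteq> 0" and e: "specular n v = e"
  shows "n = (v - e) /\<^sub>R norm (v - e) \<or> n = - ((v - e) /\<^sub>R norm (v - e))"
proof -
  have ve: "v - e = (2 * (v \<bullet> n)) *\<^sub>R n" unfolding e[symmetric] by (simp add: specular_def)
  have "norm (v - e) = 2 * \<bar>v \<bullet> n\<bar>" unfolding ve using n by (simp add: abs_mult)
  then show ?thesis unfolding ve using vn n by (cases "v \<bullet> n > 0") (auto simp: divide_simps abs_if)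
qed

lemma finite_line_meets_segment:
  fixes x v p q :: "'a::euclidean_space"
  assumes v: "norm v = 1" and d: "v \<noteq> (q - p) /\<^sub>R norm (q - p)" "v \<noteq> - ((q - p) /\<^sub>R norm (q - p))"
  shows "finite {s. x + s *\<^sub>R v \<in> closed_segment p q}"
proof (rule ccontr)
  assume "infinite {s. x + s *\<^sub>R v \<in> closed_segment p q}"
  then obtain s where s: "x + s *\<^sub>R v \<in> closed_segment p q"
    and "infinite ({s. x + s *\<^sub>R v \<in> closed_segment p q} - {s})"
    by (metis (mono_tags, lifting) infinite_imp_nonempty infinite_remove mem_Collect_eq ex_in_conv)
  then obtain t where t: "x + t *\<^sub>R v \<in> closed_segment p q" "t \<noteq> s"
    by (metis (mono_tags, lifting) DiffE ex_in_conv infinite_imp_nonempty insertCI mem_Collect_eq)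
  obtain a where a: "x + s *\<^sub>R v = (1 - a) *\<^sub>R p + a *\<^sub>R q" using s by (auto simp: closed_segment_def)
  obtain b where b: "x + t *\<^sub>R v = (1 - b) *\<^sub>R p + b *\<^sub>R q" using t(1) by (auto simp: closed_segment_def)
  have "(t - s) *\<^sub>R v = (x + t *\<^sub>R v) - (x + s *\<^sub>R v)" by (simp add: algebra_simps)
  also have "\<dots> = (b - a) *\<^sub>R (q - p)" unfolding a b by (simp add: algebra_simps)
  finally have eq: "(t - s) *\<^sub>R v = (b - a) *\<^sub>R (q - p)" .
  define k where "k = (b - a) / (t - s)"
  have "v = (1 / (t - s)) *\<^sub>R ((t - s) *\<^sub>R v)" using t(2) by simp
  also have "\<dots> = k *\<^sub>R (q - p)" unfolding eq k_def by simp
  finally have vk: "v = k *\<^sub>R (q - p)" .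
  then have "\<bar>k\<bar> * norm (q - p) = 1" using v by (metis norm_scaleR)
  then have "k = inverse (norm (q - p)) \<or> k = - inverse (norm (q - p))"
    by (smt (verit) inverse_unique mult.commute mult_minus_left)
  then show False using d vk by auto
qed

lemma collision_rate_enn2real:
  fixes v :: "'a::euclidean_space"
  assumes "norm v = 1" shows "ennreal (enn2real (collision_rate v)) = collision_rate v"
  using collision_rate_finite[OF assms] by simp

lemma mem_closed_segment_line:
  fixes y w :: "'a::real_vector"
  assumes "0 \<le> \<tau>" "\<tau> \<le> T" "0 < T"
  shows "y + \<tau> *\<^sub>R w \<in> closed_segment y (y + T *\<^sub>R w)"
proof -
  define u where "u = \<tau> / T"
  have "\<tau> = u * T" "0 \<le> u" "u \<le> 1" using assms by (simp_all add: u_def)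
  moreover have "y + (u * T) *\<^sub>R w = (1 - u) *\<^sub>R y + u *\<^sub>R (y + T *\<^sub>R w)" by (simp add: algebra_simps)
  ultimately show ?thesis unfolding closed_segment_def by blast
qed

lemma measurable_damping [measurable (raw)]:
  fixes v :: "'b \<Rightarrow> 'a::euclidean_space"
  assumes [measurable]: "v \<in> borel_measurable M" "s \<in> borel_measurable M"
  shows "(\<lambda>w. damping (v w) (s w)) \<in> borel_measurable M"
  unfolding damping_def by measurable

lemma measurable_duhamel:
  fixes g :: "'a::euclidean_space \<Rightarrow> 'a \<Rightarrow> ennreal"
  assumes g: "(\<lambda>(x, v). g x v) \<in> borel_measurable (borel \<Otimes>\<^sub>M borel)"
  shows "(\<lambda>(r, x, v). duhamel g n r x v) \<in> borel_measurable (borel \<Otimes>\<^sub>M borel \<Otimes>\<^sub>M borel)"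
proof (induction n)
  case 0
  have [measurable]: "(\<lambda>w. g (fst (snd w) + fst w *\<^sub>R snd (snd w)) (snd (snd w))) \<in> borel_measurable (borel \<Otimes>\<^sub>M borel \<Otimes>\<^sub>M borel)"
    using measurable_compose[OF _ g, of "\<lambda>w. (fst (snd w) + fst w *\<^sub>R snd (snd w), snd (snd w))" "borel \<Otimes>\<^sub>M borel \<Otimes>\<^sub>M borel"]
    by simp
  show ?case by (simp add: case_prod_beta)
next
  case (Suc n)
  have [measurable (raw)]: "(\<lambda>w. duhamel g n (f w) (h w) (k w)) \<in> borel_measurable N"
    if "f \<in> borel_measurable N" "h \<in> borel_measurable N" "k \<in> borel_measurable N"
    for N :: "'n measure" and f h k
    using measurable_compose[OF measurable_Pair[OF that(1) measurable_Pair[OF that(2,3)]] Suc] by simp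
  show ?case unfolding duhamel.simps case_prod_beta indicator_def of_bool_def greaterThanLessThan_iff by measurable
qed

lemma measurable_duhamel_compose:
  fixes g :: "'a::euclidean_space \<Rightarrow> 'a \<Rightarrow> ennreal"
  assumes g: "(\<lambda>(x, v). g x v) \<in> borel_measurable (borel \<Otimes>\<^sub>M borel)"
    and "f \<in> borel_measurable N" "h \<in> borel_measurable N" "k \<in> borel_measurable N"
  shows "(\<lambda>w. duhamel g n (f w) (h w) (k w)) \<in> borel_measurable N"
  using measurable_compose[OF measurable_Pair[OF assms(2) measurable_Pair[OF assms(3,4)]] measurable_duhamel[OF g, of n]]
  by simp

text \<open>Induction over the number of collisions, with the history in the statement. In the limit the void
  regions \<open>A k\<close> shrink to finitely many segments \<open>S\<close>, each meeting the current line finitely often. The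
  expected number of obstacles in \<open>A k\<close> is at most \<open>a k\<close>, which tends to \<open>\<alpha>\<close>, and the known obstacles \<open>P k\<close> shrink to finitely many points \<open>Q\<close>.
  After one more collision at time \<open>s\<close> with normal \<open>n'\<close>, the same holds with the segment of the last flight and its
  end point added, unless \<open>s\<close> or \<open>n'\<close> lies in a finite set: the collision point must avoid \<open>S\<close> and \<open>Q\<close>,
  and the new velocity must not be parallel to a segment of \<open>S\<close> nor point to \<open>Q\<close>. Fatou's lemma
  then passes to the limit under both integrals.\<close>

theorem duhamel_le_liminf_void_mean:
  fixes PP :: "nat \<Rightarrow> 'a::euclidean_space set measure" and eps lam :: "nat \<Rightarrow> real"
  assumes dim: "DIM('a) \<ge> 2"
    and config: "\<And>k. poisson_config (PP k) (lam k)"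
    and eps: "\<And>k. eps k > 0" "eps \<longlonglongrightarrow> 0"
    and scaling: "\<And>k. lam k * eps k ^ (DIM('a) - 1) = 1"
    and g: "(\<lambda>(x, v). g x v) \<in> borel_measurable (borel \<Otimes>\<^sub>M borel)" and g_finite: "\<And>x v. g x v < top"
  assumes v: "norm v = 1" and r: "r > 0"
    and A: "\<And>k. A k \<in> sets borel" and a: "a \<longlonglongrightarrow> \<alpha>" "\<And>k. 0 \<le> a k"
      "\<And>k. ennreal (lam k) * emeasure lborel (A k) \<le> ennreal (a k)"
    and S: "finite S" "\<And>\<eta>. \<eta> > 0 \<Longrightarrow> \<forall>\<^sub>F k in sequentially. \<forall>y\<in>A k. \<exists>(p, q)\<in>S. \<exists>z\<in>closed_segment p q. dist y z < \<eta>"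
      "\<And>p q. (p, q) \<in> S \<Longrightarrow> finite {s. x + s *\<^sub>R v \<in> closed_segment p q}"
    and P: "\<And>k. finite (P k)"
    and Q: "finite Q" "\<And>\<eta>. \<eta> > 0 \<Longrightarrow> \<forall>\<^sub>F k in sequentially. \<forall>p\<in>P k. \<exists>q\<in>Q. dist p q < \<eta>"
    and PB: "\<forall>\<^sub>F k in sequentially. \<forall>p\<in>P k. \<not> blocked (eps k) r x v p"
  shows "ennreal (exp (- \<alpha>)) * duhamel g n r x v \<le> liminf (\<lambda>k. void_mean (PP k) (eps k) g n r x v (A k) (P k))"
  using v r A a S P Q PB
proof (induction n arbitrary: r x v A a \<alpha> S P Q)
  case 0
  note v = "0.prems"(1) and r = "0.prems"(2) and A = "0.prems"(3) and a = "0.prems"(4-6)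
    and PB = "0.prems"(13)
  let ?\<kappa> = "enn2real (collision_rate v)"
  let ?e = "\<lambda>k. ennreal (exp (- (a k + ?\<kappa> * r + unit_ball_vol DIM('a) * eps k)))"
  have "?e \<longlonglongrightarrow> ennreal (exp (- (\<alpha> + ?\<kappa> * r + unit_ball_vol DIM('a) * 0)))"
    by (intro tendsto_ennrealI tendsto_intros a eps)
  then have "(\<lambda>k. g (x + r *\<^sub>R v) v * ?e k) \<longlonglongrightarrow> g (x + r *\<^sub>R v) v * ennreal (exp (- (\<alpha> + ?\<kappa> * r + unit_ball_vol DIM('a) * 0)))"
    by (rule ennreal_tendsto_cmult[OF g_finite])
  then have "liminf (\<lambda>k. g (x + r *\<^sub>R v) v * ?e k) = g (x + r *\<^sub>R v) v * ennreal (exp (- (\<alpha> + ?\<kappa> * r + unit_ball_vol DIM('a) * 0)))"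
    by (rule lim_imp_Liminf[OF trivial_limit_sequentially])
  also have "\<dots> = ennreal (exp (- \<alpha>)) * duhamel g 0 r x v"
  proof -
    have "ennreal (exp (- (\<alpha> + ?\<kappa> * r + unit_ball_vol DIM('a) * 0))) = ennreal (exp (- \<alpha>)) * damping v r"
      unfolding damping_def by (subst ennreal_mult[symmetric]) (simp_all add: exp_add[symmetric])
    then show ?thesis by (simp only: duhamel.simps mult_ac)
  qed
  finally have "ennreal (exp (- \<alpha>)) * duhamel g 0 r x v = liminf (\<lambda>k. g (x + r *\<^sub>R v) v * ?e k)" ..
  also have "\<dots> \<le> liminf (\<lambda>k. void_mean (PP k) (eps k) g 0 r x v (A k) (P k))"
  proof (rule Liminf_mono, use PB in eventually_elim)
    case (elim k)
    interpret poisson_config "PP k" "lam k" by (rule config)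
    show ?case
      by (rule void_mean_0_lower[OF dim v eps(1) _ scaling A _ a(2,3)]) (use r elim in auto)
  qed
  finally show ?case .
next
  case (Suc n)
  note v = Suc.prems(1) and r = Suc.prems(2) and A = Suc.prems(3) and a = Suc.prems(4-6)
    and S = Suc.prems(7-9) and P = Suc.prems(10) and Q = Suc.prems(11,12) and PB = Suc.prems(13)
  let ?\<kappa> = "enn2real (collision_rate v)"
  let ?E = "\<lambda>n'. ennreal (max 0 (- (v \<bullet> n')))"
  let ?N = "\<lambda>k. next_void_mean (PP k) (eps k) g n r x v (A k) (P k)"
  have N_meas [measurable]: "?N k \<in> borel_measurable borel" for k
  proof -
    interpret poisson_config "PP k" "lam k" by (rule config)
    show ?thesis by (rule measurable_next_void_mean[OF A P g])
  qed
  let ?W = "\<lambda>k s n'. ?E n' * ?N k (x + s *\<^sub>R v - eps k *\<^sub>R n')"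
  have key: "ennreal (exp (- \<alpha>)) * (?E n' * (indicator {0<..<r} s * damping v s * duhamel g n (r - s) (x + s *\<^sub>R v) (specular n' v)))
      \<le> liminf (\<lambda>k. ?W k s n')"
    if s: "0 < s" "s < r" and n': "norm n' = 1" and vn: "v \<bullet> n' < 0"
      and sS: "\<And>p q. (p, q) \<in> S \<Longrightarrow> x + s *\<^sub>R v \<notin> closed_segment p q" and sQ: "x + s *\<^sub>R v \<notin> Q"
      and dS: "\<And>p q. (p, q) \<in> insert (x, x + s *\<^sub>R v) S \<Longrightarrow> specular n' v \<noteq> (q - p) /\<^sub>R norm (q - p) \<and>
          specular n' v \<noteq> - ((q - p) /\<^sub>R norm (q - p))"
      and dQ: "\<And>q. q \<in> Q \<Longrightarrow> specular n' v \<noteq> (q - (x + s *\<^sub>R v)) /\<^sub>R norm (q - (x + s *\<^sub>R v))"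
    for s n'
  proof -
    define y where "y = x + s *\<^sub>R v"
    define w where "w = specular n' v"
    define c where "c k = y - eps k *\<^sub>R n'" for k
    define tube where "tube k = {c'. blocked (eps k) s x v c'}" for k
    define A' where "A' k = A k \<union> tube k" for k
    define P' where "P' k = insert (c k) (P k)" for k
    have w: "norm w = 1" unfolding w_def using norm_specular[OF n'] v by simp
    have wn: "w \<bullet> n' > 0" unfolding w_def inner_specular[OF n'] using vn by simp
    have dist_c: "dist (c k) y = eps k" for k using n' eps(1)[of k] by (simp add: c_def dist_norm)
    have eps_small: "\<forall>\<^sub>F k in sequentially. eps k < \<eta>" if "\<eta> > 0" for \<eta>
      using order_tendstoD(2)[OF eps(2) that] .
    have tube_meas: "tube k \<in> sets borel" for k unfolding tube_def by measurable
    \<comment> \<open>the obstacle hit next avoids the region known to be empty\<close>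
    have cA: "\<forall>\<^sub>F k in sequentially. c k \<notin> A k"
    proof -
      let ?\<Gamma> = "\<Union>(p, q)\<in>S. closed_segment p q"
      have "closed ?\<Gamma>" using S(1) by (intro closed_UN) auto
      moreover have "y \<notin> ?\<Gamma>" using sS by (auto simp: y_def)
      ultimately obtain \<delta> where \<delta>: "\<delta> > 0" "\<And>z. z \<in> ?\<Gamma> \<Longrightarrow> \<delta> \<le> dist y z"
        using separate_point_closed[of ?\<Gamma> y] by blast
      have "\<delta> / 2 > 0" using \<delta>(1) by simp
      from S(2)[OF this] eps_small[OF this] show ?thesis
      proof eventually_elim
        case (elim k)
        show ?case
        proof
          assume "c k \<in> A k"
          then obtain p q z where z: "(p, q) \<in> S" "z \<in> closed_segment p q" "dist (c k) z < \<delta> / 2"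
            using elim(1) by blast
          then have "\<delta> \<le> dist y z" using \<delta>(2) by blast
          then show False using z(3) elim(2) dist_c[of k] dist_triangle[of y z "c k"] by (simp add: dist_commute)
        qed
      qed
    qed
    have PBs: "\<forall>\<^sub>F k in sequentially. \<forall>p\<in>P k. \<not> blocked (eps k) s x v p"
      using PB by eventually_elim (use s in \<open>auto simp: blocked_def\<close>)
    (* for small \<epsilon> the next obstacle is admissible, so the integrand is an expectation with the enlarged history *)
    have W: "\<forall>\<^sub>F k in sequentially. ?W k s n' = ?E n' * void_mean (PP k) (eps k) g n (r - s) y w (A' k) (P' k)"
      using cA PBs
    proof eventually_elim
      case (elim k)
      have "?N k (x + s *\<^sub>R v - eps k *\<^sub>R n') = void_mean (PP k) (eps k) g n (r - s) (x + s *\<^sub>R v) (specular n' v)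
          (A k \<union> {c'. blocked (eps k) s x v c'}) (insert (x + s *\<^sub>R v - eps k *\<^sub>R n') (P k))"
        by (rule next_void_mean_eq[OF v n' eps(1) vn s]) (use elim in \<open>auto simp: c_def y_def\<close>)
      then show ?case by (simp only: A'_def P'_def tube_def c_def y_def w_def)
    qed
    have IH: "ennreal (exp (- (\<alpha> + (?\<kappa> * s + unit_ball_vol DIM('a) * 0)))) * duhamel g n (r - s) y w
      \<le> liminf (\<lambda>k. void_mean (PP k) (eps k) g n (r - s) y w (A' k) (P' k))"
    proof (rule Suc.IH[where a = "\<lambda>k. a k + (?\<kappa> * s + unit_ball_vol DIM('a) * eps k)" and S = "insert (x, y) S" and Q = "insert y Q"])
      show "norm w = 1" by (rule w)
      show "0 < r - s" using s by simp
      show "A' k \<in> sets borel" for k unfolding A'_def using A tube_meas by auto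
      show "(\<lambda>k. a k + (?\<kappa> * s + unit_ball_vol DIM('a) * eps k)) \<longlonglongrightarrow> \<alpha> + (?\<kappa> * s + unit_ball_vol DIM('a) * 0)"
        by (intro tendsto_intros a eps)
      have t0: "0 \<le> ?\<kappa> * s + unit_ball_vol DIM('a) * eps k" for k
        using s eps(1)[of k] by (simp add: unit_ball_vol_nonneg)
      show "0 \<le> a k + (?\<kappa> * s + unit_ball_vol DIM('a) * eps k)" for k using a(2)[of k] t0[of k] by simp
      show "ennreal (lam k) * emeasure lborel (A' k) \<le> ennreal (a k + (?\<kappa> * s + unit_ball_vol DIM('a) * eps k))" for k
      proof -
        interpret poisson_config "PP k" "lam k" by (rule config)
        have "ennreal (lam k) * emeasure lborel (tube k) \<le> ennreal (lam k) * (ennreal (eps k ^ (DIM('a) - 1)) *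
            (collision_rate v * ennreal s + ennreal (unit_ball_vol DIM('a) * eps k)))"
          unfolding tube_def by (rule mult_left_mono[OF tube_volume[OF dim v eps(1)]]) (use s in auto)
        also have "\<dots> = ennreal (lam k * eps k ^ (DIM('a) - 1)) * (collision_rate v * ennreal s + ennreal (unit_ball_vol DIM('a) * eps k))"
          using eps(1)[of k] lam_nonneg by (simp add: ennreal_mult mult.assoc)
        also have "\<dots> = ennreal (?\<kappa> * s + unit_ball_vol DIM('a) * eps k)"
        proof -
          have "collision_rate v * ennreal s = ennreal (?\<kappa> * s)"
            using s by (subst collision_rate_enn2real[OF v, symmetric]) (simp add: ennreal_mult)
          moreover have "0 \<le> ?\<kappa> * s" "0 \<le> unit_ball_vol DIM('a) * eps k"
            using s eps(1)[of k] by (simp_all add: unit_ball_vol_nonneg)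
          ultimately show ?thesis unfolding scaling by (simp only: ennreal_plus ennreal_1 mult_1)
        qed
        finally have tube: "ennreal (lam k) * emeasure lborel (tube k) \<le> ennreal (?\<kappa> * s + unit_ball_vol DIM('a) * eps k)" .
        have "ennreal (lam k) * emeasure lborel (A' k) \<le> ennreal (lam k) * (emeasure lborel (A k) + emeasure lborel (tube k))"
          unfolding A'_def by (intro mult_left_mono emeasure_subadditive) (use A tube_meas in auto)
        also have "\<dots> \<le> ennreal (a k) + ennreal (?\<kappa> * s + unit_ball_vol DIM('a) * eps k)"
          unfolding distrib_left by (intro add_mono a(3) tube)
        also have "\<dots> = ennreal (a k + (?\<kappa> * s + unit_ball_vol DIM('a) * eps k))"
          using a(2)[of k] t0[of k] by (rule ennreal_plus[symmetric])
        finally show ?thesis .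
      qed
      show "finite (insert (x, y) S)" using S(1) by simp
      show "\<forall>\<^sub>F k in sequentially. \<forall>y'\<in>A' k. \<exists>(p, q)\<in>insert (x, y) S. \<exists>z\<in>closed_segment p q. dist y' z < \<eta>" if "\<eta> > 0" for \<eta>
        using S(2)[OF that] eps_small[OF that]
      proof eventually_elim
        case (elim k)
        show ?case
        proof
          fix y' assume "y' \<in> A' k"
          then consider "y' \<in> A k" | "y' \<in> tube k" by (auto simp: A'_def)
          then show "\<exists>(p, q)\<in>insert (x, y) S. \<exists>z\<in>closed_segment p q. dist y' z < \<eta>"
          proof cases
            case 1
            then show ?thesis using elim(1) by blast
          next
            case 2
            then obtain s' where s': "s' \<in> {0..s}" "norm (x + s' *\<^sub>R v - y') \<le> eps k"
              unfolding tube_def mem_Collect_eq blocked_iff[OF v eps(1) s(1)] by blast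
            have "x + s' *\<^sub>R v \<in> closed_segment x y"
              unfolding y_def using s' s by (intro mem_closed_segment_line) auto
            moreover have "dist y' (x + s' *\<^sub>R v) < \<eta>" using s'(2) elim(2) by (simp add: dist_norm norm_minus_commute)
            ultimately show ?thesis by blast
          qed
        qed
      qed
      show "finite {\<tau>. y + \<tau> *\<^sub>R w \<in> closed_segment p q}" if "(p, q) \<in> insert (x, y) S" for p q
        by (rule finite_line_meets_segment[OF w]) (use dS[of p q] that in \<open>auto simp: w_def y_def\<close>)
      show "finite (P' k)" for k unfolding P'_def using P by simp
      show "finite (insert y Q)" using Q(1) by simp
      show "\<forall>\<^sub>F k in sequentially. \<forall>p\<in>P' k. \<exists>q\<in>insert y Q. dist p q < \<eta>" if "\<eta> > 0" for \<eta>
        using Q(2)[OF that] eps_small[OF that]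
        by eventually_elim (auto simp: P'_def dist_c)
      show "\<forall>\<^sub>F k in sequentially. \<forall>p\<in>P' k. \<not> blocked (eps k) (r - s) y w p"
      proof -
        let ?L = "closed_segment y (y + (r - s) *\<^sub>R w)"
        have mem: "y + \<tau> *\<^sub>R w \<in> ?L" if "\<tau> \<in> {0..r - s}" for \<tau>
          using that s by (intro mem_closed_segment_line) auto
        (* the next flight stays away from the obstacles already hit *)
        have "Q \<inter> ?L = {}"
        proof (rule ccontr)
          assume "Q \<inter> ?L \<noteq> {}"
          then obtain q u where q: "q \<in> Q" "q = (1 - u) *\<^sub>R y + u *\<^sub>R (y + (r - s) *\<^sub>R w)" "0 \<le> u"
            by (auto simp: closed_segment_def)
          then have qy: "q - y = (u * (r - s)) *\<^sub>R w" by (simp add: algebra_simps)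
          have "q \<noteq> y" using q(1) sQ by (auto simp: y_def)
          then have "u * (r - s) > 0" using qy q(3) s by (cases "u = 0") auto
          moreover have "w = (m *\<^sub>R w) /\<^sub>R norm (m *\<^sub>R w)" if "m > 0" for m using w that by simp
          ultimately have "w = (q - y) /\<^sub>R norm (q - y)" unfolding qy by blast
          then show False using dQ[OF q(1)] by (simp add: w_def y_def)
        qed
        then obtain \<delta> where \<delta>: "\<delta> > 0" "\<And>q z. q \<in> Q \<Longrightarrow> z \<in> ?L \<Longrightarrow> \<delta> \<le> dist q z"
          using separate_compact_closed[of Q ?L] Q(1) finite_imp_compact by (metis closed_segment)
        have "\<delta> / 2 > 0" using \<delta>(1) by simp
        from Q(2)[OF this] eps_small[OF this] show ?thesis
        proof eventually_elim
          case (elim k)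
          show ?case
          proof
            fix p assume "p \<in> P' k"
            then consider "p = c k" | "p \<in> P k" by (auto simp: P'_def)
            then show "\<not> blocked (eps k) (r - s) y w p"
            proof cases
              case 1
              then show ?thesis unfolding c_def using outgoing_not_blocked[OF w n' eps(1) wn] by simp
            next
              case 2
              show ?thesis
              proof
                assume "blocked (eps k) (r - s) y w p"
                then obtain \<tau> where \<tau>: "\<tau> \<in> {0..r - s}" "norm (y + \<tau> *\<^sub>R w - p) \<le> eps k"
                  using blocked_iff[OF w eps(1), of "r - s"] s by auto
                obtain q where q: "q \<in> Q" "dist p q < \<delta> / 2" using elim(1) 2 by blast
                have "\<delta> \<le> dist q (y + \<tau> *\<^sub>R w)" by (rule \<delta>(2)[OF q(1) mem[OF \<tau>(1)]])
                also have "\<dots> \<le> dist q p + dist p (y + \<tau> *\<^sub>R w)" by (rule dist_triangle)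
                also have "\<dots> < \<delta> / 2 + \<delta> / 2"
                proof -
                  have "dist p (y + \<tau> *\<^sub>R w) \<le> eps k" using \<tau>(2) by (simp add: dist_norm norm_minus_commute)
                  then show ?thesis using q(2) elim(2) dist_commute[of q p] by linarith
                qed
                finally show False by simp
              qed
            qed
          qed
        qed
      qed
    qed
    have "ennreal (exp (- \<alpha>)) * (?E n' * (indicator {0<..<r} s * damping v s * duhamel g n (r - s) (x + s *\<^sub>R v) (specular n' v)))
      = ?E n' * (ennreal (exp (- (\<alpha> + (?\<kappa> * s + unit_ball_vol DIM('a) * 0)))) * duhamel g n (r - s) y w)"
    proof -
      have "ennreal (exp (- (\<alpha> + (?\<kappa> * s + unit_ball_vol DIM('a) * 0)))) = ennreal (exp (- \<alpha>)) * damping v s"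
        unfolding damping_def by (subst ennreal_mult[symmetric]) (simp_all add: exp_add[symmetric])
      then show ?thesis using s by (simp add: y_def w_def mult_ac)
    qed
    also have "\<dots> \<le> ?E n' * liminf (\<lambda>k. void_mean (PP k) (eps k) g n (r - s) y w (A' k) (P' k))"
      by (rule mult_left_mono[OF IH]) simp
    also have "\<dots> = liminf (\<lambda>k. ?E n' * void_mean (PP k) (eps k) g n (r - s) y w (A' k) (P' k))"
    proof (rule Liminf_compose_continuous_mono[symmetric, where f="\<lambda>z. ?E n' * z"])
      show "continuous_on UNIV (\<lambda>z. ?E n' * z)" by (intro ennreal_continuous_on_cmult continuous_on_id) simp
      show "mono (\<lambda>z. ?E n' * z)" by (intro monoI mult_left_mono) simp_all
    qed simp
    also have "\<dots> = liminf (\<lambda>k. ?W k s n')"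
      by (rule Liminf_eq) (use W in \<open>auto elim: eventually_mono\<close>)
    finally show ?thesis .
  qed
  have "ennreal (exp (- \<alpha>)) * duhamel g (Suc n) r x v \<le>
     (\<integral>\<^sup>+s. \<integral>\<^sup>+n'. ennreal (exp (- \<alpha>)) * (?E n' * (indicator {0<..<r} s * damping v s *
        duhamel g n (r - s) (x + s *\<^sub>R v) (specular n' v))) \<partial>surface \<partial>lborel)"
  proof -
    note [measurable (raw)] = measurable_duhamel_compose[OF g]
    have m: "(\<lambda>n'. ?E n' * (indicator {0<..<r} s * damping v s * duhamel g n (r - s) (x + s *\<^sub>R v) (specular n' v)))
        \<in> borel_measurable surface" for s
      by measurable
    have m2: "(\<lambda>s. \<integral>\<^sup>+n'. ?E n' * (indicator {0<..<r} s * damping v s * duhamel g n (r - s) (x + s *\<^sub>R v) (specular n' v)) \<partial>surface)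
        \<in> borel_measurable lborel"
      by measurable
    show ?thesis unfolding duhamel.simps by (simp only: nn_integral_cmult[OF m] nn_integral_cmult[OF m2] order_refl)
  qed
  also have "\<dots> \<le> (\<integral>\<^sup>+s. \<integral>\<^sup>+n'. liminf (\<lambda>k. ?W k s n') \<partial>surface \<partial>lborel)"
  proof (rule nn_integral_mono_AE)
    have "finite (\<Union>(p, q)\<in>S. {s. x + s *\<^sub>R v \<in> closed_segment p q})"
      using S(1,3) by (intro finite_UN_I) auto
    moreover have "finite {s. x + s *\<^sub>R v \<in> Q}"
    proof -
      have "inj_on (\<lambda>s. x + s *\<^sub>R v) UNIV" using v by (auto simp: inj_on_def)
      then have "finite ((\<lambda>s. x + s *\<^sub>R v) -` Q)" using Q(1) by (rule finite_vimageI[rotated])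
      then show ?thesis by (simp add: vimage_def)
    qed
    ultimately have "finite ((\<Union>(p, q)\<in>S. {s. x + s *\<^sub>R v \<in> closed_segment p q}) \<union> {s. x + s *\<^sub>R v \<in> Q})" by simp
    from AE_not_in_finite[OF this]
    show "AE s in lborel. (\<integral>\<^sup>+n'. ennreal (exp (- \<alpha>)) * (?E n' * (indicator {0<..<r} s * damping v s *
        duhamel g n (r - s) (x + s *\<^sub>R v) (specular n' v))) \<partial>surface) \<le> (\<integral>\<^sup>+n'. liminf (\<lambda>k. ?W k s n') \<partial>surface)"
    proof eventually_elim
      case (elim s)
      (* the finitely many outgoing velocities to be avoided *)
      define D where "D = (\<Union>(p, q)\<in>insert (x, x + s *\<^sub>R v) S. {(q - p) /\<^sub>R norm (q - p), - ((q - p) /\<^sub>R norm (q - p))}) \<union>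
         (\<lambda>q. (q - (x + s *\<^sub>R v)) /\<^sub>R norm (q - (x + s *\<^sub>R v))) ` Q"
      have "finite D" unfolding D_def using S(1) Q(1) by auto
      then have "finite (\<Union>e\<in>D. {(v - e) /\<^sub>R norm (v - e), - ((v - e) /\<^sub>R norm (v - e))})" by simp
      note s_good = elim
      from AE_surface_not_in_finite[OF dim \<open>finite (\<Union>e\<in>D. _ e)\<close>] AE_surface_norm
      have "AE n' in surface. ennreal (exp (- \<alpha>)) * (?E n' * (indicator {0<..<r} s * damping v s *
        duhamel g n (r - s) (x + s *\<^sub>R v) (specular n' v))) \<le> liminf (\<lambda>k. ?W k s n')"
      proof eventually_elim
        case (elim n')
        show ?case
        proof (cases "0 < s \<and> s < r \<and> v \<bullet> n' < 0")
          case True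
          have "specular n' v \<notin> D"
          proof
            assume "specular n' v \<in> D"
            moreover have "n' = (v - specular n' v) /\<^sub>R norm (v - specular n' v) \<or> n' = - ((v - specular n' v) /\<^sub>R norm (v - specular n' v))"
              by (rule specular_eq_normal[OF elim(2) _ refl]) (use True in simp)
            ultimately show False using elim(1) by blast
          qed
          then show ?thesis using True s_good elim(2)
            by (intro key) (auto simp: D_def)
        next
          case False
          then have zero: "?E n' * (indicator {0<..<r} s * damping v s * duhamel g n (r - s) (x + s *\<^sub>R v) (specular n' v)) = 0"
            by (auto simp: max_def split: split_indicator)
          show ?thesis unfolding zero by simp
        qed
      qed
      then show ?case by (rule nn_integral_mono_AE)
    qed
  qed
  also have "\<dots> \<le> (\<integral>\<^sup>+s. liminf (\<lambda>k. \<integral>\<^sup>+n'. ?W k s n' \<partial>surface) \<partial>lborel)"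
    by (intro nn_integral_mono nn_integral_liminf) measurable
  also have "\<dots> \<le> liminf (\<lambda>k. \<integral>\<^sup>+s. \<integral>\<^sup>+n'. ?W k s n' \<partial>surface \<partial>lborel)"
    by (rule nn_integral_liminf) measurable
  also have "\<dots> \<le> liminf (\<lambda>k. void_mean (PP k) (eps k) g (Suc n) r x v (A k) (P k))"
  proof (intro Liminf_mono always_eventually allI)
    fix k
    interpret poisson_config "PP k" "lam k" by (rule config)
    have "(\<integral>\<^sup>+s. \<integral>\<^sup>+n'. ?W k s n' \<partial>surface \<partial>lborel) =
       ennreal (lam k) * (ennreal (eps k ^ (DIM('a) - 1)) * (\<integral>\<^sup>+s. \<integral>\<^sup>+n'. ?W k s n' \<partial>surface \<partial>lborel))"
    proof -
      have "ennreal (lam k) * ennreal (eps k ^ (DIM('a) - 1)) = 1"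
        using scaling[of k] eps(1)[of k] lam_nonneg by (simp add: ennreal_mult[symmetric])
      then show ?thesis by (simp add: mult.assoc[symmetric])
    qed
    also have "\<dots> \<le> void_mean (PP k) (eps k) g (Suc n) r x v (A k) (P k)"
      by (rule void_mean_Suc_lower[OF v eps(1) A P g])
    finally show "(\<integral>\<^sup>+s. \<integral>\<^sup>+n'. ?W k s n' \<partial>surface \<partial>lborel) \<le> void_mean (PP k) (eps k) g (Suc n) r x v (A k) (P k)" .
  qed
  finally show ?case .
qed

section \<open>The damped form of mild solutions\<close>

text \<open>The specular reflection does not distinguish the two normals of a plane, which accounts for the factor
  \<open>1 / 2\<close> in the collision operator.\<close>

lemma nn_integral_even_abs:
  fixes h :: "'a::euclidean_space \<Rightarrow> ennreal"
  assumes [measurable]: "h \<in> borel_measurable borel" and even: "\<And>n. h (- n) = h n"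
  shows "(\<integral>\<^sup>+n. ennreal \<bar>v \<bullet> n\<bar> * h n \<partial>surface) = 2 * (\<integral>\<^sup>+n. ennreal (max 0 (- (v \<bullet> n))) * h n \<partial>surface)"
proof -
  have "(\<integral>\<^sup>+n. ennreal \<bar>v \<bullet> n\<bar> * h n \<partial>surface) =
     (\<integral>\<^sup>+n. ennreal (max 0 (- (v \<bullet> n))) * h n + ennreal (max 0 (- (v \<bullet> (- n)))) * h (- n) \<partial>surface)"
    by (intro nn_integral_cong) (auto simp: even abs_if max_def)
  also have "\<dots> = (\<integral>\<^sup>+n. ennreal (max 0 (- (v \<bullet> n))) * h n \<partial>surface) +
      (\<integral>\<^sup>+n. ennreal (max 0 (- (v \<bullet> (- n)))) * h (- n) \<partial>surface)"
    by (rule nn_integral_add) measurable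
  also have "(\<integral>\<^sup>+n. ennreal (max 0 (- (v \<bullet> (- n)))) * h (- n) \<partial>surface) =
      (\<integral>\<^sup>+n. ennreal (max 0 (- (v \<bullet> n))) * h n \<partial>surface)"
    by (rule nn_integral_surface_uminus[where f="\<lambda>n. ennreal (max 0 (- (v \<bullet> n))) * h n"]) measurable
  finally show ?thesis by (simp add: mult_2)
qed

lemma integral_sphere_measure:
  fixes f :: "'a::euclidean_space \<Rightarrow> real"
  assumes "f \<in> borel_measurable borel"
  shows "(\<integral>n. f n \<partial>sphere_measure) = (\<integral>n. f n \<partial>surface)"
  unfolding surface_def
  by (subst integral_distr) (use measurable_ident_sphere assms in
         \<open>auto simp: measurable_cong_sets[OF sets_sphere_measure refl]\<close>)

text \<open>The value at 0 is an arbitrary unit vector.\<close>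

definition direction :: "'a::euclidean_space \<Rightarrow> 'a" where
  "direction v = (if v = 0 then SOME b. b \<in> Basis else v /\<^sub>R norm v)"

lemma norm_direction: "norm (direction v) = 1"
  using some_in_eq[of "Basis :: 'a::euclidean_space set"] nonempty_Basis by (simp add: direction_def norm_Basis)

lemma direction_unit: "norm v = 1 \<Longrightarrow> direction v = v"
  by (auto simp: direction_def)

lemma measurable_direction [measurable]: "direction \<in> borel_measurable borel"
  unfolding direction_def[abs_def] by measurable

lemma measurable_direction_sphere: "direction \<in> borel \<rightarrow>\<^sub>M (sphere_measure :: 'a::euclidean_space measure)"
proof -
  have "direction \<in> borel \<rightarrow>\<^sub>M (restrict_space borel (sphere (0::'a) 1))"
    by (rule measurable_restrict_space2) (auto simp: norm_direction)
  then show ?thesis using measurable_cong_sets[OF refl sets_sphere_measure] by blast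
qed

lemma measurable_phase_time_extend:
  fixes F :: "real \<Rightarrow> 'a::euclidean_space \<Rightarrow> 'a \<Rightarrow> real"
  assumes F: "(\<lambda>(t, x, v). F t x v) \<in> borel_measurable phase_time_measure"
  shows "(\<lambda>(t, x, v). F (max 0 t) x (direction v)) \<in> borel_measurable (borel \<Otimes>\<^sub>M borel \<Otimes>\<^sub>M borel)"
proof -
  have m: "(\<lambda>t::real. max 0 t) \<in> borel \<rightarrow>\<^sub>M restrict_space lborel {0..}"
    by (rule measurable_restrict_space2) auto
  let ?M = "borel \<Otimes>\<^sub>M borel \<Otimes>\<^sub>M borel :: (real \<times> 'a \<times> 'a) measure"
  have c1: "(\<lambda>w. max 0 (fst w)) \<in> ?M \<rightarrow>\<^sub>M restrict_space lborel {0..}"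
    by (rule measurable_compose[OF measurable_fst m])
  have c2: "(\<lambda>w. fst (snd w)) \<in> ?M \<rightarrow>\<^sub>M lborel"
    unfolding measurable_lborel2 by measurable
  have c3: "(\<lambda>w. direction (snd (snd w))) \<in> ?M \<rightarrow>\<^sub>M sphere_measure"
    by (rule measurable_compose[OF _ measurable_direction_sphere]) measurable
  have "(\<lambda>w. (max 0 (fst w), fst (snd w), direction (snd (snd w)))) \<in>
      ?M \<rightarrow>\<^sub>M restrict_space lborel {0..} \<Otimes>\<^sub>M (lborel \<Otimes>\<^sub>M (sphere_measure :: 'a measure))"
    by (intro measurable_Pair c1 c2 c3)
  from measurable_compose[OF this F[unfolded phase_time_measure_def]] show ?thesis
    by (simp add: case_prod_beta)
qed

text \<open>Duhamel's formula with integrating factor \<open>exp (\<kappa> t)\<close>. Since \<open>\<phi>\<close> is only known to be an integral,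
  the factor is produced by Fubini on the triangle \<open>0 \<le> s \<le> u \<le> t\<close> instead of differentiation.\<close>

lemma damped_form:
  fixes w \<phi> :: "real \<Rightarrow> real"
  assumes t: "0 \<le> t" and [measurable]: "w \<in> borel_measurable borel" and B: "\<And>s. s \<in> {0..t} \<Longrightarrow> \<bar>w s\<bar> \<le> B"
    and \<phi>: "\<And>s. s \<in> {0..t} \<Longrightarrow> \<phi> s = \<phi>0 + (LINT u:{0..s}|lborel. w u)" and \<kappa>: "0 \<le> \<kappa>"
  shows "\<phi> t = exp (- (\<kappa> * t)) * \<phi>0 + (LINT u:{0..t}|lborel. exp (- (\<kappa> * (t - u))) * (w u + \<kappa> * \<phi> u))"
proof -
  have B0: "0 \<le> B" using B[of 0] t by force
  let ?f = "\<lambda>u s. indicator {0..t} u * indicator {0..u} s * (\<kappa> * exp (\<kappa> * u) * w s) :: real"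
  have int_bdd: "set_integrable lborel {a..b} h" if [measurable]: "h \<in> borel_measurable borel"
    and h: "\<And>s. s \<in> {a..b} \<Longrightarrow> \<bar>h s\<bar> \<le> K" for h :: "real \<Rightarrow> real" and a b K
    unfolding set_integrable_def
    by (rule integrableI_bounded_set_indicator[where B=K]) (use h in \<open>auto simp: emeasure_lborel_Icc_eq\<close>)
  have exp_le: "exp (\<kappa> * u) \<le> exp (\<kappa> * t)" if "u \<le> t" for u using that \<kappa> by (simp add: mult_left_mono)
  have exp_int: "(LINT u:{a..b}|lborel. \<kappa> * exp (\<kappa> * u)) = exp (\<kappa> * b) - exp (\<kappa> * a)" if "a \<le> b" for a b
    unfolding set_lebesgue_integral_def real_scaleR_def
    by (subst mult.commute, rule integral_FTC_Icc_real[OF that]) (auto intro!: derivative_eq_intros)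
  have fint: "integrable (lborel \<Otimes>\<^sub>M lborel) (\<lambda>(u, s). ?f u s)"
  proof (rule integrableI_bounded_set[where A="{0..t} \<times> {0..t}" and B="\<kappa> * exp (\<kappa> * t) * B"])
    show "emeasure (lborel \<Otimes>\<^sub>M lborel) ({0..t} \<times> {0..t}) < \<infinity>"
      using t by (simp add: lborel.emeasure_pair_measure_Times ennreal_mult_less_top)
    show "AE z\<in>{0..t} \<times> {0..t} in lborel \<Otimes>\<^sub>M lborel. norm ((\<lambda>(u, s). ?f u s) z) \<le> \<kappa> * exp (\<kappa> * t) * B"
    proof (intro AE_I2 impI)
      fix z :: "real \<times> real" assume "z \<in> {0..t} \<times> {0..t}"
      then obtain u s where z: "z = (u, s)" "u \<in> {0..t}" "s \<in> {0..t}" by auto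
      have "\<bar>?f u s\<bar> \<le> \<bar>\<kappa> * exp (\<kappa> * u) * w s\<bar>" by (auto split: split_indicator)
      also have "\<dots> = \<kappa> * exp (\<kappa> * u) * \<bar>w s\<bar>" using \<kappa> by (simp add: abs_mult)
      also have "\<dots> \<le> \<kappa> * exp (\<kappa> * t) * B" using z \<kappa> B0 by (intro mult_mono B exp_le) auto
      finally show "norm ((\<lambda>(u, s). ?f u s) z) \<le> \<kappa> * exp (\<kappa> * t) * B" by (simp add: z)
    qed
    show "AE z in lborel \<Otimes>\<^sub>M lborel. z \<notin> {0..t} \<times> {0..t} \<longrightarrow> (\<lambda>(u, s). ?f u s) z = 0"
      by (auto intro!: AE_I2 simp: indicator_def)
    have [measurable]: "(\<lambda>z. w (snd z)) \<in> borel_measurable (borel \<Otimes>\<^sub>M borel)"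
      by (rule measurable_compose[OF measurable_snd]) simp
    have "(\<lambda>(u, s). ?f u s) \<in> borel_measurable (borel \<Otimes>\<^sub>M borel)"
      unfolding case_prod_beta indicator_def of_bool_def atLeastAtMost_iff by measurable
    then show "(\<lambda>(u, s). ?f u s) \<in> borel_measurable (lborel \<Otimes>\<^sub>M lborel)" by measurable
  qed measurable
  have wint: "set_integrable lborel {0..t} w" by (rule int_bdd[OF _ B]) auto
  have weint: "set_integrable lborel {0..t} (\<lambda>s. exp (\<kappa> * s) * w s)"
    by (rule int_bdd[where K="exp (\<kappa> * t) * B"]) (auto simp: abs_mult intro!: mult_mono B exp_le)
  have "(LINT u:{0..t}|lborel. \<kappa> * exp (\<kappa> * u) * \<phi> u) = (LINT u:{0..t}|lborel. \<kappa> * exp (\<kappa> * u) * \<phi>0 + (LINT s|lborel. ?f u s))"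
  proof (rule set_lebesgue_integral_cong)
    show "\<forall>u. u \<in> {0..t} \<longrightarrow> \<kappa> * exp (\<kappa> * u) * \<phi> u = \<kappa> * exp (\<kappa> * u) * \<phi>0 + (LINT s|lborel. ?f u s)"
    proof (intro allI impI)
      fix u assume u: "u \<in> {0..t}"
      have "(LINT s|lborel. ?f u s) = (LINT s|lborel. (\<kappa> * exp (\<kappa> * u)) * (indicator {0..u} s * w s))"
        using u by (intro Bochner_Integration.integral_cong) auto
      also have "\<dots> = \<kappa> * exp (\<kappa> * u) * (LINT s:{0..u}|lborel. w s)"
        by (simp add: set_lebesgue_integral_def)
      finally show "\<kappa> * exp (\<kappa> * u) * \<phi> u = \<kappa> * exp (\<kappa> * u) * \<phi>0 + (LINT s|lborel. ?f u s)"
        by (simp add: \<phi>[OF u] distrib_left)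
    qed
  qed simp
  also have "\<dots> = (LINT u:{0..t}|lborel. \<kappa> * exp (\<kappa> * u) * \<phi>0) + (LINT u:{0..t}|lborel. (LINT s|lborel. ?f u s))"
  proof (rule set_integral_add)
    show "set_integrable lborel {0..t} (\<lambda>u. \<kappa> * exp (\<kappa> * u) * \<phi>0)"
      by (rule int_bdd[where K="\<kappa> * exp (\<kappa> * t) * \<bar>\<phi>0\<bar>"]) (use \<kappa> in \<open>auto simp: abs_mult intro!: mult_mono exp_le\<close>)
    have "integrable lborel (\<lambda>u. LINT s|lborel. ?f u s)"
      using lborel_pair.integrable_fst[OF fint] by simp
    also have "(\<lambda>u. LINT s|lborel. ?f u s) = (\<lambda>u. indicator {0..t} u *\<^sub>R (LINT s|lborel. ?f u s))"
      by (auto split: split_indicator)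
    finally show "set_integrable lborel {0..t} (\<lambda>u. LINT s|lborel. ?f u s)" unfolding set_integrable_def .
  qed
  also have "(LINT u:{0..t}|lborel. \<kappa> * exp (\<kappa> * u) * \<phi>0) = (exp (\<kappa> * t) - 1) * \<phi>0"
    using exp_int[OF t] by simp
  also have "(LINT u:{0..t}|lborel. (LINT s|lborel. ?f u s)) = (LINT u|lborel. LINT s|lborel. ?f u s)"
    unfolding set_lebesgue_integral_def by (intro Bochner_Integration.integral_cong) (auto split: split_indicator)
  also have "\<dots> = (LINT s|lborel. LINT u|lborel. ?f u s)"
    by (rule lborel_pair.Fubini_integral[OF fint, symmetric])
  also have "\<dots> = (LINT s:{0..t}|lborel. (exp (\<kappa> * t) * w s - exp (\<kappa> * s) * w s))"
    unfolding set_lebesgue_integral_def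
  proof (rule Bochner_Integration.integral_cong[OF refl])
    fix s :: real
    show "(LINT u|lborel. ?f u s) = indicator {0..t} s *\<^sub>R (exp (\<kappa> * t) * w s - exp (\<kappa> * s) * w s)"
    proof (cases "s \<in> {0..t}")
      case True
      have "(LINT u|lborel. ?f u s) = (LINT u|lborel. (indicator {s..t} u *\<^sub>R (\<kappa> * exp (\<kappa> * u))) * w s)"
        using True by (intro Bochner_Integration.integral_cong) (auto split: split_indicator)
      also have "\<dots> = (LINT u:{s..t}|lborel. \<kappa> * exp (\<kappa> * u)) * w s"
        unfolding set_lebesgue_integral_def by simp
      also have "\<dots> = (exp (\<kappa> * t) - exp (\<kappa> * s)) * w s" using exp_int[of s t] True by simp
      finally show ?thesis using True by (simp add: algebra_simps)
    next
      case False
      then have zero: "(\<lambda>u. ?f u s) = (\<lambda>_. 0)" by (auto split: split_indicator)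
      show ?thesis unfolding zero using False by simp
    qed
  qed
  also have "\<dots> = exp (\<kappa> * t) * (LINT s:{0..t}|lborel. w s) - (LINT s:{0..t}|lborel. exp (\<kappa> * s) * w s)"
    by (subst set_integral_diff) (use wint weint in auto)
  finally have main: "(LINT u:{0..t}|lborel. \<kappa> * exp (\<kappa> * u) * \<phi> u) + (LINT s:{0..t}|lborel. exp (\<kappa> * s) * w s) =
     exp (\<kappa> * t) * \<phi> t - \<phi>0"
    using \<phi>[of t] t by (simp add: algebra_simps)
  have \<phi>int: "set_integrable lborel {0..t} (\<lambda>u. \<kappa> * exp (\<kappa> * u) * \<phi> u)"
  proof -
    have "set_integrable lborel {0..t} (\<lambda>u. \<kappa> * exp (\<kappa> * u) * \<phi>0 + (LINT s|lborel. ?f u s))"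
    proof (rule set_integral_add)
      show "set_integrable lborel {0..t} (\<lambda>u. \<kappa> * exp (\<kappa> * u) * \<phi>0)"
        by (rule int_bdd[where K="\<kappa> * exp (\<kappa> * t) * \<bar>\<phi>0\<bar>"]) (use \<kappa> in \<open>auto simp: abs_mult intro!: mult_mono exp_le\<close>)
      have "integrable lborel (\<lambda>u. LINT s|lborel. ?f u s)"
        using lborel_pair.integrable_fst[OF fint] by simp
      also have "(\<lambda>u. LINT s|lborel. ?f u s) = (\<lambda>u. indicator {0..t} u *\<^sub>R (LINT s|lborel. ?f u s))"
        by (auto split: split_indicator)
      finally show "set_integrable lborel {0..t} (\<lambda>u. LINT s|lborel. ?f u s)" unfolding set_integrable_def .
    qed
    also have "?this \<longleftrightarrow> ?thesis"
      unfolding set_integrable_def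
    proof (intro Bochner_Integration.integrable_cong refl)
      fix u :: real
      show "indicator {0..t} u *\<^sub>R (\<kappa> * exp (\<kappa> * u) * \<phi>0 + (LINT s|lborel. ?f u s)) = indicator {0..t} u *\<^sub>R (\<kappa> * exp (\<kappa> * u) * \<phi> u)"
      proof (cases "u \<in> {0..t}")
        case True
        have "(LINT s|lborel. ?f u s) = (LINT s|lborel. (\<kappa> * exp (\<kappa> * u)) * (indicator {0..u} s * w s))"
          using True by (intro Bochner_Integration.integral_cong) auto
        also have "\<dots> = \<kappa> * exp (\<kappa> * u) * (LINT s:{0..u}|lborel. w s)"
          by (simp add: set_lebesgue_integral_def)
        finally show ?thesis by (simp add: \<phi>[OF True] distrib_left)
      qed simp
    qed
    finally show ?thesis .
  qed
  have "(LINT u:{0..t}|lborel. exp (- (\<kappa> * (t - u))) * (w u + \<kappa> * \<phi> u)) =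
     (LINT u:{0..t}|lborel. exp (- (\<kappa> * t)) * (\<kappa> * exp (\<kappa> * u) * \<phi> u + exp (\<kappa> * u) * w u))"
    by (intro set_lebesgue_integral_cong) (auto simp: algebra_simps exp_add[symmetric])
  also have "\<dots> = exp (- (\<kappa> * t)) * ((LINT u:{0..t}|lborel. \<kappa> * exp (\<kappa> * u) * \<phi> u) + (LINT u:{0..t}|lborel. exp (\<kappa> * u) * w u))"
    by (subst set_integral_add(2)[OF \<phi>int weint, symmetric]) simp
  also have "\<dots> = exp (- (\<kappa> * t)) * (exp (\<kappa> * t) * \<phi> t - \<phi>0)" unfolding main ..
  finally show ?thesis by (simp add: algebra_simps exp_add[symmetric])
qed

text \<open>An extension from the phase space to all times and velocities that is Borel measurable.\<close>

definition extend_phase :: "(real \<Rightarrow> 'a::euclidean_space \<Rightarrow> 'a \<Rightarrow> real) \<Rightarrow> real \<Rightarrow> 'a \<Rightarrow> 'a \<Rightarrow> real" where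
  "extend_phase F t x v = F (max 0 t) x (direction v)"

lemma extend_phase_eq: "0 \<le> t \<Longrightarrow> norm v = 1 \<Longrightarrow> extend_phase F t x v = F t x v"
  by (simp add: extend_phase_def direction_unit max_def)

lemma boltzmann_collision_surface:
  fixes F :: "real \<Rightarrow> 'a::euclidean_space \<Rightarrow> 'a \<Rightarrow> real"
  assumes F: "(\<lambda>(t, x, v). extend_phase F t x v) \<in> borel_measurable (borel \<Otimes>\<^sub>M borel \<Otimes>\<^sub>M borel)"
    and s: "0 \<le> s" and u: "norm u = 1"
  shows "boltzmann_collision (F s z) u =
     1 / 2 * (\<integral>n. (extend_phase F s z (specular n u) - extend_phase F s z u) * \<bar>u \<bullet> n\<bar> \<partial>surface)"
proof -
  have [measurable]: "(\<lambda>n. extend_phase F s z (specular n u)) \<in> borel_measurable borel"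
    using measurable_compose[OF _ F, of "\<lambda>n. (s, z, specular n u)" borel] by simp
  have "(\<integral>n. (F s z (specular n u) - F s z u) * \<bar>u \<bullet> n\<bar> \<partial>sphere_measure) =
     (\<integral>n. (extend_phase F s z (specular n u) - extend_phase F s z u) * \<bar>u \<bullet> n\<bar> \<partial>sphere_measure)"
    by (intro Bochner_Integration.integral_cong refl)
       (simp add: space_sphere_measure extend_phase_eq s u norm_specular)
  also have "\<dots> = (\<integral>n. (extend_phase F s z (specular n u) - extend_phase F s z u) * \<bar>u \<bullet> n\<bar> \<partial>surface)"
    by (rule integral_sphere_measure) measurable
  finally show ?thesis by (simp add: boltzmann_collision_def)
qed

text \<open>The loss term of the collision operator is \<open>\<kappa>\<close> times the solution, with \<open>\<kappa>\<close> the collision rate, so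
  \<open>damped_form\<close> absorbs it into the exponential and leaves a positive gain term. This is written along
  the backward line, with velocity \<open>v\<close> for the particle velocity \<open>- v\<close>.\<close>

theorem mild_solution_gain_form:
  fixes F :: "real \<Rightarrow> 'a::euclidean_space \<Rightarrow> 'a \<Rightarrow> real"
  assumes mild: "boltzmann_mild_solution fin F"
    and nonneg: "\<And>t x v. 0 \<le> t \<Longrightarrow> t \<le> T \<Longrightarrow> norm v = 1 \<Longrightarrow> 0 \<le> F t x v"
    and v: "norm v = 1" and r: "0 < r" "r \<le> T"
  shows "ennreal (F r x (- v)) = damping v r * ennreal (fin (x + r *\<^sub>R v) (- v)) +
     (\<integral>\<^sup>+s. \<integral>\<^sup>+n. ennreal (max 0 (- (v \<bullet> n))) * (indicator {0<..<r} s * damping v s *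
        ennreal (extend_phase F (r - s) (x + s *\<^sub>R v) (- specular n v))) \<partial>surface \<partial>lborel)"
proof -
  define u where "u = - v"
  have u: "norm u = 1" using v by (simp add: u_def)
  define y where "y = x + r *\<^sub>R v"
  let ?F = "extend_phase F"
  have F [measurable]: "(\<lambda>(t, x, v). ?F t x v) \<in> borel_measurable (borel \<Otimes>\<^sub>M borel \<Otimes>\<^sub>M borel)"
    unfolding extend_phase_def by (rule measurable_phase_time_extend) (use mild in \<open>simp add: boltzmann_mild_solution_def\<close>)
  have F' [measurable (raw)]: "(\<lambda>w. ?F (f w) (h w) (k w)) \<in> borel_measurable N"
    if "f \<in> borel_measurable N" "h \<in> borel_measurable N" "k \<in> borel_measurable N"
    for N :: "'n measure" and f h k
    using measurable_compose[OF measurable_Pair[OF that(1) measurable_Pair[OF that(2,3)]] F] by simp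
  obtain B where B: "\<And>t x v. t \<in> {0..T} \<Longrightarrow> norm v = 1 \<Longrightarrow> \<bar>F t x v\<bar> \<le> B"
    using mild unfolding boltzmann_mild_solution_def by (metis mem_sphere_0)
  have FB: "\<bar>?F t z w\<bar> \<le> B" if "t \<in> {0..r}" for t z w
    using B[of t "direction w" z] that r by (simp add: extend_phase_def norm_direction max_def)
  have F0: "0 \<le> ?F t z w" if "t \<in> {0..r}" for t z w
    using nonneg[of t "direction w" z] that r by (simp add: extend_phase_def norm_direction max_def)
  have B0: "0 \<le> B" using FB[of 0] r by (force intro: order_trans[OF abs_ge_zero])
  define \<kappa> where "\<kappa> = 1 / 2 * (\<integral>n. \<bar>u \<bullet> n\<bar> \<partial>surface)"
  have AEu: "AE n in surface. \<bar>u \<bullet> n\<bar> \<le> 1"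
    using AE_surface_norm
  proof eventually_elim
    case (elim n)
    then show ?case using Cauchy_Schwarz_ineq2[of u n] u by simp
  qed
  have int1: "integrable surface (\<lambda>n. \<bar>u \<bullet> n\<bar>)"
    by (rule surface.integrable_const_bound[of _ 1]) (use AEu in auto)
  have int2: "integrable surface (\<lambda>n. ?F s z (specular n u) * \<bar>u \<bullet> n\<bar>)" if "s \<in> {0..r}" for s z
  proof (rule surface.integrable_const_bound[of _ B])
    show "AE n in surface. norm (?F s z (specular n u) * \<bar>u \<bullet> n\<bar>) \<le> B"
      using AEu
    proof eventually_elim
      case (elim n)
      have "\<bar>?F s z (specular n u)\<bar> * \<bar>u \<bullet> n\<bar> \<le> B * 1" using FB[OF that] elim B0 by (intro mult_mono) auto
      then show ?case by (simp add: abs_mult)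
    qed
  qed measurable
  define q where "q s = 1 / 2 * (\<integral>n. ?F s (y + s *\<^sub>R u) (specular n u) * \<bar>u \<bullet> n\<bar> \<partial>surface)" for s
  define w where "w s = 1 / 2 * (\<integral>n. (?F s (y + s *\<^sub>R u) (specular n u) - ?F s (y + s *\<^sub>R u) u) * \<bar>u \<bullet> n\<bar> \<partial>surface)" for s
  define \<phi> where "\<phi> s = F s (y + s *\<^sub>R u) u" for s
  have [measurable]: "q \<in> borel_measurable borel" "w \<in> borel_measurable borel"
    unfolding q_def w_def by measurable
  have \<kappa>0: "0 \<le> \<kappa>" by (simp add: \<kappa>_def)
  have wq: "w s = q s - \<kappa> * \<phi> s" if "s \<in> {0..r}" for s
  proof -
    have "?F s (y + s *\<^sub>R u) u = \<phi> s" using that u by (simp add: extend_phase_eq \<phi>_def)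
    then show ?thesis using int1 int2[OF that]
      by (simp add: w_def q_def \<kappa>_def left_diff_distrib right_diff_distrib)
  qed
  have qB: "0 \<le> q s" "q s \<le> B * \<kappa>" if "s \<in> {0..r}" for s
  proof -
    show "0 \<le> q s" using F0[OF that] by (simp add: q_def integral_nonneg_AE)
    have "(\<integral>n. ?F s (y + s *\<^sub>R u) (specular n u) * \<bar>u \<bullet> n\<bar> \<partial>surface) \<le> (\<integral>n. B * \<bar>u \<bullet> n\<bar> \<partial>surface)"
    proof (rule integral_mono[OF int2[OF that]])
      show "integrable surface (\<lambda>n. B * \<bar>u \<bullet> n\<bar>)" using int1 by simp
      show "?F s (y + s *\<^sub>R u) (specular n u) * \<bar>u \<bullet> n\<bar> \<le> B * \<bar>u \<bullet> n\<bar>" for n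
        by (rule mult_right_mono[OF abs_le_D1[OF FB[OF that]]]) simp
    qed
    then show "q s \<le> B * \<kappa>" by (simp add: q_def \<kappa>_def)
  qed
  have \<phi>_eq: "\<phi> s = fin y u + (LINT a:{0..s}|lborel. w a)" if s: "s \<in> {0..r}" for s
  proof -
    have "\<phi> s = fin (y + s *\<^sub>R u - s *\<^sub>R u) u +
       (LINT a:{0..s}|lborel. boltzmann_collision (F a (y + s *\<^sub>R u - (s - a) *\<^sub>R u)) u)"
      using mild s u unfolding boltzmann_mild_solution_def \<phi>_def by simp
    also have "(LINT a:{0..s}|lborel. boltzmann_collision (F a (y + s *\<^sub>R u - (s - a) *\<^sub>R u)) u) = (LINT a:{0..s}|lborel. w a)"
    proof (rule set_lebesgue_integral_cong)
      show "\<forall>a. a \<in> {0..s} \<longrightarrow> boltzmann_collision (F a (y + s *\<^sub>R u - (s - a) *\<^sub>R u)) u = w a"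
      proof (intro allI impI)
        fix a assume a: "a \<in> {0..s}"
        have eq: "y + s *\<^sub>R u - (s - a) *\<^sub>R u = y + a *\<^sub>R u" by (simp add: algebra_simps)
        show "boltzmann_collision (F a (y + s *\<^sub>R u - (s - a) *\<^sub>R u)) u = w a"
          unfolding eq w_def by (rule boltzmann_collision_surface[OF F _ u]) (use a in simp)
      qed
    qed simp
    finally show ?thesis by simp
  qed
  have \<phi>B: "\<bar>\<phi> s\<bar> \<le> B" if "s \<in> {0..r}" for s using B[of s u] that r u by (simp add: \<phi>_def)
  have wB: "\<bar>w s\<bar> \<le> 2 * (B * \<kappa>)" if "s \<in> {0..r}" for s
  proof -
    have "\<bar>w s\<bar> \<le> \<bar>q s\<bar> + \<kappa> * \<bar>\<phi> s\<bar>" unfolding wq[OF that] using \<kappa>0 by (metis abs_mult abs_of_nonneg abs_triangle_ineq4)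
    also have "\<dots> \<le> B * \<kappa> + \<kappa> * B" using qB[OF that] \<phi>B[OF that] \<kappa>0 by (intro add_mono mult_left_mono) auto
    finally show ?thesis by simp
  qed
  have "\<phi> r = exp (- (\<kappa> * r)) * fin y u + (LINT s:{0..r}|lborel. exp (- (\<kappa> * (r - s))) * (w s + \<kappa> * \<phi> s))"
    by (rule damped_form[OF _ _ wB \<phi>_eq \<kappa>0]) (use r in auto)
  also have "(LINT s:{0..r}|lborel. exp (- (\<kappa> * (r - s))) * (w s + \<kappa> * \<phi> s)) =
      (LINT s:{0..r}|lborel. exp (- (\<kappa> * (r - s))) * q s)"
    by (intro set_lebesgue_integral_cong) (auto simp: wq)
  finally have \<phi>r: "\<phi> r = exp (- (\<kappa> * r)) * fin y u + (LINT s:{0..r}|lborel. exp (- (\<kappa> * (r - s))) * q s)" .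
  have \<kappa>_rate: "ennreal \<kappa> = collision_rate v"
  proof -
    have "ennreal \<kappa> = ennreal (1 / 2) * ennreal (\<integral>n. \<bar>u \<bullet> n\<bar> \<partial>surface)" unfolding \<kappa>_def by (subst ennreal_mult) auto
    also have "ennreal (\<integral>n. \<bar>u \<bullet> n\<bar> \<partial>surface) = (\<integral>\<^sup>+n. ennreal \<bar>v \<bullet> n\<bar> * 1 \<partial>surface)"
      using nn_integral_eq_integral[OF int1] by (simp add: u_def)
    also have "\<dots> = 2 * collision_rate v"
      by (subst nn_integral_even_abs) (simp_all add: collision_rate_def)
    also have "ennreal (1 / 2) * (2 * collision_rate v) = (ennreal (1 / 2) * ennreal 2) * collision_rate v" by (simp add: mult.assoc)
    also have "ennreal (1 / 2) * ennreal 2 = 1" by (subst ennreal_mult[symmetric]) auto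
    finally show ?thesis by simp
  qed
  then have \<kappa>_eq: "enn2real (collision_rate v) = \<kappa>" using \<kappa>0 by (metis enn2real_ennreal)
  have q_nn: "ennreal (q s) = (\<integral>\<^sup>+n. ennreal (max 0 (- (v \<bullet> n))) * ennreal (?F s (y + s *\<^sub>R u) (specular n u)) \<partial>surface)"
    if s: "s \<in> {0..r}" for s
  proof -
    let ?h = "\<lambda>n. ennreal (?F s (y + s *\<^sub>R u) (specular n u))"
    have "ennreal (q s) = ennreal (1 / 2) * ennreal (\<integral>n. ?F s (y + s *\<^sub>R u) (specular n u) * \<bar>u \<bullet> n\<bar> \<partial>surface)"
      unfolding q_def using F0[OF s] by (subst ennreal_mult) (auto intro!: integral_nonneg_AE)
    also have "ennreal (\<integral>n. ?F s (y + s *\<^sub>R u) (specular n u) * \<bar>u \<bullet> n\<bar> \<partial>surface) = (\<integral>\<^sup>+n. ennreal \<bar>v \<bullet> n\<bar> * ?h n \<partial>surface)"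
      using F0[OF s] by (subst nn_integral_eq_integral[OF int2[OF s], symmetric])
        (auto simp: u_def ennreal_mult'[symmetric] mult.commute intro!: nn_integral_cong)
    also have "\<dots> = 2 * (\<integral>\<^sup>+n. ennreal (max 0 (- (v \<bullet> n))) * ?h n \<partial>surface)"
      by (rule nn_integral_even_abs) (simp_all add: specular_minus_normal)
    also have "ennreal (1 / 2) * \<dots> = (ennreal (1 / 2) * ennreal 2) * (\<integral>\<^sup>+n. ennreal (max 0 (- (v \<bullet> n))) * ?h n \<partial>surface)"
      by (simp add: mult.assoc)
    also have "ennreal (1 / 2) * ennreal 2 = 1" by (subst ennreal_mult[symmetric]) auto
    finally show ?thesis by simp
  qed
  have fin0: "0 \<le> fin y u"
  proof -
    have "(LINT a:{0..0}|lborel. w a) = 0"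
      unfolding set_lebesgue_integral_def
      by (rule integral_eq_zero_AE) (use AE_lborel_singleton[of 0] in \<open>auto elim!: eventually_mono\<close>)
    then show ?thesis using \<phi>_eq[of 0] nonneg[of 0 u y] r u by (simp add: \<phi>_def)
  qed
  let ?g = "\<lambda>s. indicator {0..r} s *\<^sub>R (exp (- (\<kappa> * (r - s))) * q s)"
  have gint: "integrable lborel ?g"
  proof (rule integrableI_bounded_set_indicator[where B="B * \<kappa>"])
    show "AE s\<in>{0..r} in lborel. norm (exp (- (\<kappa> * (r - s))) * q s) \<le> B * \<kappa>"
    proof (intro AE_I2 impI)
      fix s assume s: "s \<in> {0..r}"
      then have "0 \<le> \<kappa> * (r - s)" using \<kappa>0 by simp
      then have "exp (- (\<kappa> * (r - s))) * q s \<le> 1 * (B * \<kappa>)" using qB[OF s] by (intro mult_mono) auto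
      then show "norm (exp (- (\<kappa> * (r - s))) * q s) \<le> B * \<kappa>" using qB[OF s] by (simp add: abs_mult)
    qed
  qed (use r in auto)
  have g0: "0 \<le> ?g s" for s using qB(1)[of s] by (auto split: split_indicator)
  have "ennreal (F r x (- v)) = ennreal (\<phi> r)" by (simp add: \<phi>_def y_def u_def)
  also have "\<dots> = ennreal (exp (- (\<kappa> * r))) * ennreal (fin y u) + ennreal (integral\<^sup>L lborel ?g)"
    unfolding \<phi>r set_lebesgue_integral_def using fin0 g0
    by (subst ennreal_plus) (auto simp: ennreal_mult intro!: integral_nonneg_AE)
  also have "ennreal (exp (- (\<kappa> * r))) * ennreal (fin y u) = damping v r * ennreal (fin (x + r *\<^sub>R v) (- v))"
    by (simp add: damping_def \<kappa>_eq y_def u_def)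
  also have "ennreal (integral\<^sup>L lborel ?g) = (\<integral>\<^sup>+s. ennreal (?g s) \<partial>lborel)"
    by (rule nn_integral_eq_integral[symmetric, OF gint]) (use g0 in auto)
  also have "\<dots> = ennreal \<bar>-1\<bar> * (\<integral>\<^sup>+s. ennreal (?g (r + (-1) * s)) \<partial>lborel)"
    by (rule nn_integral_real_affine) auto
  also have "\<dots> = (\<integral>\<^sup>+s. ennreal (?g (r - s)) \<partial>lborel)" by simp
  also have "\<dots> = (\<integral>\<^sup>+s. \<integral>\<^sup>+n. ennreal (max 0 (- (v \<bullet> n))) * (indicator {0<..<r} s * damping v s *
        ennreal (extend_phase F (r - s) (x + s *\<^sub>R v) (- specular n v))) \<partial>surface \<partial>lborel)"
  proof (rule nn_integral_cong_AE)
    have "AE s in lborel. s \<noteq> 0 \<and> s \<noteq> r" by (intro AE_conjI AE_lborel_singleton)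
    then show "AE s in lborel. ennreal (?g (r - s)) = (\<integral>\<^sup>+n. ennreal (max 0 (- (v \<bullet> n))) * (indicator {0<..<r} s * damping v s *
        ennreal (extend_phase F (r - s) (x + s *\<^sub>R v) (- specular n v))) \<partial>surface)"
    proof eventually_elim
      case (elim s)
      show ?case
      proof (cases "s \<in> {0<..<r}")
        case True
        then have s: "r - s \<in> {0..r}" by auto
        have pos: "y + (r - s) *\<^sub>R u = x + s *\<^sub>R v" by (simp add: y_def u_def algebra_simps)
        have "ennreal (?g (r - s)) = damping v s * ennreal (q (r - s))"
          using s qB(1)[OF s] by (simp add: damping_def \<kappa>_eq ennreal_mult)
        also have "\<dots> = (\<integral>\<^sup>+n. damping v s * (ennreal (max 0 (- (v \<bullet> n))) * ennreal (?F (r - s) (x + s *\<^sub>R v) (specular n u))) \<partial>surface)"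
          unfolding q_nn[OF s] pos by (rule nn_integral_cmult[symmetric]) measurable
        finally show ?thesis using True by (simp add: u_def specular_minus mult_ac)
      next
        case False
        then have "r - s \<notin> {0..r}" using elim by auto
        then show ?thesis using False by simp
      qed
    qed
  qed
  finally show ?thesis .
qed

section \<open>Mild solutions as Duhamel series\<close>

text \<open>The integral term of the damped equation.\<close>

definition gain :: "(real \<Rightarrow> 'a::euclidean_space \<Rightarrow> 'a \<Rightarrow> ennreal) \<Rightarrow> real \<Rightarrow> 'a \<Rightarrow> 'a \<Rightarrow> ennreal" where
  "gain h r x v = (\<integral>\<^sup>+s. \<integral>\<^sup>+n. ennreal (max 0 (- (v \<bullet> n))) *
     (indicator {0<..<r} s * damping v s * h (r - s) (x + s *\<^sub>R v) (specular n v)) \<partial>surface \<partial>lborel)"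

lemma duhamel_Suc_gain: "duhamel g (Suc n) r x v = gain (duhamel g n) r x v"
  by (simp add: gain_def)

lemma gain_mono:
  assumes "\<And>s x v. 0 < s \<Longrightarrow> s < r \<Longrightarrow> norm v = 1 \<Longrightarrow> f s x v \<le> h s x v" and v: "norm v = 1"
  shows "gain f r x v \<le> gain h r x v"
  unfolding gain_def
proof (rule nn_integral_mono, rule nn_integral_mono_AE)
  fix s
  show "AE n in surface. ennreal (max 0 (- (v \<bullet> n))) * (indicator {0<..<r} s * damping v s * f (r - s) (x + s *\<^sub>R v) (specular n v))
     \<le> ennreal (max 0 (- (v \<bullet> n))) * (indicator {0<..<r} s * damping v s * h (r - s) (x + s *\<^sub>R v) (specular n v))"
    using AE_surface_norm
  proof eventually_elim
    case (elim n)
    show ?case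
    proof (cases "s \<in> {0<..<r}")
      case True
      then show ?thesis using assms(1)[of "r - s" "specular n v"] norm_specular[OF elim, of v] v
        by (intro mult_left_mono) auto
    qed simp
  qed
qed

lemma measurable_gain_integrand:
  fixes h :: "real \<Rightarrow> 'a::euclidean_space \<Rightarrow> 'a \<Rightarrow> ennreal"
  assumes h: "(\<lambda>(r, x, v). h r x v) \<in> borel_measurable (borel \<Otimes>\<^sub>M borel \<Otimes>\<^sub>M borel)"
  shows "(\<lambda>(s, n). ennreal (max 0 (- (v \<bullet> n))) * (indicator {0<..<r} s * damping v s * h (r - s) (x + s *\<^sub>R v) (specular n v)))
     \<in> borel_measurable (borel \<Otimes>\<^sub>M borel)"
proof -
  have [measurable]: "(\<lambda>w. h (r - fst w) (x + fst w *\<^sub>R v) (specular (snd w) v)) \<in> borel_measurable (borel \<Otimes>\<^sub>M borel)"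
    using measurable_compose[OF _ h, of "\<lambda>w. (r - fst w, x + fst w *\<^sub>R v, specular (snd w) v)" "borel \<Otimes>\<^sub>M borel"] by simp
  show ?thesis unfolding case_prod_beta by measurable
qed

lemma gain_add:
  fixes f h :: "real \<Rightarrow> 'a::euclidean_space \<Rightarrow> 'a \<Rightarrow> ennreal"
  assumes f: "(\<lambda>(r, x, v). f r x v) \<in> borel_measurable (borel \<Otimes>\<^sub>M borel \<Otimes>\<^sub>M borel)"
    and h: "(\<lambda>(r, x, v). h r x v) \<in> borel_measurable (borel \<Otimes>\<^sub>M borel \<Otimes>\<^sub>M borel)"
  shows "gain (\<lambda>r x v. f r x v + h r x v) r x v = gain f r x v + gain h r x v"
proof -
  let ?k = "\<lambda>h s n. ennreal (max 0 (- (v \<bullet> n))) * (indicator {0<..<r} s * damping v s * h (r - s) (x + s *\<^sub>R v) (specular n v))"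
  have m: "(\<lambda>n. ?k q s n) \<in> borel_measurable surface" "(\<lambda>s. \<integral>\<^sup>+n. ?k q s n \<partial>surface) \<in> borel_measurable lborel"
    if "(\<lambda>(r, x, v). q r x v) \<in> borel_measurable (borel \<Otimes>\<^sub>M borel \<Otimes>\<^sub>M borel)" for q :: "real \<Rightarrow> 'a \<Rightarrow> 'a \<Rightarrow> ennreal" and s
  proof -
    note [measurable] = measurable_gain_integrand[OF that, of v r x]
    show "(\<lambda>n. ?k q s n) \<in> borel_measurable surface"
      using measurable_compose[OF measurable_Pair1' measurable_gain_integrand[OF that, of v r x], of s] by simp
    show "(\<lambda>s. \<integral>\<^sup>+n. ?k q s n \<partial>surface) \<in> borel_measurable lborel" by measurable
  qed
  have "gain (\<lambda>r x v. f r x v + h r x v) r x v = (\<integral>\<^sup>+s. \<integral>\<^sup>+n. ?k f s n + ?k h s n \<partial>surface \<partial>lborel)"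
    unfolding gain_def by (simp only: distrib_left)
  also have "\<dots> = (\<integral>\<^sup>+s. (\<integral>\<^sup>+n. ?k f s n \<partial>surface) + (\<integral>\<^sup>+n. ?k h s n \<partial>surface) \<partial>lborel)"
    by (intro nn_integral_cong nn_integral_add m f h)
  also have "\<dots> = gain f r x v + gain h r x v"
    unfolding gain_def by (intro nn_integral_add m f h)
  finally show ?thesis .
qed

lemma measurable_duhamel_sum:
  assumes g: "(\<lambda>(x, v). g x v) \<in> borel_measurable (borel \<Otimes>\<^sub>M borel)"
  shows "(\<lambda>(r, x, v). \<Sum>k<n. duhamel g k r x v) \<in> borel_measurable (borel \<Otimes>\<^sub>M borel \<Otimes>\<^sub>M borel)"
proof -
  have "(\<lambda>w. \<Sum>k<n. (case w of (r, x, v) \<Rightarrow> duhamel g k r x v)) \<in> borel_measurable (borel \<Otimes>\<^sub>M borel \<Otimes>\<^sub>M borel)"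
    by (intro borel_measurable_sum measurable_duhamel[OF g])
  then show ?thesis by (simp only: case_prod_beta')
qed

lemma gain_sum_duhamel:
  assumes g: "(\<lambda>(x, v). g x v) \<in> borel_measurable (borel \<Otimes>\<^sub>M borel)"
  shows "gain (\<lambda>r x v. \<Sum>k<n. duhamel g k r x v) r x v = (\<Sum>k<n. duhamel g (Suc k) r x v)"
proof (induction n)
  case 0
  show ?case by (simp add: gain_def)
next
  case (Suc n)
  have "gain (\<lambda>r x v. (\<Sum>k<n. duhamel g k r x v) + duhamel g n r x v) r x v =
     gain (\<lambda>r x v. \<Sum>k<n. duhamel g k r x v) r x v + gain (duhamel g n) r x v"
    by (rule gain_add[OF measurable_duhamel_sum[OF g] measurable_duhamel[OF g]])
  then show ?case using Suc by (simp del: duhamel.simps add: duhamel_Suc_gain)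
qed

lemma duhamel_add:
  assumes g: "(\<lambda>(x, v). g x v) \<in> borel_measurable (borel \<Otimes>\<^sub>M borel)"
    and g': "(\<lambda>(x, v). g' x v) \<in> borel_measurable (borel \<Otimes>\<^sub>M borel)"
  shows "duhamel (\<lambda>x v. g x v + g' x v) n r x v = duhamel g n r x v + duhamel g' n r x v"
proof (induction n arbitrary: r x v)
  case (Suc n)
  have "duhamel (\<lambda>x v. g x v + g' x v) n = (\<lambda>r x v. duhamel g n r x v + duhamel g' n r x v)"
    by (intro ext Suc)
  then show ?case unfolding duhamel_Suc_gain by (simp only: gain_add[OF measurable_duhamel[OF g] measurable_duhamel[OF g']])
qed (simp add: distrib_left)

lemma nn_integral_power_remaining:
  fixes r :: real assumes "0 \<le> r"
  shows "(\<integral>\<^sup>+s. indicator {0<..<r} s * ennreal ((r - s) ^ n) \<partial>lborel) = ennreal (r ^ Suc n / Suc n)"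
proof -
  have "(\<integral>\<^sup>+s. indicator {0<..<r} s * ennreal ((r - s) ^ n) \<partial>lborel) = (\<integral>\<^sup>+s. ennreal ((r - s) ^ n) * indicator {0..r} s \<partial>lborel)"
  proof (rule nn_integral_cong_AE)
    have "AE s in lborel. s \<noteq> 0 \<and> s \<noteq> r" by (intro AE_conjI AE_lborel_singleton)
    then show "AE s in lborel. indicator {0<..<r} s * ennreal ((r - s) ^ n) = ennreal ((r - s) ^ n) * indicator {0..r} s"
      by eventually_elim (auto split: split_indicator)
  qed
  also have "\<dots> = ennreal (- ((r - r) ^ Suc n / Suc n) - - ((r - 0) ^ Suc n / Suc n))"
  proof (rule nn_integral_FTC_Icc)
    fix s
    show "((\<lambda>s. - ((r - s) ^ Suc n / Suc n)) has_real_derivative (r - s) ^ n) (at s)"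
      by (rule derivative_eq_intros refl | simp)+
  qed (use assms in auto)
  finally show ?thesis by simp
qed

text \<open>Iterating the equation \<open>n\<close> times leaves the first \<open>n\<close> Duhamel terms and a remainder that is at most
  \<open>K (m r)^n / n!\<close>, where \<open>m\<close> is the area of the sphere.\<close>

theorem gain_form_series:
  fixes h :: "real \<Rightarrow> 'a::euclidean_space \<Rightarrow> 'a \<Rightarrow> ennreal"
  assumes g: "(\<lambda>(x, v). g x v) \<in> borel_measurable (borel \<Otimes>\<^sub>M borel)"
    and h: "(\<lambda>(r, x, v). h r x v) \<in> borel_measurable (borel \<Otimes>\<^sub>M borel \<Otimes>\<^sub>M borel)"
    and K: "0 \<le> K" "\<And>r x v. 0 < r \<Longrightarrow> r \<le> T \<Longrightarrow> norm v = 1 \<Longrightarrow> h r x v \<le> ennreal K"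
    and eq: "\<And>r x v. 0 < r \<Longrightarrow> r \<le> T \<Longrightarrow> norm v = 1 \<Longrightarrow> h r x v = damping v r * g (x + r *\<^sub>R v) v + gain h r x v"
    and r: "0 < r" "r \<le> T" and v: "norm v = 1"
  shows "h r x v = (\<Sum>n. duhamel g n r x v)"
proof -
  define m where "m = enn2real (emeasure (surface :: 'a measure) UNIV)"
  have m0: "0 \<le> m" by (simp add: m_def)
  have rate: "collision_rate w \<le> ennreal m" if "norm (w::'a) = 1" for w
  proof -
    have "emeasure (surface :: 'a measure) UNIV < top"
      by (metis surface.emeasure_finite top.not_eq_extremum infinity_ennreal_def)
    then have "ennreal m = emeasure (surface :: 'a measure) UNIV" by (simp add: m_def)
    then show ?thesis using collision_rate_le[OF that] by simp
  qed
  let ?p = "\<lambda>n r (x::'a) (v::'a). ennreal (K * (m * r) ^ n / fact n)"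
  have p_meas: "(\<lambda>(r, x, v). ?p n r x v) \<in> borel_measurable (borel \<Otimes>\<^sub>M borel \<Otimes>\<^sub>M borel)" for n by measurable
  note D_meas = measurable_duhamel_sum[OF g]
  have p_step: "gain (?p n) r x v \<le> ?p (Suc n) r x v" if v: "norm v = 1" and r: "0 < r" for n r x v
  proof -
    define c where "c = K * m ^ n / fact n"
    have c0: "0 \<le> c" using K(1) m0 by (simp add: c_def)
    have "gain (?p n) r x v \<le> (\<integral>\<^sup>+s. \<integral>\<^sup>+n'. ennreal (max 0 (- (v \<bullet> n'))) * (indicator {0<..<r} s * ennreal (c * (r - s) ^ n)) \<partial>surface \<partial>lborel)"
      unfolding gain_def
    proof (intro nn_integral_mono mult_left_mono)
      fix s
      have eq: "K * (m * (r - s)) ^ n / fact n = c * (r - s) ^ n" by (simp add: c_def power_mult_distrib)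
      show "indicator {0<..<r} s * damping v s * ennreal (K * (m * (r - s)) ^ n / fact n) \<le> indicator {0<..<r} s * ennreal (c * (r - s) ^ n)"
      proof (cases "s \<in> {0<..<r}")
        case True
        then have "damping v s \<le> 1" by (simp add: damping_def)
        from mult_right_mono[OF this, of "ennreal (c * (r - s) ^ n)"] True show ?thesis unfolding eq by simp
      qed simp
    qed simp
    also have "\<dots> = (\<integral>\<^sup>+s. collision_rate v * (indicator {0<..<r} s * ennreal (c * (r - s) ^ n)) \<partial>lborel)"
      unfolding collision_rate_def by (intro nn_integral_cong nn_integral_multc) measurable
    also have "\<dots> = (\<integral>\<^sup>+s. (collision_rate v * ennreal c) * (indicator {0<..<r} s * ennreal ((r - s) ^ n)) \<partial>lborel)"
      using c0 by (intro nn_integral_cong) (auto split: split_indicator simp: ennreal_mult' mult_ac)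
    also have "\<dots> = collision_rate v * ennreal c * ennreal (r ^ Suc n / Suc n)"
      using r by (subst nn_integral_cmult) (simp_all only: nn_integral_power_remaining less_imp_le, measurable)
    also have "\<dots> \<le> ennreal m * ennreal c * ennreal (r ^ Suc n / Suc n)"
      by (intro mult_right_mono rate[OF v]) auto
    also have "\<dots> = ennreal (m * c * (r ^ Suc n / Suc n))"
    proof -
      have "0 \<le> m * c" using m0 c0 by simp
      moreover have "0 \<le> r ^ Suc n / Suc n" using r by simp
      ultimately show ?thesis using m0 c0 by (simp only: ennreal_mult)
    qed
    also have "m * c * (r ^ Suc n / Suc n) = K * (m * r) ^ Suc n / fact (Suc n)"
      by (simp add: c_def power_mult_distrib field_simps)
    finally show ?thesis .
  qed
  have claim: "(\<Sum>k<n. duhamel g k r x v) \<le> h r x v \<and> h r x v \<le> (\<Sum>k<n. duhamel g k r x v) + ?p n r x v"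
    if "0 < r" "r \<le> T" "norm v = 1" for n r x v
    using that
  proof (induction n arbitrary: r x v)
    case 0
    then show ?case using K(2) by simp
  next
    case (Suc n)
    have split: "(\<Sum>k<Suc n. duhamel g k r x v) = damping v r * g (x + r *\<^sub>R v) v + gain (\<lambda>r x v. \<Sum>k<n. duhamel g k r x v) r x v"
      unfolding gain_sum_duhamel[OF g] sum.lessThan_Suc_shift by simp
    have lo: "gain (\<lambda>r x v. \<Sum>k<n. duhamel g k r x v) r x v \<le> gain h r x v"
      by (rule gain_mono) (use Suc in auto)
    have "gain h r x v \<le> gain (\<lambda>r x v. (\<Sum>k<n. duhamel g k r x v) + ?p n r x v) r x v"
      by (rule gain_mono) (use Suc in auto)
    also have "\<dots> = gain (\<lambda>r x v. \<Sum>k<n. duhamel g k r x v) r x v + gain (?p n) r x v"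
      by (rule gain_add[OF D_meas p_meas])
    also have "\<dots> \<le> gain (\<lambda>r x v. \<Sum>k<n. duhamel g k r x v) r x v + ?p (Suc n) r x v"
      by (rule add_left_mono[OF p_step[OF Suc.prems(3,1)]])
    finally have hi: "gain h r x v \<le> gain (\<lambda>r x v. \<Sum>k<n. duhamel g k r x v) r x v + ?p (Suc n) r x v" .
    show ?case
      unfolding split eq[OF Suc.prems] add.assoc by (intro conjI add_left_mono lo hi)
  qed
  show ?thesis
  proof (rule antisym)
    show "(\<Sum>n. duhamel g n r x v) \<le> h r x v"
      unfolding suminf_eq_SUP by (rule SUP_least) (use claim[OF r v] in blast)
    have "summable (\<lambda>n. inverse (fact n) * (m * r) ^ n)" by (rule summable_exp)
    from summable_LIMSEQ_zero[OF this] have "(\<lambda>n. ennreal (K * (inverse (fact n) * (m * r) ^ n))) \<longlonglongrightarrow> ennreal (K * 0)"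
      by (intro tendsto_ennrealI tendsto_mult_left)
    then have "(\<lambda>n. ?p n r x v) \<longlonglongrightarrow> 0" by (simp add: field_simps)
    then have "(\<lambda>n. (\<Sum>k<n. duhamel g k r x v) + ?p n r x v) \<longlonglongrightarrow> (\<Sum>n. duhamel g n r x v) + 0"
      by (intro tendsto_add summable_LIMSEQ summableI)
    then have "h r x v \<le> (\<Sum>n. duhamel g n r x v) + 0"
      by (rule LIMSEQ_le_const) (use claim[OF r v] in blast)
    then show "h r x v \<le> (\<Sum>n. duhamel g n r x v)" by simp
  qed
qed

lemma measurable_extend_mild:
  fixes F :: "real \<Rightarrow> 'a::euclidean_space \<Rightarrow> 'a \<Rightarrow> real"
  assumes "boltzmann_mild_solution fin F"
  shows "(\<lambda>(t, x, v). extend_phase F t x v) \<in> borel_measurable (borel \<Otimes>\<^sub>M borel \<Otimes>\<^sub>M borel)"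
  unfolding extend_phase_def by (rule measurable_phase_time_extend) (use assms in \<open>simp add: boltzmann_mild_solution_def\<close>)

text \<open>For nonnegative solutions the damped equation makes sense in the extended nonnegative reals, where
  \<open>gain_form_series\<close> applies.\<close>

lemma nonneg_mild_solution_series:
  fixes F :: "real \<Rightarrow> 'a::euclidean_space \<Rightarrow> 'a \<Rightarrow> real"
  assumes mild: "boltzmann_mild_solution fin F"
    and nonneg: "\<And>t x v. 0 \<le> t \<Longrightarrow> t \<le> T \<Longrightarrow> norm v = 1 \<Longrightarrow> 0 \<le> F t x v"
    and g: "(\<lambda>(x, v). g x v) \<in> borel_measurable (borel \<Otimes>\<^sub>M borel)"
    and g_eq: "\<And>x v. norm v = 1 \<Longrightarrow> g x v = ennreal (fin x (- v))"
    and v: "norm v = 1" and r: "0 < r" "r \<le> T"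
  shows "ennreal (F r x (- v)) = (\<Sum>n. duhamel g n r x v)"
proof -
  let ?h = "\<lambda>r x v. ennreal (extend_phase F r x (- v))"
  obtain B where B: "\<And>t x v. t \<in> {0..T} \<Longrightarrow> norm v = 1 \<Longrightarrow> \<bar>F t x v\<bar> \<le> B"
    using mild unfolding boltzmann_mild_solution_def by (metis mem_sphere_0)
  have B0: "0 \<le> B" using B[of T v] v r by (force intro: order_trans[OF abs_ge_zero])
  have "?h r x v = (\<Sum>n. duhamel g n r x v)"
  proof (rule gain_form_series[OF g _ B0 _ _ r v])
    show "(\<lambda>(r, x, v). ?h r x v) \<in> borel_measurable (borel \<Otimes>\<^sub>M borel \<Otimes>\<^sub>M borel)"
      using measurable_compose[OF _ measurable_extend_mild[OF mild], of "\<lambda>w. (fst w, fst (snd w), - snd (snd w))" "borel \<Otimes>\<^sub>M borel \<Otimes>\<^sub>M borel"]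
      by (simp add: case_prod_beta')
  next
    fix r x and v :: 'a assume r: "0 < r" "r \<le> T" and v: "norm v = 1"
    show "?h r x v \<le> ennreal B"
      using B[of r "- v" x] r v by (intro ennreal_leI) (simp add: extend_phase_eq abs_le_iff)
    show "?h r x v = damping v r * g (x + r *\<^sub>R v) v + gain ?h r x v"
    proof -
      have "norm (- v) = 1" using v by simp
      then have "extend_phase F r x (- v) = F r x (- v)" using r by (intro extend_phase_eq) auto
      then show ?thesis unfolding gain_def g_eq[OF v] by (simp only: mild_solution_gain_form[OF mild nonneg v r, of x])
    qed
  qed
  then show ?thesis using r v by (simp add: extend_phase_eq)
qed

lemma boltzmann_collision_add_const: "boltzmann_collision (\<lambda>v. h v + B) = boltzmann_collision h"
  by (simp add: boltzmann_collision_def fun_eq_iff)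

lemma mild_solution_add_const:
  assumes "boltzmann_mild_solution fin F"
  shows "boltzmann_mild_solution (\<lambda>x v. fin x v + B) (\<lambda>t x v. F t x v + B)"
  unfolding boltzmann_mild_solution_def
proof (intro conjI allI)
  have m: "(\<lambda>(t, x, v). F t x v) \<in> borel_measurable phase_time_measure"
    using assms by (simp add: boltzmann_mild_solution_def)
  show "(\<lambda>(t, x, v). F t x v + B) \<in> borel_measurable phase_time_measure"
    using borel_measurable_add[OF m borel_measurable_const[of B]] by (simp add: case_prod_beta')
next
  fix T :: real
  obtain A where A: "\<And>t x v. t \<in> {0..T} \<Longrightarrow> v \<in> sphere 0 1 \<Longrightarrow> \<bar>F t x v\<bar> \<le> A"
    using assms unfolding boltzmann_mild_solution_def by metis
  show "\<exists>A. \<forall>t\<in>{0..T}. \<forall>x. \<forall>v\<in>sphere 0 1. \<bar>F t x v + B\<bar> \<le> A"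
    by (rule exI[of _ "A + \<bar>B\<bar>"]) (use A in \<open>blast intro: order_trans[OF abs_triangle_ineq] add_right_mono\<close>)
next
  fix t x v
  show "0 \<le> t \<longrightarrow> (\<forall>x. \<forall>v\<in>sphere 0 1. F t x v + B = fin (x - t *\<^sub>R v) v + B +
     (LINT s:{0..t}|lborel. boltzmann_collision (\<lambda>v'. F s (x - (t - s) *\<^sub>R v) v' + B) v))"
    using assms unfolding boltzmann_collision_add_const boltzmann_mild_solution_def by auto
qed

lemma mild_solution_const: "boltzmann_mild_solution (\<lambda>x v. B) (\<lambda>t x v. B)"
  by (auto simp: boltzmann_mild_solution_def boltzmann_collision_def set_lebesgue_integral_def)

lemma duhamel_const_series:
  fixes v :: "'a::euclidean_space"
  assumes "0 \<le> B" "norm v = 1" "0 < r"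
  shows "(\<Sum>n. duhamel (\<lambda>_ _. ennreal B) n r x v) = ennreal B"
  by (rule nonneg_mild_solution_series[OF mild_solution_const, of r, symmetric]) (use assms in auto)

text \<open>Nothing is known about the sign of \<open>F\<close> beforehand. Adding a bound \<open>B\<close> gives a nonnegative mild solution,
  as the collision operator annihilates constants; the Duhamel series of the constant \<open>B\<close> is \<open>B\<close>, and
  subtracting it also shows that \<open>F\<close> is nonnegative.\<close>

theorem mild_solution_series:
  fixes F :: "real \<Rightarrow> 'a::euclidean_space \<Rightarrow> 'a \<Rightarrow> real"
  assumes mild: "boltzmann_mild_solution fin F"
    and fin: "\<And>x v. norm v = 1 \<Longrightarrow> 0 \<le> fin x v"
    and g: "(\<lambda>(x, v). g x v) \<in> borel_measurable (borel \<Otimes>\<^sub>M borel)"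
    and g_eq: "\<And>x v. norm v = 1 \<Longrightarrow> g x v = ennreal (fin x (- v))"
    and v: "norm v = 1" and r: "0 < r"
  shows "(\<Sum>n. duhamel g n r x v) = ennreal (F r x (- v))" and "0 \<le> F r x (- v)"
proof -
  obtain B where B: "\<And>t x v. t \<in> {0..r} \<Longrightarrow> norm v = 1 \<Longrightarrow> \<bar>F t x v\<bar> \<le> B"
    using mild unfolding boltzmann_mild_solution_def by (metis mem_sphere_0)
  have B0: "0 \<le> B" using B[of r v] v r by (force intro: order_trans[OF abs_ge_zero])
  have FB: "0 \<le> F t x v + B" if "0 \<le> t" "t \<le> r" "norm v = 1" for t x v
    using B[of t v x] that by (simp add: abs_le_iff)
  let ?c = "\<lambda>_ _. ennreal B"
  have c: "(\<lambda>(x::'a, v::'a). ?c x v) \<in> borel_measurable (borel \<Otimes>\<^sub>M borel)" by simp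
  have "ennreal (F r x (- v) + B) = (\<Sum>n. duhamel (\<lambda>x v. g x v + ?c x v) n r x v)"
  proof (rule nonneg_mild_solution_series[OF mild_solution_add_const[OF mild, of B] FB _ _ v r order_refl])
    show "(\<lambda>(x, v). g x v + ennreal B) \<in> borel_measurable (borel \<Otimes>\<^sub>M borel)"
      using borel_measurable_add[OF g c] by (simp add: case_prod_beta')
    show "g x v + ennreal B = ennreal (fin x (- v) + B)" if "norm v = 1" for x v
      using g_eq[OF that] fin[of "- v" x] that B0 by simp
  qed
  also have "\<dots> = (\<Sum>n. duhamel g n r x v + duhamel ?c n r x v)"
    by (simp only: duhamel_add[OF g c])
  also have "\<dots> = (\<Sum>n. duhamel g n r x v) + (\<Sum>n. duhamel ?c n r x v)"
    by (rule suminf_add[symmetric]) (rule summableI)+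
  also have "(\<Sum>n. duhamel ?c n r x v) = ennreal B" by (rule duhamel_const_series[OF B0 v r])
  finally have eq: "ennreal (F r x (- v) + B) = (\<Sum>n. duhamel g n r x v) + ennreal B" .
  have FB0: "0 \<le> F r x (- v) + B" using FB[of r "- v" x] r v by simp
  have "ennreal B \<le> ennreal (F r x (- v) + B)" unfolding eq by simp
  then show F0: "0 \<le> F r x (- v)" using FB0 B0 by (simp add: ennreal_le_iff)
  have "ennreal B + (\<Sum>n. duhamel g n r x v) = ennreal B + ennreal (F r x (- v))"
    using F0 B0 eq by (simp add: add.commute)
  then show "(\<Sum>n. duhamel g n r x v) = ennreal (F r x (- v))"
    by (simp only: ennreal_add_left_cancel) simp
qed

section \<open>Poisson point processes as random locally finite sets\<close>

text \<open>The probabilities of the values \<open>0, 1, 2, \<dots>\<close> add up to 1.\<close>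

lemma (in prob_space) poisson_law_AE_nat:
  assumes law: "has_poisson_law M p N" and p: "p < \<infinity>"
  shows "AE w in M. \<exists>k::nat. N w = of_nat k"
proof -
  define q where "q = enn2real p"
  have [measurable]: "N \<in> borel_measurable M" using law by (simp add: has_poisson_law_def)
  define E where "E k = {w \<in> space M. N w = of_nat k}" for k :: nat
  have [measurable]: "E k \<in> sets M" for k unfolding E_def by measurable
  have "(\<lambda>k. q ^ k /\<^sub>R fact k * exp (- q)) sums (exp q * exp (- q))"
    by (intro sums_mult2 exp_converges)
  moreover have "prob (E k) = q ^ k /\<^sub>R fact k * exp (- q)" for k
    using law p by (auto simp: has_poisson_law_def E_def q_def field_simps)
  ultimately have "(\<lambda>k. prob (E k)) sums 1" by (simp add: exp_minus)
  moreover have "(\<lambda>k. prob (E k)) sums prob (\<Union>k. E k)"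
    by (rule finite_measure_UNION) (auto simp: E_def disjoint_family_on_def)
  ultimately have "prob (\<Union>k. E k) = 1" by (metis sums_unique2)
  then have "AE w in M. w \<in> (\<Union>k. E k)" by (rule AE_prob_1)
  then show ?thesis by eventually_elim (auto simp: E_def)
qed

lemma (in prob_space) poisson_law_mean:
  assumes law: "has_poisson_law M p N"
  shows "(\<integral>\<^sup>+w. N w \<partial>M) = p"
proof (cases "p = \<infinity>")
  case True
  then have "AE w in M. N w = \<infinity>" using law by (simp add: has_poisson_law_def)
  then have "(\<integral>\<^sup>+w. N w \<partial>M) = (\<integral>\<^sup>+w. \<infinity> \<partial>M)" by (rule nn_integral_cong_AE)
  then show ?thesis using True by (simp add: emeasure_space_1)
next
  case False
  define q where "q = enn2real p"
  have q: "p = ennreal q" "0 \<le> q" using False by (simp_all add: q_def less_top)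
  have [measurable]: "N \<in> borel_measurable M" using law by (simp add: has_poisson_law_def)
  define E where "E k = {w \<in> space M. N w = of_nat k}" for k :: nat
  have [measurable]: "E k \<in> sets M" for k unfolding E_def by measurable
  have PE: "prob (E k) = q ^ k / fact k * exp (- q)" for k
    using law False by (auto simp: has_poisson_law_def E_def q_def)
  have "(\<integral>\<^sup>+w. N w \<partial>M) = (\<integral>\<^sup>+w. (\<Sum>k. of_nat k * indicator (E k) w) \<partial>M)"
  proof (rule nn_integral_cong_AE)
    have p: "p < \<infinity>" using False by (simp add: less_top)
    show "AE w in M. N w = (\<Sum>k. of_nat k * indicator (E k) w)"
      using poisson_law_AE_nat[OF law p] AE_space
    proof eventually_elim
      case (elim w)
      then obtain n where n: "N w = of_nat n" by blast
      have "(\<Sum>k. of_nat k * indicator (E k) w) = (\<Sum>k\<in>{n}. of_nat k * indicator (E k) w :: ennreal)"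
        by (rule suminf_finite) (use n in \<open>auto simp: E_def\<close>)
      then show ?case using n elim by (simp add: E_def)
    qed
  qed
  also have "\<dots> = (\<Sum>k. of_nat k * emeasure M (E k))"
    by (subst nn_integral_suminf) (simp_all add: nn_integral_cmult)
  also have "\<dots> = (\<Sum>k. ennreal (k * (q ^ k / fact k * exp (- q))))"
    unfolding emeasure_eq_measure PE
    by (simp only: ennreal_mult'[OF of_nat_0_le_iff] ennreal_of_nat_eq_real_of_nat)
  also have "\<dots> = ennreal q"
  proof (rule suminf_ennreal_eq)
    have "(\<lambda>k. (q * exp (- q)) * (q ^ k /\<^sub>R fact k)) sums ((q * exp (- q)) * exp q)"
      by (intro sums_mult exp_converges)
    also have "(\<lambda>k. (q * exp (- q)) * (q ^ k /\<^sub>R fact k)) = (\<lambda>k. Suc k * (q ^ Suc k / fact (Suc k) * exp (- q)))"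
      by (simp del: of_nat_Suc add: fun_eq_iff field_simps)
    also have "(q * exp (- q)) * exp q = q" by (simp add: exp_minus)
    finally show "(\<lambda>k. k * (q ^ k / fact k * exp (- q))) sums q"
      using sums_Suc[of "\<lambda>k. k * (q ^ k / fact k * exp (- q))"] by simp
  qed (use q in simp)
  finally show ?thesis using q by simp
qed

lemma point_count_eq_0_iff: "point_count C A = 0 \<longleftrightarrow> C \<inter> A = {}"
  by (auto simp: point_count_def emeasure_count_space_eq_0)

lemma point_count_finite_iff: "point_count C A < \<infinity> \<longleftrightarrow> finite (C \<inter> A)"
  by (simp add: point_count_def emeasure_count_space of_nat_less_top)

lemma locally_finite_iff_count: "locally_finite C \<longleftrightarrow> (\<forall>n::nat. point_count C (cball 0 n) < \<infinity>)"
proof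
  assume *: "\<forall>n::nat. point_count C (cball 0 n) < \<infinity>"
  show "locally_finite C"
    unfolding locally_finite_def
  proof
    fix R :: real
    obtain n :: nat where n: "R \<le> n" using real_arch_simple by blast
    have "finite (C \<inter> cball 0 (real n))" using *[rule_format, of n] unfolding point_count_finite_iff .
    then show "finite (C \<inter> cball 0 R)" by (rule finite_subset[rotated]) (use n in auto)
  qed
qed (simp only: locally_finite_def point_count_finite_iff, blast)

text \<open>A Poisson process is almost surely locally finite; on the exceptional event it is replaced by the empty
  configuration to obtain a map into \<open>config\<close> everywhere.\<close>

definition regularise :: "'a::euclidean_space set \<Rightarrow> 'a set" where
  "regularise C = (if locally_finite C then C else {})"

context
  fixes M :: "'w measure" and lam :: real and C :: "'w \<Rightarrow> 'a::euclidean_space set"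
  assumes ppp: "poisson_point_process M lam C" and lam: "0 \<le> lam"
begin

lemma ppp_law: "A \<in> sets borel \<Longrightarrow> has_poisson_law M (ennreal lam * emeasure lborel A) (\<lambda>w. point_count (C w) A)"
  using ppp by (simp add: poisson_point_process_def)

lemma ppp_prob_space: "prob_space M"
  using ppp by (simp add: poisson_point_process_def)

lemma measurable_ppp_count [measurable]: "A \<in> sets borel \<Longrightarrow> (\<lambda>w. point_count (C w) A) \<in> borel_measurable M"
  using ppp_law by (simp add: has_poisson_law_def)

lemma AE_locally_finite: "AE w in M. locally_finite (C w)"
proof -
  interpret prob_space M by (rule ppp_prob_space)
  have "AE w in M. \<forall>n::nat. point_count (C w) (cball 0 n) < \<infinity>"
    unfolding AE_all_countable
  proof
    fix n :: nat
    have "emeasure lborel (cball (0::'a) n) < \<infinity>" by (intro emeasure_bounded_finite bounded_cball)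
    then have "ennreal lam * emeasure lborel (cball (0::'a) n) < \<infinity>" by (simp add: ennreal_mult_less_top)
    from poisson_law_AE_nat[OF ppp_law this] show "AE w in M. point_count (C w) (cball 0 n) < \<infinity>"
      by (simp, elim eventually_mono) (auto simp: less_top[symmetric])
  qed
  then show ?thesis by (simp add: locally_finite_iff_count)
qed

lemma AE_regularise: "AE w in M. regularise (C w) = C w"
  using AE_locally_finite by eventually_elim (simp add: regularise_def)

lemma measurable_regularise: "(\<lambda>w. regularise (C w)) \<in> M \<rightarrow>\<^sub>M config"
proof (rule measurable_configI)
  show "locally_finite (regularise (C w))" for w by (simp add: regularise_def locally_finite_def)
  fix A :: "'a set" assume [measurable]: "A \<in> sets borel"
  have "{w \<in> space M. regularise (C w) \<inter> A \<noteq> {}} =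
      {w \<in> space M. (\<forall>n::nat. point_count (C w) (cball 0 n) < \<infinity>) \<and> point_count (C w) A \<noteq> 0}"
    by (auto simp: regularise_def locally_finite_iff_count point_count_eq_0_iff)
  also have "\<dots> \<in> sets M" by measurable
  finally show "{w \<in> space M. regularise (C w) \<inter> A \<noteq> {}} \<in> sets M" .
qed

text \<open>The two defining properties involve counts in at most two disjoint sets: the void probability is the
  Poisson probability of 0, and the mean count in \<open>B\<close> on the void event of \<open>A\<close> factorises by
  independence.\<close>

theorem poisson_config_distr: "poisson_config (distr M config (\<lambda>w. regularise (C w))) lam"
proof -
  interpret prob_space M by (rule ppp_prob_space)
  note [measurable] = measurable_regularise
  let ?PP = "distr M config (\<lambda>w. regularise (C w))"
  have void: "emeasure ?PP {D \<in> space ?PP. D \<inter> A = {}} = emeasure M {w \<in> space M. point_count (C w) A = 0}"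
    if [measurable]: "A \<in> sets borel" for A
  proof -
    have S: "{D \<in> space ?PP. D \<inter> A = {}} \<in> sets config"
      unfolding space_distr using pred_config_avoid[OF measurable_ident that] by (simp add: pred_def)
    have "emeasure ?PP {D \<in> space ?PP. D \<inter> A = {}} =
        emeasure M ((\<lambda>w. regularise (C w)) -` {D \<in> space ?PP. D \<inter> A = {}} \<inter> space M)"
      by (rule emeasure_distr[OF _ S]) measurable
    also have "\<dots> = emeasure M {w \<in> space M. point_count (C w) A = 0}"
    proof (rule emeasure_eq_AE)
      show "AE w in M. (w \<in> (\<lambda>w. regularise (C w)) -` {D \<in> space ?PP. D \<inter> A = {}} \<inter> space M) =
          (w \<in> {w \<in> space M. point_count (C w) A = 0})"
        using AE_locally_finite
        by eventually_elim (auto simp: regularise_def point_count_eq_0_iff space_config)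
      show "(\<lambda>w. regularise (C w)) -` {D \<in> space ?PP. D \<inter> A = {}} \<inter> space M \<in> sets M"
        by (rule measurable_sets[OF measurable_regularise S])
    qed measurable
    finally show ?thesis .
  qed
  interpret PP: prob_space ?PP by (rule prob_space_distr) measurable
  show ?thesis
  proof
    show "sets ?PP = sets config" by simp
    show "0 \<le> lam" by (rule lam)
    fix A :: "'a set" assume A: "A \<in> sets borel"
    show "emeasure ?PP {D \<in> space ?PP. D \<inter> A = {}} = ennreal (exp (- (lam * measure lborel A)))"
      if fin: "emeasure lborel A < \<infinity>"
    proof -
      have "ennreal lam * emeasure lborel A = ennreal (lam * measure lborel A)"
        using fin lam by (simp add: emeasure_eq_ennreal_measure less_top[symmetric] ennreal_mult)
      then have law: "has_poisson_law M (ennreal (lam * measure lborel A)) (\<lambda>w. point_count (C w) A)"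
        using ppp_law[OF A] by simp
      have "\<forall>k::nat. measure M {w \<in> space M. point_count (C w) A = of_nat k} =
          (lam * measure lborel A) ^ k / fact k * exp (- (lam * measure lborel A))"
        using law lam unfolding has_poisson_law_def by simp
      from this[rule_format, of 0] show ?thesis unfolding void[OF A] emeasure_eq_measure by simp
    qed
    fix B :: "'a set" assume B: "B \<in> sets borel" and AB: "A \<inter> B = {}"
    note [measurable] = A B
    let ?X = "\<lambda>i w. point_count (C w) (if i = (0::nat) then B else A)"
    let ?Y = "\<lambda>i. if i = (0::nat) then (\<lambda>z. z) else indicator {0::ennreal}"
    have "indep_vars (\<lambda>_. borel) ?X {..<2}"
    proof -
      have "\<forall>(k::nat) A. (\<forall>i<k. A i \<in> sets borel) \<longrightarrow> disjoint_family_on A {..<k} \<longrightarrow>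
          indep_vars (\<lambda>_. borel) (\<lambda>i w. point_count (C w) (A i)) {..<k}"
        using ppp unfolding poisson_point_process_def by blast
      note family = this[rule_format, of 2 "\<lambda>i. if i = 0 then B else A"]
      show ?thesis
        by (rule family) (use A B AB in \<open>auto simp: disjoint_family_on_def split: if_splits\<close>)
    qed
    then have ind: "indep_vars (\<lambda>_. borel) (\<lambda>i w. ?Y i (?X i w)) {..<2}"
      by (rule indep_vars_compose2) auto
    have two: "{..<2} = {0, 1::nat}" by auto
    have "(\<integral>\<^sup>+D. point_count D B * indicator {D. D \<inter> A = {}} D \<partial>?PP) =
        (\<integral>\<^sup>+w. point_count (regularise (C w)) B * indicator {D. D \<inter> A = {}} (regularise (C w)) \<partial>M)"
    proof -
      have [measurable]: "Measurable.pred config (\<lambda>D. D \<inter> A = {})" using pred_config_avoid[OF measurable_ident A] by simp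
      have "(\<lambda>D. point_count D B * indicator {D. D \<inter> A = {}} D) \<in> borel_measurable config"
        unfolding indicator_def of_bool_def mem_Collect_eq using measurable_point_count[OF B] by measurable
      then show ?thesis by (intro nn_integral_distr measurable_regularise) simp
    qed
    also have "\<dots> = (\<integral>\<^sup>+w. (\<Prod>i\<in>{..<2}. ?Y i (?X i w)) \<partial>M)"
    proof (rule nn_integral_cong_AE)
      show "AE w in M. point_count (regularise (C w)) B * indicator {D. D \<inter> A = {}} (regularise (C w)) =
          (\<Prod>i\<in>{..<2}. ?Y i (?X i w))"
        using AE_regularise
        by eventually_elim (auto simp: two point_count_eq_0_iff split: split_indicator)
    qed
    also have "\<dots> = (\<Prod>i\<in>{..<2}. \<integral>\<^sup>+w. ?Y i (?X i w) \<partial>M)"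
      by (rule indep_vars_nn_integral[OF _ ind]) auto
    also have "\<dots> = (\<integral>\<^sup>+w. point_count (C w) B \<partial>M) * (\<integral>\<^sup>+w. indicator {0} (point_count (C w) A) \<partial>M)"
      by (simp add: two)
    also have "(\<integral>\<^sup>+w. point_count (C w) B \<partial>M) = ennreal lam * emeasure lborel B"
      by (rule poisson_law_mean[OF ppp_law[OF B]])
    also have "(\<integral>\<^sup>+w. indicator {0} (point_count (C w) A) \<partial>M) = (\<integral>\<^sup>+w. indicator {w \<in> space M. point_count (C w) A = 0} w \<partial>M)"
      by (intro nn_integral_cong) (simp split: split_indicator)
    also have "\<dots> = emeasure M {w \<in> space M. point_count (C w) A = 0}"
      by (rule nn_integral_indicator) measurable
    finally show "(\<integral>\<^sup>+D. point_count D B * indicator {D. D \<inter> A = {}} D \<partial>?PP) =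
        ennreal lam * emeasure lborel B * emeasure ?PP {D \<in> space ?PP. D \<inter> A = {}}"
      unfolding void[OF A] .
  qed
qed

end

section \<open>The averaged density as a Poisson expectation\<close>

text \<open>A starting point inside an obstacle blocks its own flight and prevents a first hit, so positions
  outside the billiard table contribute nothing.\<close>

lemma after_collisions_inside:
  fixes x v c :: "'a::euclidean_space"
  assumes c: "c \<in> C" "norm (x - c) < \<epsilon>" and v: "norm v = 1" and r: "r > 0"
  shows "after_collisions \<epsilon> C g n r x v = 0"
proof -
  have \<epsilon>: "\<epsilon> > 0" using c(2) norm_ge_zero[of "x - c"] by linarith
  have io: "disc \<epsilon> x v c > 0" "entry_time \<epsilon> x v c < 0" "0 < exit_time \<epsilon> x v c"
    using in_ball_line_iff(1)[OF v \<epsilon>, of x 0 c] c(2) by simp_all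
  show ?thesis
  proof (cases n)
    case 0
    then show ?thesis using c(1) io r by (auto simp: after_collisions_0 free_flight_def blocked_def)
  next
    case (Suc m)
    have "\<not> first_hit \<epsilon> C r x v c'" for c'
      using c(1) io unfolding first_hit_def blocked_def by fastforce
    then show ?thesis unfolding Suc after_collisions_Suc by (intro collide_eq_0)
  qed
qed

lemma after_collisions_add:
  "after_collisions \<epsilon> C (\<lambda>x v. g x v + h x v) n r x v = after_collisions \<epsilon> C g n r x v + after_collisions \<epsilon> C h n r x v"
proof (induction n arbitrary: r x v)
  case 0
  show ?case by (simp add: after_collisions_0 free_flight_def)
next
  case (Suc n)
  consider c where "c \<in> C" "first_hit \<epsilon> C r x v c" | "\<forall>c\<in>C. \<not> first_hit \<epsilon> C r x v c" by blast
  then show ?case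
    by cases (simp_all add: after_collisions_Suc collide_eq collide_eq_0 Suc)
qed

lemma (in poisson_config) AE_avoids_null_set:
  assumes A: "A \<in> sets borel" "emeasure lborel A = 0"
  shows "AE D in PP. D \<inter> A = {}"
proof -
  have "emeasure PP {D \<in> space PP. D \<inter> A = {}} = 1"
    using void_probability[OF A(1)] A(2) by (simp add: measure_def)
  then have "prob {D \<in> space PP. D \<inter> A = {}} = 1" by (simp add: emeasure_eq_measure)
  then have "AE D in PP. D \<in> {D \<in> space PP. D \<inter> A = {}}" by (rule AE_prob_1)
  then show ?thesis by eventually_elim simp
qed

lemma emeasure_lborel_sphere:
  fixes x :: "'a::euclidean_space"
  shows "emeasure lborel (sphere x \<epsilon>) = 0"
proof -
  have "{z \<in> space lborel. \<not> norm (z - x) \<noteq> \<epsilon>} = sphere x \<epsilon>" by (auto simp: dist_norm norm_minus_commute)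
  moreover have "sphere x \<epsilon> \<in> sets lborel" by simp
  ultimately show ?thesis using AE_iff_measurable[of "sphere x \<epsilon>" lborel "\<lambda>z. norm (z - x) \<noteq> \<epsilon>"] AE_norm_neq[of x \<epsilon>] by simp
qed

lemma measurable_completion_AE:
  assumes g: "g \<in> M \<rightarrow>\<^sub>M N" and f: "f \<in> space M \<rightarrow> space N" and eq: "AE z in M. f z = g z"
  shows "f \<in> completion M \<rightarrow>\<^sub>M N"
proof (rule measurableI)
  show "f z \<in> space N" if "z \<in> space (completion M)" for z using f that by auto
  fix A assume A: "A \<in> sets N"
  show "f -` A \<inter> space (completion M) \<in> sets (completion M)"
  proof (rule completion.in_sets_AE)
    show "g -` A \<inter> space M \<in> sets (completion M)" using measurable_sets[OF g A] by simp
    show "AE z in completion M. z \<in> g -` A \<inter> space M \<longleftrightarrow> z \<in> f -` A \<inter> space (completion M)"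
      by (rule AE_completion) (use eq in eventually_elim, simp)
  qed simp
qed

lemma measurable_sphere_inclusion: "(\<lambda>v. v) \<in> borel_measurable (sphere_measure :: 'a::euclidean_space measure)"
  using measurable_ident_sphere by (simp add: measurable_cong_sets[OF sets_sphere_measure refl])

lemma finite_measure_sphere: "finite_measure (sphere_measure :: 'a::euclidean_space measure)"
proof
  have "emeasure (sphere_measure :: 'a measure) (space sphere_measure) = emeasure (surface :: 'a measure) UNIV"
    unfolding surface_def by (subst emeasure_distr) (simp_all add: measurable_sphere_inclusion)
  also have "\<dots> < \<infinity>" by (metis surface.emeasure_finite top.not_eq_extremum infinity_ennreal_def)
  finally show "emeasure (sphere_measure :: 'a measure) (space sphere_measure) \<noteq> \<infinity>" by simp
qed

lemma measurable_from_phase_time: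
  fixes N :: "real \<times> 'a::euclidean_space \<times> 'a \<Rightarrow> 'b"
  assumes N: "N \<in> borel \<Otimes>\<^sub>M borel \<Otimes>\<^sub>M borel \<rightarrow>\<^sub>M L"
  shows "N \<in> phase_time_measure \<rightarrow>\<^sub>M L"
proof -
  let ?M = "restrict_space lborel {0..} \<Otimes>\<^sub>M (lborel \<Otimes>\<^sub>M sphere_measure) :: (real \<times> 'a \<times> 'a) measure"
  have "fst \<in> borel_measurable ?M"
    by (rule measurable_compose[OF measurable_fst]) (simp add: measurable_restrict_space1)
  moreover have "(\<lambda>z. fst (snd z)) \<in> borel_measurable ?M"
    by (rule measurable_compose[OF measurable_snd]) (rule measurable_compose[OF measurable_fst], simp)
  moreover have "(\<lambda>z. snd (snd z)) \<in> borel_measurable ?M"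
    by (rule measurable_compose[OF measurable_snd], rule measurable_compose[OF measurable_snd])
       (rule measurable_sphere_inclusion)
  ultimately have "(\<lambda>z. (fst z, fst (snd z), snd (snd z))) \<in> ?M \<rightarrow>\<^sub>M borel \<Otimes>\<^sub>M borel \<Otimes>\<^sub>M borel"
    by (intro measurable_Pair)
  from measurable_compose[OF this N] show ?thesis unfolding phase_time_measure_def by simp
qed

text \<open>Fubini and the invariance of the sphere under \<open>v \<mapsto> - v\<close>, which translates between particle velocities
  and velocities of backward trajectories.\<close>

lemma AE_phase_time:
  fixes N :: "real \<times> 'a::euclidean_space \<times> 'a \<Rightarrow> ennreal"
  assumes N: "N \<in> borel_measurable (borel \<Otimes>\<^sub>M borel \<Otimes>\<^sub>M borel)"
    and z: "\<And>t. 0 < t \<Longrightarrow> AE v in surface. AE x in lborel. N (t, x, v) = 0"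
  shows "AE (t, x, v) in phase_time_measure. N (t, x, - v) = 0"
proof -
  interpret S: finite_measure "sphere_measure :: 'a measure" by (rule finite_measure_sphere)
  have sf: "sigma_finite_measure (lborel \<Otimes>\<^sub>M (sphere_measure :: 'a measure))"
    by (intro sigma_finite_pair_measure S.sigma_finite_measure_axioms lborel.sigma_finite_measure_axioms)
  interpret XV: pair_sigma_finite "lborel :: 'a measure" "surface :: 'a measure" ..
  define N' where "N' = (\<lambda>(t, x, v). N (t, x, - v))"
  have N' [measurable]: "N' \<in> borel_measurable (borel \<Otimes>\<^sub>M borel \<Otimes>\<^sub>M borel)"
    using measurable_compose[OF _ N, of "\<lambda>w. (fst w, fst (snd w), - snd (snd w))"] unfolding N'_def case_prod_beta' by simp
  have N'_ptm: "N' \<in> borel_measurable phase_time_measure" by (rule measurable_from_phase_time[OF N'])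
  note [measurable] = N
  have slice: "(\<integral>\<^sup>+y. N' (t, y) \<partial>(lborel \<Otimes>\<^sub>M sphere_measure)) = 0" if t: "0 < t" for t
  proof -
    have m: "(\<lambda>y. N' (t, y)) \<in> borel_measurable (lborel \<Otimes>\<^sub>M (sphere_measure :: 'a measure))"
      by (rule measurable_compose[OF measurable_Pair1' N'_ptm[unfolded phase_time_measure_def]]) (use t in \<open>simp add: space_restrict_space\<close>)
    have "(\<integral>\<^sup>+y. N' (t, y) \<partial>(lborel \<Otimes>\<^sub>M sphere_measure)) = (\<integral>\<^sup>+x. \<integral>\<^sup>+v. N (t, x, - v) \<partial>sphere_measure \<partial>lborel)"
      using S.nn_integral_fst[OF m] by (simp add: N'_def)
    also have "\<dots> = (\<integral>\<^sup>+x. \<integral>\<^sup>+v. N (t, x, - v) \<partial>surface \<partial>lborel)"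
    proof (intro nn_integral_cong)
      fix x
      have "(\<lambda>v. N (t, x, - v)) \<in> borel_measurable borel" by measurable
      then show "(\<integral>\<^sup>+v. N (t, x, - v) \<partial>sphere_measure) = (\<integral>\<^sup>+v. N (t, x, - v) \<partial>surface)"
        unfolding surface_def by (subst nn_integral_distr) (simp_all add: measurable_sphere_inclusion)
    qed
    also have "\<dots> = (\<integral>\<^sup>+x. \<integral>\<^sup>+v. N (t, x, v) \<partial>surface \<partial>lborel)"
      by (intro nn_integral_cong nn_integral_surface_uminus[where f="\<lambda>v. N (t, _, v)"]) measurable
    also have "\<dots> = (\<integral>\<^sup>+v. \<integral>\<^sup>+x. N (t, x, v) \<partial>lborel \<partial>surface)"
      by (rule XV.Fubini'[symmetric]) measurable
    also have "\<dots> = (\<integral>\<^sup>+v. 0 \<partial>(surface :: 'a measure))"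
    proof (rule nn_integral_cong_AE)
      show "AE v in surface. (\<integral>\<^sup>+x. N (t, x, v) \<partial>lborel) = 0"
        using z[OF t]
      proof eventually_elim
        case (elim v)
        then have "(\<integral>\<^sup>+x. N (t, x, v) \<partial>lborel) = (\<integral>\<^sup>+x. 0 \<partial>(lborel :: 'a measure))" by (rule nn_integral_cong_AE)
        then show ?case by simp
      qed
    qed
    finally show ?thesis by simp
  qed
  have "(\<integral>\<^sup>+z. N' z \<partial>phase_time_measure) =
      (\<integral>\<^sup>+t. \<integral>\<^sup>+y. N' (t, y) \<partial>(lborel \<Otimes>\<^sub>M sphere_measure) \<partial>restrict_space lborel {0..})"
    using sigma_finite_measure.nn_integral_fst[OF sf N'_ptm[unfolded phase_time_measure_def]]
    unfolding phase_time_measure_def by simp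
  also have "\<dots> = (\<integral>\<^sup>+t. (\<integral>\<^sup>+y. N' (t, y) \<partial>(lborel \<Otimes>\<^sub>M sphere_measure)) * indicator {0..} t \<partial>lborel)"
    by (rule nn_integral_restrict_space) simp
  also have "\<dots> = (\<integral>\<^sup>+t. 0 \<partial>(lborel :: real measure))"
  proof (rule nn_integral_cong_AE)
    show "AE t in lborel. (\<integral>\<^sup>+y. N' (t, y) \<partial>(lborel \<Otimes>\<^sub>M sphere_measure)) * indicator {0..} t = 0"
      using AE_lborel_singleton[of "0::real"]
    proof eventually_elim
      case (elim t)
      then show ?case using slice[of t] by (cases "t > 0") (auto split: split_indicator)
    qed
  qed
  finally have "(\<integral>\<^sup>+z. N' z \<partial>phase_time_measure) = 0" by simp
  then have "AE z in phase_time_measure. N' z = 0"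
    using nn_integral_0_iff_AE[OF N'_ptm] by blast
  then show ?thesis unfolding N'_def case_prod_beta' .
qed

definition mean_transport :: "'a::euclidean_space set measure \<Rightarrow> real \<Rightarrow> ('a \<Rightarrow> 'a \<Rightarrow> ennreal) \<Rightarrow> real \<Rightarrow> 'a \<Rightarrow> 'a \<Rightarrow> ennreal" where
  "mean_transport PP \<epsilon> g r x v = (\<integral>\<^sup>+D. (\<Sum>n. after_collisions \<epsilon> D g n r x v) \<partial>PP)"

text \<open>Indicator of the event that the trajectory starts in the billiard table but is not accounted for by
  any number of collisions.\<close>

definition lost :: "real \<Rightarrow> real \<Rightarrow> 'a::euclidean_space \<Rightarrow> 'a \<Rightarrow> 'a set \<Rightarrow> ennreal" where
  "lost \<epsilon> r x v D = (if (\<forall>c\<in>D. \<epsilon> < norm (x - c)) \<longrightarrow>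
     (\<Sum>n. after_collisions \<epsilon> D (\<lambda>_ _. 1) n r x v) = 1 then 0 else 1)"

context poisson_config
begin

lemma measurable_transport_sum:
  assumes g: "(\<lambda>(x, v). g x v) \<in> borel_measurable (borel \<Otimes>\<^sub>M borel)"
    and K: "K \<in> N \<rightarrow>\<^sub>M config" and [measurable]: "r \<in> borel_measurable N" "x \<in> borel_measurable N" "v \<in> borel_measurable N"
  shows "(\<lambda>y. \<Sum>n. after_collisions \<epsilon> (K y) g n (r y) (x y) (v y)) \<in> borel_measurable N"
  by (intro borel_measurable_suminf_order measurable_after_collisions[OF K g]) measurable

lemma measurable_mean_transport:
  assumes g: "(\<lambda>(x, v). g x v) \<in> borel_measurable (borel \<Otimes>\<^sub>M borel)"
  shows "(\<lambda>(r, x, v). mean_transport PP \<epsilon> g r x v) \<in> borel_measurable (borel \<Otimes>\<^sub>M borel \<Otimes>\<^sub>M borel)"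
proof -
  have "(\<lambda>(w, D). \<Sum>n. after_collisions \<epsilon> D g n (fst w) (fst (snd w)) (snd (snd w)))
      \<in> borel_measurable ((borel \<Otimes>\<^sub>M borel \<Otimes>\<^sub>M borel) \<Otimes>\<^sub>M PP)"
    unfolding case_prod_beta'
    by (rule measurable_transport_sum[OF g measurable_compose[OF measurable_snd measurable_ident_config]]) measurable
  from borel_measurable_nn_integral[OF this] show ?thesis unfolding mean_transport_def case_prod_beta' .
qed

lemma mean_transport_series:
  assumes g: "(\<lambda>(x, v). g x v) \<in> borel_measurable (borel \<Otimes>\<^sub>M borel)"
  shows "mean_transport PP \<epsilon> g r x v = (\<Sum>n. void_mean PP \<epsilon> g n r x v {} {})"
  unfolding mean_transport_def void_mean_def
  by (simp, intro nn_integral_suminf measurable_after_collisions[OF measurable_ident_config g]) auto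

lemma transport_sum_le:
  assumes "\<And>x v. g x v \<le> K" shows "(\<Sum>n. after_collisions \<epsilon> D g n r x v) \<le> K"
  unfolding suminf_eq_SUP by (intro SUP_least after_collisions_sum_le assms)

lemma mean_transport_le:
  assumes "\<And>x v. g x v \<le> K"
  shows "mean_transport PP \<epsilon> g r x v \<le> K"
proof -
  have "mean_transport PP \<epsilon> g r x v \<le> (\<integral>\<^sup>+D. K \<partial>PP)"
    unfolding mean_transport_def by (intro nn_integral_mono transport_sum_le assms)
  then show ?thesis by (simp add: emeasure_space_1)
qed

lemma mean_transport_add:
  assumes g: "(\<lambda>(x, v). g x v) \<in> borel_measurable (borel \<Otimes>\<^sub>M borel)"
    and h: "(\<lambda>(x, v). h x v) \<in> borel_measurable (borel \<Otimes>\<^sub>M borel)"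
  shows "mean_transport PP \<epsilon> (\<lambda>x v. g x v + h x v) r x v = mean_transport PP \<epsilon> g r x v + mean_transport PP \<epsilon> h r x v"
proof -
  have m: "(\<lambda>D. \<Sum>n. after_collisions \<epsilon> D g n r x v) \<in> borel_measurable PP"
    if "(\<lambda>(x, v). g x v) \<in> borel_measurable (borel \<Otimes>\<^sub>M borel)" for g
    by (rule measurable_transport_sum[OF that measurable_ident_config]) auto
  have "mean_transport PP \<epsilon> (\<lambda>x v. g x v + h x v) r x v =
      (\<integral>\<^sup>+D. (\<Sum>n. after_collisions \<epsilon> D g n r x v) + (\<Sum>n. after_collisions \<epsilon> D h n r x v) \<partial>PP)"
    unfolding mean_transport_def after_collisions_add
    by (intro nn_integral_cong suminf_add[symmetric] summableI)
  also have "\<dots> = mean_transport PP \<epsilon> g r x v + mean_transport PP \<epsilon> h r x v"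
    unfolding mean_transport_def by (intro nn_integral_add m g h)
  finally show ?thesis .
qed

lemma measurable_lost:
  assumes K [measurable]: "K \<in> N \<rightarrow>\<^sub>M config" and [measurable]: "r \<in> borel_measurable N" "x \<in> borel_measurable N" "v \<in> borel_measurable N"
  shows "(\<lambda>y. lost \<epsilon> (r y) (x y) (v y) (K y)) \<in> borel_measurable N"
proof -
  have [measurable]: "Measurable.pred N (\<lambda>y. \<forall>c\<in>K y. \<epsilon> < norm (x y - c))"
    by (rule pred_Ball_config[OF K]) (simp add: case_prod_beta', measurable)
  have [measurable]: "(\<lambda>y. \<Sum>n. after_collisions \<epsilon> (K y) (\<lambda>_ _. 1) n (r y) (x y) (v y)) \<in> borel_measurable N"
    by (rule measurable_transport_sum[OF _ K]) measurable
  show ?thesis unfolding lost_def by measurable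
qed

text \<open>\<open>after_collisions_total\<close> holds for every fixed configuration and almost every phase point; Fubini
  exchanges the quantifiers.\<close>

lemma AE_not_lost:
  assumes dim: "DIM('a) \<ge> 2" and \<epsilon>: "\<epsilon> > 0" and r: "r > 0"
  shows "AE v in surface. AE x in lborel. (\<integral>\<^sup>+D. lost \<epsilon> r x v D \<partial>PP) = 0"
proof (rule AE_phase_zero)
  have ip: "sigma_finite_measure PP" ..
  interpret PV: pair_sigma_finite PP "surface :: 'a measure" ..
  interpret PX: pair_sigma_finite PP "lborel :: 'a measure" ..
  have m: "(\<lambda>(w, D). lost \<epsilon> r (snd w) (fst w) D) \<in> borel_measurable ((borel \<Otimes>\<^sub>M borel) \<Otimes>\<^sub>M PP)"
    unfolding case_prod_beta'
    by (rule measurable_lost[OF measurable_compose[OF measurable_snd measurable_ident_config]]) measurable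
  show "(\<lambda>(v, x). \<integral>\<^sup>+D. lost \<epsilon> r x v D \<partial>PP) \<in> borel_measurable (borel \<Otimes>\<^sub>M borel)"
    using borel_measurable_nn_integral[OF m] by (simp add: case_prod_beta')
  have m1: "(\<lambda>(D, x). lost \<epsilon> r x v D) \<in> borel_measurable (PP \<Otimes>\<^sub>M lborel)" for v
    unfolding case_prod_beta'
    by (rule measurable_lost[OF measurable_compose[OF measurable_fst measurable_ident_config]]) measurable
  have m2': "(\<lambda>(y, x). lost \<epsilon> r x (snd y) (fst y)) \<in> borel_measurable ((PP \<Otimes>\<^sub>M surface) \<Otimes>\<^sub>M lborel)"
    unfolding case_prod_beta'
    by (rule measurable_lost[OF measurable_compose[OF measurable_fst measurable_compose[OF measurable_fst measurable_ident_config]]]) measurable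
  have m2: "(\<lambda>(D, v). \<integral>\<^sup>+x. lost \<epsilon> r x v D \<partial>lborel) \<in> borel_measurable (PP \<Otimes>\<^sub>M surface)"
    using lborel.borel_measurable_nn_integral[OF m2'] by (simp add: case_prod_beta')
  have "(\<integral>\<^sup>+v. \<integral>\<^sup>+x. \<integral>\<^sup>+D. lost \<epsilon> r x v D \<partial>PP \<partial>lborel \<partial>surface) = (\<integral>\<^sup>+v. \<integral>\<^sup>+D. \<integral>\<^sup>+x. lost \<epsilon> r x v D \<partial>lborel \<partial>PP \<partial>surface)"
    by (intro nn_integral_cong PX.Fubini' m1)
  also have "\<dots> = (\<integral>\<^sup>+D. \<integral>\<^sup>+v. \<integral>\<^sup>+x. lost \<epsilon> r x v D \<partial>lborel \<partial>surface \<partial>PP)"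
    by (rule PV.Fubini'[OF m2])
  also have "\<dots> = (\<integral>\<^sup>+D. 0 \<partial>PP)"
  proof (rule nn_integral_cong)
    fix D assume "D \<in> space PP"
    then have D: "locally_finite D" by (simp add: space_PP)
    have "(\<integral>\<^sup>+v. \<integral>\<^sup>+x. lost \<epsilon> r x v D \<partial>lborel \<partial>surface) = (\<integral>\<^sup>+v. 0 \<partial>(surface :: 'a measure))"
    proof (rule nn_integral_cong_AE)
      show "AE v in surface. (\<integral>\<^sup>+x. lost \<epsilon> r x v D \<partial>lborel) = 0"
        using after_collisions_total[OF dim \<epsilon> D r]
      proof eventually_elim
        case (elim v)
        then have "AE x in lborel. lost \<epsilon> r x v D = 0" by eventually_elim (simp add: lost_def)
        then have "(\<integral>\<^sup>+x. lost \<epsilon> r x v D \<partial>lborel) = (\<integral>\<^sup>+x. 0 \<partial>(lborel :: 'a measure))" by (rule nn_integral_cong_AE)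
        then show ?case by simp
      qed
    qed
    then show "(\<integral>\<^sup>+v. \<integral>\<^sup>+x. lost \<epsilon> r x v D \<partial>lborel \<partial>surface) = 0" by simp
  qed
  finally show "(\<integral>\<^sup>+v. \<integral>\<^sup>+x. \<integral>\<^sup>+D. lost \<epsilon> r x v D \<partial>PP \<partial>lborel \<partial>surface) = 0" by simp
qed

end

text \<open>Almost surely the process is locally finite and has no point at distance exactly \<open>\<epsilon>\<close> from \<open>x\<close>. If all
  points are farther away, \<open>(x, v)\<close> lies in the closed phase space and the density is the transported
  value; if one is nearer, \<open>(x, v)\<close> lies outside and both sides vanish.\<close>

lemma averaged_density_eq:
  fixes C :: "'w \<Rightarrow> 'a::euclidean_space set"
  assumes ppp: "poisson_point_process M lam C" and lam: "0 \<le> lam" and \<epsilon>: "0 < \<epsilon>"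
    and sol: "AE w in M. transport_solution \<epsilon> (C w) fin (\<lambda>t x v. f t x v (C w))"
    and fin: "\<And>x v. norm v = 1 \<Longrightarrow> 0 \<le> fin x v"
    and g: "(\<lambda>(x, v). g x v) \<in> borel_measurable (borel \<Otimes>\<^sub>M borel)"
    and g_eq: "\<And>x v. norm v = 1 \<Longrightarrow> g x v = ennreal (fin x (- v))"
    and g_le: "\<And>x v. g x v \<le> ennreal K"
    and t: "0 < t" and v: "norm v = 1"
    and total: "(\<integral>\<^sup>+D. lost \<epsilon> t x (- v) D \<partial>distr M config (\<lambda>w. regularise (C w))) = 0"
  shows "averaged_density M \<epsilon> C f t x v = enn2real (mean_transport (distr M config (\<lambda>w. regularise (C w))) \<epsilon> g t x (- v))"
proof -
  let ?\<rho> = "\<lambda>w. regularise (C w)"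
  let ?PP = "distr M config ?\<rho>"
  interpret PC: poisson_config ?PP lam by (rule poisson_config_distr[OF ppp lam])
  note \<rho> = measurable_regularise[OF ppp lam]
  define S where "S D = (\<Sum>n. after_collisions \<epsilon> D g n t x (- v))" for D
  have v': "norm (- v) = 1" using v by simp
  have S_meas: "(\<lambda>w. S (k w)) \<in> borel_measurable N" if "k \<in> N \<rightarrow>\<^sub>M config" for N :: "'n measure" and k
    unfolding S_def by (rule PC.measurable_transport_sum[OF g that]) auto
  have S_le: "S D \<le> ennreal K" for D unfolding S_def by (rule PC.transport_sum_le[OF g_le])
  then have S_fin: "S D < top" for D using ennreal_less_top le_less_trans by blast
  have "AE D in ?PP. lost \<epsilon> t x (- v) D = 0"
    using total by (subst (asm) nn_integral_0_iff_AE) (rule PC.measurable_lost[OF PC.measurable_ident_config], simp_all)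
  then have tot: "AE w in M. lost \<epsilon> t x (- v) (?\<rho> w) = 0" by (rule AE_distrD[OF \<rho>])
  have "AE D in ?PP. D \<inter> sphere x \<epsilon> = {}"
    by (rule PC.AE_avoids_null_set) (simp_all add: emeasure_lborel_sphere)
  then have off: "AE w in M. ?\<rho> w \<inter> sphere x \<epsilon> = {}" by (rule AE_distrD[OF \<rho>])
  let ?I = "\<lambda>w. f t x v (C w) * indicator (closure (billiard_phase \<epsilon> (C w))) (x, v)"
  have eq: "AE w in M. ?I w = enn2real (S (?\<rho> w))"
    using tot off AE_locally_finite[OF ppp lam] AE_regularise[OF ppp lam] sol
  proof eventually_elim
    case (elim w)
    let ?D = "C w"
    have D: "locally_finite ?D" and \<rho>D: "?\<rho> w = ?D" using elim by auto
    show ?case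
    proof (cases "\<forall>c\<in>?D. \<epsilon> < norm (x - c)")
      case True
      then have one: "(\<Sum>n. after_collisions \<epsilon> ?D (\<lambda>_ _. 1) n t x (- v)) = 1"
        using elim(1) unfolding \<rho>D lost_def by (metis zero_neq_one)
      have val: "S ?D = ennreal (f t x (- (- v)) ?D)" "0 \<le> f t x (- (- v)) ?D"
        unfolding S_def by (rule transport_value[OF elim(5) \<epsilon> D g_eq fin v' t one]; assumption)+
      have "(x, v) \<in> billiard_phase \<epsilon> ?D"
        using True v mem_billiard_table_iff[OF D] by (auto simp: billiard_phase_def)
      then have "(x, v) \<in> closure (billiard_phase \<epsilon> ?D)" using closure_subset by blast
      then show ?thesis using val unfolding \<rho>D by simp
    next
      case False
      then obtain c where c: "c \<in> ?D" "norm (x - c) \<le> \<epsilon>" by force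
      moreover have "norm (x - c) \<noteq> \<epsilon>" using elim(2) c(1) unfolding \<rho>D by (auto simp: dist_norm)
      ultimately have lt: "norm (x - c) < \<epsilon>" by simp
      have "billiard_phase \<epsilon> ?D \<subseteq> {y. \<epsilon> \<le> norm (fst y - c)}"
        using mem_billiard_table_iff[OF D] c(1) by (force simp: billiard_phase_def)
      then have "closure (billiard_phase \<epsilon> ?D) \<subseteq> {y. \<epsilon> \<le> norm (fst y - c)}"
        by (rule closure_minimal) (intro closed_Collect_le continuous_intros)
      then have "(x, v) \<notin> closure (billiard_phase \<epsilon> ?D)" using lt by auto
      moreover have "S ?D = 0" unfolding S_def using after_collisions_inside[OF c(1) lt v' t] by simp
      ultimately show ?thesis unfolding \<rho>D by simp
    qed
  qed
  have m: "(\<lambda>w. enn2real (S (?\<rho> w))) \<in> borel_measurable M" by (intro borel_measurable_enn2real S_meas[OF \<rho>])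
  have "averaged_density M \<epsilon> C f t x v = (\<integral>w. enn2real (S (?\<rho> w)) \<partial>completion M)"
    unfolding averaged_density_def
    by (rule integral_cong_AE[OF measurable_completion_AE[OF m _ eq] measurable_completion[OF m] AE_completion[OF eq]]) simp
  also have "\<dots> = (\<integral>w. enn2real (S (?\<rho> w)) \<partial>M)" by (rule integral_completion[OF m])
  also have "\<dots> = enn2real (\<integral>\<^sup>+w. ennreal (enn2real (S (?\<rho> w))) \<partial>M)"
    by (rule integral_eq_nn_integral[OF m]) simp
  also have "(\<integral>\<^sup>+w. ennreal (enn2real (S (?\<rho> w))) \<partial>M) = (\<integral>\<^sup>+w. S (?\<rho> w) \<partial>M)"
  proof -
    have "ennreal (enn2real (S D)) = S D" for D using S_fin[of D] by simp
    then show ?thesis by simp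
  qed
  also have "\<dots> = (\<integral>\<^sup>+D. S D \<partial>?PP)"
    by (rule nn_integral_distr[OF \<rho>, symmetric]) (rule S_meas, simp)
  finally show ?thesis unfolding S_def mean_transport_def .
qed

lemma AE_phase_time_positive:
  "AE (t, x, v) in (phase_time_measure :: (real \<times> 'a::euclidean_space \<times> 'a) measure). 0 < t \<and> norm v = 1"
proof -
  have "AE (t, x, v::'a) in phase_time_measure. (if t = 0 then 1 else 0 :: ennreal) = 0"
  proof -
    have "(\<lambda>(t::real, x::'a, v). if t = 0 then 1 else 0 :: ennreal) \<in> borel_measurable (borel \<Otimes>\<^sub>M borel \<Otimes>\<^sub>M (borel :: 'a measure))"
    proof -
      have time: "(\<lambda>t::real. if t = 0 then 1 else 0 :: ennreal) \<in> borel_measurable borel" by measurable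
      show ?thesis unfolding case_prod_beta' by (rule measurable_compose[OF measurable_fst time])
    qed
    from AE_phase_time[OF this] show ?thesis by simp
  qed
  moreover have "AE z in (phase_time_measure :: (real \<times> 'a \<times> 'a) measure). z \<in> space phase_time_measure" by (rule AE_space)
  ultimately show ?thesis
  proof eventually_elim
    case (elim z)
    then show ?case
      by (auto simp: phase_time_measure_def space_pair_measure space_restrict_space space_sphere_measure split: if_splits)
  qed
qed

theorem AE_averaged_density:
  fixes C :: "'w \<Rightarrow> 'a::euclidean_space set"
  assumes dim: "DIM('a) \<ge> 2"
    and ppp: "poisson_point_process M lam C" and lam: "0 \<le> lam" and \<epsilon>: "0 < \<epsilon>"
    and sol: "AE w in M. transport_solution \<epsilon> (C w) fin (\<lambda>t x v. f t x v (C w))"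
    and fin: "\<And>x v. norm v = 1 \<Longrightarrow> 0 \<le> fin x v"
    and g: "(\<lambda>(x, v). g x v) \<in> borel_measurable (borel \<Otimes>\<^sub>M borel)"
    and g_eq: "\<And>x v. norm v = 1 \<Longrightarrow> g x v = ennreal (fin x (- v))"
    and g_le: "\<And>x v. g x v \<le> ennreal K"
  shows "AE (t, x, v) in phase_time_measure. averaged_density M \<epsilon> C f t x v =
     enn2real (mean_transport (distr M config (\<lambda>w. regularise (C w))) \<epsilon> g t x (- v))"
proof -
  let ?PP = "distr M config (\<lambda>w. regularise (C w))"
  interpret PC: poisson_config ?PP lam by (rule poisson_config_distr[OF ppp lam])
  let ?N = "\<lambda>(t, x, v). \<integral>\<^sup>+D. lost \<epsilon> t x v D \<partial>?PP"
  have "(\<lambda>(w, D). lost \<epsilon> (fst w) (fst (snd w)) (snd (snd w)) D) \<in> borel_measurable ((borel \<Otimes>\<^sub>M borel \<Otimes>\<^sub>M borel) \<Otimes>\<^sub>M ?PP)"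
    unfolding case_prod_beta'
    by (rule PC.measurable_lost[OF measurable_compose[OF measurable_snd PC.measurable_ident_config]]) measurable
  from PC.borel_measurable_nn_integral[OF this]
  have N: "?N \<in> borel_measurable (borel \<Otimes>\<^sub>M borel \<Otimes>\<^sub>M borel)" unfolding case_prod_beta' .
  have "AE (t, x, v) in phase_time_measure. ?N (t, x, - v) = 0"
    by (rule AE_phase_time[OF N]) (use PC.AE_not_lost[OF dim \<epsilon>] in simp)
  then show ?thesis using AE_phase_time_positive
  proof eventually_elim
    case (elim z)
    obtain t x v where z: "z = (t, x, v)" by (cases z) auto
    then show ?case
      using averaged_density_eq[OF ppp lam \<epsilon> sol fin g g_eq g_le, of t v x] elim unfolding z by simp
  qed
qed

section \<open>Convergence of the averaged density\<close>

text \<open>If \<open>A k + B k \<le> a + b\<close>, a lower bound on \<open>B k\<close> near \<open>b\<close> is an upper bound on \<open>A k\<close> near \<open>a\<close>.\<close>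

lemma tendsto_of_complementary_lower_bounds:
  fixes A B :: "nat \<Rightarrow> ennreal"
  assumes A: "ennreal a \<le> liminf A" and B: "ennreal b \<le> liminf B" and ab: "0 \<le> a" "0 \<le> b"
    and le: "\<And>k. A k + B k \<le> ennreal (a + b)"
  shows "(\<lambda>k. enn2real (A k)) \<longlonglongrightarrow> a"
proof (rule LIMSEQ_I)
  have fin: "A k < top" "B k < top" for k
    using le[of k] by (auto simp: less_top[symmetric] top_unique)
  define \<alpha> where "\<alpha> k = enn2real (A k)" for k
  define \<beta> where "\<beta> k = enn2real (B k)" for k
  have AB: "A k = ennreal (\<alpha> k)" "B k = ennreal (\<beta> k)" "0 \<le> \<alpha> k" "0 \<le> \<beta> k" for k
    using fin[of k] by (simp_all add: \<alpha>_def \<beta>_def ennreal_enn2real_if less_top)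
  have sum: "\<alpha> k + \<beta> k \<le> a + b" for k
    using le[of k] AB[of k] ab by (simp add: ennreal_plus[symmetric] del: ennreal_plus)
  have low: "\<forall>\<^sub>F k in sequentially. c - e < \<gamma> k"
    if "0 < e" "0 \<le> c" "ennreal c \<le> liminf (\<lambda>k. ennreal (\<gamma> k))" "\<And>k. 0 \<le> \<gamma> k" for c e :: real and \<gamma>
  proof (cases "c - e < 0")
    case True
    then have "c - e < \<gamma> k" for k using that(4)[of k] by linarith
    then show ?thesis by simp
  next
    case False
    then have "ennreal (c - e) < ennreal c" using that by (intro ennreal_lessI) auto
    then have "ennreal (c - e) < liminf (\<lambda>k. ennreal (\<gamma> k))" using that(3) by (rule less_le_trans)
    from less_LiminfD[OF this] show ?thesis
      by (rule eventually_mono) (use False in \<open>simp add: ennreal_less_iff\<close>)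
  qed
  fix e :: real assume e: "0 < e"
  have "\<forall>\<^sub>F k in sequentially. a - e < \<alpha> k \<and> b - e < \<beta> k"
    using low[OF e ab(1) A[unfolded AB] AB(3)] low[OF e ab(2) B[unfolded AB] AB(4)] by (rule eventually_conj)
  then obtain k0 where "\<And>k. k0 \<le> k \<Longrightarrow> a - e < \<alpha> k \<and> b - e < \<beta> k" unfolding eventually_sequentially by blast
  then have "norm (\<alpha> k - a) < e" if "k0 \<le> k" for k using that sum[of k] by (force simp: abs_less_iff)
  then show "\<exists>k0. \<forall>k\<ge>k0. norm (enn2real (A k) - a) < e" unfolding \<alpha>_def by blast
qed

lemma suminf_liminf_le:
  fixes f :: "nat \<Rightarrow> nat \<Rightarrow> ennreal"
  shows "(\<Sum>n. liminf (\<lambda>k. f k n)) \<le> liminf (\<lambda>k. \<Sum>n. f k n)"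
  using nn_integral_liminf[of f "count_space UNIV"] by (simp add: nn_integral_count_space_nat)

lemma duhamel_series_le_liminf:
  fixes PP :: "nat \<Rightarrow> 'a::euclidean_space set measure"
  assumes dim: "DIM('a) \<ge> 2" and config: "\<And>k. poisson_config (PP k) (lam k)"
    and eps: "\<And>k. eps k > 0" "eps \<longlonglongrightarrow> 0"
    and scaling: "\<And>k. lam k * eps k ^ (DIM('a) - 1) = 1"
    and g: "(\<lambda>(x, v). g x v) \<in> borel_measurable (borel \<Otimes>\<^sub>M borel)" and g_finite: "\<And>x v. g x v < top"
    and v: "norm v = 1" and r: "r > 0"
  shows "(\<Sum>n. duhamel g n r x v) \<le> liminf (\<lambda>k. mean_transport (PP k) (eps k) g r x v)"
proof -
  have "duhamel g n r x v \<le> liminf (\<lambda>k. void_mean (PP k) (eps k) g n r x v {} {})" for n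
    using duhamel_le_liminf_void_mean[OF dim config eps scaling g g_finite v r,
        where A="\<lambda>_. {}" and a="\<lambda>_. 0" and \<alpha>=0 and S="{}" and P="\<lambda>_. {}" and Q="{}" and n=n and x=x] by simp
  then have "(\<Sum>n. duhamel g n r x v) \<le> (\<Sum>n. liminf (\<lambda>k. void_mean (PP k) (eps k) g n r x v {} {}))"
    by (intro suminf_le summableI)
  also have "\<dots> \<le> liminf (\<lambda>k. \<Sum>n. void_mean (PP k) (eps k) g n r x v {} {})"
    by (rule suminf_liminf_le)
  also have "(\<lambda>k. \<Sum>n. void_mean (PP k) (eps k) g n r x v {} {}) = (\<lambda>k. mean_transport (PP k) (eps k) g r x v)"
    by (intro ext poisson_config.mean_transport_series[OF config g, symmetric])
  finally show ?thesis .
qed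

text \<open>The lower bound of \<open>duhamel_series_le_liminf\<close> is applied to \<open>g\<close> and to \<open>K - g\<close>; their Duhamel series
  add up to that of the constant \<open>K\<close>, and their expectations to at most \<open>K\<close>.\<close>

theorem mean_transport_tendsto:
  fixes PP :: "nat \<Rightarrow> 'a::euclidean_space set measure" and fin :: "'a \<Rightarrow> 'a \<Rightarrow> real"
  assumes dim: "DIM('a) \<ge> 2" and config: "\<And>k. poisson_config (PP k) (lam k)"
    and eps: "\<And>k. eps k > 0" "eps \<longlonglongrightarrow> 0"
    and scaling: "\<And>k. lam k * eps k ^ (DIM('a) - 1) = 1"
    and g: "(\<lambda>(x, v). g x v) \<in> borel_measurable (borel \<Otimes>\<^sub>M borel)"
    and gK: "\<And>x v. 0 \<le> g x v" "\<And>x v. g x v \<le> K"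
    and g_eq: "\<And>x v. norm v = 1 \<Longrightarrow> g x v = fin x (- v)"
    and mild: "boltzmann_mild_solution fin F"
    and v: "norm v = 1" and r: "r > 0"
  shows "(\<lambda>k. enn2real (mean_transport (PP k) (eps k) (\<lambda>x v. ennreal (g x v)) r x v)) \<longlonglongrightarrow> F r x (- v)"
    and "0 \<le> F r x (- v)" and "F r x (- v) \<le> K"
proof -
  let ?g = "\<lambda>x v. ennreal (g x v)" and ?h = "\<lambda>x v. ennreal (K - g x v)"
  have g_meas: "(\<lambda>(x, v). ?g x v) \<in> borel_measurable (borel \<Otimes>\<^sub>M borel)"
    using measurable_compose[OF g measurable_ennreal] by (simp add: case_prod_beta')
  have h_meas: "(\<lambda>(x, v). ?h x v) \<in> borel_measurable (borel \<Otimes>\<^sub>M borel)"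
    using measurable_compose[OF borel_measurable_diff[OF borel_measurable_const[of K] g] measurable_ennreal]
    by (simp add: case_prod_beta')
  have K0: "0 \<le> K" using gK order_trans by blast
  have fin: "0 \<le> fin x v" if "norm v = 1" for x v using gK(1)[of x "- v"] g_eq[of "- v" x] that by simp
  have gh: "?g x v + ?h x v = ennreal K" for x v
    using gK[of x v] by (simp add: ennreal_plus[symmetric] del: ennreal_plus)
  have Fg: "(\<Sum>n. duhamel ?g n r x v) = ennreal (F r x (- v))" and F0: "0 \<le> F r x (- v)"
    by (rule mild_solution_series[OF mild fin g_meas _ v r], assumption, simp add: g_eq)+
  have "(\<Sum>n. duhamel ?g n r x v) + (\<Sum>n. duhamel ?h n r x v) = (\<Sum>n. duhamel (\<lambda>x v. ?g x v + ?h x v) n r x v)"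
    unfolding duhamel_add[OF g_meas h_meas] by (rule suminf_add) (rule summableI)+
  also have "\<dots> = ennreal K" unfolding gh by (rule duhamel_const_series[OF K0 v r])
  finally have sum: "ennreal (F r x (- v)) + (\<Sum>n. duhamel ?h n r x v) = ennreal K" unfolding Fg .
  have "ennreal (F r x (- v)) \<le> ennreal K" unfolding sum[symmetric] by simp
  then have FK: "F r x (- v) \<le> K" using K0 by (simp add: ennreal_le_iff)
  have "ennreal (F r x (- v)) + (\<Sum>n. duhamel ?h n r x v) = ennreal (F r x (- v)) + ennreal (K - F r x (- v))"
    unfolding sum using F0 FK by (simp add: ennreal_plus[symmetric] del: ennreal_plus)
  then have Fh: "(\<Sum>n. duhamel ?h n r x v) = ennreal (K - F r x (- v))"
    by (simp only: ennreal_add_left_cancel) simp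
  show "(\<lambda>k. enn2real (mean_transport (PP k) (eps k) ?g r x v)) \<longlonglongrightarrow> F r x (- v)"
  proof (rule tendsto_of_complementary_lower_bounds[where b="K - F r x (- v)"])
    show "ennreal (F r x (- v)) \<le> liminf (\<lambda>k. mean_transport (PP k) (eps k) ?g r x v)"
      unfolding Fg[symmetric] by (rule duhamel_series_le_liminf[OF dim config eps scaling g_meas _ v r]) simp
    show "ennreal (K - F r x (- v)) \<le> liminf (\<lambda>k. mean_transport (PP k) (eps k) ?h r x v)"
      unfolding Fh[symmetric] by (rule duhamel_series_le_liminf[OF dim config eps scaling h_meas _ v r]) simp
    show "mean_transport (PP k) (eps k) ?g r x v + mean_transport (PP k) (eps k) ?h r x v
        \<le> ennreal (F r x (- v) + (K - F r x (- v)))" for k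
      using poisson_config.mean_transport_le[OF config[of k], of "\<lambda>x v. ?g x v + ?h x v" "ennreal K" "eps k" r x v]
      unfolding poisson_config.mean_transport_add[OF config g_meas h_meas] by (simp only: gh) simp
  qed (use F0 FK in auto)
  show "0 \<le> F r x (- v)" "F r x (- v) \<le> K" by (rule F0 FK)+
qed

lemma continuous_compact_support_bound:
  fixes fin :: "'a::euclidean_space \<Rightarrow> 'a \<Rightarrow> real"
  assumes cont: "continuous_on (UNIV \<times> sphere 0 1) (\<lambda>(x, v). fin x v)"
    and supp: "compact (closure {(x, v). v \<in> sphere 0 1 \<and> fin x v \<noteq> 0})"
  obtains K where "0 \<le> K" "\<And>x v. norm v = 1 \<Longrightarrow> fin x v \<le> K"
proof -
  let ?S = "{(x, v). v \<in> sphere 0 1 \<and> fin x v \<noteq> 0}"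
  have "closure ?S \<subseteq> UNIV \<times> sphere 0 1"
    by (rule closure_minimal) (auto intro: closed_Times)
  then have "compact ((\<lambda>(x, v). fin x v) ` closure ?S)"
    by (intro compact_continuous_image continuous_on_subset[OF cont] supp)
  then obtain K where K: "\<And>y. y \<in> (\<lambda>(x, v). fin x v) ` closure ?S \<Longrightarrow> norm y \<le> K"
    using compact_imp_bounded bounded_iff by meson
  have "fin x v \<le> max 0 K" if "norm v = 1" for x v
  proof (cases "fin x v = 0")
    case False
    then have "(x, v) \<in> closure ?S" using that closure_subset[of ?S] by auto
    from K[OF imageI[OF this]] show ?thesis by auto
  qed simp
  then show ?thesis using that[of "max 0 K"] by simp
qed

text \<open>The initial density is prescribed only for unit velocities; composing with \<open>direction\<close> gives a Borel
  function on the whole space.\<close>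

lemma measurable_on_sphere_extend:
  fixes fin :: "'a::euclidean_space \<Rightarrow> 'a \<Rightarrow> real"
  assumes cont: "continuous_on (UNIV \<times> sphere 0 1) (\<lambda>(x, v). fin x v)"
  shows "(\<lambda>(x, v). fin x (direction (- v))) \<in> borel_measurable (borel \<Otimes>\<^sub>M borel)"
proof -
  have "(\<lambda>w. (fst w, direction (- snd w))) \<in> borel \<Otimes>\<^sub>M borel \<rightarrow>\<^sub>M (borel \<Otimes>\<^sub>M borel :: ('a \<times> 'a) measure)"
    by measurable
  then have "(\<lambda>w. (fst w, direction (- snd w))) \<in> borel \<Otimes>\<^sub>M borel \<rightarrow>\<^sub>M restrict_space (borel :: ('a \<times> 'a) measure) (UNIV \<times> sphere 0 1)"
    unfolding borel_prod by (intro measurable_restrict_space2) (auto simp: norm_direction)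
  from measurable_compose[OF this borel_measurable_continuous_on_restrict[OF cont]]
  show ?thesis by (simp add: case_prod_beta')
qed

lemma boltzmann_grad_scaling:
  fixes \<epsilon> :: real
  assumes "0 < \<epsilon>" "1 \<le> d"
  shows "\<epsilon> powi (1 - int d) * \<epsilon> ^ (d - 1) = 1"
proof -
  have "\<epsilon> powi (1 - int d) * \<epsilon> ^ (d - 1) = \<epsilon> powi (1 - int d) * \<epsilon> powi (int (d - 1))"
    by (simp add: power_int_of_nat)
  also have "\<dots> = \<epsilon> powi (1 - int d + int (d - 1))"
    using assms by (intro power_int_add[symmetric]) auto
  also have "1 - int d + int (d - 1) = 0" using assms by (simp add: of_nat_diff)
  finally show ?thesis by simp
qed

theorem theorem3p1:
  fixes M :: "real \<Rightarrow> 'w measure"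
    and C :: "real \<Rightarrow> 'w \<Rightarrow> 'a::euclidean_space set"
    and fin :: "'a \<Rightarrow> 'a \<Rightarrow> real"
    and f :: "real \<Rightarrow> real \<Rightarrow> 'a \<Rightarrow> 'a \<Rightarrow> 'a set \<Rightarrow> real"
    and F :: "real \<Rightarrow> 'a \<Rightarrow> 'a \<Rightarrow> real"
  assumes dim: "DIM('a) \<ge> 2"
    and poisson: "\<And>\<epsilon>. \<epsilon> > 0 \<Longrightarrow>
      poisson_point_process (M \<epsilon>) (\<epsilon> powi (1 - int DIM('a))) (C \<epsilon>)"
    and fin_continuous: "continuous_on (UNIV \<times> sphere 0 1) (\<lambda>(x, v). fin x v)"
    and fin_compact_support:
      "compact (closure {(x, v). v \<in> sphere 0 1 \<and> fin x v \<noteq> 0})"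
    and fin_nonneg: "\<And>x v. v \<in> sphere 0 1 \<Longrightarrow> fin x v \<ge> 0"
    and f_solution: "\<And>\<epsilon>. \<epsilon> > 0 \<Longrightarrow>
      AE w in M \<epsilon>. transport_solution \<epsilon> (C \<epsilon> w) fin (\<lambda>t x v. f \<epsilon> t x v (C \<epsilon> w))"
    and F_solution: "boltzmann_mild_solution fin F"
  shows "weak_star_tendsto_Linf (completion phase_time_measure)
    (\<lambda>\<epsilon> (t, x, v). averaged_density (M \<epsilon>) \<epsilon> (C \<epsilon>) (f \<epsilon>) t x v)
    (\<lambda>(t, x, v). F t x v) (at_right 0)"
proof -
  let ?P = "phase_time_measure :: (real \<times> 'a \<times> 'a) measure"
  let ?lam = "\<lambda>\<epsilon>::real. \<epsilon> powi (1 - int DIM('a))"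
  let ?PP = "\<lambda>\<epsilon>. distr (M \<epsilon>) config (\<lambda>w. regularise (C \<epsilon> w))"
  let ?G = "\<lambda>\<epsilon> (t, x, v). averaged_density (M \<epsilon>) \<epsilon> (C \<epsilon>) (f \<epsilon>) t x v"
  let ?F = "\<lambda>(t, x, v). F t x v"
  define g where "g x v = fin x (direction (- v))" for x v
  define m where "m \<epsilon> z = (case z of (t, x, v) \<Rightarrow>
    enn2real (mean_transport (?PP \<epsilon>) \<epsilon> (\<lambda>x v. ennreal (g x v)) t x (- v)))" for \<epsilon> z
  obtain K where K0: "0 \<le> K" and K: "\<And>x v. norm v = 1 \<Longrightarrow> fin x v \<le> K"
    using continuous_compact_support_bound[OF fin_continuous fin_compact_support] by blast
  have g: "(\<lambda>(x, v). g x v) \<in> borel_measurable (borel \<Otimes>\<^sub>M borel)"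
    unfolding g_def by (rule measurable_on_sphere_extend[OF fin_continuous])
  have g': "(\<lambda>(x, v). ennreal (g x v)) \<in> borel_measurable (borel \<Otimes>\<^sub>M borel)"
    using measurable_compose[OF g measurable_ennreal] by (simp add: case_prod_beta')
  have g0: "0 \<le> g x v" and gK: "g x v \<le> K" for x v
    unfolding g_def using fin_nonneg K by (simp_all add: norm_direction)
  have g_eq: "g x v = fin x (- v)" if "norm v = 1" for x v
    using that by (simp add: g_def direction_unit)
  have lam: "0 \<le> ?lam \<epsilon>" if "0 < \<epsilon>" for \<epsilon> using that by (intro zero_le_power_int) simp
  have config: "poisson_config (?PP \<epsilon>) (?lam \<epsilon>)" if "0 < \<epsilon>" for \<epsilon>
    by (rule poisson_config_distr[OF poisson[OF that] lam[OF that]])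
  have m_meas: "m \<epsilon> \<in> borel_measurable ?P" if \<epsilon>: "0 < \<epsilon>" for \<epsilon>
  proof (rule measurable_from_phase_time)
    have "(\<lambda>z. (fst z, fst (snd z), - snd (snd z))) \<in> borel \<Otimes>\<^sub>M borel \<Otimes>\<^sub>M (borel :: 'a measure) \<rightarrow>\<^sub>M borel \<Otimes>\<^sub>M (borel :: 'a measure) \<Otimes>\<^sub>M borel"
      by measurable
    from borel_measurable_enn2real[OF measurable_compose[OF this poisson_config.measurable_mean_transport[OF config[OF \<epsilon>] g', of \<epsilon>]]]
    show "m \<epsilon> \<in> borel_measurable (borel \<Otimes>\<^sub>M borel \<Otimes>\<^sub>M borel)" by (simp add: m_def[abs_def] case_prod_beta')
  qed
  have m_bound: "\<bar>m \<epsilon> z\<bar> \<le> K" if \<epsilon>: "0 < \<epsilon>" for \<epsilon> z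
  proof -
    obtain t x v where z: "z = (t, x, v)" by (cases z) auto
    have "mean_transport (?PP \<epsilon>) \<epsilon> (\<lambda>x v. ennreal (g x v)) t x (- v) \<le> ennreal K"
      by (rule poisson_config.mean_transport_le[OF config[OF \<epsilon>]]) (simp add: ennreal_leI gK)
    from enn2real_mono[OF this] K0 show ?thesis by (simp add: m_def z)
  qed
  have G_m: "AE z in ?P. ?G \<epsilon> z = m \<epsilon> z" if \<epsilon>: "0 < \<epsilon>" for \<epsilon>
  proof -
    have "AE (t, x, v) in ?P. averaged_density (M \<epsilon>) \<epsilon> (C \<epsilon>) (f \<epsilon>) t x v =
        enn2real (mean_transport (?PP \<epsilon>) \<epsilon> (\<lambda>x v. ennreal (g x v)) t x (- v))"
      by (rule AE_averaged_density[OF dim poisson[OF \<epsilon>] lam[OF \<epsilon>] \<epsilon> f_solution[OF \<epsilon>] _ g', where K=K])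
         (use fin_nonneg in \<open>simp_all add: g_eq gK ennreal_leI\<close>)
    then show ?thesis by eventually_elim (auto simp: m_def)
  qed
  have G_meas: "?G \<epsilon> \<in> borel_measurable (completion ?P)" if "0 < \<epsilon>" for \<epsilon>
    by (rule measurable_completion_AE[OF m_meas[OF that] _ G_m[OF that]]) simp
  have G_bound: "AE z in completion ?P. \<bar>?G \<epsilon> z\<bar> \<le> K" if "0 < \<epsilon>" for \<epsilon>
    by (rule AE_completion) (use G_m[OF that] in eventually_elim, use m_bound[OF that] in simp)
  have F_meas: "?F \<in> borel_measurable (completion ?P)"
    by (rule measurable_completion) (use F_solution in \<open>simp add: boltzmann_mild_solution_def\<close>)
  have pointwise: "AE z in ?P. 0 \<le> ?F z \<and> ?F z \<le> K \<and> (\<lambda>k. m (X k) z) \<longlonglongrightarrow> ?F z"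
    if X: "\<And>k. 0 < X k" "X \<longlonglongrightarrow> 0" for X :: "nat \<Rightarrow> real"
    using AE_phase_time_positive
  proof eventually_elim
    case (elim z)
    obtain t x v where z: "z = (t, x, v)" by (cases z) auto
    have "0 < t" "norm (- v) = 1" using elim unfolding z by auto
    note limit = mean_transport_tendsto[OF dim config[OF X(1)] X boltzmann_grad_scaling[OF X(1)]
        g g0 gK g_eq F_solution this(2,1), of x]
    show ?case using limit dim unfolding z by (simp add: m_def)
  qed
  have F_bound: "AE z in completion ?P. \<bar>?F z\<bar> \<le> K"
  proof (rule AE_completion)
    have "AE z in ?P. 0 \<le> ?F z \<and> ?F z \<le> K \<and> (\<lambda>k. m (inverse (real (Suc k))) z) \<longlonglongrightarrow> ?F z"
      by (rule pointwise[OF _ LIMSEQ_inverse_real_of_nat]) simp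
    then show "AE z in ?P. \<bar>?F z\<bar> \<le> K"
    proof eventually_elim
      case (elim z)
      then show ?case by linarith
    qed
  qed
  show ?thesis
    unfolding weak_star_tendsto_Linf_def
  proof (intro conjI allI impI)
    have "?G \<epsilon> \<in> Linf (completion ?P)" if "0 < \<epsilon>" for \<epsilon>
      using G_meas[OF that] G_bound[OF that] unfolding Linf_def by blast
    then show "\<forall>\<^sub>F \<epsilon> in at_right 0. ?G \<epsilon> \<in> Linf (completion ?P)"
      using eventually_at_right_less[of "0::real"] by (rule eventually_mono[rotated])
    show "?F \<in> Linf (completion ?P)" using F_meas F_bound unfolding Linf_def by blast
    fix \<phi> :: "real \<times> 'a \<times> 'a \<Rightarrow> real" assume \<phi>: "integrable (completion ?P) \<phi>"
    show "((\<lambda>\<epsilon>. \<integral>z. ?G \<epsilon> z * \<phi> z \<partial>completion ?P) \<longlongrightarrow> (\<integral>z. ?F z * \<phi> z \<partial>completion ?P)) (at_right 0)"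
      unfolding tendsto_at_iff_sequentially
    proof (intro allI impI)
      fix X :: "nat \<Rightarrow> real" assume "\<forall>i. X i \<in> {0<..} - {0}" and X: "X \<longlonglongrightarrow> 0"
      then have X0: "\<And>k. 0 < X k" by simp
      have "(\<lambda>k. \<integral>z. ?G (X k) z * \<phi> z \<partial>completion ?P) \<longlonglongrightarrow> (\<integral>z. ?F z * \<phi> z \<partial>completion ?P)"
      proof (rule integral_dominated_convergence[where w="\<lambda>z. K * \<bar>\<phi> z\<bar>"])
        show "(\<lambda>z. ?F z * \<phi> z) \<in> borel_measurable (completion ?P)"
          by (intro borel_measurable_times F_meas borel_measurable_integrable[OF \<phi>])
        show "(\<lambda>z. ?G (X k) z * \<phi> z) \<in> borel_measurable (completion ?P)" for k
          by (intro borel_measurable_times G_meas[OF X0] borel_measurable_integrable[OF \<phi>])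
        show "integrable (completion ?P) (\<lambda>z. K * \<bar>\<phi> z\<bar>)"
          by (intro integrable_mult_right integrable_abs \<phi>)
        show "AE z in completion ?P. norm (?G (X k) z * \<phi> z) \<le> K * \<bar>\<phi> z\<bar>" for k
          using G_bound[OF X0[of k]]
        proof eventually_elim
          case (elim z)
          then show ?case by (simp only: real_norm_def abs_mult) (intro mult_right_mono, simp_all)
        qed
        have "AE z in ?P. \<forall>k. ?G (X k) z = m (X k) z"
          unfolding AE_all_countable using G_m[OF X0] by blast
        then have "AE z in ?P. (\<lambda>k. ?G (X k) z * \<phi> z) \<longlonglongrightarrow> ?F z * \<phi> z"
          using pointwise[OF X0 X]
        proof eventually_elim
          case (elim z)
          then have "(\<lambda>k. ?G (X k) z) = (\<lambda>k. m (X k) z)" by blast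
          then show ?case using elim(2) by (intro tendsto_mult_right) simp
        qed
        then show "AE z in completion ?P. (\<lambda>k. ?G (X k) z * \<phi> z) \<longlonglongrightarrow> ?F z * \<phi> z"
          by (rule AE_completion)
      qed
      then show "((\<lambda>\<epsilon>. \<integral>z. ?G \<epsilon> z * \<phi> z \<partial>completion ?P) \<circ> X) \<longlonglongrightarrow> (\<integral>z. ?F z * \<phi> z \<partial>completion ?P)"
        by (simp only: comp_def)
    qed
  qed
qed

end
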